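(* Let $\gamma:[0,1]\to[0,1]$ be a measurable function and let $(\nu_N)_{N\ge 1}$ be a sequence of probability measures on $\Omega_N$ associated to the profile $\gamma$. Then, for every $G\in C([0,1])$, every $t\in[0,T]$ and every $\delta>0$, $$\lim_{N\to\infty}\mathbb P_{\nu_N}\Big(\Big|\langle \pi^N_t,G\rangle-\int_0^1 G(x)\rho_t(x)\,dx\Big|>\delta\Big)=0,$$ where $\rho$ is the unique weak solution of $$\begin{cases}\partial_t\rho_t(x)=\Delta\rho_t(x), & (t,x)\in(0,T)\times(0,1),\\ \nabla\rho_t(0)=-F_-(\rho_t(0)), & t\in(0,T),\\ \nabla\rho_t(1)=F_+(\rho_t(1)), & t\in(0,T),\\ \rho_0(x)=\gamma(x), & x\in[0,1].\end{cases}$$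
   Context: Model. For $N\in\mathbb N$ let $\epsilon_N=1/N$, $\tau_N=(N-1)/N$, $\Lambda_N=\{\epsilon_N,2\epsilon_N,\dots,\tau_N\}$, $\Lambda_N^\circ=\Lambda_N\setminus\{\tau_N\}$, $\Omega_N=\{0,1\}^{\Lambda_N}$. Fix $l\in\mathbb N$ (with $l\le N-1$) and let $\Sigma_l^-=\{\epsilon_N,\dots,l\epsilon_N\}$, $\Sigma_l^+=\{(N-l)\epsilon_N,\dots,\tau_N\}$. For $\eta\in\Omega_N$ let $\Pi^\pm\eta$ be the restriction of $\eta$ to $\Sigma_l^\pm$; for $\xi\in\{0,1\}^{\Sigma_l^\pm}$ let $\eta^{\xi,\pm}$ be the configuration equal to $\xi$ on $\Sigma_l^\pm$ and to $\eta$ elsewhere; let $\sigma^{x,x+\epsilon_N}\eta$ be $\eta$ with the values at $x$ and $x+\epsilon_N$ exchanged. The boundary rates $R^\pm:\{0,1\}^{\Sigma_l^\pm}\times\{0,1\}^{\Sigma_l^\pm}\to[0,\infty)$ do not depend on $N$ (windows identified with $\{1,\dots,l\}$) and are such that, in each window, the superposition of the boundary dynamics with rates $R^\pm$ and the nearest-neighbor exchange dynamics restricted to the window is irreducible on $\{0,1\}^{\Sigma_l^\pm}$. The process $\{\eta_t\}_{t\ge0}$ on $\Omega_N$ is the Markov process with generator $$(\mathscr L_Nf)(\eta)=N^2\sum_{x\in\Lambda_N^\circ}[f(\sigma^{x,x+\epsilon_N}\eta)-f(\eta)]+N\sum_{\pm}\ \sum_{\xi\in\{0,1\}^{\Sigma_l^\pm}}R^\pm(\Pi^\pm\eta,\xi)[f(\eta^{\xi,\pm})-f(\eta)].$$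 $\mathbb P_{\nu_N}$ is the law on $\mathcal D([0,T],\Omega_N)$ (càdlàg paths) of this process with initial law $\nu_N$; $T>0$ is fixed. Empirical measure: $\pi^N_t=\frac1{N-1}\sum_{x\in\Lambda_N}\eta_t(x)\delta_x$ and $\langle\pi^N_t,G\rangle=\frac1{N-1}\sum_{x\in\Lambda_N}\eta_t(x)G(x)$; write $\pi^N$ for the same object built from a configuration $\eta$. $(\nu_N)$ is associated to $\gamma$ if $\lim_{N}\nu_N(|\langle\pi^N,H\rangle-\int_0^1H\gamma\,dx|>\delta)=0$ for every $H\in C([0,1])$, $\delta>0$. Boundary fluxes: for $\alpha\in[0,1]$, $\nu_\alpha$ is the Bernoulli product measure of density $\alpha$ and $$F_\pm(\alpha)=\mathbb E_{\nu_\alpha}\Big[\sum_{\xi\in\{0,1\}^{\Sigma_l^\pm}}R^\pm(\Pi^\pm\eta,\xi)\sum_{x\in\Sigma_l^\pm}(\xi(x)-\eta(x))\Big].$$ Let $\Omega_T=[0,T]\times[0,1]$. $C^{m,n}(\Omega_T)$ denotes functions $m$ times continuously differentiable in time and $n$ times in space, extended continuously to the boundary. Weak solution: a function $\rho:\Omega_T\to\mathbb R$ with $0\le\rho\le1$ a.e., $\rho\in L^2([0,T];H^1([0,1]))$, such that for every $H\in C^{1,2}(\Omega_T)$ and every $t\in[0,T]$, $$\int_0^1\rho_tH_t\,dx-\int_0^1\gamma H_0\,dx=\int_0^t\!\!\int_0^1\rho_s\partial_sH_s\,dx\,ds-\int_0^t\!\!\int_0^1\nabla\rho_s\nabla H_s\,dx\,ds+\int_0^t\{F_+(\rho_s(1))H_s(1)+F_-(\rho_s(0))H_s(0)\}\,ds.$$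 *)

theory Defs
  imports "HOL-Probability.Probability"
begin

section \<open>The microscopic model\<close>

text \<open>The index \<open>i\<close> stands for the site \<open>i / N\<close>, so the lattice is \<open>{1..N - 1}\<close>; for \<open>0 < l < N\<close>
  the windows are \<open>{1..l}\<close> and \<open>{N - l..N - 1}\<close>, both identified with \<open>{1..l}\<close> by a translation
  \<open>i \<mapsto> k + i\<close> (\<open>k = 0\<close> on the left, \<open>k = N - 1 - l\<close> on the right).
  An element of \<open>{0,1}\<^sup>A\<close> is a predicate that is false off \<open>A\<close>.\<close>

type_synonym config = "nat \<Rightarrow> bool"

definition configs :: "nat set \<Rightarrow> config set" where
  "configs A = {\<eta>. \<forall>i. \<eta> i \<longrightarrow> i \<in> A}"

abbreviation Omega :: "nat \<Rightarrow> config set" where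
  "Omega N \<equiv> configs {1..N - 1}"

definition swap :: "nat \<Rightarrow> config \<Rightarrow> config" where
  "swap x \<eta> = \<eta>(x := \<eta> (Suc x), Suc x := \<eta> x)"

definition window :: "nat \<Rightarrow> nat \<Rightarrow> config \<Rightarrow> config" where
  "window l k \<eta> = (\<lambda>i. i \<in> {1..l} \<and> \<eta> (k + i))"

definition paste :: "nat \<Rightarrow> nat \<Rightarrow> config \<Rightarrow> config \<Rightarrow> config" where
  "paste l k \<xi> \<eta> = (\<lambda>i. if i \<in> {k + 1..k + l} then \<xi> (i - k) else \<eta> i)"

type_synonym rates = "config \<Rightarrow> config \<Rightarrow> real"

definition admissible_rates :: "nat \<Rightarrow> rates \<Rightarrow> bool" where
  "admissible_rates l R \<longleftrightarrow>
     (\<forall>\<xi>\<in>configs {1..l}. \<forall>\<xi>'\<in>configs {1..l}. 0 \<le> R \<xi> \<xi>') \<and>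
     (\<forall>\<xi>\<in>configs {1..l}. \<forall>\<xi>'\<in>configs {1..l}.
        (\<xi>, \<xi>') \<in> {(\<zeta>, \<zeta>'). \<zeta> \<in> configs {1..l} \<and> \<zeta>' \<in> configs {1..l} \<and>
                     (R \<zeta> \<zeta>' > 0 \<or> (\<exists>x\<in>{1..<l}. \<zeta>' = swap x \<zeta>))}\<^sup>*)"

definition boundary_generator ::
  "nat \<Rightarrow> nat \<Rightarrow> rates \<Rightarrow> (config \<Rightarrow> real) \<Rightarrow> config \<Rightarrow> real" where
  "boundary_generator l k R f \<eta> =
     (\<Sum>\<xi>\<in>configs {1..l}. R (window l k \<eta>) \<xi> * (f (paste l k \<xi> \<eta>) - f \<eta>))"

definition generator ::
  "nat \<Rightarrow> nat \<Rightarrow> rates \<Rightarrow> rates \<Rightarrow> (config \<Rightarrow> real) \<Rightarrow> config \<Rightarrow> real" where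
  "generator N l Rm Rp f \<eta> =
     real N ^ 2 * (\<Sum>x\<in>{1..<N - 1}. f (swap x \<eta>) - f \<eta>)
     + real N * (boundary_generator l 0 Rm f \<eta> + boundary_generator l (N - 1 - l) Rp f \<eta>)"

text \<open>\<open>e\<^sup>t\<^sup>L f\<close>, the Markov semigroup of a generator on a finite state space.\<close>

definition semigroup :: "((config \<Rightarrow> real) \<Rightarrow> config \<Rightarrow> real) \<Rightarrow> real \<Rightarrow> (config \<Rightarrow> real) \<Rightarrow> config \<Rightarrow> real"
  where "semigroup L t f \<eta> = (\<Sum>k. t ^ k / fact k * (L ^^ k) f \<eta>)"


section \<open>The law of the process on the space of cadlag paths\<close>

text \<open>\<^typ>\<open>config\<close> carries the product topology, which is discrete on the finite set \<^term>\<open>Omega N\<close>.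
  Paths are extensional functions on \<open>{0..T}\<close>.\<close>

definition cadlag :: "real \<Rightarrow> (real \<Rightarrow> config) \<Rightarrow> bool" where
  "cadlag T \<omega> \<longleftrightarrow>
     (\<forall>t\<in>{0..<T}. continuous (at_right t) \<omega>) \<and>
     (\<forall>t\<in>{0<..T}. \<exists>\<eta>. (\<omega> \<longlongrightarrow> \<eta>) (at_left t))"

definition path_space :: "nat \<Rightarrow> real \<Rightarrow> (real \<Rightarrow> config) measure" where
  "path_space N T =
     restrict_space (PiM {0..T} (\<lambda>_. count_space (Omega N))) {\<omega>. cadlag T \<omega>}"

definition past :: "nat \<Rightarrow> real \<Rightarrow> real \<Rightarrow> (real \<Rightarrow> config) measure" where
  "past N T s = vimage_algebra (space (path_space N T)) (\<lambda>\<omega>. restrict \<omega> {0..s})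
     (PiM {0..s} (\<lambda>_. count_space (Omega N)))"

definition process_law ::
  "nat \<Rightarrow> nat \<Rightarrow> rates \<Rightarrow> rates \<Rightarrow> real \<Rightarrow> config pmf \<Rightarrow> (real \<Rightarrow> config) measure \<Rightarrow> bool" where
  "process_law N l Rm Rp T \<nu> P \<longleftrightarrow>
     prob_space P \<and> sets P = sets (path_space N T) \<and>
     (\<forall>\<eta>\<in>Omega N. measure P {\<omega> \<in> space P. \<omega> 0 = \<eta>} = pmf \<nu> \<eta>) \<and>
     (\<forall>f s t. 0 \<le> s \<and> s \<le> t \<and> t \<le> T \<longrightarrow>
        (AE \<omega> in P. real_cond_exp P (past N T s) (\<lambda>\<omega>. f (\<omega> t)) \<omega>
                    = semigroup (generator N l Rm Rp) (t - s) f (\<omega> s)))"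

definition empirical :: "nat \<Rightarrow> config \<Rightarrow> (real \<Rightarrow> real) \<Rightarrow> real" where
  "empirical N \<eta> G = 1 / (real N - 1) * (\<Sum>i\<in>{1..N - 1}. of_bool (\<eta> i) * G (real i / real N))"

definition associated :: "(nat \<Rightarrow> config pmf) \<Rightarrow> (real \<Rightarrow> real) \<Rightarrow> bool" where
  "associated \<nu> \<gamma> \<longleftrightarrow>
     (\<forall>H \<delta>. continuous_on {0..1} H \<and> \<delta> > 0 \<longrightarrow>
        (\<lambda>N. measure_pmf.prob (\<nu> N)
           {\<eta>. \<bar>empirical N \<eta> H - (LINT x|lebesgue_on {0..1}. H x * \<gamma> x)\<bar> > \<delta>}) \<longlonglongrightarrow> 0)"

text \<open>The integrand depends only on the occupation variables in the window, so the Bernoulli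
  product measure is taken on \<open>{0,1}\<close>-configurations of the window \<open>{1..l}\<close>.\<close>

definition boundary_flux :: "nat \<Rightarrow> rates \<Rightarrow> real \<Rightarrow> real" where
  "boundary_flux l R \<alpha> =
     measure_pmf.expectation (Pi_pmf {1..l} False (\<lambda>_. bernoulli_pmf \<alpha>))
       (\<lambda>\<eta>. \<Sum>\<xi>\<in>configs {1..l}. R \<eta> \<xi> * (\<Sum>x\<in>{1..l}. of_bool (\<xi> x) - of_bool (\<eta> x)))"


section \<open>Weak solutions of the limiting equation\<close>

definition test_function :: "(real \<Rightarrow> real) \<Rightarrow> bool" where
  "test_function \<phi> \<longleftrightarrow>
     (\<forall>n x. (deriv ^^ n) \<phi> field_differentiable at x) \<and>
     (\<exists>a b. 0 < a \<and> b < 1 \<and> (\<forall>x. x \<notin> {a..b} \<longrightarrow> \<phi> x = 0))"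

definition H1_with_gradient :: "(real \<Rightarrow> real) \<Rightarrow> (real \<Rightarrow> real) \<Rightarrow> bool" where
  "H1_with_gradient f g \<longleftrightarrow>
     f \<in> borel_measurable (lebesgue_on {0..1}) \<and> integrable (lebesgue_on {0..1}) (\<lambda>x. (f x)\<^sup>2) \<and>
     g \<in> borel_measurable (lebesgue_on {0..1}) \<and> integrable (lebesgue_on {0..1}) (\<lambda>x. (g x)\<^sup>2) \<and>
     (\<forall>\<phi>. test_function \<phi> \<longrightarrow>
        (LINT x|lebesgue_on {0..1}. f x * deriv \<phi> x) = - (LINT x|lebesgue_on {0..1}. g x * \<phi> x))"

text \<open>A function in \<open>H\<^sup>1([0,1])\<close> has exactly one continuous representative on \<open>[0,1]\<close>, whose value
  at \<open>a \<in> [0,1]\<close> is what the notation \<open>f(a)\<close> for a boundary point \<open>a\<close> means.\<close>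

definition boundary_value :: "(real \<Rightarrow> real) \<Rightarrow> real \<Rightarrow> real" where
  "boundary_value f a = (THE c. \<exists>v. continuous_on {0..1} v \<and>
                          (AE x in lebesgue_on {0..1}. f x = v x) \<and> v a = c)"

text \<open>Measurability of \<open>t \<mapsto> \<rho>\<^sub>t\<close> into the separable space \<open>H\<^sup>1\<close> amounts to joint measurability
  of \<open>\<rho>\<close> and of its weak gradient.\<close>

definition L2_H1_with_gradient ::
  "real \<Rightarrow> (real \<Rightarrow> real \<Rightarrow> real) \<Rightarrow> (real \<Rightarrow> real \<Rightarrow> real) \<Rightarrow> bool" where
  "L2_H1_with_gradient T \<rho> g \<longleftrightarrow>
     (\<lambda>(t, x). \<rho> t x) \<in> borel_measurable (lebesgue_on ({0..T} \<times> {0..1})) \<and>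
     (\<lambda>(t, x). g t x) \<in> borel_measurable (lebesgue_on ({0..T} \<times> {0..1})) \<and>
     integrable (lebesgue_on ({0..T} \<times> {0..1})) (\<lambda>(t, x). (\<rho> t x)\<^sup>2) \<and>
     integrable (lebesgue_on ({0..T} \<times> {0..1})) (\<lambda>(t, x). (g t x)\<^sup>2) \<and>
     (AE t in lebesgue_on {0..T}. H1_with_gradient (\<rho> t) (g t))"

text \<open>\<open>H\<close> is of class \<open>C\<^sup>1\<^sup>,\<^sup>2\<close>, and \<open>Ht\<close>, \<open>Hx\<close> are the continuous extensions to the closed rectangle
  of its first derivatives in time and space.\<close>

definition C12 ::
  "real \<Rightarrow> (real \<Rightarrow> real \<Rightarrow> real) \<Rightarrow> (real \<Rightarrow> real \<Rightarrow> real) \<Rightarrow> (real \<Rightarrow> real \<Rightarrow> real) \<Rightarrow> bool" where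
  "C12 T H Ht Hx \<longleftrightarrow> (\<exists>Hxx.
     (\<forall>F\<in>{H, Ht, Hx, Hxx}. continuous_on ({0..T} \<times> {0..1}) (\<lambda>(t, x). F t x)) \<and>
     (\<forall>t\<in>{0<..<T}. \<forall>x\<in>{0<..<1}.
        ((\<lambda>s. H s x) has_real_derivative Ht t x) (at t) \<and>
        ((\<lambda>y. H t y) has_real_derivative Hx t x) (at x) \<and>
        ((\<lambda>y. Hx t y) has_real_derivative Hxx t x) (at x)))"

text \<open>Integrability of \<open>\<rho>\<^sub>t\<close> for every \<open>t\<close>, and not only for almost every \<open>t\<close>, makes the first
  integral of the weak formulation meaningful at every time.\<close>

definition weak_solution ::
  "real \<Rightarrow> (real \<Rightarrow> real) \<Rightarrow> (real \<Rightarrow> real) \<Rightarrow> (real \<Rightarrow> real) \<Rightarrow> (real \<Rightarrow> real \<Rightarrow> real) \<Rightarrow> bool" where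
  "weak_solution T Fm Fp \<gamma> \<rho> \<longleftrightarrow>
     (AE (t, x) in lebesgue_on ({0..T} \<times> {0..1}). 0 \<le> \<rho> t x \<and> \<rho> t x \<le> 1) \<and>
     (\<forall>t\<in>{0..T}. integrable (lebesgue_on {0..1}) (\<rho> t)) \<and>
     (\<exists>g. L2_H1_with_gradient T \<rho> g \<and>
        (\<forall>H Ht Hx. C12 T H Ht Hx \<longrightarrow> (\<forall>t\<in>{0..T}.
           (LINT x|lebesgue_on {0..1}. \<rho> t x * H t x) - (LINT x|lebesgue_on {0..1}. \<gamma> x * H 0 x)
           = (LINT s|lebesgue_on {0..t}. LINT x|lebesgue_on {0..1}. \<rho> s x * Ht s x)
             - (LINT s|lebesgue_on {0..t}. LINT x|lebesgue_on {0..1}. g s x * Hx s x)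
             + (LINT s|lebesgue_on {0..t}.
                  Fp (boundary_value (\<rho> s) 1) * H s 1 + Fm (boundary_value (\<rho> s) 0) * H s 0))))"

end

theory Submission
  imports Defs
begin

text \<open>The density is followed through its cosine coefficients. Let \<open>X\<^sub>k\<close> be the \<open>k\<close>-th cosine coefficient
  of the empirical measure, taken at cell centres, where cosines are exact eigenvectors of the discrete Neumann
  Laplacian. Testing the equation with \<open>cos (k \<pi> x)\<close> turns it into
  \<open>r\<^sub>k' = - (k \<pi>)\<^sup>2 r\<^sub>k + (-1)\<^sup>k F\<^sub>+ + F\<^sub>-\<close>, where the fluxes depend on the boundary traces, and these are the
  sums of the cosine series at the end points. So the problem is a Volterra equation for the two traces, and it is a
  contraction in the norm with weight \<open>e\<^sup>- \<^sup>\<Lambda> \<^sup>t\<close>, as \<open>\<Sum>\<^sub>k 1 / (\<Lambda> + (k \<pi>)\<^sup>2)\<close> tends to 0 for \<open>\<Lambda> \<rightarrow> \<infinity>\<close>. This gives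
  existence; it gives uniqueness too, because testing a weak solution with \<open>e\<^sup>(\<^sup>k\<^sup>\<pi>\<^sup>)\<^sup>2\<^sup>t cos (k \<pi> x)\<close> shows that its modes
  solve the same equation.

  For the process, the entropy production controls the Dirichlet form of the law, and moving particles along paths
  replaces the boundary current by the flux evaluated at a Fejer average of the configuration. Up to this error the
  quantities \<open>E (\<Sum>\<^sub>k c\<^sub>k (X\<^sub>k - r\<^sub>k))\<^sup>2\<close>, for \<open>c\<close> in a class that contains the Fejer coefficients and is stable under the
  heat flow, satisfy the inequality behind the same contraction, so they tend to 0. No compactness argument is
  used.\<close>

section \<open>Cosine series on the unit interval\<close>

text \<open>The obstacle is that the fluxes act at single points. The kernel
  \<open>\<Sum>k. 2 * exp (- lam k * (t - s))\<close>, which carries a flux error from time s to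
  time t, is of order 1 / sqrt (t - s), while entropy controls the replacement error only after
  integration in time. Hence the kernel is split at a mode \<open>K1\<close>: the modes below it are
  bounded and meet the time integral of the error, those above it have a small integral and meet its
  supremum, which a trivial bound keeps finite. A second obstacle is that nothing confines the
  limiting density to [0,1] while it is being constructed. The Bernoulli parameter is clamped, so
  the fluxes are bounded and Lipschitz on all of the reals and the equation can be solved first; the
  bounds 0 \<le> \<rho> \<le> 1 are read off at the end from expectations of Fejer averages of the
  particle system. A third is that the profile is merely measurable: traces have no value at time 0,
  so fluxes are continuous at positive times only, and the iteration runs in the difference between
  the trace and that of the free heat flow.\<close>

definition lam :: "nat \<Rightarrow> real" where "lam k = (real k * pi)^2"

text \<open>The reciprocal of the squared norm of \<open>cm k\<close> in L2(0,1), so that the plain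
  pairings \<open>h k\<close> of a function with the cosines give back the function as
  \<open>\<Sum>k. wt k * h k * cm k x\<close>.\<close>

definition wt :: "nat \<Rightarrow> real" where "wt k = (if k = 0 then 1 else 2)"

definition cm :: "nat \<Rightarrow> real \<Rightarrow> real" where "cm k x = cos (real k * pi * x)"

definition sm :: "nat \<Rightarrow> real \<Rightarrow> real" where "sm k x = sin (real k * pi * x)"

abbreviation I01 :: "real measure" where "I01 \<equiv> lebesgue_on {0..1}"

lemma lam_nonneg [simp]: "0 \<le> lam k" and lam_0 [simp]: "lam 0 = 0"
  by (auto simp: lam_def)

lemma lam_ge: "real k ^ 2 \<le> lam k"
proof -
  have "real k * 1 \<le> real k * pi"
    using pi_ge_two by (intro mult_left_mono) auto
  then show ?thesis
    unfolding lam_def by (intro power_mono) auto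
qed

lemma wt_pos [simp]: "0 < wt k" "0 \<le> wt k" and wt_le_2: "wt k \<le> 2"
  by (auto simp: wt_def)

lemma abs_cm_le [simp]: "\<bar>cm k x\<bar> \<le> 1" and abs_sm_le [simp]: "\<bar>sm k x\<bar> \<le> 1"
  by (auto simp: cm_def sm_def)

lemma cm_0 [simp]: "cm 0 x = 1" and sm_0 [simp]: "sm 0 x = 0"
  by (auto simp: cm_def sm_def)

lemma cm_at_0 [simp]: "cm k 0 = 1" and sm_at_0 [simp]: "sm k 0 = 0"
  and cm_at_1 [simp]: "cm k 1 = (-1)^k" and sm_at_1 [simp]: "sm k 1 = 0"
  by (auto simp: cm_def sm_def mult.commute)

lemma cm_has_derivative [derivative_intros]: "(cm k has_real_derivative - (real k * pi * sm k x)) (at x within S)"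
  and sm_has_derivative [derivative_intros]: "(sm k has_real_derivative real k * pi * cm k x) (at x within S)"
  unfolding cm_def[abs_def] sm_def[abs_def] by (auto intro!: derivative_eq_intros)

lemma continuous_cm [continuous_intros]: "continuous_on A f \<Longrightarrow> continuous_on A (\<lambda>x. cm k (f x))"
  and continuous_sm [continuous_intros]: "continuous_on A f \<Longrightarrow> continuous_on A (\<lambda>x. sm k (f x))"
  by (rule continuous_on_compose2[OF DERIV_continuous_on[OF cm_has_derivative]], auto)
     (rule continuous_on_compose2[OF DERIV_continuous_on[OF sm_has_derivative]], auto)

lemma cm_measurable [measurable]: "cm k \<in> borel_measurable borel"
  and sm_measurable [measurable]: "sm k \<in> borel_measurable borel"
  by (auto intro!: borel_measurable_continuous_onI continuous_intros)

lemma cm_mult: "cm j x * cm k x = (cm (j + k) x + cm (if j \<le> k then k - j else j - k) x) / 2"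
  by (cases "j \<le> k") (simp_all add: cm_def cos_add cos_diff distrib_right left_diff_distrib of_nat_diff)

lemma sm_mult: "sm j x * sm k x = (cm (if j \<le> k then k - j else j - k) x - cm (j + k) x) / 2"
  by (cases "j \<le> k") (simp_all add: cm_def sm_def cos_add cos_diff distrib_right left_diff_distrib of_nat_diff)

lemma integral_cm: "(LINT x|I01. cm k x) = (if k = 0 then 1 else 0)"
proof (cases "k = 0")
  case False
  have "((\<lambda>x. cm k x) has_integral sm k 1 / (real k * pi) - sm k 0 / (real k * pi)) {0..1}"
    using False by (intro fundamental_theorem_of_calculus)
      (auto intro!: derivative_eq_intros simp flip: has_real_derivative_iff_has_vector_derivative)
  then have "integral {0..1} (cm k) = 0"
    by (simp add: integral_unique)
  then show ?thesis
    using False by (subst lebesgue_integral_eq_integral)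
      (auto intro!: continuous_imp_integrable_real continuous_intros)
qed (simp add: measure_restrict_space)

lemma continuous_mult_integrable:
  fixes u G :: "real \<Rightarrow> real"
  assumes u: "integrable I01 u" and G: "continuous_on {0..1} G"
  shows "integrable I01 (\<lambda>x. u x * G x)"
proof -
  have "bounded (G ` {0..1})"
    using compact_continuous_image[OF G] compact_imp_bounded by auto
  then obtain B where B: "\<And>x. x \<in> {0..1} \<Longrightarrow> \<bar>G x\<bar> \<le> B"
    by (fastforce simp: bounded_iff)
  have [measurable]: "G \<in> borel_measurable I01" "u \<in> borel_measurable I01"
    using continuous_imp_integrable_real[OF G] u by auto
  show ?thesis
  proof (rule Bochner_Integration.integrable_bound[where f = "\<lambda>x. B * u x"])
    show "AE x in I01. norm (u x * G x) \<le> norm (B * u x)"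
      using B by (auto simp: abs_mult mult.commute[of B] intro!: AE_I2 mult_left_mono order_trans[OF B abs_ge_self])
  qed (use u in auto)
qed

lemma cm_bounded_integrable:
  "integrable I01 u \<Longrightarrow> integrable I01 (\<lambda>x. u x * cm k x)"
  "integrable I01 u \<Longrightarrow> integrable I01 (\<lambda>x. u x * sm k x)"
  by (auto intro!: continuous_mult_integrable continuous_intros)

lemma integral_cm_cm: "(LINT x|I01. cm j x * cm k x) = (if j = k then 1 / wt k else 0)"
  and integral_sm_sm: "(LINT x|I01. sm j x * sm k x) = (if j = k \<and> k \<noteq> 0 then 1 / 2 else 0)"
proof -
  have i: "integrable I01 (cm k)" for k
    by (intro continuous_imp_integrable_real continuous_intros)
  show "(LINT x|I01. cm j x * cm k x) = (if j = k then 1 / wt k else 0)"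
    unfolding cm_mult by (auto simp: i integral_cm wt_def)
  show "(LINT x|I01. sm j x * sm k x) = (if j = k \<and> k \<noteq> 0 then 1 / 2 else 0)"
    unfolding sm_mult by (auto simp: i integral_cm)
qed

text \<open>Multiples of single modes and sums are all that is needed to pass from the modes to a
  dense class: what is proved later about cosine polynomials is an induction over these two
  rules.\<close>

inductive cospoly :: "(real \<Rightarrow> real) \<Rightarrow> bool" where
  cospoly_cm: "cospoly (\<lambda>x. c * cm k x)"
| cospoly_add: "cospoly f \<Longrightarrow> cospoly g \<Longrightarrow> cospoly (\<lambda>x. f x + g x)"

lemma cospoly_mult_cm1: "cospoly f \<Longrightarrow> cospoly (\<lambda>x. f x * cm 1 x)"
proof (induction rule: cospoly.induct)
  case (cospoly_cm c k)
  have "cospoly (\<lambda>x. (c/2) * cm (k + 1) x + (c/2) * cm (if k \<le> 1 then 1 - k else k - 1) x)"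
    by (intro cospoly.intros)
  then show ?case
    by (simp only: mult.assoc cm_mult) (simp add: add_divide_distrib distrib_left)
next
  case (cospoly_add f g)
  from cospoly.cospoly_add[OF cospoly_add.IH] show ?case
    by (simp add: distrib_right)
qed

lemma cospoly_scale: "cospoly f \<Longrightarrow> cospoly (\<lambda>x. c * f x)"
proof (induction rule: cospoly.induct)
  case (cospoly_cm a k)
  then show ?case using cospoly.cospoly_cm[of "c*a" k] by (simp add: mult.assoc)
next
  case (cospoly_add f g)
  from cospoly.cospoly_add[OF cospoly_add.IH] show ?case by (simp add: distrib_left)
qed

lemma cospoly_power: "cospoly (\<lambda>x. cm 1 x ^ m)"
proof (induction m)
  case 0 then show ?case using cospoly_cm[of 1 0] by simp
next
  case (Suc m) from cospoly_mult_cm1[OF this] show ?case by (simp add: mult.commute)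
qed

lemma cospoly_sum: "cospoly (\<lambda>x. \<Sum>i\<le>(n::nat). a i * cm 1 x ^ i)"
proof (induction n)
  case 0 then show ?case using cospoly_cm[of "a 0" 0] by simp
next
  case (Suc n) then show ?case
    using cospoly_add[OF Suc cospoly_scale[OF cospoly_power[of "Suc n"]], of "a (Suc n)"] by simp
qed

lemma cospoly_continuous: "cospoly f \<Longrightarrow> continuous_on A f"
  by (induction rule: cospoly.induct) (auto intro!: continuous_intros)

text \<open>The map x -> cos (\<pi> x) carries [0,1] homeomorphically onto [-1,1], and polynomials
  in it are cosine polynomials; so the Weierstrass theorem on [-1,1] applies to G composed with
  arccos / \<pi>.\<close>

lemma cospoly_dense:
  assumes "continuous_on {0..1} G" "0 < e"
  obtains f where "cospoly f" "\<And>x. x \<in> {0..1} \<Longrightarrow> \<bar>G x - f x\<bar> < e"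
proof -
  have c: "continuous_on {-1..1} (\<lambda>y. G (arccos y / pi))"
    by (rule continuous_on_compose2[OF assms(1)])
      (auto intro!: continuous_intros arccos_lbound divide_nonneg_pos simp: arccos_ubound)
  obtain g where g: "real_polynomial_function g" "\<And>y. y \<in> {-1..1} \<Longrightarrow> \<bar>G (arccos y / pi) - g y\<bar> < e"
    using Stone_Weierstrass_real_polynomial_function[OF _ c assms(2)] by auto
  obtain a n where an: "g = (\<lambda>y. \<Sum>i\<le>n. a i * y^i)"
    using g(1) real_polynomial_function_iff_sum by blast
  show ?thesis
  proof
    show "cospoly (\<lambda>x. g (cm 1 x))"
      unfolding an by (rule cospoly_sum)
    fix x :: real assume x: "x \<in> {0..1}"
    have "arccos (cm 1 x) = pi * x"
      using x by (simp add: cm_def arccos_cos)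
    then show "\<bar>G x - g (cm 1 x)\<bar> < e"
      using g(2)[of "cm 1 x"] abs_cm_le[of 1 x] by (simp add: abs_le_iff)
  qed
qed

lemma lint_cospoly_zero:
  fixes u :: "real \<Rightarrow> real"
  assumes u: "integrable I01 u" and 0: "\<And>k. (LINT x|I01. u x * cm k x) = 0" and f: "cospoly f"
  shows "integrable I01 (\<lambda>x. u x * f x) \<and> (LINT x|I01. u x * f x) = 0"
  using f
proof (induction rule: cospoly.induct)
  case (cospoly_cm c k)
  show ?case
    using cm_bounded_integrable(1)[OF u, of k] 0[of k]
    by (simp add: mult.left_commute)
qed (simp_all add: distrib_left)

lemma lint_continuous_zero:
  fixes u :: "real \<Rightarrow> real"
  assumes u: "integrable I01 u" and 0: "\<And>k. (LINT x|I01. u x * cm k x) = 0" and G: "continuous_on {0..1} G"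
  shows "(LINT x|I01. u x * G x) = 0"
proof -
  have "\<bar>LINT x|I01. u x * G x\<bar> \<le> e * (LINT x|I01. \<bar>u x\<bar>)" if e: "e > 0" for e
  proof -
    obtain f where f: "cospoly f" "\<And>x. x \<in> {0..1} \<Longrightarrow> \<bar>G x - f x\<bar> < e"
      using cospoly_dense[OF G e] by blast
    have i: "integrable I01 (\<lambda>x. u x * G x)" "integrable I01 (\<lambda>x. u x * f x)"
      using continuous_mult_integrable[OF u] G cospoly_continuous[OF f(1)] by auto
    have "(LINT x|I01. u x * G x) = (LINT x|I01. u x * G x - u x * f x)"
      using lint_cospoly_zero[OF u 0 f(1)] i by simp
    also have "\<bar>\<dots>\<bar> \<le> (LINT x|I01. \<bar>u x * G x - u x * f x\<bar>)"
      by (rule integral_abs_bound)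
    also have "\<dots> \<le> (LINT x|I01. e * \<bar>u x\<bar>)"
    proof (intro integral_mono)
      fix x assume "x \<in> space I01"
      then have "\<bar>u x\<bar> * \<bar>G x - f x\<bar> \<le> \<bar>u x\<bar> * e"
        using f(2)[of x] by (intro mult_left_mono) auto
      then show "\<bar>u x * G x - u x * f x\<bar> \<le> e * \<bar>u x\<bar>"
        by (simp add: abs_mult mult.commute[of e] flip: right_diff_distrib)
    qed (use i u in auto)
    finally show ?thesis using u by simp
  qed
  note * = this
  show ?thesis
  proof (rule ccontr)
    assume ne: "(LINT x|I01. u x * G x) \<noteq> 0"
    have "0 < (LINT x|I01. \<bar>u x\<bar>)"
      using *[of 1] ne by linarith
    then show False
      using *[of "\<bar>LINT x|I01. u x * G x\<bar> / (2 * (LINT x|I01. \<bar>u x\<bar>))"] ne by (simp add: field_simps)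
  qed
qed

text \<open>The sign of \<open>u\<close> is a limit almost everywhere of continuous functions, and
  truncating these to [-1,1] makes \<open>\<bar>u\<bar>\<close> a dominating function. The limit of
  the vanishing integrals is the L1 norm of \<open>u\<close>.\<close>

lemma AE_zero_if_lint_continuous_zero:
  fixes u :: "real \<Rightarrow> real"
  assumes u: "integrable I01 u" and 0: "\<And>G. continuous_on {0..1} G \<Longrightarrow> (LINT x|I01. u x * G x) = 0"
  shows "AE x in I01. u x = 0"
proof -
  have [measurable]: "u \<in> borel_measurable I01" using u by auto
  have "(\<lambda>x. sgn (u x)) \<in> borel_measurable I01" by measurable
  then have "(\<lambda>x. sgn (u x)) measurable_on {0..1}"
    using measurable_on_iff_borel_measurable[of "{0..1}" "\<lambda>x. sgn (u x)"] by auto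
  then obtain N g where N: "negligible N" and g: "\<And>n. continuous_on UNIV (g n)"
    and lim: "\<And>x. x \<notin> N \<Longrightarrow> (\<lambda>n. g n x) \<longlonglongrightarrow> (if x \<in> {0..1} then sgn (u x) else 0)"
    unfolding measurable_on_def by blast
  define h where "h n x = max (-1) (min 1 (g n x :: real))" for n x
  have hc: "continuous_on {0..1} (h n)" for n
    unfolding h_def using g continuous_on_subset by (intro continuous_intros) blast
  have "(\<lambda>n. LINT x|I01. u x * h n x) \<longlonglongrightarrow> (LINT x|I01. u x * sgn (u x))"
  proof (rule integral_dominated_convergence[where w = "\<lambda>x. \<bar>u x\<bar>"])
    show "AE x in I01. (\<lambda>n. u x * h n x) \<longlonglongrightarrow> u x * sgn (u x)"
    proof -
      have "N \<in> null_sets lebesgue" using N by (simp add: negligible_iff_null_sets)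
      then have "AE x in lebesgue. x \<notin> N" by (rule AE_not_in)
      then have "AE x in I01. x \<notin> N" by (auto simp: AE_restrict_space_iff elim: eventually_mono)
      then show ?thesis
      proof (rule AE_mp, intro AE_I2 impI)
        fix x :: real assume x: "x \<in> space I01" "x \<notin> N"
        then have "(\<lambda>n. g n x) \<longlonglongrightarrow> sgn (u x)" using lim[of x] by auto
        then have "(\<lambda>n. h n x) \<longlonglongrightarrow> max (-1) (min 1 (sgn (u x)))"
          unfolding h_def by (intro tendsto_intros)
        also have "max (-1) (min 1 (sgn (u x))) = sgn (u x)" by (auto simp: sgn_if)
        finally show "(\<lambda>n. u x * h n x) \<longlonglongrightarrow> u x * sgn (u x)" by (intro tendsto_intros)
      qed
    qed
    show "AE x in I01. norm (u x * h n x) \<le> \<bar>u x\<bar>" for n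
      by (auto simp: abs_mult h_def intro!: AE_I2 mult_left_le)
    show "(\<lambda>x. u x * h n x) \<in> borel_measurable I01" for n
      using continuous_mult_integrable[OF u hc[of n]] by auto
  qed (use u in auto)
  then have "(LINT x|I01. \<bar>u x\<bar>) = 0"
    unfolding 0[OF hc] by (simp add: LIMSEQ_const_iff mult_sgn_abs abs_sgn)
  then show ?thesis
    using u by (subst (asm) integral_nonneg_eq_0_iff_AE) auto
qed

lemma AE_zero_if_cos_coeffs_zero:
  fixes u :: "real \<Rightarrow> real"
  assumes "integrable I01 u" "\<And>k. (LINT x|I01. u x * cm k x) = 0"
  shows "AE x in I01. u x = 0"
  using AE_zero_if_lint_continuous_zero[OF assms(1) lint_continuous_zero[OF assms]] .

lemma continuous_AE_eq_imp_eq: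
  fixes v w :: "real \<Rightarrow> real"
  assumes "continuous_on {0..1} v" "continuous_on {0..1} w" "AE x in I01. v x = w x" "x \<in> {0..1}"
  shows "v x = w x"
proof -
  have c: "continuous_on {0..1} (\<lambda>x. (v x - w x)^2)"
    using assms by (intro continuous_intros)
  have "(LINT x|I01. (v x - w x)^2) = 0"
    using assms(3) by (intro integral_eq_zero_AE) auto
  then show ?thesis
    using integralL_eq_0_iff[OF c] assms(4) by auto
qed

section \<open>Absolutely summable cosine series\<close>

lemma cos_series_continuous:
  assumes "summable (\<lambda>k. \<bar>h k\<bar>)"
  shows "continuous_on A (\<lambda>x. \<Sum>k. wt k * h k * cm k x)"
proof -
  have "uniform_limit A (\<lambda>n x. \<Sum>k<n. wt k * h k * cm k x) (\<lambda>x. \<Sum>k. wt k * h k * cm k x) sequentially"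
  proof (rule Weierstrass_m_test)
    show "norm (wt k * h k * cm k x) \<le> 2 * \<bar>h k\<bar>" for k x
      using mult_mono[OF mult_mono[OF wt_le_2[of k] order_refl[of "\<bar>h k\<bar>"]] abs_cm_le[of k x]]
      by (simp add: abs_mult)
  qed (use assms in auto)
  then show ?thesis
    by (rule uniform_limit_theorem[rotated]) (auto intro!: continuous_intros always_eventually)
qed

lemma cos_series_sums:
  assumes h: "summable (\<lambda>k. \<bar>h k\<bar>)" and u: "integrable I01 u"
  shows "(\<lambda>k. wt k * h k * (LINT x|I01. u x * cm k x)) sums (LINT x|I01. u x * (\<Sum>k. wt k * h k * cm k x))"
proof -
  have s: "summable (\<lambda>k. \<bar>wt k * h k * cm k x\<bar>)" for x
  proof (rule summable_comparison_test[OF _ summable_mult[OF h, of 2]], intro exI allI impI)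
    show "norm \<bar>wt k * h k * cm k x\<bar> \<le> 2 * \<bar>h k\<bar>" for k
      using mult_mono[OF mult_mono[OF wt_le_2[of k] order_refl[of "\<bar>h k\<bar>"]] abs_cm_le[of k x]]
      by (simp add: abs_mult)
  qed
  have b: "norm (wt k * h k * (u x * cm k x)) \<le> 2 * \<bar>h k\<bar> * \<bar>u x\<bar>" for k x
    using mult_mono[OF mult_mono[OF wt_le_2[of k] order_refl[of "\<bar>h k\<bar>"]] mult_mono[OF order_refl[of "\<bar>u x\<bar>"] abs_cm_le[of k x]]]
    by (simp add: abs_mult)
  have i: "integrable I01 (\<lambda>x. wt k * h k * (u x * cm k x))" for k
    using cm_bounded_integrable[OF u] by auto
  have sm: "summable (\<lambda>k. LINT x|I01. norm (wt k * h k * (u x * cm k x)))"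
  proof (rule summable_comparison_test[OF _ summable_mult[OF h, of "2 * (LINT x|I01. \<bar>u x\<bar>)"]], intro exI allI impI)
    fix k
    have "(LINT x|I01. norm (wt k * h k * (u x * cm k x))) \<le> (LINT x|I01. 2 * \<bar>h k\<bar> * \<bar>u x\<bar>)"
      using i u b by (intro integral_mono) auto
    then show "norm (LINT x|I01. norm (wt k * h k * (u x * cm k x))) \<le> 2 * (LINT x|I01. \<bar>u x\<bar>) * \<bar>h k\<bar>"
      using u by (simp add: mult.commute mult.left_commute)
  qed
  have "(\<lambda>k. LINT x|I01. wt k * h k * (u x * cm k x)) sums (LINT x|I01. (\<Sum>k. wt k * h k * (u x * cm k x)))"
  proof (rule sums_integral[OF i AE_I2 sm])
    show "summable (\<lambda>k. norm (wt k * h k * (u x * cm k x)))" for x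
      using summable_mult[OF s[of x], of "\<bar>u x\<bar>"] by (simp add: abs_mult mult_ac)
  qed
  moreover have "(\<Sum>k. wt k * h k * (u x * cm k x)) = u x * (\<Sum>k. wt k * h k * cm k x)" for x
    using suminf_mult[OF summable_rabs_cancel[OF s[of x]], of "u x"] by (simp add: mult_ac)
  ultimately show ?thesis by simp
qed

lemma cos_series_coeff:
  assumes h: "summable (\<lambda>k. \<bar>h k\<bar>)"
  shows "(LINT x|I01. (\<Sum>k. wt k * h k * cm k x) * cm j x) = h j"
proof -
  have "(\<lambda>k. wt k * h k * (LINT x|I01. cm j x * cm k x)) sums (LINT x|I01. cm j x * (\<Sum>k. wt k * h k * cm k x))"
    by (intro cos_series_sums[OF h] continuous_imp_integrable_real continuous_intros)
  moreover have "(\<lambda>k. wt k * h k * (LINT x|I01. cm j x * cm k x)) = (\<lambda>k. if k = j then h j else 0)"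
    by (auto simp: integral_cm_cm wt_def)
  ultimately show ?thesis
    using sums_unique2[OF _ sums_single[of j h]] by (simp add: mult.commute[of "cm j _"] eq_commute[of _ j] if_distrib cong: if_cong)
qed

text \<open>No pointwise theory of Fourier series enters: both sides are continuous and have the
  same coefficients, hence agree almost everywhere and therefore everywhere.\<close>

lemma cos_inversion:
  assumes v: "continuous_on {0..1} v" and h: "\<And>k. h k = (LINT x|I01. v x * cm k x)"
    and s: "summable (\<lambda>k. \<bar>h k\<bar>)" and x: "x \<in> {0..1}"
  shows "v x = (\<Sum>k. wt k * h k * cm k x)"
proof -
  let ?S = "\<lambda>x. \<Sum>k. wt k * h k * cm k x"
  have i: "integrable I01 v" "integrable I01 ?S"
    by (intro continuous_imp_integrable_real v cos_series_continuous[OF s])+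
  have "AE x in I01. v x - ?S x = 0"
  proof (rule AE_zero_if_cos_coeffs_zero)
    show "(LINT x|I01. (v x - ?S x) * cm k x) = 0" for k
      using cos_series_coeff[OF s, of k] cm_bounded_integrable[OF i(1)] cm_bounded_integrable[OF i(2)]
      by (simp add: left_diff_distrib h)
  qed (use i in auto)
  then show ?thesis
    by (intro continuous_AE_eq_imp_eq[OF v cos_series_continuous[OF s] _ x]) auto
qed

text \<open>The integral of \<open>(u x - S x)^2\<close> is nonnegative for the partial sum S. The
  lemma is meant for the initial profile, about whose coefficients nothing better than square
  summability is known.\<close>

lemma cos_bessel:
  assumes u: "u \<in> borel_measurable I01" and B: "\<And>x. x \<in> {0..1} \<Longrightarrow> \<bar>u x\<bar> \<le> B"
  shows "summable (\<lambda>k. (LINT x|I01. u x * cm k x)^2)"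
proof (rule bounded_imp_summable)
  define h where "h k = (LINT x|I01. u x * cm k x)" for k
  have ui: "integrable I01 u"
    by (rule measurable_bounded_by_integrable_imp_lebesgue_integrable[OF u, of "\<lambda>_. B"])
      (use B in \<open>auto simp: integrable_const_ivl\<close>)
  have u2: "integrable I01 (\<lambda>x. (u x)^2)"
  proof (rule measurable_bounded_by_integrable_imp_lebesgue_integrable[of _ _ "\<lambda>_. B^2"])
    show "norm ((u x)\<^sup>2) \<le> B\<^sup>2" if "x \<in> {0..1}" for x
      using power_mono[OF B[OF that], of 2] by simp
  qed (use u in \<open>auto simp: integrable_const_ivl\<close>)
  fix n
  define S where "S x = (\<Sum>k\<le>n. wt k * h k * cm k x)" for x
  have Sc: "continuous_on {0..1} S"
    unfolding S_def by (intro continuous_intros)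
  have i: "integrable I01 (\<lambda>x. u x * S x)" "integrable I01 (\<lambda>x. S x * S x)"
    by (intro continuous_mult_integrable ui continuous_imp_integrable_real Sc continuous_intros)+
  have ci: "integrable I01 (\<lambda>x. cm j x * cm k x)" for j k
    by (intro continuous_imp_integrable_real continuous_intros)
  have uS: "(LINT x|I01. u x * S x) = (\<Sum>k\<le>n. wt k * (h k)^2)"
    unfolding S_def sum_distrib_left
    using cm_bounded_integrable[OF ui] by (simp add: mult.left_commute[of "u _"] h_def[symmetric] power2_eq_square mult.assoc)
  have "(LINT x|I01. S x * S x) = (\<Sum>j\<le>n. \<Sum>k\<le>n. (wt j * h j) * (wt k * h k) * (LINT x|I01. cm j x * cm k x))"
  proof -
    have "S x * S x = (\<Sum>j\<le>n. \<Sum>k\<le>n. ((wt j * h j) * (wt k * h k)) * (cm j x * cm k x))" for x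
      unfolding S_def sum_product by (simp add: mult_ac)
    then show ?thesis using ci by simp
  qed
  also have "\<dots> = (\<Sum>j\<le>n. wt j * (h j)^2)"
    by (intro sum.cong refl)
      (auto simp: integral_cm_cm if_distrib power2_eq_square sum.delta' less_imp_neq[THEN not_sym] cong: if_cong)
  finally have SS: "(LINT x|I01. S x * S x) = (\<Sum>k\<le>n. wt k * (h k)^2)" .
  have "0 \<le> (LINT x|I01. (u x)^2 - 2 * (u x * S x) + S x * S x)"
  proof (rule integral_nonneg_AE, intro AE_I2)
    show "0 \<le> (u x)^2 - 2 * (u x * S x) + S x * S x" for x
      using zero_le_power2[of "u x - S x"] by (simp add: power2_eq_square algebra_simps)
  qed
  also have "\<dots> = (LINT x|I01. (u x)^2) - (\<Sum>k\<le>n. wt k * (h k)^2)"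
    using u2 i by (simp add: uS SS)
  finally have "(\<Sum>k\<le>n. wt k * (h k)^2) \<le> (LINT x|I01. (u x)^2)" by simp
  moreover have "(\<Sum>k\<le>n. (h k)^2) \<le> (\<Sum>k\<le>n. wt k * (h k)^2)"
    by (intro sum_mono) (auto simp: wt_def)
  ultimately show "(\<Sum>k\<le>n. (LINT x|I01. u x * cm k x)^2) \<le> (LINT x|I01. (u x)^2)"
    by (simp add: h_def)
qed auto

section \<open>Entropy production\<close>

declare One_nat_def [simp del]

section \<open>Sums over configurations\<close>

lemma configs_image: "configs A = (\<lambda>S i. i \<in> S) ` Pow A"
proof (intro set_eqI iffI)
  fix \<eta> assume "\<eta> \<in> configs A"
  then have "\<eta> = (\<lambda>i. i \<in> Collect \<eta>)" "Collect \<eta> \<in> Pow A" by (auto simp: configs_def)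
  then show "\<eta> \<in> (\<lambda>S i. i \<in> S) ` Pow A" by (rule image_eqI)
qed (auto simp: configs_def)

lemma finite_configs [simp]: "finite A \<Longrightarrow> finite (configs A)"
  by (simp add: configs_image)

lemma card_configs: "finite A \<Longrightarrow> card (configs A) = 2 ^ card A"
  unfolding configs_image by (subst card_image) (auto simp: inj_on_def fun_eq_iff card_Pow)

lemma configs_comp_transpose:
  "x \<in> A \<Longrightarrow> y \<in> A \<Longrightarrow> \<eta> \<in> configs A \<Longrightarrow> \<eta> \<circ> Transposition.transpose x y \<in> configs A"
  by (auto simp: configs_def Transposition.transpose_def split: if_splits)

lemma swap_eq_comp: "swap x \<eta> = \<eta> \<circ> Transposition.transpose x (Suc x)"
  by (auto simp: swap_def fun_eq_iff Transposition.transpose_def)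

lemma sum_configs_comp_transpose:
  assumes "x \<in> A" "y \<in> A"
  shows "(\<Sum>\<eta>\<in>configs A. f (\<eta> \<circ> Transposition.transpose x y)) = (\<Sum>\<eta>\<in>configs A. f \<eta>)"
  by (rule sum.reindex_bij_witness[of _ "\<lambda>\<eta>. \<eta> \<circ> Transposition.transpose x y" "\<lambda>\<eta>. \<eta> \<circ> Transposition.transpose x y"])
    (use assms in \<open>auto simp: configs_comp_transpose comp_assoc\<close>)

lemma window_configs [simp]: "window l k \<eta> \<in> configs {1..l}"
  by (auto simp: configs_def window_def)

lemma paste_configs:
  "\<xi> \<in> configs {1..l} \<Longrightarrow> \<eta> \<in> configs A \<Longrightarrow> {k + 1..k + l} \<subseteq> A \<Longrightarrow> paste l k \<xi> \<eta> \<in> configs A"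
  by (auto simp: configs_def paste_def split: if_splits)

text \<open>A configuration is determined by its image under pasting and its old window.\<close>

lemma sum_paste_le:
  assumes "\<xi> \<in> configs {1..l}" "finite A" "{k + 1..k + l} \<subseteq> A" "\<And>\<eta>. \<eta> \<in> configs A \<Longrightarrow> 0 \<le> (g \<eta> :: real)"
  shows "(\<Sum>\<eta>\<in>configs A. g (paste l k \<xi> \<eta>)) \<le> 2 ^ l * (\<Sum>\<eta>\<in>configs A. g \<eta>)"
proof -
  let ?\<phi> = "paste l k \<xi>"
  have im: "?\<phi> ` configs A \<subseteq> configs A"
    using assms by (auto intro: paste_configs)
  have card: "real (card {\<eta> \<in> configs A. ?\<phi> \<eta> = \<zeta>}) \<le> 2 ^ l" for \<zeta>
  proof -
    have "inj_on (window l k) {\<eta> \<in> configs A. ?\<phi> \<eta> = \<zeta>}"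
    proof (rule inj_onI, rule ext)
      fix \<eta> \<eta>' i assume *: "\<eta> \<in> {\<eta> \<in> configs A. ?\<phi> \<eta> = \<zeta>}" "\<eta>' \<in> {\<eta> \<in> configs A. ?\<phi> \<eta> = \<zeta>}" "window l k \<eta> = window l k \<eta>'"
      then have "?\<phi> \<eta> i = ?\<phi> \<eta>' i" "window l k \<eta> (i - k) = window l k \<eta>' (i - k)" by auto
      then show "\<eta> i = \<eta>' i"
        by (cases "i \<in> {k+1..k+l}") (auto simp: paste_def window_def split: if_splits)
    qed
    then have "card {\<eta> \<in> configs A. ?\<phi> \<eta> = \<zeta>} \<le> card (configs {1..l})"
      by (rule card_inj_on_le) auto
    also have "\<dots> = 2 ^ l" by (simp add: card_configs)
    finally have "real (card {\<eta> \<in> configs A. ?\<phi> \<eta> = \<zeta>}) \<le> real (2 ^ l)" by (simp only: of_nat_le_iff)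
    then show ?thesis by simp
  qed
  have "(\<Sum>\<eta>\<in>configs A. g (?\<phi> \<eta>)) = (\<Sum>\<zeta>\<in>?\<phi> ` configs A. \<Sum>\<eta>\<in>{\<eta> \<in> configs A. ?\<phi> \<eta> = \<zeta>}. g (?\<phi> \<eta>))"
    using assms(2) by (intro sum.image_gen) auto
  also have "\<dots> = (\<Sum>\<zeta>\<in>?\<phi> ` configs A. real (card {\<eta> \<in> configs A. ?\<phi> \<eta> = \<zeta>}) * g \<zeta>)"
    by (intro sum.cong refl) simp
  also have "\<dots> \<le> (\<Sum>\<zeta>\<in>?\<phi> ` configs A. 2 ^ l * g \<zeta>)"
    using im assms(4) card by (intro sum_mono mult_right_mono) auto
  also have "\<dots> \<le> (\<Sum>\<zeta>\<in>configs A. 2 ^ l * g \<zeta>)"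
    using im assms by (intro sum_mono2) auto
  finally show ?thesis by (simp add: sum_distrib_left)
qed

text \<open>From \<open>ln z \<le> z - 1\<close> at the ratio of the smaller to the larger number.
  The quotient by a + b is the form of the dissipation that Cauchy-Schwarz turns into a bound of an
  L1 distance in \<open>Tr_bond\<close>.\<close>

lemma log_diff_bound:
  fixes a b :: real
  assumes "0 < a" "0 < b"
  shows "(a - b) * (ln b - ln a) \<le> - ((a - b)^2 / (a + b))"
proof -
  have main: "(x - y) * (ln x - ln y) \<ge> (x - y)^2 / (x + y)" if "0 < y" "y \<le> x" for x y :: real
  proof -
    have "ln (y / x) \<le> y / x - 1" using that by (intro ln_le_minus_one) auto
    then have "(x - y) / x \<le> ln x - ln y" using that by (simp add: ln_div field_simps)
    moreover have "(x - y) / (x + y) \<le> (x - y) / x"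
      using that by (intro divide_left_mono) auto
    ultimately have "(x - y) * ((x - y) / (x + y)) \<le> (x - y) * (ln x - ln y)"
      using that by (intro mult_left_mono) auto
    then show ?thesis by (simp add: power2_eq_square)
  qed
  show ?thesis
  proof (cases "b \<le> a")
    case True
    then show ?thesis using main[of b a] assms by (simp add: algebra_simps)
  next
    case False
    then show ?thesis using main[of a b] assms by (simp add: algebra_simps power2_commute)
  qed
qed

text \<open>The Boolean selects the boundary, \<open>True\<close> being the right one, so that each
  estimate is proved once for both ends.\<close>

locale micro_model =
  fixes N l :: nat and R :: "bool \<Rightarrow> rates" and RB :: real
  assumes l: "1 \<le> l" and N: "2 * l + 2 \<le> N"
    and R_nonneg: "\<And>\<sigma> \<xi> \<xi>'. \<xi> \<in> configs {1..l} \<Longrightarrow> \<xi>' \<in> configs {1..l} \<Longrightarrow> 0 \<le> R \<sigma> \<xi> \<xi>'"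
    and R_bound: "\<And>\<sigma> \<xi> \<xi>'. \<xi> \<in> configs {1..l} \<Longrightarrow> \<xi>' \<in> configs {1..l} \<Longrightarrow> R \<sigma> \<xi> \<xi>' \<le> RB"
begin

definition n :: nat where "n = N - 1"

definition base :: "bool \<Rightarrow> nat" where "base \<sigma> = (if \<sigma> then N - 1 - l else 0)"

abbreviation L :: "(config \<Rightarrow> real) \<Rightarrow> config \<Rightarrow> real" where
  "L \<equiv> generator N l (R False) (R True)"

lemma RB_nonneg: "0 \<le> RB"
proof -
  have z: "(\<lambda>_. False) \<in> configs {1..l}" by (auto simp: configs_def)
  show ?thesis using R_nonneg[OF z z, of False] R_bound[OF z z, of False] by linarith
qed

lemma CR_nonneg: "0 \<le> 4 * RB * 4 ^ l"
  using RB_nonneg by simp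

lemma n_pos: "1 \<le> n" "2 * l + 1 \<le> n" and N_eq: "N = Suc n"
  using N by (auto simp: n_def)

lemma window_sites: "{base \<sigma> + 1..base \<sigma> + l} \<subseteq> {1..N - 1}"
  using N by (auto simp: base_def)

lemma L_eq: "L f \<eta> = real N ^ 2 * (\<Sum>x\<in>{1..<n}. f (swap x \<eta>) - f \<eta>)
     + real N * (\<Sum>\<sigma>\<in>UNIV. \<Sum>\<xi>\<in>configs {1..l}. R \<sigma> (window l (base \<sigma>) \<eta>) \<xi> * (f (paste l (base \<sigma>) \<xi> \<eta>) - f \<eta>))"
  by (simp add: generator_def boundary_generator_def base_def n_def UNIV_bool add.commute)

lemma swap_Omega [simp]: "x \<in> {1..<n} \<Longrightarrow> \<eta> \<in> Omega N \<Longrightarrow> swap x \<eta> \<in> Omega N"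
  unfolding swap_eq_comp by (intro configs_comp_transpose) (auto simp: n_def)

lemma paste_Omega [simp]: "\<xi> \<in> configs {1..l} \<Longrightarrow> \<eta> \<in> Omega N \<Longrightarrow> paste l (base \<sigma>) \<xi> \<eta> \<in> Omega N"
  using window_sites by (intro paste_configs)

lemma L_cong: "(\<And>\<eta>. \<eta> \<in> Omega N \<Longrightarrow> f \<eta> = g \<eta>) \<Longrightarrow> \<eta> \<in> Omega N \<Longrightarrow> L f \<eta> = L g \<eta>"
  unfolding L_eq by (intro arg_cong2[where f = "(+)"] arg_cong2[where f = "(*)"] sum.cong refl) auto

lemma L_sum: "L (\<lambda>\<eta>. \<Sum>i\<in>I. c i * f i \<eta>) \<eta> = (\<Sum>i\<in>I. c i * L (f i) \<eta>)"
proof (cases "finite I")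
  case True
  then show ?thesis
  proof (induction I)
    case empty show ?case by (simp add: L_eq)
  next
    case (insert i I)
    have "L (\<lambda>\<eta>. c i * f i \<eta> + (\<Sum>i\<in>I. c i * f i \<eta>)) \<eta> = c i * L (f i) \<eta> + L (\<lambda>\<eta>. \<Sum>i\<in>I. c i * f i \<eta>) \<eta>"
      unfolding L_eq by (simp add: sum_distrib_left sum.distrib sum_subtractf algebra_simps)
    then show ?case using insert by simp
  qed
qed (simp add: L_eq)

end

text \<open>Of the process only the one-time marginals and their forward equation enter. The
  equation is required at every real time, which the power series of the semigroup provides, so that
  derivatives at 0 and \<open>T\<close> are two-sided; positivity and total mass are required on
  \<open>{0..T}\<close> only.\<close>

locale flow = micro_model +
  fixes T :: real and p :: "real \<Rightarrow> config \<Rightarrow> real"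
  assumes T: "0 < T"
    and p_nonneg: "\<And>s \<eta>. s \<in> {0..T} \<Longrightarrow> \<eta> \<in> Omega N \<Longrightarrow> 0 \<le> p s \<eta>"
    and p_sum: "\<And>s. s \<in> {0..T} \<Longrightarrow> (\<Sum>\<eta>\<in>Omega N. p s \<eta>) = 1"
    and p_deriv: "\<And>s \<eta>. \<eta> \<in> Omega N \<Longrightarrow> ((\<lambda>s. p s \<eta>) has_real_derivative
        (\<Sum>\<zeta>\<in>Omega N. p s \<zeta> * L (\<lambda>\<xi>. of_bool (\<xi> = \<eta>)) \<zeta>)) (at s)"
begin

definition Ex :: "real \<Rightarrow> (config \<Rightarrow> real) \<Rightarrow> real" where
  "Ex s f = (\<Sum>\<eta>\<in>Omega N. p s \<eta> * f \<eta>)"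

text \<open>The forward equation is stated for indicators; expanding \<open>f s\<close> in
  indicators moves the generator onto it.\<close>

lemma Ex_deriv:
  assumes "\<And>\<eta>. \<eta> \<in> Omega N \<Longrightarrow> ((\<lambda>s. f s \<eta>) has_real_derivative f' \<eta>) (at s)"
  shows "((\<lambda>s. Ex s (f s)) has_real_derivative Ex s (\<lambda>\<eta>. L (f s) \<eta> + f' \<eta>)) (at s)"
proof -
  have "((\<lambda>s. Ex s (f s)) has_real_derivative
      (\<Sum>\<eta>\<in>Omega N. (\<Sum>\<zeta>\<in>Omega N. p s \<zeta> * L (\<lambda>\<xi>. of_bool (\<xi> = \<eta>)) \<zeta>) * f s \<eta> + f' \<eta> * p s \<eta>)) (at s)"
    unfolding Ex_def by (intro DERIV_sum DERIV_mult p_deriv assms)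
  also have "(\<Sum>\<eta>\<in>Omega N. (\<Sum>\<zeta>\<in>Omega N. p s \<zeta> * L (\<lambda>\<xi>. of_bool (\<xi> = \<eta>)) \<zeta>) * f s \<eta> + f' \<eta> * p s \<eta>)
    = (\<Sum>\<eta>\<in>Omega N. \<Sum>\<zeta>\<in>Omega N. p s \<zeta> * (f s \<eta> * L (\<lambda>\<xi>. of_bool (\<xi> = \<eta>)) \<zeta>)) + (\<Sum>\<eta>\<in>Omega N. p s \<eta> * f' \<eta>)"
    unfolding sum.distrib sum_distrib_right by (simp only: mult.assoc mult.commute[of "L _ _"] mult.commute[of "f' _"])
  also have "(\<Sum>\<eta>\<in>Omega N. \<Sum>\<zeta>\<in>Omega N. p s \<zeta> * (f s \<eta> * L (\<lambda>\<xi>. of_bool (\<xi> = \<eta>)) \<zeta>))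
    = (\<Sum>\<zeta>\<in>Omega N. p s \<zeta> * L (\<lambda>\<xi>. \<Sum>\<eta>\<in>Omega N. f s \<eta> * of_bool (\<xi> = \<eta>)) \<zeta>)"
    by (subst sum.swap) (simp only: L_sum sum_distrib_left)
  also have "\<dots> = (\<Sum>\<zeta>\<in>Omega N. p s \<zeta> * L (f s) \<zeta>)"
  proof (intro sum.cong refl arg_cong2[where f = "(*)"] L_cong)
    fix \<xi> assume "\<xi> \<in> Omega N"
    then show "(\<Sum>\<eta>\<in>Omega N. f s \<eta> * of_bool (\<xi> = \<eta>)) = f s \<xi>"
      by (simp add: of_bool_def if_distrib cong: if_cong)
  qed
  finally show ?thesis by (simp add: Ex_def sum.distrib distrib_left)
qed

lemma Ex_const: "s \<in> {0..T} \<Longrightarrow> Ex s (\<lambda>_. c) = c"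
  using p_sum[of s] by (simp add: Ex_def flip: sum_distrib_right)

lemma Ex_mono: "s \<in> {0..T} \<Longrightarrow> (\<And>\<eta>. \<eta> \<in> Omega N \<Longrightarrow> f \<eta> \<le> g \<eta>) \<Longrightarrow> Ex s f \<le> Ex s g"
  unfolding Ex_def by (intro sum_mono mult_left_mono p_nonneg)

lemma Ex_add: "Ex s (\<lambda>\<eta>. f \<eta> + g \<eta>) = Ex s f + Ex s g"
  and Ex_diff: "Ex s (\<lambda>\<eta>. f \<eta> - g \<eta>) = Ex s f - Ex s g"
  and Ex_cmult: "Ex s (\<lambda>\<eta>. c * f \<eta>) = c * Ex s f"
  by (simp_all add: Ex_def sum.distrib sum_subtractf algebra_simps sum_distrib_left)

lemma Ex_sum: "Ex s (\<lambda>\<eta>. \<Sum>i\<in>I. h i \<eta>) = (\<Sum>i\<in>I. Ex s (h i))"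
  unfolding Ex_def sum_distrib_left by (rule sum.swap)

lemma Ex_abs_le:
  assumes "s \<in> {0..T}" "\<And>\<eta>. \<eta> \<in> Omega N \<Longrightarrow> \<bar>f \<eta>\<bar> \<le> B"
  shows "\<bar>Ex s f\<bar> \<le> B"
proof -
  have "- B \<le> f \<eta>" "f \<eta> \<le> B" if "\<eta> \<in> Omega N" for \<eta>
    using assms(2)[OF that] by auto
  then have "Ex s f \<le> B" "- B \<le> Ex s f"
    using Ex_mono[OF assms(1), of f "\<lambda>_. B"] Ex_mono[OF assms(1), of "\<lambda>_. - B" f] Ex_const[OF assms(1)] by auto
  then show ?thesis by auto
qed

text \<open>Adding the uniform law to \<open>p\<close> makes all weights positive, so the entropy can be differentiated.\<close>

definition cN :: real where "cN = 1 / 2 ^ n"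

definition gg :: "real \<Rightarrow> config \<Rightarrow> real" where "gg s \<eta> = p s \<eta> + cN"

definition entropy :: "real \<Rightarrow> real" where
  "entropy s = (\<Sum>\<eta>\<in>Omega N. gg s \<eta> * ln (gg s \<eta> / cN))"

definition dirichlet :: "real \<Rightarrow> nat \<Rightarrow> real" where
  "dirichlet s x = (\<Sum>\<eta>\<in>Omega N. (gg s (swap x \<eta>) - gg s \<eta>)^2 / (gg s (swap x \<eta>) + gg s \<eta>))"

definition Dir :: "real \<Rightarrow> real" where "Dir s = (\<Sum>x\<in>{1..<n}. dirichlet s x)"

text \<open>Two boundaries, \<open>2 ^ l\<close> target windows, and for each of them
  \<open>RB * 2 ^ l * 2\<close>: here \<open>2 ^ l\<close> bounds the number of configurations with
  the same image under pasting, and 2 is the total mass of \<open>gg\<close>.\<close>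

definition CR :: real where "CR = 4 * RB * 4 ^ l"

lemma cN_pos [simp]: "0 < cN" "cN \<noteq> 0" by (simp_all add: cN_def)

lemma card_Omega: "card (Omega N) = 2 ^ n"
  by (simp add: card_configs n_def)

lemma gg_pos: "s \<in> {0..T} \<Longrightarrow> \<eta> \<in> Omega N \<Longrightarrow> 0 < gg s \<eta>" "s \<in> {0..T} \<Longrightarrow> \<eta> \<in> Omega N \<Longrightarrow> cN \<le> gg s \<eta>"
  using p_nonneg[of s \<eta>] cN_pos by (auto simp: gg_def simp del: cN_pos)

lemma gg_sum: "s \<in> {0..T} \<Longrightarrow> (\<Sum>\<eta>\<in>Omega N. gg s \<eta>) = 2"
  by (simp add: gg_def sum.distrib p_sum card_Omega cN_def)

lemma dirichlet_nonneg: "s \<in> {0..T} \<Longrightarrow> x \<in> {1..<n} \<Longrightarrow> 0 \<le> dirichlet s x"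
  unfolding dirichlet_def by (intro sum_nonneg divide_nonneg_pos add_pos_pos gg_pos) auto

lemma Dir_nonneg: "s \<in> {0..T} \<Longrightarrow> 0 \<le> Dir s"
  unfolding Dir_def by (intro sum_nonneg dirichlet_nonneg)

lemma p_continuous: "\<eta> \<in> Omega N \<Longrightarrow> continuous_on A (\<lambda>s. p s \<eta>)"
  by (rule DERIV_continuous_on[OF has_field_derivative_at_within[OF p_deriv]])

lemma Dir_continuous: "continuous_on {0..T} Dir"
  unfolding Dir_def[abs_def] dirichlet_def gg_def
proof (intro continuous_intros p_continuous ballI swap_Omega)
  fix x \<eta> s assume "x \<in> {1..<n}" "\<eta> \<in> Omega N" "s \<in> {0..T}"
  then show "p s (swap x \<eta>) + cN + (p s \<eta> + cN) \<noteq> 0"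
    using gg_pos(1)[of s "swap x \<eta>", OF _ swap_Omega] gg_pos(1)[of s \<eta>] by (simp add: gg_def)
qed auto

lemma entropy_nonneg: "s \<in> {0..T} \<Longrightarrow> 0 \<le> entropy s"
  unfolding entropy_def using gg_pos by (intro sum_nonneg mult_nonneg_nonneg) (auto simp: less_imp_le)

lemma entropy_le: "s \<in> {0..T} \<Longrightarrow> entropy s \<le> 2 * real N"
proof -
  assume s: "s \<in> {0..T}"
  have "ln (gg s \<eta> / cN) \<le> real N" if "\<eta> \<in> Omega N" for \<eta>
  proof -
    have "p s \<eta> \<le> 1" using p_sum[OF s] p_nonneg[OF s] that member_le_sum[of \<eta> "Omega N" "p s"] by auto
    then have "gg s \<eta> / cN \<le> 2 ^ n + 1" by (simp add: gg_def cN_def field_simps)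
    also have "\<dots> \<le> 2 ^ Suc n" by simp
    also have "Suc n = N" using N_eq by simp
    finally have "ln (gg s \<eta> / cN) \<le> ln (2 ^ N)" using gg_pos(1)[OF s that] by (subst ln_le_cancel_iff) auto
    also have "\<dots> \<le> real N * 1" unfolding ln_realpow using ln_2_less_1 by (intro mult_left_mono) auto
    finally show ?thesis by simp
  qed
  then have "entropy s \<le> (\<Sum>\<eta>\<in>Omega N. gg s \<eta> * real N)"
    unfolding entropy_def using gg_pos(1)[OF s] by (intro sum_mono mult_left_mono) (auto intro: less_imp_le)
  also have "\<dots> = 2 * real N" using gg_sum[OF s] by (simp flip: sum_distrib_right)
  finally show ?thesis .
qed

lemma entropy_deriv:
  assumes s: "s \<in> {0..T}"
  shows "(entropy has_real_derivative Ex s (L (\<lambda>\<eta>. ln (gg s \<eta> / cN)))) (at s)"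
proof -
  let ?p' = "\<lambda>\<eta>. (\<Sum>\<zeta>\<in>Omega N. p s \<zeta> * L (\<lambda>\<xi>. of_bool (\<xi> = \<eta>)) \<zeta>)"
  have d: "((\<lambda>s. gg s \<eta>) has_real_derivative ?p' \<eta>) (at s)" if "\<eta> \<in> Omega N" for \<eta>
    unfolding gg_def using p_deriv[OF that] by (auto intro!: derivative_eq_intros)
  have e: "((\<lambda>s. gg s \<eta> * ln (gg s \<eta> / cN)) has_real_derivative (?p' \<eta> * ln (gg s \<eta> / cN) + ?p' \<eta>)) (at s)"
    if "\<eta> \<in> Omega N" for \<eta>
    using gg_pos(1)[OF s that] by (auto intro!: derivative_eq_intros d that)
  have "(entropy has_real_derivative (\<Sum>\<eta>\<in>Omega N. ?p' \<eta> * ln (gg s \<eta> / cN) + ?p' \<eta>)) (at s)"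
    unfolding entropy_def[abs_def] by (intro DERIV_sum e)
  moreover have q: "(\<Sum>\<eta>\<in>Omega N. ?p' \<eta> * f \<eta>) = Ex s (L f)" for f
  proof (rule DERIV_unique)
    show "((\<lambda>s. Ex s f) has_real_derivative (\<Sum>\<eta>\<in>Omega N. ?p' \<eta> * f \<eta>)) (at s)"
      unfolding Ex_def by (intro DERIV_sum DERIV_cmult_right p_deriv)
    show "((\<lambda>s. Ex s f) has_real_derivative Ex s (L f)) (at s)"
      using Ex_deriv[of "\<lambda>_. f" "\<lambda>_. 0" s] by simp
  qed
  \<comment> \<open>The second term in the derivative of x ln x contributes the derivative of the
    total mass, which is zero.\<close>
  moreover have "Ex s (L (\<lambda>_. 1)) = 0" by (simp add: Ex_def L_eq)
  ultimately show ?thesis using q[of "\<lambda>_. 1"] by (simp add: sum.distrib)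
qed

text \<open>Exchanges preserve the uniform law and dissipate entropy at speed \<open>N ^ 2\<close>.
  The boundary dynamics need not preserve it; its contribution is only bounded, through
  \<open>ln z \<le> z\<close>, by a constant times its speed N.\<close>

lemma entropy_production:
  assumes s: "s \<in> {0..T}"
  shows "Ex s (L (\<lambda>\<eta>. ln (gg s \<eta> / cN))) \<le> - (real N ^ 2 / 2 * Dir s) + real N * CR"
proof -
  define \<psi> where "\<psi> \<eta> = ln (gg s \<eta> / cN)" for \<eta>
  have \<psi>d: "\<psi> a - \<psi> b = ln (gg s a) - ln (gg s b)" if "a \<in> Omega N" "b \<in> Omega N" for a b
    using gg_pos(1)[OF s that(1)] gg_pos(1)[OF s that(2)] by (simp add: \<psi>_def ln_div)
  have ex: "Ex s (\<lambda>\<eta>. \<psi> (swap x \<eta>) - \<psi> \<eta>) \<le> - (dirichlet s x / 2)" if x: "x \<in> {1..<n}" for x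
  proof -
    have xs: "x \<in> {1..N - 1}" "Suc x \<in> {1..N - 1}" using x by (auto simp: n_def)
    note re = sum_configs_comp_transpose[OF xs, folded swap_eq_comp]
    have ss: "swap x (swap x \<eta>) = \<eta>" for \<eta> by (simp add: swap_eq_comp comp_assoc)
    \<comment> \<open>The uniform part added to \<open>p\<close> contributes nothing here, because
      exchanging two sites permutes the configurations.\<close>
    have "Ex s (\<lambda>\<eta>. \<psi> (swap x \<eta>) - \<psi> \<eta>) = (\<Sum>\<eta>\<in>Omega N. gg s \<eta> * (\<psi> (swap x \<eta>) - \<psi> \<eta>))"
      using re[of \<psi>] by (simp add: Ex_def gg_def distrib_right sum.distrib sum_subtractf flip: sum_distrib_left)
    moreover have "(\<Sum>\<eta>\<in>Omega N. gg s \<eta> * (\<psi> (swap x \<eta>) - \<psi> \<eta>)) = (\<Sum>\<eta>\<in>Omega N. gg s (swap x \<eta>) * (\<psi> \<eta> - \<psi> (swap x \<eta>)))"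
      using re[of "\<lambda>\<eta>. gg s \<eta> * (\<psi> (swap x \<eta>) - \<psi> \<eta>)"] by (simp add: ss)
    \<comment> \<open>Adding the two forms symmetrises the sum and produces the product treated by
      \<open>log_diff_bound\<close>.\<close>
    ultimately have "2 * Ex s (\<lambda>\<eta>. \<psi> (swap x \<eta>) - \<psi> \<eta>)
        = (\<Sum>\<eta>\<in>Omega N. (gg s (swap x \<eta>) - gg s \<eta>) * (\<psi> \<eta> - \<psi> (swap x \<eta>)))"
      by (simp add: algebra_simps sum.distrib sum_subtractf)
    also have "\<dots> \<le> (\<Sum>\<eta>\<in>Omega N. - ((gg s (swap x \<eta>) - gg s \<eta>)^2 / (gg s (swap x \<eta>) + gg s \<eta>)))"
    proof (rule sum_mono)
      fix \<eta> assume \<eta>: "\<eta> \<in> Omega N"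
      show "(gg s (swap x \<eta>) - gg s \<eta>) * (\<psi> \<eta> - \<psi> (swap x \<eta>)) \<le> - ((gg s (swap x \<eta>) - gg s \<eta>)^2 / (gg s (swap x \<eta>) + gg s \<eta>))"
        unfolding \<psi>d[OF \<eta> swap_Omega[OF x \<eta>]]
        by (rule log_diff_bound) (use gg_pos(1)[OF s] \<eta> x in auto)
    qed
    finally show ?thesis by (simp add: dirichlet_def sum_negf)
  qed
  have bd: "Ex s (\<lambda>\<eta>. R \<sigma> (window l (base \<sigma>) \<eta>) \<xi> * (\<psi> (paste l (base \<sigma>) \<xi> \<eta>) - \<psi> \<eta>)) \<le> RB * 2 ^ l * 2"
    if \<xi>: "\<xi> \<in> configs {1..l}" for \<sigma> \<xi>
  proof -
    have "Ex s (\<lambda>\<eta>. R \<sigma> (window l (base \<sigma>) \<eta>) \<xi> * (\<psi> (paste l (base \<sigma>) \<xi> \<eta>) - \<psi> \<eta>))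
      \<le> (\<Sum>\<eta>\<in>Omega N. RB * gg s (paste l (base \<sigma>) \<xi> \<eta>))"
      unfolding Ex_def
    proof (rule sum_mono)
      fix \<eta> assume \<eta>: "\<eta> \<in> Omega N"
      let ?a = "gg s (paste l (base \<sigma>) \<xi> \<eta>)" and ?b = "gg s \<eta>" and ?r = "R \<sigma> (window l (base \<sigma>) \<eta>) \<xi>"
      have a: "0 < ?a" and b: "0 < ?b" using gg_pos(1)[OF s] \<eta> \<xi> by auto
      have r: "0 \<le> ?r" "?r \<le> RB" using R_nonneg R_bound \<xi> by auto
      have p: "0 \<le> p s \<eta>" "p s \<eta> \<le> ?b" using p_nonneg[OF s \<eta>] by (auto simp: gg_def less_imp_le)
      have "\<psi> (paste l (base \<sigma>) \<xi> \<eta>) - \<psi> \<eta> = ln (?a / ?b)"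
        using a b \<xi> \<eta> by (simp add: \<psi>d ln_div)
      also have "\<dots> \<le> ?a / ?b" using ln_le_minus_one[of "?a / ?b"] a b by simp
      finally have "p s \<eta> * (?r * (\<psi> (paste l (base \<sigma>) \<xi> \<eta>) - \<psi> \<eta>)) \<le> p s \<eta> * (?r * (?a / ?b))"
        using p r by (intro mult_left_mono) auto
      also have "\<dots> \<le> ?b * (RB * (?a / ?b))"
        using p r a b by (intro mult_mono) auto
      finally show "p s \<eta> * (?r * (\<psi> (paste l (base \<sigma>) \<xi> \<eta>) - \<psi> \<eta>)) \<le> RB * ?a" using b by simp
    qed
    also have "\<dots> \<le> RB * (2 ^ l * (\<Sum>\<eta>\<in>Omega N. gg s \<eta>))"
      unfolding sum_distrib_left[symmetric]
      using RB_nonneg window_sites[of \<sigma>] gg_pos(1)[OF s] \<xi>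
      by (intro mult_left_mono sum_paste_le) (auto intro: less_imp_le)
    finally show ?thesis by (simp add: gg_sum[OF s])
  qed
  have "Ex s (L \<psi>) = real N ^ 2 * (\<Sum>x\<in>{1..<n}. Ex s (\<lambda>\<eta>. \<psi> (swap x \<eta>) - \<psi> \<eta>))
     + real N * (\<Sum>\<sigma>\<in>UNIV. \<Sum>\<xi>\<in>configs {1..l}. Ex s (\<lambda>\<eta>. R \<sigma> (window l (base \<sigma>) \<eta>) \<xi> * (\<psi> (paste l (base \<sigma>) \<xi> \<eta>) - \<psi> \<eta>)))"
    unfolding L_eq[abs_def] by (simp only: Ex_add Ex_cmult Ex_sum)
  also have "\<dots> \<le> real N ^ 2 * (\<Sum>x\<in>{1..<n}. - (dirichlet s x / 2))
     + real N * (\<Sum>\<sigma>\<in>(UNIV::bool set). \<Sum>\<xi>\<in>configs {1..l}. RB * 2 ^ l * 2)"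
    by (intro add_mono mult_left_mono sum_mono ex bd) auto
  also have "\<dots> = - (real N ^ 2 / 2 * Dir s) + real N * CR"
    by (simp add: Dir_def sum_negf sum_divide_distrib[symmetric] card_configs CR_def UNIV_bool flip: power_mult_distrib)
  finally show ?thesis by (simp add: \<psi>_def[abs_def])
qed

text \<open>The initial entropy is of order N and the boundaries add order N per unit time, against
  a dissipation \<open>N ^ 2 / 2 * Dir s\<close>. Dividing by \<open>N / 2\<close> leaves a bound
  free of N; this is the only input from entropy later on.\<close>

lemma Dir_integral: "integral {0..T} (\<lambda>s. real N * Dir s) \<le> 4 + 2 * CR * T"
proof -
  have N0: "0 < real N" "N \<noteq> 0" using N by simp_all
  define G where "G s = - (2 / real N) * entropy s + 2 * CR * s" for s
  define G' where "G' s = - (2 / real N) * Ex s (L (\<lambda>\<eta>. ln (gg s \<eta> / cN))) + 2 * CR" for s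
  have "(G' has_integral G T - G 0) {0..T}"
  proof (rule fundamental_theorem_of_calculus)
    fix s assume "s \<in> {0..T}"
    then have "(G has_real_derivative G' s) (at s)"
      unfolding G_def[abs_def] G'_def using N0 by (auto intro!: derivative_eq_intros entropy_deriv)
    then show "(G has_vector_derivative G' s) (at s within {0..T})"
      by (auto simp flip: has_real_derivative_iff_has_vector_derivative intro: has_field_derivative_at_within)
  qed (use T in auto)
  moreover have "real N * Dir s \<le> G' s" if "s \<in> {0..T}" for s
  proof -
    have "2 / real N * Ex s (L (\<lambda>\<eta>. ln (gg s \<eta> / cN))) \<le> 2 / real N * (- (real N ^ 2 / 2 * Dir s) + real N * CR)"
      using N0 entropy_production[OF that] by (intro mult_left_mono) auto
    also have "\<dots> = - (real N * Dir s) + 2 * CR" using N0 by (simp add: field_simps power2_eq_square)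
    finally show ?thesis unfolding G'_def by simp
  qed
  ultimately have "integral {0..T} (\<lambda>s. real N * Dir s) \<le> G T - G 0"
    by (intro has_integral_le[OF integrable_integral]) (auto intro!: integrable_continuous_interval continuous_intros Dir_continuous)
  also have "\<dots> \<le> (2 / real N) * entropy 0 + 2 * CR * T"
    using entropy_nonneg[of T] T N0 CR_nonneg by (simp add: G_def CR_def)
  also have "\<dots> \<le> (2 / real N) * (2 * real N) + 2 * CR * T"
    using N0 entropy_le[of 0] T by (intro add_mono[OF mult_left_mono order_refl]) auto
  finally show ?thesis using N0 by simp
qed

end

section \<open>Replacement of the boundary current\<close>

primrec itav :: "(nat \<Rightarrow> real) \<Rightarrow> nat set \<Rightarrow> ((nat \<Rightarrow> nat) \<Rightarrow> real) \<Rightarrow> nat \<Rightarrow> (nat \<Rightarrow> nat) \<Rightarrow> real" where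
  "itav w A G 0 z = G z"
| "itav w A G (Suc m) z = (\<Sum>c\<in>A. w c * itav w A G m (z(Suc m := c)))"

text \<open>Averages one coordinate after another in the same order as \<open>itav\<close>, so that
  the two recursions match step by step in \<open>itav_bexp\<close>. Being a polynomial in the
  density, it also yields the Lipschitz bound of the flux.\<close>

primrec bexp :: "nat \<Rightarrow> real \<Rightarrow> (config \<Rightarrow> real) \<Rightarrow> config \<Rightarrow> real" where
  "bexp 0 \<alpha> q \<xi> = q \<xi>"
| "bexp (Suc m) \<alpha> q \<xi> = \<alpha> * bexp m \<alpha> q (\<xi>(Suc m := True)) + (1 - \<alpha>) * bexp m \<alpha> q (\<xi>(Suc m := False))"

lemma itav_bound:
  assumes "\<And>c. c \<in> A \<Longrightarrow> 0 \<le> w c" "sum w A = 1" "\<And>z. \<bar>G z\<bar> \<le> B"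
  shows "\<bar>itav w A G m z\<bar> \<le> B"
proof (induction m arbitrary: z)
  case (Suc m)
  have "\<bar>itav w A G (Suc m) z\<bar> \<le> (\<Sum>c\<in>A. \<bar>w c * itav w A G m (z(Suc m := c))\<bar>)"
    by (simp add: sum_abs)
  also have "\<dots> \<le> (\<Sum>c\<in>A. w c * B)"
    using assms(1) Suc by (intro sum_mono) (auto simp: abs_mult intro!: mult_left_mono)
  finally show ?case using assms(2) by (simp flip: sum_distrib_right)
qed (use assms in auto)

text \<open>Coordinates outside \<open>{1..m}\<close> are read from \<xi>, which makes the statement
  strong enough for the induction on m.\<close>

lemma bexp_expectation:
  assumes \<alpha>: "0 \<le> \<alpha>" "\<alpha> \<le> 1"
  shows "bexp m \<alpha> q \<xi> = measure_pmf.expectation (Pi_pmf {1..m} False (\<lambda>_. bernoulli_pmf \<alpha>))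
    (\<lambda>\<eta>. q (\<lambda>i. if i \<in> {1..m} then \<eta> i else \<xi> i))"
proof (induction m arbitrary: \<xi>)
  case 0 then show ?case by simp
next
  case (Suc m)
  let ?P = "Pi_pmf {1..m} False (\<lambda>_. bernoulli_pmf \<alpha>)"
  have ins: "{1..Suc m} = insert (Suc m) {1..m}" by auto
  have fin: "finite (set_pmf (Pi_pmf {1..m} False (\<lambda>_. bernoulli_pmf \<alpha>)))"
    by (rule finite_subset[OF _ finite_configs[of "{1..m}"]])
      (use set_Pi_pmf_subset[of "{1..m}" False "\<lambda>_. bernoulli_pmf \<alpha>"] in \<open>auto simp: configs_def\<close>)
  let ?q = "\<lambda>\<eta>. q (\<lambda>i. if i \<in> insert (Suc m) {1..m} then \<eta> i else \<xi> i)"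
  have e: "measure_pmf.expectation (?P \<bind> (\<lambda>f. return_pmf (f(Suc m := b)))) ?q = bexp m \<alpha> q (\<xi>(Suc m := b))" for b
  proof -
    have "measure_pmf.expectation (?P \<bind> (\<lambda>f. return_pmf (f(Suc m := b)))) ?q
      = measure_pmf.expectation (map_pmf (\<lambda>f. f(Suc m := b)) ?P) ?q"
      by (simp add: map_pmf_def)
    also have "\<dots> = measure_pmf.expectation ?P (\<lambda>\<eta>. q (\<lambda>i. if i \<in> {1..m} then \<eta> i else (\<xi>(Suc m := b)) i))"
      unfolding integral_map_pmf by (intro Bochner_Integration.integral_cong refl arg_cong[where f = q]) auto
    finally show ?thesis using Suc by simp
  qed
  have "measure_pmf.expectation (Pi_pmf {1..Suc m} False (\<lambda>_. bernoulli_pmf \<alpha>)) (\<lambda>\<eta>. q (\<lambda>i. if i \<in> {1..Suc m} then \<eta> i else \<xi> i))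
    = (\<Sum>b\<in>UNIV. pmf (bernoulli_pmf \<alpha>) b *\<^sub>R measure_pmf.expectation (?P \<bind> (\<lambda>f. return_pmf (f(Suc m := b)))) ?q)"
  proof -
    have "Pi_pmf (insert (Suc m) {1..m}) False (\<lambda>_. bernoulli_pmf \<alpha>)
      = bernoulli_pmf \<alpha> \<bind> (\<lambda>b. ?P \<bind> (\<lambda>f. return_pmf (f(Suc m := b))))"
      by (rule Pi_pmf_insert') auto
    then show ?thesis
      unfolding ins by (simp only:) (rule pmf_expectation_bind, use fin in auto)
  qed
  also have "\<dots> = (\<Sum>b\<in>UNIV. pmf (bernoulli_pmf \<alpha>) b *\<^sub>R bexp m \<alpha> q (\<xi>(Suc m := b)))"
    by (simp only: e)
  also have "\<dots> = bexp (Suc m) \<alpha> q \<xi>" using \<alpha> by (simp add: UNIV_bool)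
  finally show ?case by (rule sym)
qed

lemma bexp_bound:
  assumes "0 \<le> \<alpha>" "\<alpha> \<le> 1" "\<And>\<xi>. \<xi> \<in> configs {1..l} \<Longrightarrow> \<bar>q \<xi>\<bar> \<le> Q" "m \<le> l" "\<xi> \<in> configs {1..l}"
  shows "\<bar>bexp m \<alpha> q \<xi>\<bar> \<le> Q"
  using assms(4,5)
proof (induction m arbitrary: \<xi>)
  case (Suc m)
  have u: "\<xi>(Suc m := b) \<in> configs {1..l}" for b
    using Suc.prems by (auto simp: configs_def)
  have IH: "\<bar>bexp m \<alpha> q (\<xi>(Suc m := b))\<bar> \<le> Q" for b
    by (rule Suc.IH[OF _ u]) (use Suc.prems in simp)
  have "\<bar>bexp (Suc m) \<alpha> q \<xi>\<bar> \<le> \<alpha> * \<bar>bexp m \<alpha> q (\<xi>(Suc m := True))\<bar> + (1 - \<alpha>) * \<bar>bexp m \<alpha> q (\<xi>(Suc m := False))\<bar>"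
    using assms(1,2) by (auto intro!: order_trans[OF abs_triangle_ineq] simp: abs_mult)
  also have "\<dots> \<le> \<alpha> * Q + (1 - \<alpha>) * Q"
    using assms(1,2) by (intro add_mono mult_left_mono IH) auto
  finally show ?case by (simp add: algebra_simps)
qed (use assms in auto)

text \<open>Changing the parameter in one coordinate at a time costs
  \<open>2 * Q * \<bar>\<alpha> - \<beta>\<bar>\<close> for each of the m coordinates.\<close>

lemma bexp_lipschitz:
  assumes "0 \<le> \<alpha>" "\<alpha> \<le> 1" "0 \<le> \<beta>" "\<beta> \<le> 1" "\<And>\<xi>. \<xi> \<in> configs {1..l} \<Longrightarrow> \<bar>q \<xi>\<bar> \<le> Q" "m \<le> l" "\<xi> \<in> configs {1..l}"
  shows "\<bar>bexp m \<alpha> q \<xi> - bexp m \<beta> q \<xi>\<bar> \<le> 2 * real m * Q * \<bar>\<alpha> - \<beta>\<bar>"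
  using assms(6,7)
proof (induction m arbitrary: \<xi>)
  case (Suc m)
  let ?t = "\<xi>(Suc m := True)" and ?f = "\<xi>(Suc m := False)"
  have u: "\<xi>(Suc m := b) \<in> configs {1..l}" for b
    using Suc.prems by (auto simp: configs_def)
  have b: "\<bar>bexp m \<beta> q (\<xi>(Suc m := b))\<bar> \<le> Q" for b
    by (rule bexp_bound[OF assms(3,4,5) _ u]) (use Suc.prems in simp_all)
  have i: "\<bar>bexp m \<alpha> q (\<xi>(Suc m := b)) - bexp m \<beta> q (\<xi>(Suc m := b))\<bar> \<le> 2 * real m * Q * \<bar>\<alpha> - \<beta>\<bar>" for b
    by (rule Suc.IH[OF _ u]) (use Suc.prems in simp)
  have tri: "\<bar>a + b + c - d\<bar> \<le> \<bar>a\<bar> + \<bar>b\<bar> + \<bar>c\<bar> + \<bar>d\<bar>" for a b c d :: real by linarith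
  have eq: "bexp (Suc m) \<alpha> q \<xi> - bexp (Suc m) \<beta> q \<xi> = \<alpha> * (bexp m \<alpha> q ?t - bexp m \<beta> q ?t)
    + (1 - \<alpha>) * (bexp m \<alpha> q ?f - bexp m \<beta> q ?f) + (\<alpha> - \<beta>) * bexp m \<beta> q ?t - (\<alpha> - \<beta>) * bexp m \<beta> q ?f"
    by (simp add: algebra_simps)
  have "\<bar>bexp (Suc m) \<alpha> q \<xi> - bexp (Suc m) \<beta> q \<xi>\<bar> \<le> \<bar>\<alpha> * (bexp m \<alpha> q ?t - bexp m \<beta> q ?t)\<bar> + \<bar>(1 - \<alpha>) * (bexp m \<alpha> q ?f - bexp m \<beta> q ?f)\<bar>
     + \<bar>(\<alpha> - \<beta>) * bexp m \<beta> q ?t\<bar> + \<bar>(\<alpha> - \<beta>) * bexp m \<beta> q ?f\<bar>"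
    unfolding eq by (rule tri)
  also have "\<dots> \<le> \<alpha> * (2 * real m * Q * \<bar>\<alpha> - \<beta>\<bar>) + (1 - \<alpha>) * (2 * real m * Q * \<bar>\<alpha> - \<beta>\<bar>) + \<bar>\<alpha> - \<beta>\<bar> * Q + \<bar>\<alpha> - \<beta>\<bar> * Q"
  proof (intro add_mono)
    show "\<bar>\<alpha> * (bexp m \<alpha> q ?t - bexp m \<beta> q ?t)\<bar> \<le> \<alpha> * (2 * real m * Q * \<bar>\<alpha> - \<beta>\<bar>)"
      using mult_left_mono[OF i[of True] assms(1)] assms(1) by (simp only: abs_mult abs_of_nonneg)
    show "\<bar>(1 - \<alpha>) * (bexp m \<alpha> q ?f - bexp m \<beta> q ?f)\<bar> \<le> (1 - \<alpha>) * (2 * real m * Q * \<bar>\<alpha> - \<beta>\<bar>)"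
      using mult_left_mono[OF i[of False], of "1 - \<alpha>"] assms(2) by (simp only: abs_mult abs_of_nonneg diff_ge_0_iff_ge)
    show "\<bar>(\<alpha> - \<beta>) * bexp m \<beta> q ?t\<bar> \<le> \<bar>\<alpha> - \<beta>\<bar> * Q" "\<bar>(\<alpha> - \<beta>) * bexp m \<beta> q ?f\<bar> \<le> \<bar>\<alpha> - \<beta>\<bar> * Q"
      using mult_left_mono[OF b[of True], of "\<bar>\<alpha> - \<beta>\<bar>"] mult_left_mono[OF b[of False], of "\<bar>\<alpha> - \<beta>\<bar>"] by (simp_all only: abs_mult abs_ge_zero)
  qed
  also have "\<dots> = 2 * real (Suc m) * Q * \<bar>\<alpha> - \<beta>\<bar>" by (simp add: algebra_simps)
  finally show ?case .
qed auto

section \<open>Boundedness and Lipschitz continuity of the boundary flux\<close>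

definition flux_obs :: "nat \<Rightarrow> rates \<Rightarrow> config \<Rightarrow> real" where
  "flux_obs l R \<zeta> = (\<Sum>\<xi>\<in>configs {1..l}. R \<zeta> \<xi> * (\<Sum>x\<in>{1..l}. of_bool (\<xi> x) - of_bool (\<zeta> x)))"

lemma flux_obs_bound:
  assumes "\<And>\<xi> \<xi>'. \<xi> \<in> configs {1..l} \<Longrightarrow> \<xi>' \<in> configs {1..l} \<Longrightarrow> 0 \<le> R \<xi> \<xi>' \<and> R \<xi> \<xi>' \<le> RB" "\<zeta> \<in> configs {1..l}"
  shows "\<bar>flux_obs l R \<zeta>\<bar> \<le> 2 ^ l * RB * real l"
proof -
  have "\<bar>flux_obs l R \<zeta>\<bar> \<le> (\<Sum>\<xi>\<in>configs {1..l}. \<bar>R \<zeta> \<xi> * (\<Sum>x\<in>{1..l}. of_bool (\<xi> x) - of_bool (\<zeta> x))\<bar>)"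
    unfolding flux_obs_def by (rule sum_abs)
  also have "\<dots> \<le> (\<Sum>\<xi>\<in>configs {1..l}. RB * real l)"
  proof (rule sum_mono)
    fix \<xi> assume \<xi>: "\<xi> \<in> configs {1..l}"
    have "\<bar>(\<Sum>x\<in>{1..l}. of_bool (\<xi> x) - of_bool (\<zeta> x) :: real)\<bar> \<le> (\<Sum>x\<in>{1..l}. 1)"
      by (rule order_trans[OF sum_abs sum_mono]) auto
    then show "\<bar>R \<zeta> \<xi> * (\<Sum>x\<in>{1..l}. of_bool (\<xi> x) - of_bool (\<zeta> x))\<bar> \<le> RB * real l"
      unfolding abs_mult using assms(1)[OF assms(2) \<xi>] by (intro mult_mono) auto
  qed
  finally show ?thesis by (simp add: card_configs)
qed

lemma boundary_flux_bexp:
  assumes "0 \<le> \<alpha>" "\<alpha> \<le> 1" "\<xi> \<in> configs {1..l}"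
  shows "boundary_flux l R \<alpha> = bexp l \<alpha> (flux_obs l R) \<xi>"
  unfolding bexp_expectation[OF assms(1,2)] boundary_flux_def flux_obs_def[symmetric]
proof (intro integral_cong_AE AE_pmfI arg_cong[where f = "flux_obs l R"])
  fix \<eta> assume "\<eta> \<in> set_pmf (Pi_pmf {1..l} False (\<lambda>_. bernoulli_pmf \<alpha>))"
  then have "\<eta> \<in> PiE_dflt {1..l} False (\<lambda>_. UNIV)"
    using set_Pi_pmf_subset[of "{1..l}" False] by (auto simp: PiE_dflt_def)
  then show "\<eta> = (\<lambda>i. if i \<in> {1..l} then \<eta> i else \<xi> i)"
    using assms(3) by (auto simp: PiE_dflt_def configs_def fun_eq_iff)
qed auto

text \<open>A Bernoulli law with a parameter outside [0,1] is the one with the clamped parameter.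
  The flux is therefore bounded and Lipschitz on all of the reals and may be evaluated at a cosine
  series before that is known to lie in [0,1].\<close>

definition clamp01 :: "real \<Rightarrow> real" where "clamp01 \<alpha> = max 0 (min 1 \<alpha>)"

lemma boundary_flux_clamp: "boundary_flux l R \<alpha> = boundary_flux l R (clamp01 \<alpha>)"
proof -
  have "bernoulli_pmf \<alpha> = bernoulli_pmf (clamp01 \<alpha>)"
    by (rule pmf_eqI) (auto simp: bernoulli_pmf.rep_eq clamp01_def)
  then show ?thesis by (simp add: boundary_flux_def)
qed

lemma boundary_flux_bound:
  assumes "\<And>\<xi> \<xi>'. \<xi> \<in> configs {1..l} \<Longrightarrow> \<xi>' \<in> configs {1..l} \<Longrightarrow> 0 \<le> R \<xi> \<xi>' \<and> R \<xi> \<xi>' \<le> RB"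
  shows "\<bar>boundary_flux l R \<alpha>\<bar> \<le> 2 ^ l * RB * real l"
proof -
  have z: "(\<lambda>_. False) \<in> configs {1..l}" by (auto simp: configs_def)
  show ?thesis
    unfolding boundary_flux_clamp[of _ _ \<alpha>]
    by (subst boundary_flux_bexp[OF _ _ z])
      (auto intro!: bexp_bound[OF _ _ flux_obs_bound[OF assms] order_refl z] simp: clamp01_def)
qed

lemma boundary_flux_lipschitz:
  assumes "\<And>\<xi> \<xi>'. \<xi> \<in> configs {1..l} \<Longrightarrow> \<xi>' \<in> configs {1..l} \<Longrightarrow> 0 \<le> R \<xi> \<xi>' \<and> R \<xi> \<xi>' \<le> RB"
  shows "\<bar>boundary_flux l R \<alpha> - boundary_flux l R \<beta>\<bar> \<le> 2 * real l * (2 ^ l * RB * real l) * \<bar>\<alpha> - \<beta>\<bar>"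
proof -
  have z: "(\<lambda>_. False) \<in> configs {1..l}" by (auto simp: configs_def)
  have RB: "0 \<le> RB" using assms[OF z z] by linarith
  have c: "0 \<le> clamp01 a" "clamp01 a \<le> 1" for a by (auto simp: clamp01_def)
  have "\<bar>boundary_flux l R \<alpha> - boundary_flux l R \<beta>\<bar> \<le> 2 * real l * (2 ^ l * RB * real l) * \<bar>clamp01 \<alpha> - clamp01 \<beta>\<bar>"
    unfolding boundary_flux_clamp[of _ _ \<alpha>] boundary_flux_clamp[of _ _ \<beta>]
      boundary_flux_bexp[OF c(1) c(2) z]
    by (rule bexp_lipschitz[OF c c flux_obs_bound[OF assms] order_refl z])
  also have "\<dots> \<le> 2 * real l * (2 ^ l * RB * real l) * \<bar>\<alpha> - \<beta>\<bar>"
    using RB by (intro mult_left_mono) (auto simp: clamp01_def)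
  finally show ?thesis .
qed

section \<open>Moving particles along paths\<close>

context flow
begin

definition Tr :: "real \<Rightarrow> nat \<Rightarrow> nat \<Rightarrow> real" where
  "Tr s x y = (\<Sum>\<eta>\<in>Omega N. \<bar>p s (\<eta> \<circ> Transposition.transpose x y) - p s \<eta>\<bar>)"

text \<open>Reads the occupation of the sites \<open>z 1\<close>, ..., \<open>z l\<close> as if they
  formed a window. The replacement moves these sites one by one away from the boundary.\<close>

definition pull :: "(nat \<Rightarrow> nat) \<Rightarrow> config \<Rightarrow> config" where
  "pull z \<eta> = (\<lambda>i. i \<in> {1..l} \<and> \<eta> (z i))"

lemma pull_configs [simp]: "pull z \<eta> \<in> configs {1..l}"
  by (auto simp: pull_def configs_def)

lemma Tr_sym: "Tr s x y = Tr s y x"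
  by (simp add: Tr_def transpose_commute)

lemma Tr_nonneg: "0 \<le> Tr s x y"
  by (auto simp: Tr_def intro: sum_nonneg)

text \<open>Cauchy-Schwarz with the weights \<open>gg s (swap x \<eta>) + gg s \<eta>\<close>; their
  total mass 4 gives the factor 2.\<close>

lemma Tr_bond:
  assumes s: "s \<in> {0..T}" and x: "x \<in> {1..<n}"
  shows "Tr s x (Suc x) \<le> 2 * sqrt (dirichlet s x)"
proof -
  let ?d = "\<lambda>\<eta>. gg s (swap x \<eta>) - gg s \<eta>" and ?m = "\<lambda>\<eta>. gg s (swap x \<eta>) + gg s \<eta>"
  have m: "0 < ?m \<eta>" if "\<eta> \<in> Omega N" for \<eta>
    using gg_pos(1)[OF s swap_Omega[OF x that]] gg_pos(1)[OF s that] by simp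
  have xs: "x \<in> {1..N - 1}" "Suc x \<in> {1..N - 1}" using x by (auto simp: n_def)
  have "Tr s x (Suc x) = (\<Sum>\<eta>\<in>Omega N. \<bar>?d \<eta> / sqrt (?m \<eta>)\<bar> * \<bar>sqrt (?m \<eta>)\<bar>)"
    unfolding Tr_def
  proof (intro sum.cong refl)
    fix \<eta> assume "\<eta> \<in> Omega N"
    then have "?m \<eta> \<noteq> 0" using m by fastforce
    then have "\<bar>?d \<eta> / sqrt (?m \<eta>)\<bar> * \<bar>sqrt (?m \<eta>)\<bar> = \<bar>?d \<eta>\<bar>"
      unfolding abs_mult[symmetric] by simp
    then show "\<bar>p s (\<eta> \<circ> Transposition.transpose x (Suc x)) - p s \<eta>\<bar> = \<bar>?d \<eta> / sqrt (?m \<eta>)\<bar> * \<bar>sqrt (?m \<eta>)\<bar>"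
      by (simp add: gg_def swap_eq_comp)
  qed
  also have "\<dots> \<le> L2_set (\<lambda>\<eta>. ?d \<eta> / sqrt (?m \<eta>)) (Omega N) * L2_set (\<lambda>\<eta>. sqrt (?m \<eta>)) (Omega N)"
    by (rule L2_set_mult_ineq)
  also have "L2_set (\<lambda>\<eta>. ?d \<eta> / sqrt (?m \<eta>)) (Omega N) = sqrt (dirichlet s x)"
    unfolding L2_set_def dirichlet_def using m
    by (intro arg_cong[where f = sqrt] sum.cong refl) (auto simp: power_divide less_imp_le)
  also have "L2_set (\<lambda>\<eta>. sqrt (?m \<eta>)) (Omega N) = sqrt (\<Sum>\<eta>\<in>Omega N. ?m \<eta>)"
    unfolding L2_set_def using m by (intro arg_cong[where f = sqrt] sum.cong refl) (auto simp: less_imp_le)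
  also have "(\<Sum>\<eta>\<in>Omega N. ?m \<eta>) = 4"
    using sum_configs_comp_transpose[OF xs, of "gg s"] gg_sum[OF s] by (simp add: sum.distrib swap_eq_comp)
  finally show ?thesis by (simp add: mult.commute)
qed

text \<open>Exchanging x with y + 1 is the exchange of x with y conjugated by that of y with y + 1.
  Each of the three factors costs its own distance, because an exchange preserves sums over
  configurations.\<close>

lemma Tr_step:
  assumes "x \<in> {1..N - 1}" "Suc y \<in> {1..N - 1}" "x \<le> y"
  shows "Tr s x (Suc y) \<le> Tr s x y + 2 * Tr s y (Suc y)"
proof (cases "x = y")
  case True
  then show ?thesis using Tr_nonneg[of s y "Suc y"] Tr_nonneg[of s y y] by simp
next
  case False
  let ?t = "Transposition.transpose x y" and ?u = "Transposition.transpose y (Suc y)"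
  have y: "y \<in> {1..N - 1}" using assms by auto
  have c: "Transposition.transpose x (Suc y) = ?u \<circ> ?t \<circ> ?u"
    using False assms(3) by (auto simp: fun_eq_iff Transposition.transpose_def)
  note r1 = sum_configs_comp_transpose[OF y assms(2)] and r2 = sum_configs_comp_transpose[OF assms(1) y]
  have "Tr s x (Suc y) \<le> (\<Sum>\<eta>\<in>Omega N. \<bar>p s (\<eta> \<circ> ?u \<circ> ?t \<circ> ?u) - p s (\<eta> \<circ> ?u \<circ> ?t)\<bar>
     + \<bar>p s (\<eta> \<circ> ?u \<circ> ?t) - p s (\<eta> \<circ> ?u)\<bar> + \<bar>p s (\<eta> \<circ> ?u) - p s \<eta>\<bar>)"
    unfolding Tr_def c by (intro sum_mono) (simp add: comp_assoc)
  also have "\<dots> = Tr s y (Suc y) + Tr s x y + Tr s y (Suc y)"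
    unfolding sum.distrib Tr_def
    using r1[of "\<lambda>\<eta>. \<bar>p s (\<eta> \<circ> ?t \<circ> ?u) - p s (\<eta> \<circ> ?t)\<bar>"] r2[of "\<lambda>\<eta>. \<bar>p s (\<eta> \<circ> ?u) - p s \<eta>\<bar>"]
      r1[of "\<lambda>\<eta>. \<bar>p s (\<eta> \<circ> ?t) - p s \<eta>\<bar>"] by simp
  finally show ?thesis by simp
qed

lemma Tr_path:
  assumes "x \<in> {1..N - 1}" "x + d \<le> N - 1"
  shows "Tr s x (x + d) \<le> 2 * (\<Sum>b\<in>{x..<x + d}. Tr s b (Suc b))"
  using assms(2)
proof (induction d)
  case 0
  then show ?case by (simp add: Tr_def)
next
  case (Suc d)
  then show ?case using Tr_step[OF assms(1), of "x + d" s] by simp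
qed

text \<open>A second Cauchy-Schwarz, over the bonds of the path, replaces a sum of square roots by
  the root of length times Dirichlet form. Since \<open>Dir\<close> is of order 1 / N in the time
  mean, a distance that is a small fraction of N has a small cost.\<close>

lemma Tr_dist_le:
  assumes s: "s \<in> {0..T}" and "x \<in> {1..N - 1}" "y \<in> {1..N - 1}" "x \<le> y"
  shows "Tr s x y \<le> 4 * sqrt (real (y - x) * Dir s)"
proof -
  have sub: "{x..<y} \<subseteq> {1..<n}" using assms by (auto simp: n_def)
  have "Tr s x y \<le> 2 * (\<Sum>b\<in>{x..<y}. Tr s b (Suc b))"
    using Tr_path[OF assms(2), of "y - x" s] assms by simp
  also have "\<dots> \<le> 2 * (\<Sum>b\<in>{x..<y}. 2 * sqrt (dirichlet s b))"
    using sub by (intro mult_left_mono sum_mono Tr_bond s) auto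
  also have "\<dots> = 4 * (\<Sum>b\<in>{x..<y}. \<bar>1\<bar> * \<bar>sqrt (dirichlet s b)\<bar>)"
  proof -
    have "(\<Sum>b\<in>{x..<y}. sqrt (dirichlet s b)) = (\<Sum>b\<in>{x..<y}. \<bar>sqrt (dirichlet s b)\<bar>)"
      using dirichlet_nonneg[OF s] sub by (intro sum.cong refl) (auto simp: subset_iff)
    then show ?thesis by (simp flip: sum_distrib_left)
  qed
  also have "\<dots> \<le> 4 * (L2_set (\<lambda>_. 1) {x..<y} * L2_set (\<lambda>b. sqrt (dirichlet s b)) {x..<y})"
    by (intro mult_left_mono L2_set_mult_ineq) auto
  also have "\<dots> = 4 * sqrt (real (y - x) * (\<Sum>b\<in>{x..<y}. (sqrt (dirichlet s b))^2))"
    by (simp add: L2_set_def real_sqrt_mult)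
  also have "\<dots> \<le> 4 * sqrt (real (y - x) * Dir s)"
    unfolding Dir_def using sub dirichlet_nonneg[OF s]
    by (intro mult_left_mono real_sqrt_le_mono order_trans[OF sum_mono2[of "{1..<n}" "{x..<y}"]])
       (auto simp: subset_iff intro!: sum_mono sum_mono2)
  finally show ?thesis .
qed

lemma Tr_dist:
  assumes s: "s \<in> {0..T}" and "x \<in> {1..N - 1}" "y \<in> {1..N - 1}"
  shows "Tr s x y \<le> 4 * sqrt (\<bar>real x - real y\<bar> * Dir s)"
proof (cases "x \<le> y")
  case True
  then have "\<bar>real x - real y\<bar> = real (y - x)" by (simp add: of_nat_diff)
  then show ?thesis using Tr_dist_le[OF assms True] by simp
next
  case False
  then show ?thesis using Tr_dist_le[OF s assms(3,2)] Tr_sym[of s x y] by (simp add: of_nat_diff)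
qed

text \<open>A change of variables by the exchange moves one site of the observable. The price is the
  change of the law plus the change of \<psi> under the exchange.\<close>

lemma replace_one:
  assumes s: "s \<in> {0..T}" and xy: "x \<in> {1..N - 1}" "y \<in> {1..N - 1}"
    and \<psi>: "\<And>\<eta>. \<eta> \<in> Omega N \<Longrightarrow> \<bar>\<psi> \<eta>\<bar> \<le> B" "\<And>\<eta>. \<eta> \<in> Omega N \<Longrightarrow> \<bar>\<psi> (\<eta> \<circ> Transposition.transpose x y) - \<psi> \<eta>\<bar> \<le> \<omega>"
    and q: "\<And>\<xi>. \<xi> \<in> configs {1..l} \<Longrightarrow> \<bar>q \<xi>\<bar> \<le> Q"
    and z: "\<And>i. i \<in> {1..l} \<Longrightarrow> z' i = Transposition.transpose x y (z i)"
  shows "\<bar>Ex s (\<lambda>\<eta>. \<psi> \<eta> * q (pull z' \<eta>)) - Ex s (\<lambda>\<eta>. \<psi> \<eta> * q (pull z \<eta>))\<bar> \<le> B * Q * Tr s x y + Q * \<omega>"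
proof -
  let ?t = "Transposition.transpose x y"
  have pl: "pull z (\<eta> \<circ> ?t) = pull z' \<eta>" for \<eta>
    using z by (auto simp: pull_def fun_eq_iff)
  have "Ex s (\<lambda>\<eta>. \<psi> \<eta> * q (pull z \<eta>)) = (\<Sum>\<eta>\<in>Omega N. p s (\<eta> \<circ> ?t) * (\<psi> (\<eta> \<circ> ?t) * q (pull z' \<eta>)))"
    unfolding Ex_def using sum_configs_comp_transpose[OF xy, of "\<lambda>\<eta>. p s \<eta> * (\<psi> \<eta> * q (pull z \<eta>))"] by (simp add: pl)
  then have eq: "Ex s (\<lambda>\<eta>. \<psi> \<eta> * q (pull z' \<eta>)) - Ex s (\<lambda>\<eta>. \<psi> \<eta> * q (pull z \<eta>))
    = (\<Sum>\<eta>\<in>Omega N. - (p s (\<eta> \<circ> ?t) - p s \<eta>) * (\<psi> (\<eta> \<circ> ?t) * q (pull z' \<eta>))) + (\<Sum>\<eta>\<in>Omega N. p s \<eta> * (- (\<psi> (\<eta> \<circ> ?t) - \<psi> \<eta>) * q (pull z' \<eta>)))"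
    by (simp add: Ex_def sum_subtractf[symmetric] sum.distrib[symmetric] algebra_simps)
  have "\<bar>Ex s (\<lambda>\<eta>. \<psi> \<eta> * q (pull z' \<eta>)) - Ex s (\<lambda>\<eta>. \<psi> \<eta> * q (pull z \<eta>))\<bar>
     \<le> (\<Sum>\<eta>\<in>Omega N. \<bar>p s (\<eta> \<circ> ?t) - p s \<eta>\<bar> * (B * Q)) + (\<Sum>\<eta>\<in>Omega N. p s \<eta> * (\<omega> * Q))"
    unfolding eq
  proof (intro order_trans[OF abs_triangle_ineq] add_mono order_trans[OF sum_abs] sum_mono)
    fix \<eta> assume \<eta>: "\<eta> \<in> Omega N"
    have \<eta>': "\<eta> \<circ> ?t \<in> Omega N" using \<eta> xy by (rule configs_comp_transpose[rotated 2])
    have B: "0 \<le> B" "0 \<le> Q" "0 \<le> \<omega>" using \<psi>[OF \<eta>] q[OF pull_configs] abs_ge_zero order_trans by blast+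
    show "\<bar>- (p s (\<eta> \<circ> ?t) - p s \<eta>) * (\<psi> (\<eta> \<circ> ?t) * q (pull z' \<eta>))\<bar> \<le> \<bar>p s (\<eta> \<circ> ?t) - p s \<eta>\<bar> * (B * Q)"
      unfolding abs_mult abs_minus_cancel using \<psi>(1)[OF \<eta>'] q[OF pull_configs] B by (intro mult_left_mono mult_mono) auto
    show "\<bar>p s \<eta> * (- (\<psi> (\<eta> \<circ> ?t) - \<psi> \<eta>) * q (pull z' \<eta>))\<bar> \<le> p s \<eta> * (\<omega> * Q)"
      unfolding abs_mult abs_minus_cancel using p_nonneg[OF s \<eta>] \<psi>(2)[OF \<eta>] q[OF pull_configs] B
      by (intro mult_mono) auto
  qed
  also have "\<dots> = B * Q * Tr s x y + Q * \<omega>"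
    using p_sum[OF s] by (simp add: Tr_def flip: sum_distrib_right)
  finally show ?thesis .
qed

lemma itav_Ex: "itav w A (\<lambda>z. Ex s (g z)) m z = Ex s (\<lambda>\<eta>. itav w A (\<lambda>z. g z \<eta>) m z)"
  by (induction m arbitrary: z) (simp_all add: Ex_sum Ex_cmult)

lemma itav_cmult: "itav w A (\<lambda>z. c * g z) m z = c * itav w A g m z"
  by (induction m arbitrary: z) (simp_all add: sum_distrib_left mult.left_commute)

text \<open>For a frozen configuration, reading each coordinate at an independently drawn site gives
  independent bits whose mean is the weighted density. The average over positions is thus a
  Bernoulli expectation exactly, with no error term.\<close>

lemma itav_bexp:
  assumes "sum w A = 1" "m \<le> l"
  shows "itav w A (\<lambda>z. q (pull z \<eta>)) m z = bexp m (\<Sum>c\<in>A. w c * of_bool (\<eta> c)) q (pull z \<eta>)"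
  using assms(2)
proof (induction m arbitrary: z)
  case (Suc m)
  let ?\<alpha> = "\<Sum>c\<in>A. w c * of_bool (\<eta> c)"
  have u: "pull (z(Suc m := c)) \<eta> = (pull z \<eta>)(Suc m := \<eta> c)" for c
    using Suc.prems by (auto simp: pull_def fun_eq_iff)
  let ?H = "\<lambda>b. bexp m ?\<alpha> q ((pull z \<eta>)(Suc m := b))"
  have "itav w A (\<lambda>z. q (pull z \<eta>)) (Suc m) z = (\<Sum>c\<in>A. w c * ?H (\<eta> c))"
    using Suc by (simp add: u)
  also have "\<dots> = (\<Sum>c\<in>A. w c * of_bool (\<eta> c) * (?H True - ?H False) + w c * ?H False)"
    by (intro sum.cong refl) (auto simp: algebra_simps)
  also have "\<dots> = ?\<alpha> * (?H True - ?H False) + ?H False"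
    using assms(1) by (simp add: sum.distrib flip: sum_distrib_right)
  finally show ?case by (simp add: algebra_simps)
qed simp

definition rep_err :: "real \<Rightarrow> real \<Rightarrow> real \<Rightarrow> real \<Rightarrow> real \<Rightarrow> real \<Rightarrow> real" where
  "rep_err s B Q \<omega> \<Delta> wm = real l * (B * Q * (4 * sqrt (Dir s * \<Delta>)) + Q * \<omega> + 4 * real l * B * Q * wm)"

text \<open>The coordinates above m have already been moved, those up to m still stand in the
  window. In the inductive step an exchange moves coordinate m + 1 alone if the new site lies
  neither in the window nor among the sites already chosen. There are at most \<open>2 * l\<close>
  bad sites, each of weight at most \<open>wm\<close>, and for them the trivial bound is
  taken.\<close>

lemma replacement_itav:
  assumes s: "s \<in> {0..T}"
    and \<psi>: "\<And>\<eta>. \<eta> \<in> Omega N \<Longrightarrow> \<bar>\<psi> \<eta>\<bar> \<le> B"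
      "\<And>\<eta> x y. \<eta> \<in> Omega N \<Longrightarrow> x \<in> {1..N - 1} \<Longrightarrow> y \<in> {1..N - 1} \<Longrightarrow> \<bar>\<psi> (\<eta> \<circ> Transposition.transpose x y) - \<psi> \<eta>\<bar> \<le> \<omega>"
    and q: "\<And>\<xi>. \<xi> \<in> configs {1..l} \<Longrightarrow> \<bar>q \<xi>\<bar> \<le> Q"
    and w: "\<And>c. c \<in> {1..N - 1} \<Longrightarrow> 0 \<le> w c \<and> w c \<le> wm" "sum w {1..N - 1} = 1"
    and k: "{k + 1..k + l} \<subseteq> {1..N - 1}"
    and \<Delta>: "\<And>i. i \<in> {1..l} \<Longrightarrow> (\<Sum>c\<in>{1..N - 1}. w c * \<bar>real (k + i) - real c\<bar>) \<le> \<Delta>"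
    and m: "m \<le> l"
    and z: "\<And>i. i \<in> {1..m} \<Longrightarrow> z i = k + i" "\<And>i. i \<in> {m + 1..l} \<Longrightarrow> z i \<notin> {k + 1..k + m}"
  defines "G \<equiv> \<lambda>z. Ex s (\<lambda>\<eta>. \<psi> \<eta> * q (pull z \<eta>))"
  shows "\<bar>itav w {1..N - 1} G m z - G z\<bar> \<le> real m * (B * Q * (4 * sqrt (Dir s * \<Delta>)) + Q * \<omega> + 4 * real l * B * Q * wm)"
  using m z
proof (induction m arbitrary: z)
  case 0
  then show ?case by simp
next
  case (Suc m)
  let ?A = "{1..N - 1}"
  define \<delta> where "\<delta> = B * Q * (4 * sqrt (Dir s * \<Delta>)) + Q * \<omega> + 4 * real l * B * Q * wm"
  define x where "x = k + Suc m"
  define bad where "bad = {k + 1..k + l} \<union> z ` {m + 2..l}"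
  have xA: "x \<in> ?A" using k Suc.prems by (auto simp: x_def)
  have \<eta>0: "(\<lambda>_. False) \<in> Omega N" by (auto simp: configs_def)
  have BQ: "0 \<le> B" "0 \<le> Q" "0 \<le> \<omega>" using \<psi>(1)[OF \<eta>0] \<psi>(2)[OF \<eta>0 xA xA] q[OF pull_configs] abs_ge_zero order_trans by blast+
  have wm: "0 \<le> wm" using w(1)[OF xA] by linarith
  have Gb: "\<bar>G z\<bar> \<le> B * Q" for z
    unfolding G_def using s
  proof (rule Ex_abs_le)
    show "\<bar>\<psi> \<eta> * q (pull z \<eta>)\<bar> \<le> B * Q" if "\<eta> \<in> Omega N" for \<eta>
      unfolding abs_mult using \<psi>(1)[OF that] q[OF pull_configs] BQ by (intro mult_mono) auto
  qed
  have Ib: "\<bar>itav w ?A G m z\<bar> \<le> B * Q" for z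
    using w Gb by (intro itav_bound) auto
  have good: "\<bar>itav w ?A G m (z(Suc m := c)) - G z\<bar> \<le> real m * \<delta> + (B * Q * Tr s x c + Q * \<omega>)"
    if c: "c \<in> ?A" "c \<notin> bad" for c
  proof -
    have "\<bar>itav w ?A G m (z(Suc m := c)) - G (z(Suc m := c))\<bar> \<le> real m * \<delta>"
      unfolding \<delta>_def
    proof (rule Suc.IH)
      show "m \<le> l" using Suc.prems by auto
      show "(z(Suc m := c)) i = k + i" if "i \<in> {1..m}" for i using Suc.prems(2)[of i] that by auto
      show "(z(Suc m := c)) i \<notin> {k + 1..k + m}" if "i \<in> {m + 1..l}" for i
        using Suc.prems(3)[of i] that c by (auto simp: bad_def)
    qed
    moreover have "\<bar>G (z(Suc m := c)) - G z\<bar> \<le> B * Q * Tr s x c + Q * \<omega>"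
      unfolding G_def
    proof (rule replace_one[where \<psi> = \<psi> and q = q and B = B and \<omega> = \<omega>, OF s xA c(1) \<psi>(1) \<psi>(2)[OF _ xA c(1)] q])
      fix i assume i: "i \<in> {1..l}"
      consider "i < Suc m" | "i = Suc m" | "Suc m < i" by linarith
      then show "(z(Suc m := c)) i = Transposition.transpose x c (z i)"
      proof cases
        case 1
        then have "z i = k + i" using Suc.prems(2)[of i] i by auto
        moreover have "k + i \<noteq> c" using c i by (auto simp: bad_def)
        ultimately show ?thesis using 1 by (simp add: x_def Transposition.transpose_def)
      next
        case 2
        then show ?thesis using Suc.prems(2)[of i] i by (simp add: x_def)
      next
        case 3
        then have "z i \<notin> {k + 1..k + Suc m}" using Suc.prems(3)[of i] i by auto
        moreover have "z i \<noteq> c" using c i 3 by (auto simp: bad_def)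
        ultimately show ?thesis using 3 by (auto simp: x_def Transposition.transpose_def)
      qed
    qed auto
    ultimately show ?thesis by linarith
  qed
  have \<Delta>0: "0 \<le> \<Delta>"
    using \<Delta>[of "Suc m"] Suc.prems(1) w(1) by (intro order_trans[OF sum_nonneg \<Delta>[of "Suc m"]]) auto
  have \<delta>0: "0 \<le> \<delta>" unfolding \<delta>_def using BQ wm Dir_nonneg[OF s] \<Delta>0
    by (intro add_nonneg_nonneg mult_nonneg_nonneg) auto
  have each: "\<bar>itav w ?A G m (z(Suc m := c)) - G z\<bar> \<le> real m * \<delta> + (B * Q * Tr s x c + Q * \<omega>) + of_bool (c \<in> bad) * (2 * B * Q)"
    if c: "c \<in> ?A" for c
  proof (cases "c \<in> bad")
    case True
    have "0 \<le> real m * \<delta> + (B * Q * Tr s x c + Q * \<omega>)" using BQ \<delta>0 Tr_nonneg[of s x c] by auto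
    then show ?thesis using True Ib[of "z(Suc m := c)"] Gb[of z] by simp
  qed (use good[OF c] in auto)
  have cb: "(\<Sum>c\<in>?A. w c * of_bool (c \<in> bad)) \<le> 2 * real l * wm"
  proof -
    have "card bad \<le> l + l"
      unfolding bad_def by (intro order_trans[OF card_Un_le] add_mono order_trans[OF card_image_le]) auto
    moreover have "card (?A \<inter> bad) \<le> card bad" by (intro card_mono) (auto simp: bad_def)
    ultimately have cc: "real (card (?A \<inter> bad)) \<le> 2 * real l" by linarith
    have "(\<Sum>c\<in>?A. w c * of_bool (c \<in> bad)) \<le> (\<Sum>c\<in>?A. wm * of_bool (c \<in> bad))"
      using w(1) by (intro sum_mono mult_right_mono) auto
    also have "\<dots> = wm * real (card (?A \<inter> bad))"
      by (simp add: sum_distrib_left[symmetric] Int_def)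
    also have "\<dots> \<le> wm * (2 * real l)" using cc wm by (intro mult_left_mono)
    finally show ?thesis by (simp add: mult_ac)
  qed
  \<comment> \<open>Cauchy-Schwarz against the probability weights: the mean of the square roots is
    at most the root of the mean distance.\<close>
  have tr: "(\<Sum>c\<in>?A. w c * Tr s x c) \<le> 4 * sqrt (Dir s * \<Delta>)"
  proof -
    have "(\<Sum>c\<in>?A. w c * Tr s x c) \<le> (\<Sum>c\<in>?A. w c * (4 * sqrt (\<bar>real x - real c\<bar> * Dir s)))"
      using w(1) by (intro sum_mono mult_left_mono Tr_dist s xA) auto
    also have "\<dots> = 4 * (\<Sum>c\<in>?A. \<bar>sqrt (w c)\<bar> * \<bar>sqrt (w c * \<bar>real x - real c\<bar> * Dir s)\<bar>)"
      using w(1) Dir_nonneg[OF s]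
      by (auto simp: sum_distrib_left real_sqrt_mult mult_ac abs_mult intro!: sum.cong) 
    also have "\<dots> \<le> 4 * (L2_set (\<lambda>c. sqrt (w c)) ?A * L2_set (\<lambda>c. sqrt (w c * \<bar>real x - real c\<bar> * Dir s)) ?A)"
      by (intro mult_left_mono L2_set_mult_ineq) auto
    also have "\<dots> = 4 * sqrt (Dir s * (\<Sum>c\<in>?A. w c * \<bar>real x - real c\<bar>))"
    proof -
      have "(\<Sum>c\<in>?A. (sqrt (w c))^2) = 1"
        unfolding w(2)[symmetric] using w(1) by (intro sum.cong refl) simp
      moreover have "(\<Sum>c\<in>?A. (sqrt (w c * \<bar>real x - real c\<bar> * Dir s))^2) = Dir s * (\<Sum>c\<in>?A. w c * \<bar>real x - real c\<bar>)"
        unfolding sum_distrib_left using w(1) Dir_nonneg[OF s] by (intro sum.cong refl) (simp add: mult_ac)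
      ultimately show ?thesis by (simp add: L2_set_def)
    qed
    also have "\<dots> \<le> 4 * sqrt (Dir s * \<Delta>)"
      using \<Delta>[of "Suc m"] Suc.prems(1) Dir_nonneg[OF s] by (intro mult_left_mono real_sqrt_le_mono) (auto simp: x_def)
    finally show ?thesis .
  qed
  have eq: "itav w ?A G (Suc m) z - G z = (\<Sum>c\<in>?A. w c * (itav w ?A G m (z(Suc m := c)) - G z))"
    using w(2) by (simp add: right_diff_distrib sum_subtractf flip: sum_distrib_right)
  have "\<bar>itav w ?A G (Suc m) z - G z\<bar> \<le> (\<Sum>c\<in>?A. w c * (real m * \<delta> + (B * Q * Tr s x c + Q * \<omega>) + of_bool (c \<in> bad) * (2 * B * Q)))"
    unfolding eq
  proof (rule order_trans[OF sum_abs sum_mono])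
    fix c assume c: "c \<in> ?A"
    show "\<bar>w c * (itav w ?A G m (z(Suc m := c)) - G z)\<bar>
      \<le> w c * (real m * \<delta> + (B * Q * Tr s x c + Q * \<omega>) + of_bool (c \<in> bad) * (2 * B * Q))"
      using mult_left_mono[OF each[OF c], of "w c"] w(1)[OF c] by (simp only: abs_mult abs_of_nonneg)
  qed
  also have "\<dots> = (\<Sum>c\<in>?A. w c * (real m * \<delta> + Q * \<omega>)) + B * Q * (\<Sum>c\<in>?A. w c * Tr s x c) + 2 * B * Q * (\<Sum>c\<in>?A. w c * of_bool (c \<in> bad))"
    unfolding sum_distrib_left sum.distrib[symmetric] by (intro sum.cong refl) (simp only: algebra_simps)
  also have "\<dots> \<le> (real m * \<delta> + Q * \<omega>) + B * Q * (4 * sqrt (Dir s * \<Delta>)) + 2 * B * Q * (2 * real l * wm)"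
    using w(2) tr cb BQ by (intro add_mono mult_left_mono) (auto simp flip: sum_distrib_right)
  also have "\<dots> = real (Suc m) * \<delta>" by (simp add: \<delta>_def algebra_simps)
  finally show ?case unfolding \<delta>_def .
qed

text \<open>Only the expectation against a functional \<psi> is controlled, with no absolute value
  inside. This suffices, because the energy estimate pairs the current with a fluctuation of the
  modes, which plays the part of \<psi>.\<close>

lemma replacement:
  assumes s: "s \<in> {0..T}"
    and \<psi>: "\<And>\<eta>. \<eta> \<in> Omega N \<Longrightarrow> \<bar>\<psi> \<eta>\<bar> \<le> B"
      "\<And>\<eta> x y. \<eta> \<in> Omega N \<Longrightarrow> x \<in> {1..N - 1} \<Longrightarrow> y \<in> {1..N - 1} \<Longrightarrow> \<bar>\<psi> (\<eta> \<circ> Transposition.transpose x y) - \<psi> \<eta>\<bar> \<le> \<omega>"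
    and w: "\<And>c. c \<in> {1..N - 1} \<Longrightarrow> 0 \<le> w c \<and> w c \<le> wm" "sum w {1..N - 1} = 1"
    and \<Delta>: "\<And>i. i \<in> {1..l} \<Longrightarrow> (\<Sum>c\<in>{1..N - 1}. w c * \<bar>real (base \<sigma> + i) - real c\<bar>) \<le> \<Delta>"
  shows "\<bar>Ex s (\<lambda>\<eta>. \<psi> \<eta> * (flux_obs l (R \<sigma>) (window l (base \<sigma>) \<eta>) - boundary_flux l (R \<sigma>) (\<Sum>c\<in>{1..N - 1}. w c * of_bool (\<eta> c))))\<bar>
     \<le> rep_err s B (2 ^ l * RB * real l) \<omega> \<Delta> wm"
proof -
  let ?q = "flux_obs l (R \<sigma>)" and ?z = "\<lambda>i. base \<sigma> + i" and ?A = "{1..N - 1}"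
  have q: "\<bar>?q \<xi>\<bar> \<le> 2 ^ l * RB * real l" if "\<xi> \<in> configs {1..l}" for \<xi>
    using R_nonneg R_bound by (intro flux_obs_bound that) auto
  have b: "0 \<le> (\<Sum>c\<in>?A. w c * of_bool (\<eta> c))" "(\<Sum>c\<in>?A. w c * of_bool (\<eta> c)) \<le> 1" for \<eta>
  proof -
    show "0 \<le> (\<Sum>c\<in>?A. w c * of_bool (\<eta> c))" using w(1) by (intro sum_nonneg) auto
    have "(\<Sum>c\<in>?A. w c * of_bool (\<eta> c)) \<le> sum w ?A" using w(1) by (intro sum_mono) auto
    then show "(\<Sum>c\<in>?A. w c * of_bool (\<eta> c)) \<le> 1" by (simp only: w(2))
  qed
  have "\<bar>itav w ?A (\<lambda>z. Ex s (\<lambda>\<eta>. \<psi> \<eta> * ?q (pull z \<eta>))) l ?z - Ex s (\<lambda>\<eta>. \<psi> \<eta> * ?q (pull ?z \<eta>))\<bar>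
    \<le> rep_err s B (2 ^ l * RB * real l) \<omega> \<Delta> wm"
    unfolding rep_err_def
    by (rule replacement_itav[OF s \<psi> q w window_sites \<Delta>]) auto
  moreover have "itav w ?A (\<lambda>z. Ex s (\<lambda>\<eta>. \<psi> \<eta> * ?q (pull z \<eta>))) l ?z
    = Ex s (\<lambda>\<eta>. \<psi> \<eta> * boundary_flux l (R \<sigma>) (\<Sum>c\<in>?A. w c * of_bool (\<eta> c)))"
    unfolding itav_Ex itav_cmult itav_bexp[OF w(2) order_refl]
    using boundary_flux_bexp[OF b pull_configs] by simp
  moreover have "pull ?z \<eta> = window l (base \<sigma>) \<eta>" for \<eta>
    by (auto simp: pull_def window_def)
  ultimately show ?thesis
    by (simp add: right_diff_distrib Ex_diff abs_minus_commute)
qed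

end

section \<open>Fejer kernels\<close>

text \<open>The centres of n equal cells of [0,1]. With n = N - 1 they are within 1 / n of the sites
  i / N at which the empirical measure sits.\<close>

definition th :: "nat \<Rightarrow> nat \<Rightarrow> real" where "th n i = (real i - 1/2) / real n"

lemma th_range: "i \<in> {1..n} \<Longrightarrow> th n i \<in> {0..1}"
  by (auto simp: th_def field_simps)

text \<open>Multiplication by twice the sine of half a step makes the sum telescope, and what
  remains is sin (k \<pi>) = 0. The range of k keeps half a step inside (0, \<pi>), where the sine
  is positive.\<close>

lemma sum_cm_th:
  assumes "0 < k" "k < 2 * n"
  shows "(\<Sum>i\<in>{1..n}. cm k (th n i)) = 0"
proof -
  define a where "a = real k * pi / (2 * real n)"
  have a: "0 < a" "a < pi" using assms by (auto simp: a_def field_simps)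
  have "2 * sin a * cm k (th n i) = sin (2 * a * real i) - sin (2 * a * real (i - 1))" if "i \<in> {1..n}" for i
  proof -
    have c: "real k * pi * th n i = 2 * a * real i - a"
      using assms by (simp add: a_def th_def field_simps)
    have e: "2 * a * real (i - 1) = (2 * a * real i - a) - a" "2 * a * real i = (2 * a * real i - a) + a"
      using that by (auto simp: of_nat_diff algebra_simps)
    have "sin (b + a) - sin (b - a) = 2 * sin a * cos b" for b
      by (simp add: sin_add sin_diff)
    from this[of "2 * a * real i - a"] show ?thesis
      unfolding cm_def c e(1) by simp
  qed
  then have "2 * sin a * (\<Sum>i\<in>{1..n}. cm k (th n i)) = (\<Sum>i\<in>{1..n}. sin (2 * a * real i) - sin (2 * a * real (i - 1)))"
    unfolding sum_distrib_left by (rule sum.cong[OF refl])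
  also have "\<dots> = sin (2 * a * real n) - sin (2 * a * real 0)"
    using sum_telescope''[of 0 n "\<lambda>i. sin (2 * a * real i)"] by (simp add: One_nat_def)
  also have "2 * a * real n = real k * pi" using assms by (simp add: a_def)
  finally show ?thesis using sin_gt_zero[OF a] by simp
qed

lemma sum_cm_cm_th:
  assumes "j + k < 2 * n"
  shows "(\<Sum>i\<in>{1..n}. cm j (th n i) * cm k (th n i)) = (if j = k then real n / wt k else 0)"
proof -
  have "(\<Sum>i\<in>{1..n}. cm m (th n i)) = (if m = 0 then real n else 0)" if "m < 2 * n" for m
    using sum_cm_th[of m n] that by auto
  then show ?thesis
    unfolding cm_mult sum_divide_distrib[symmetric] sum.distrib using assms by (auto simp: wt_def)
qed

text \<open>\<open>sg \<sigma> ^ k\<close> is the value of \<open>cm k\<close> at the end point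
  \<sigma>; on [0,1], \<open>refl01 \<sigma>\<close> is the distance from that end point.\<close>

definition sg :: "bool \<Rightarrow> real" where "sg \<sigma> = (if \<sigma> then -1 else 1)"

definition refl01 :: "bool \<Rightarrow> real \<Rightarrow> real" where "refl01 \<sigma> x = (if \<sigma> then 1 - x else x)"

lemma cm_refl01: "cm k (refl01 \<sigma> x) = sg \<sigma> ^ k * cm k x"
  by (auto simp: cm_def refl01_def sg_def right_diff_distrib cos_diff sin_npi2)

lemma abs_sg_power [simp]: "\<bar>sg \<sigma> ^ k\<bar> = 1"
  by (simp add: sg_def power_abs)

text \<open>The Fejer weights with \<open>wt\<close> built in, so that
  \<open>\<Sum>k<K. fc K k * h k\<close> approximates \<open>\<Sum>k. wt k * h k\<close>.\<close>

definition fc :: "nat \<Rightarrow> nat \<Rightarrow> real" where "fc K k = (if k < K then wt k * (1 - real k / real K) else 0)"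

lemma fc_bounds: "0 \<le> fc K k" "fc K k \<le> wt k" "fc K k \<le> 2"
proof -
  show "0 \<le> fc K k" by (auto simp: fc_def field_simps)
  have "wt k * (1 - real k / real K) \<le> wt k * 1" by (intro mult_left_mono) auto
  then show "fc K k \<le> wt k" by (auto simp: fc_def)
  then show "fc K k \<le> 2" using wt_le_2[of k] by linarith
qed

definition fejer :: "nat \<Rightarrow> real \<Rightarrow> real" where "fejer K x = (\<Sum>k<K. fc K k * cm k x)"

text \<open>The Fejer kernel is \<open>\<bar>\<Sum>\<^sub>j\<^sub><\<^sub>K e\<^sup>i\<^sup>j\<^sup>\<pi>\<^sup>x\<bar>\<^sup>2 / K\<close>.\<close>

lemma fejer_nonneg: "0 \<le> fejer K x"
proof (cases "K = 0")
  case False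
  have sq: "(\<Sum>k<K. wt k * (real K - real k) * cm k x) = (\<Sum>j<K. cm j x)^2 + (\<Sum>j<K. sm j x)^2" for K
  proof (induction K)
    case (Suc K)
    have cs: "cm j x * cm K x + sm j x * sm K x = cm (K - j) x" if "j < K" for j
      using that by (simp add: cm_mult sm_mult add_divide_distrib[symmetric])
    have rev: "(\<Sum>j<K. cm (K - j) x) = (\<Sum>k=1..K. cm k x)"
      by (rule sum.reindex_bij_witness[of _ "\<lambda>k. K - k" "\<lambda>j. K - j"]) auto
    have "(\<Sum>k<Suc K. wt k * (real (Suc K) - real k) * cm k x)
      = (\<Sum>k<K. wt k * (real K - real k) * cm k x) + (\<Sum>k<Suc K. wt k * cm k x)"
      by (simp add: algebra_simps sum.distrib sum_subtractf)
    also have "(\<Sum>k<Suc K. wt k * cm k x) = 1 + 2 * (\<Sum>k=1..K. cm k x)"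
    proof -
      have "{..<Suc K} = insert 0 {1..K}" by auto
      then show ?thesis by (simp add: wt_def sum_distrib_left)
    qed
    also have "(\<Sum>k=1..K. cm k x) = (\<Sum>j<K. cm j x) * cm K x + (\<Sum>j<K. sm j x) * sm K x"
      unfolding rev[symmetric] by (simp add: cs[symmetric] sum.distrib sum_distrib_right)
    finally show ?case
      using Suc sin_cos_squared_add2[of "real K * pi * x"]
      by (simp add: power2_eq_square algebra_simps cm_def[of K] sm_def[of K])
  qed simp
  have "real K * fejer K x = (\<Sum>k<K. wt k * (real K - real k) * cm k x)"
    unfolding fejer_def sum_distrib_left using False by (intro sum.cong refl) (auto simp: fc_def field_simps)
  then have "0 \<le> real K * fejer K x" unfolding sq by simp
  then show ?thesis using False by (simp add: zero_le_mult_iff)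
qed (simp add: fejer_def)

text \<open>The factor \<open>exp (- lam k * r)\<close> is the average of \<open>cos (k \<pi> y)\<close> over a centred Gaussian \<open>y\<close> of variance \<open>2 r\<close>,
  so the heat flow preserves positivity.\<close>

lemma heat_fejer_nonneg:
  assumes r: "0 \<le> r"
  shows "0 \<le> (\<Sum>k<K. fc K k * exp (- lam k * r) * cm k x)"
proof -
  let ?M = "std_normal_distribution"
  interpret prob_space ?M by (intro real_distribution.axioms(1) real_dist_normal_dist)
  define s where "s = sqrt (2 * r)"
  have sq: "s^2 = 2 * r" using r by (simp add: s_def)
  have c: "(LINT g|?M. cm k (s * g)) = exp (- lam k * r)" and sn: "(LINT g|?M. sm k (s * g)) = 0" for k
  proof -
    define t where "t = real k * pi * s"
    have i: "integrable ?M (\<lambda>g. iexp (t * g))"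
      by (rule integrable_const_bound[of _ 1]) auto
    have e: "t^2 / 2 = lam k * r" by (simp add: t_def lam_def power_mult_distrib sq)
    have "(CLINT g|?M. iexp (t * g)) = complex_of_real (exp (- (lam k * r)))"
      using fun_cong[OF char_std_normal_distribution, of t] by (simp add: char_def e)
    then have "Re (CLINT g|?M. iexp (t * g)) = exp (- (lam k * r))" "Im (CLINT g|?M. iexp (t * g)) = 0"
      by (auto simp: exp_of_real)
    then show "(LINT g|?M. cm k (s * g)) = exp (- lam k * r)" "(LINT g|?M. sm k (s * g)) = 0"
      unfolding integral_Re[OF i, symmetric] integral_Im[OF i, symmetric]
      by (simp_all add: cm_def sm_def t_def mult.assoc Re_exp Im_exp)
  qed
  have ic: "integrable ?M (\<lambda>g. cm k (a * g))" "integrable ?M (\<lambda>g. sm k (a * g))" for k a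
    by (auto intro!: integrable_const_bound[of _ 1] AE_I2)
  have ad: "cm k (x + s * g) = cm k x * cm k (s * g) - sm k x * sm k (s * g)" for k g
    by (simp add: cm_def sm_def distrib_left cos_add)
  have "0 \<le> (LINT g|?M. fejer K (x + s * g))"
    by (intro integral_nonneg_AE AE_I2 fejer_nonneg)
  also have "\<dots> = (\<Sum>k<K. fc K k * (cm k x * exp (- lam k * r)))"
    unfolding fejer_def ad using ic by (simp add: c sn)
  finally show ?thesis by (simp add: mult_ac)
qed

lemma heat_fejer_refl_nonneg:
  "0 \<le> r \<Longrightarrow> 0 \<le> (\<Sum>k<K. fc K k * sg \<sigma> ^ k * exp (- lam k * r) * cm k x)"
  using heat_fejer_nonneg[of r K "refl01 \<sigma> x"] by (simp add: cm_refl01 mult_ac)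

text \<open>Only mode 0 has a nonzero sum over the cell centres, since the modes below K are also
  below 2 n. So the positive kernel becomes a probability on the sites exactly, not just in the
  limit.\<close>

lemma sum_heat_fejer_th:
  assumes "1 \<le> K" "K \<le> n"
  shows "(\<Sum>i\<in>{1..n}. \<Sum>k<K. fc K k * sg \<sigma> ^ k * exp (- lam k * r) * cm k (th n i)) = real n"
proof -
  have "(\<Sum>i\<in>{1..n}. \<Sum>k<K. fc K k * sg \<sigma> ^ k * exp (- lam k * r) * cm k (th n i))
    = (\<Sum>k<K. fc K k * sg \<sigma> ^ k * exp (- lam k * r) * (\<Sum>i\<in>{1..n}. cm k (th n i)))"
    unfolding sum_distrib_left by (rule sum.swap)
  also have "\<dots> = (\<Sum>k<K. if k = 0 then real n else 0)"
    using assms sum_cm_th[of _ n] by (intro sum.cong refl) (auto simp: fc_def wt_def)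
  finally show ?thesis using assms by simp
qed

text \<open>The Fejer kernel centred at an end point, as a probability on the sites. The density
  average that it defines is a finite combination of modes, so the flux evaluated at this average is
  a function of the modes.\<close>

definition fw :: "nat \<Rightarrow> nat \<Rightarrow> bool \<Rightarrow> nat \<Rightarrow> real" where
  "fw K n \<sigma> i = (\<Sum>k<K. fc K k * sg \<sigma> ^ k * cm k (th n i)) / real n"

lemma fw_bounds:
  "0 \<le> fw K n \<sigma> i" "fw K n \<sigma> i \<le> 2 * real K / real n"
proof -
  show "0 \<le> fw K n \<sigma> i"
    using heat_fejer_refl_nonneg[of 0 K \<sigma> "th n i"] by (simp add: fw_def)
  have "fc K k * sg \<sigma> ^ k * cm k (th n i) \<le> 2" for k
  proof -
    have "\<bar>fc K k * sg \<sigma> ^ k * cm k (th n i)\<bar> \<le> 2 * 1 * 1"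
      unfolding abs_mult using fc_bounds[of K k] by (intro mult_mono) auto
    then show ?thesis by linarith
  qed
  then have "(\<Sum>k<K. fc K k * sg \<sigma> ^ k * cm k (th n i)) \<le> (\<Sum>k<K. 2)" by (intro sum_mono)
  then show "fw K n \<sigma> i \<le> 2 * real K / real n" unfolding fw_def by (intro divide_right_mono) auto
qed

lemma fw_sum: "1 \<le> K \<Longrightarrow> K \<le> n \<Longrightarrow> (\<Sum>i\<in>{1..n}. fw K n \<sigma> i) = 1"
  using sum_heat_fejer_th[of K n \<sigma> 0] by (simp add: fw_def flip: sum_divide_distrib)

text \<open>The sine is concave on [0, \<pi> / 2] and lies above its chord, so y \<le> sin (\<pi> y
  / 2); now square.\<close>

lemma sq_le_one_minus_cos: "y \<in> {0..1} \<Longrightarrow> y^2 \<le> (1 - cm 1 y) / 2"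
proof -
  assume y: "y \<in> {0..1}"
  have "convex_on {0..1} (\<lambda>y. - sin (pi / 2 * y))"
  proof (rule f''_ge0_imp_convex)
    show "((\<lambda>y. - sin (pi / 2 * y)) has_real_derivative - (pi / 2 * cos (pi / 2 * x))) (at x)" for x
      by (auto intro!: derivative_eq_intros)
    show "((\<lambda>x. - (pi / 2 * cos (pi / 2 * x))) has_real_derivative (pi / 2)^2 * sin (pi / 2 * x)) (at x)" for x
      by (auto intro!: derivative_eq_intros simp: power2_eq_square)
    show "0 \<le> (pi / 2)^2 * sin (pi / 2 * x)" if "x \<in> {0..1}" for x
      using that by (intro mult_nonneg_nonneg sin_ge_zero) auto
  qed auto
  from convex_onD[OF this, of y 0 1] y have "y \<le> sin (pi / 2 * y)" by simp
  then have "y^2 \<le> (sin (pi / 2 * y))^2" using y by (intro power_mono) auto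
  also have "\<dots> = (1 - cm 1 y) / 2"
    using cos_double_sin[of "pi / 2 * y"] by (simp add: cm_def)
  finally show ?thesis .
qed

text \<open>The mean of \<open>cm 1\<close> under the weights is read off from the Fejer coefficient
  of mode 1 and misses 1 by 1 / K. This controls the second moment of the distance to the end point,
  and Cauchy-Schwarz controls the first.\<close>

lemma fw_spread:
  assumes K: "1 \<le> K" "K < n"
  shows "(\<Sum>i\<in>{1..n}. fw K n \<sigma> i * refl01 \<sigma> (th n i)) \<le> 1 / sqrt (real K)"
proof -
  let ?y = "\<lambda>i. refl01 \<sigma> (th n i)"
  have y: "?y i \<in> {0..1}" if "i \<in> {1..n}" for i
    using th_range[OF that] by (auto simp: refl01_def)
  have "(\<Sum>i\<in>{1..n}. fw K n \<sigma> i * cm 1 (?y i)) = 1 - 1 / real K"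
  proof -
    have "(\<Sum>i\<in>{1..n}. fw K n \<sigma> i * cm 1 (?y i))
      = (\<Sum>i\<in>{1..n}. \<Sum>k<K. fc K k * sg \<sigma> ^ k * sg \<sigma> / real n * (cm k (th n i) * cm 1 (th n i)))"
      unfolding fw_def cm_refl01 sum_divide_distrib sum_distrib_right by (intro sum.cong refl) (simp add: mult_ac)
    also have "\<dots> = (\<Sum>k<K. fc K k * sg \<sigma> ^ k * sg \<sigma> / real n * (\<Sum>i\<in>{1..n}. cm k (th n i) * cm 1 (th n i)))"
      unfolding sum_distrib_left by (rule sum.swap)
    also have "\<dots> = (\<Sum>k<K. if k = 1 then fc K 1 / 2 else 0)"
      using K by (intro sum.cong refl) (auto simp: sum_cm_cm_th wt_def sg_def)
    also have "\<dots> = 1 - 1 / real K"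
      using K by (cases "K = 1") (auto simp: fc_def wt_def)
    finally show ?thesis .
  qed
  then have "(\<Sum>i\<in>{1..n}. fw K n \<sigma> i * ((1 - cm 1 (?y i)) / 2)) = 1 / (2 * real K)"
    using fw_sum[of K n \<sigma>] K by (simp add: right_diff_distrib sum_subtractf flip: sum_divide_distrib)
  moreover have "(\<Sum>i\<in>{1..n}. fw K n \<sigma> i * (?y i)^2) \<le> (\<Sum>i\<in>{1..n}. fw K n \<sigma> i * ((1 - cm 1 (?y i)) / 2))"
    using y by (intro sum_mono mult_left_mono sq_le_one_minus_cos fw_bounds)
  ultimately have sq: "(\<Sum>i\<in>{1..n}. fw K n \<sigma> i * (?y i)^2) \<le> 1 / (2 * real K)" by simp
  have "(\<Sum>i\<in>{1..n}. fw K n \<sigma> i * ?y i) = (\<Sum>i\<in>{1..n}. \<bar>sqrt (fw K n \<sigma> i)\<bar> * \<bar>sqrt (fw K n \<sigma> i) * ?y i\<bar>)"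
    using y fw_bounds(1)[of K n \<sigma>] by (intro sum.cong refl) (auto simp: abs_mult)
  also have "\<dots> \<le> L2_set (\<lambda>i. sqrt (fw K n \<sigma> i)) {1..n} * L2_set (\<lambda>i. sqrt (fw K n \<sigma> i) * ?y i) {1..n}"
    by (rule L2_set_mult_ineq)
  also have "\<dots> = sqrt (\<Sum>i\<in>{1..n}. fw K n \<sigma> i * (?y i)^2)"
    using fw_sum[of K n \<sigma>] K fw_bounds(1)[of K n \<sigma>] by (simp add: L2_set_def power_mult_distrib)
  also have "\<dots> \<le> sqrt (1 / (2 * real K))" using sq by (rule real_sqrt_le_mono)
  also have "\<dots> \<le> sqrt (1 / real K)" using K by (intro real_sqrt_le_mono) (auto simp: field_simps)
  finally show ?thesis by (simp add: real_sqrt_divide)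
qed

section \<open>Second moments of the empirical modes\<close>

lemma abs_cos_minus_one_le: "\<bar>cos a - 1\<bar> \<le> \<bar>a\<bar>" for a :: real
proof -
  have "\<bar>cos a - 1\<bar> = 2 * \<bar>sin (a / 2)\<bar> * \<bar>sin (a / 2)\<bar>"
    using cos_double_sin[of "a / 2"] by (simp add: power2_eq_square)
  also have "\<dots> \<le> 2 * \<bar>a / 2\<bar> * 1"
    using abs_sin_x_le_abs_x[of "a / 2"] by (intro mult_mono) auto
  finally show ?thesis by simp
qed

lemma cm_lipschitz: "\<bar>cm k x - cm k y\<bar> \<le> real k * pi * \<bar>x - y\<bar>"
proof -
  have "(cm k has_field_derivative - (real k * pi * sm k z)) (at z within UNIV)" for z
    by (rule cm_has_derivative)
  moreover have "norm (- (real k * pi * sm k z)) \<le> real k * pi" for z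
    using mult_left_mono[OF abs_sm_le[of k z], of "real k * pi"] by (simp add: abs_mult)
  ultimately show ?thesis
    using field_differentiable_bound[of UNIV "cm k" "\<lambda>z. - (real k * pi * sm k z)" "real k * pi" x y] by simp
qed

lemma sq_le_if_abs_le: "\<bar>x\<bar> \<le> y \<Longrightarrow> x^2 \<le> y^2" for x y :: real
  using power_mono[of "\<bar>x\<bar>" y 2] by simp

lemma summation_by_parts:
  fixes a e :: "nat \<Rightarrow> real"
  assumes "1 \<le> m"
  shows "(\<Sum>x\<in>{1..<m}. (a (Suc x) - a x) * (e x - e (Suc x)))
    = (\<Sum>i\<in>{1..m}. a i * (e (Suc i) + e (i - 1) - 2 * e i)) + a 1 * (e 1 - e 0) - a m * (e (Suc m) - e m)"
  using assms
proof (induction m rule: dec_induct)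
  case base
  then show ?case by (simp add: algebra_simps One_nat_def)
next
  case (step m)
  then have "{1..<Suc m} = insert m {1..<m}" "{1..Suc m} = insert (Suc m) {1..m}" by auto
  then show ?case using step by (simp add: algebra_simps)
qed

section \<open>Action of the generator on the empirical modes\<close>

context flow
begin

definition X :: "nat \<Rightarrow> config \<Rightarrow> real" where
  "X k \<eta> = (\<Sum>i\<in>{1..n}. of_bool (\<eta> i) * cm k (th n i)) / real n"

text \<open>The eigenvalue of mode k for the discrete Neumann Laplacian on n cells, at speed
  \<open>N ^ 2\<close>.\<close>

definition lamN :: "nat \<Rightarrow> real" where "lamN k = 2 * real N ^ 2 * (1 - cos (real k * pi / real n))"

definition cur :: "bool \<Rightarrow> config \<Rightarrow> real" where "cur \<sigma> \<eta> = flux_obs l (R \<sigma>) (window l (base \<sigma>) \<eta>)"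

definition Q :: real where "Q = 2 ^ l * RB * real l"

lemma Q_nonneg: "0 \<le> Q" using RB_nonneg by (simp add: Q_def)

lemma rn: "0 < real n" using n_pos by simp

lemma Omega_n: "{1..N - 1} = {1..n}" by (simp add: n_def)

lemma cur_bound: "\<bar>cur \<sigma> \<eta>\<bar> \<le> Q"
  unfolding cur_def Q_def using R_nonneg R_bound by (intro flux_obs_bound) auto

lemma abs_X_le: "\<bar>X k \<eta>\<bar> \<le> 1"
proof -
  have "\<bar>of_bool (\<eta> i) * cm k (th n i)\<bar> \<le> 1" for i by auto
  then have "\<bar>\<Sum>i\<in>{1..n}. of_bool (\<eta> i) * cm k (th n i)\<bar> \<le> (\<Sum>i\<in>{1..n}. 1)"
    by (intro order_trans[OF sum_abs] sum_mono)
  then show ?thesis using rn by (simp add: X_def)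
qed

lemma X_transpose:
  assumes "x \<in> {1..n}" "y \<in> {1..n}"
  shows "X k (\<eta> \<circ> Transposition.transpose x y) - X k \<eta> = (of_bool (\<eta> y) - of_bool (\<eta> x)) * (cm k (th n x) - cm k (th n y)) / real n"
proof (cases "x = y")
  case False
  let ?t = "Transposition.transpose x y"
  have "(\<Sum>i\<in>{1..n}. (of_bool (\<eta> (?t i)) - of_bool (\<eta> i)) * cm k (th n i))
     = (\<Sum>i\<in>{x, y}. (of_bool (\<eta> (?t i)) - of_bool (\<eta> i)) * cm k (th n i))"
    using assms by (intro sum.mono_neutral_right) (auto simp: Transposition.transpose_def)
  also have "\<dots> = (of_bool (\<eta> y) - of_bool (\<eta> x)) * (cm k (th n x) - cm k (th n y))"
    using False by (simp add: algebra_simps)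
  finally show ?thesis
    by (simp add: X_def sum_subtractf left_diff_distrib flip: diff_divide_distrib)
qed simp

lemma X_swap:
  "x \<in> {1..<n} \<Longrightarrow> X k (swap x \<eta>) - X k \<eta> = (of_bool (\<eta> (Suc x)) - of_bool (\<eta> x)) * (cm k (th n x) - cm k (th n (Suc x))) / real n"
  unfolding swap_eq_comp by (rule X_transpose) auto

lemma X_paste:
  "X k (paste l (base \<sigma>) \<xi> \<eta>) - X k \<eta>
    = (\<Sum>j\<in>{1..l}. (of_bool (\<xi> j) - of_bool (window l (base \<sigma>) \<eta> j)) * cm k (th n (base \<sigma> + j))) / real n"
proof -
  let ?b = "base \<sigma>" and ?p = "paste l (base \<sigma>) \<xi> \<eta>"
  have "(\<Sum>i\<in>{1..n}. (of_bool (?p i) - of_bool (\<eta> i)) * cm k (th n i))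
     = (\<Sum>i\<in>{?b + 1..?b + l}. (of_bool (?p i) - of_bool (\<eta> i)) * cm k (th n i))"
    using window_sites[of \<sigma>] unfolding Omega_n by (intro sum.mono_neutral_right) (auto simp: paste_def)
  also have "\<dots> = (\<Sum>j\<in>{1..l}. (of_bool (?p (?b + j)) - of_bool (\<eta> (?b + j))) * cm k (th n (?b + j)))"
    by (rule sum.reindex_bij_witness[of _ "\<lambda>j. ?b + j" "\<lambda>i. i - ?b"]) auto
  also have "\<dots> = (\<Sum>j\<in>{1..l}. (of_bool (\<xi> j) - of_bool (window l ?b \<eta> j)) * cm k (th n (?b + j)))"
    by (intro sum.cong refl) (auto simp: paste_def window_def)
  finally show ?thesis
    by (simp add: X_def sum_subtractf left_diff_distrib flip: diff_divide_distrib)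
qed

lemma exchange_X: "(\<Sum>x\<in>{1..<n}. X k (swap x \<eta>) - X k \<eta>) = - 2 * (1 - cos (real k * pi / real n)) * X k \<eta>"
proof -
  define a :: "nat \<Rightarrow> real" where "a i = of_bool (\<eta> i)" for i
  define e where "e i = cm k (th n i)" for i
  \<comment> \<open>Sampling at half-integers makes the ghost values outside the lattice equal to
    their neighbours, so the boundary terms of the summation by parts vanish.\<close>
  have e0: "e 0 = e 1" by (simp add: e_def cm_def th_def field_simps)
  have en: "e (Suc n) = e n"
  proof -
    have "real k * pi * th n (Suc n) = real k * pi + real k * pi / (2 * real n)"
      "real k * pi * th n n = real k * pi - real k * pi / (2 * real n)"
      using rn by (auto simp: th_def field_simps)
    then show ?thesis by (simp add: e_def cm_def cos_add cos_diff sin_npi2)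
  qed
  have ei: "e (Suc i) + e (i - 1) - 2 * e i = - 2 * (1 - cos (real k * pi / real n)) * e i" if "i \<in> {1..n}" for i
  proof -
    have "real k * pi * th n (Suc i) = real k * pi * th n i + real k * pi / real n"
      "real k * pi * th n (i - 1) = real k * pi * th n i - real k * pi / real n"
      using rn that by (auto simp: th_def field_simps of_nat_diff)
    then show ?thesis by (simp only: e_def cm_def cos_add cos_diff) (simp add: algebra_simps)
  qed
  have "real n * (\<Sum>x\<in>{1..<n}. X k (swap x \<eta>) - X k \<eta>) = (\<Sum>x\<in>{1..<n}. (a (Suc x) - a x) * (e x - e (Suc x)))"
    unfolding sum_distrib_left using rn X_swap[of _ k \<eta>] by (intro sum.cong refl) (simp add: a_def e_def)
  also have "\<dots> = (\<Sum>i\<in>{1..n}. a i * (e (Suc i) + e (i - 1) - 2 * e i))"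
    using n_pos by (subst summation_by_parts) (auto simp: e0 en)
  also have "\<dots> = (\<Sum>i\<in>{1..n}. - 2 * (1 - cos (real k * pi / real n)) * (a i * e i))"
    by (intro sum.cong refl) (simp only: ei, simp only: mult_ac)
  also have "\<dots> = real n * (- 2 * (1 - cos (real k * pi / real n)) * X k \<eta>)"
    unfolding sum_distrib_left[symmetric] using rn by (simp add: X_def a_def e_def)
  finally show ?thesis using rn by simp
qed

definition EB :: "nat \<Rightarrow> real" where "EB k = 2 * (Q * ((1 + real k * pi * real l) / real n))"

text \<open>Up to reflection the site lies within l / n of the end point, where the cosine moves by
  at most \<open>k * pi\<close> times the distance; N / n = 1 + 1 / n accounts for the other 1 /
  n.\<close>

lemma cm_window:
  assumes "j \<in> {1..l}"
  shows "\<bar>real N / real n * cm k (th n (base \<sigma> + j)) - sg \<sigma> ^ k\<bar> \<le> (1 + real k * pi * real l) / real n"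
proof -
  let ?e = "cm k (th n (base \<sigma> + j))"
  have y: "\<bar>refl01 \<sigma> (th n (base \<sigma> + j))\<bar> \<le> real l / real n"
  proof (cases \<sigma>)
    case False
    then show ?thesis using assms rn by (auto simp: refl01_def th_def base_def divide_right_mono)
  next
    case True
    have "base \<sigma> + j = n + j - l" using n_pos True by (simp add: base_def n_def)
    then have "real (base \<sigma> + j) = real n + real j - real l" using n_pos by (simp add: of_nat_diff)
    then have "refl01 \<sigma> (th n (base \<sigma> + j)) = (real l - real j + 1/2) / real n"
      using rn True by (simp add: refl01_def th_def field_simps)
    then show ?thesis using assms rn by (auto simp: divide_right_mono)
  qed
  have "\<bar>?e - sg \<sigma> ^ k\<bar> = \<bar>sg \<sigma> ^ k * ?e - 1\<bar>"
  proof -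
    have "sg \<sigma> ^ k * sg \<sigma> ^ k = 1" by (auto simp: sg_def power_mult_distrib[symmetric])
    then have "?e - sg \<sigma> ^ k = sg \<sigma> ^ k * (sg \<sigma> ^ k * ?e - 1)" by (simp add: algebra_simps)
    then show ?thesis by (simp add: abs_mult)
  qed
  also have "\<dots> = \<bar>cm k (refl01 \<sigma> (th n (base \<sigma> + j))) - 1\<bar>" by (simp add: cm_refl01)
  also have "\<dots> \<le> \<bar>real k * pi * refl01 \<sigma> (th n (base \<sigma> + j))\<bar>"
    unfolding cm_def by (rule abs_cos_minus_one_le)
  also have "\<dots> \<le> real k * pi * (real l / real n)"
    unfolding abs_mult using y by (intro mult_mono) auto
  finally have a: "\<bar>?e - sg \<sigma> ^ k\<bar> \<le> real k * pi * real l / real n" by simp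
  have "real N / real n * ?e - sg \<sigma> ^ k = (?e - sg \<sigma> ^ k) + ?e / real n"
    using rn N_eq by (simp add: field_simps) (metis N_eq of_nat_Suc distrib_right mult_1 add.commute)
  moreover have "\<bar>?e / real n\<bar> \<le> 1 / real n" using rn by (simp add: divide_right_mono)
  ultimately have "\<bar>real N / real n * ?e - sg \<sigma> ^ k\<bar> \<le> real k * pi * real l / real n + 1 / real n"
    using a abs_triangle_ineq[of "?e - sg \<sigma> ^ k" "?e / real n"] by linarith
  then show ?thesis by (simp add: add_divide_distrib)
qed

text \<open>A boundary update changes \<open>X k\<close> by order 1 / n, and the speed N turns this
  into the current times the value of the cosine at the end point. The exchange part is
  exact.\<close>

lemma L_X: "\<bar>L (X k) \<eta> - (- lamN k * X k \<eta> + (\<Sum>\<sigma>\<in>UNIV. sg \<sigma> ^ k * cur \<sigma> \<eta>))\<bar> \<le> EB k"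
proof -
  let ?w = "\<lambda>\<sigma>. window l (base \<sigma>) \<eta>"
  let ?S = "\<lambda>\<sigma> \<xi>. (\<Sum>j\<in>{1..l}. (of_bool (\<xi> j) - of_bool (?w \<sigma> j)) * (real N / real n * cm k (th n (base \<sigma> + j)) - sg \<sigma> ^ k))"
  have each: "\<bar>real N * (\<Sum>\<xi>\<in>configs {1..l}. R \<sigma> (?w \<sigma>) \<xi> * (X k (paste l (base \<sigma>) \<xi> \<eta>) - X k \<eta>)) - sg \<sigma> ^ k * cur \<sigma> \<eta>\<bar>
      \<le> Q * ((1 + real k * pi * real l) / real n)" for \<sigma>
  proof -
    have eq: "real N * (\<Sum>\<xi>\<in>configs {1..l}. R \<sigma> (?w \<sigma>) \<xi> * (X k (paste l (base \<sigma>) \<xi> \<eta>) - X k \<eta>)) - sg \<sigma> ^ k * cur \<sigma> \<eta>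
       = (\<Sum>\<xi>\<in>configs {1..l}. R \<sigma> (?w \<sigma>) \<xi> * ?S \<sigma> \<xi>)"
    proof -
      have "real N * (R \<sigma> (?w \<sigma>) \<xi> * (X k (paste l (base \<sigma>) \<xi> \<eta>) - X k \<eta>)) -
         sg \<sigma> ^ k * (R \<sigma> (?w \<sigma>) \<xi> * (\<Sum>j\<in>{1..l}. of_bool (\<xi> j) - of_bool (?w \<sigma> j))) = R \<sigma> (?w \<sigma>) \<xi> * ?S \<sigma> \<xi>" for \<xi>
      proof -
      have "?S \<sigma> \<xi> = real N / real n * (\<Sum>j\<in>{1..l}. (of_bool (\<xi> j) - of_bool (?w \<sigma> j)) * cm k (th n (base \<sigma> + j)))
         - sg \<sigma> ^ k * (\<Sum>j\<in>{1..l}. of_bool (\<xi> j) - of_bool (?w \<sigma> j))"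
        unfolding sum_distrib_left sum_subtractf[symmetric] by (intro sum.cong refl) (simp add: algebra_simps)
      then show ?thesis
        unfolding X_paste by (simp only:) (simp add: algebra_simps)
      qed
      then show ?thesis
        unfolding cur_def flux_obs_def by (simp only: sum_subtractf[symmetric] sum_distrib_left[of "real N"] sum_distrib_left[of "sg \<sigma> ^ k" _ "configs {1..l}"])
    qed
    have "\<bar>\<Sum>\<xi>\<in>configs {1..l}. R \<sigma> (?w \<sigma>) \<xi> * ?S \<sigma> \<xi>\<bar> \<le> (\<Sum>\<xi>\<in>configs {1..l}. RB * (real l * ((1 + real k * pi * real l) / real n)))"
    proof (rule order_trans[OF sum_abs sum_mono])
      fix \<xi> assume \<xi>: "\<xi> \<in> configs {1..l}"
      have "\<bar>?S \<sigma> \<xi>\<bar> \<le> (\<Sum>j\<in>{1..l}. 1 * ((1 + real k * pi * real l) / real n))"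
        by (rule order_trans[OF sum_abs sum_mono], unfold abs_mult, intro mult_mono cm_window) auto
      then show "\<bar>R \<sigma> (?w \<sigma>) \<xi> * ?S \<sigma> \<xi>\<bar> \<le> RB * (real l * ((1 + real k * pi * real l) / real n))"
        unfolding abs_mult using R_nonneg[of "?w \<sigma>" \<xi> \<sigma>] R_bound[of "?w \<sigma>" \<xi> \<sigma>] \<xi>
        by (intro mult_mono) auto
    qed
    then show ?thesis unfolding eq by (simp add: card_configs Q_def mult_ac)
  qed
  have "L (X k) \<eta> - (- lamN k * X k \<eta> + (\<Sum>\<sigma>\<in>UNIV. sg \<sigma> ^ k * cur \<sigma> \<eta>))
    = (\<Sum>\<sigma>\<in>UNIV. real N * (\<Sum>\<xi>\<in>configs {1..l}. R \<sigma> (?w \<sigma>) \<xi> * (X k (paste l (base \<sigma>) \<xi> \<eta>) - X k \<eta>)) - sg \<sigma> ^ k * cur \<sigma> \<eta>)"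
    unfolding L_eq exchange_X lamN_def by (simp add: UNIV_bool algebra_simps)
  then show ?thesis
    using each[of True] each[of False] unfolding EB_def by (simp add: UNIV_bool)
qed

definition Yf :: "nat \<Rightarrow> (nat \<Rightarrow> real) \<Rightarrow> (nat \<Rightarrow> real) \<Rightarrow> config \<Rightarrow> real" where
  "Yf K b m \<eta> = (\<Sum>k<K. b k * (X k \<eta> - m k))"

lemma Yf_diff: "Yf K b m \<eta>' - Yf K b m \<eta> = (\<Sum>k<K. b k * (X k \<eta>' - X k \<eta>))"
  unfolding Yf_def sum_subtractf[symmetric] by (intro sum.cong refl) (simp add: algebra_simps)

lemma L_Yf: "L (Yf K b m) \<eta> = (\<Sum>k<K. b k * L (X k) \<eta>)"
proof -
  have "L (Yf K b m) \<eta> = L (\<lambda>\<eta>. \<Sum>k<K. b k * X k \<eta>) \<eta>"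
    unfolding L_eq Yf_diff by (simp add: sum_subtractf algebra_simps)
  then show ?thesis by (simp add: L_sum)
qed

lemma Yf_transpose:
  assumes "\<And>k. \<bar>b k\<bar> \<le> 2" "x \<in> {1..n}" "y \<in> {1..n}"
  shows "\<bar>Yf K b m (\<eta> \<circ> Transposition.transpose x y) - Yf K b m \<eta>\<bar> \<le> 4 * real K / real n"
proof -
  have "\<bar>b k * (X k (\<eta> \<circ> Transposition.transpose x y) - X k \<eta>)\<bar> \<le> 2 * (2 / real n)" for k
    unfolding abs_mult
  proof (intro mult_mono assms(1))
    have "\<bar>(of_bool (\<eta> y) - of_bool (\<eta> x)) * (cm k (th n x) - cm k (th n y))\<bar> \<le> 1 * 2"
      unfolding abs_mult by (intro mult_mono) (use abs_cm_le[of k "th n x"] abs_cm_le[of k "th n y"] in \<open>auto simp: abs_le_iff\<close>)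
    then show "\<bar>X k (\<eta> \<circ> Transposition.transpose x y) - X k \<eta>\<bar> \<le> 2 / real n"
      unfolding X_transpose[OF assms(2,3)] abs_divide using rn by (simp add: divide_right_mono)
  qed auto
  then have "\<bar>Yf K b m (\<eta> \<circ> Transposition.transpose x y) - Yf K b m \<eta>\<bar> \<le> (\<Sum>k<K. 2 * (2 / real n))"
    unfolding Yf_diff by (intro order_trans[OF sum_abs] sum_mono)
  then show ?thesis by (simp add: mult.commute)
qed

definition GB :: "nat \<Rightarrow> real" where
  "GB K = real N ^ 2 * real n * (2 * real K ^ 2 * pi / real n ^ 2)^2
     + real N * (2 * (2 ^ l * (RB * (2 * real K * real l / real n)^2)))"

text \<open>The excess of the generator of a square over \<open>2 * Y * L Y\<close> is the sum of
  the squared jumps. An exchange moves Y by order \<open>1 / n^2\<close>, as neighbouring cosines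
  differ by order 1 / n, and a boundary update moves it by order 1 / n. Counted with their speeds,
  both parts are of order 1 / n for fixed K.\<close>

lemma carre_du_champ:
  assumes b: "\<And>k. \<bar>b k\<bar> \<le> 2"
  shows "L (\<lambda>\<eta>. (Yf K b m \<eta>)^2) \<eta> \<le> 2 * Yf K b m \<eta> * L (Yf K b m) \<eta> + GB K"
proof -
  let ?Y = "Yf K b m" and ?w = "\<lambda>\<sigma>. window l (base \<sigma>) \<eta>"
  have sq: "u^2 - v^2 = 2 * v * (u - v) + (u - v)^2" for u v :: real
    by (simp add: power2_eq_square algebra_simps)
  have sw: "(?Y (swap x \<eta>) - ?Y \<eta>)^2 \<le> (2 * real K ^ 2 * pi / real n ^ 2)^2" if x: "x \<in> {1..<n}" for x
  proof (rule sq_le_if_abs_le)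
    have "\<bar>b k * (X k (swap x \<eta>) - X k \<eta>)\<bar> \<le> 2 * (real K * pi / real n ^ 2)" if "k < K" for k
      unfolding abs_mult
    proof (intro mult_mono b)
      have d: "\<bar>th n x - th n (Suc x)\<bar> = 1 / real n"
        using rn by (simp add: th_def diff_divide_distrib[symmetric])
      have "\<bar>(of_bool (\<eta> (Suc x)) - of_bool (\<eta> x)) * (cm k (th n x) - cm k (th n (Suc x)))\<bar> \<le> 1 * (real k * pi * \<bar>th n x - th n (Suc x)\<bar>)"
        unfolding abs_mult by (intro mult_mono cm_lipschitz) auto
      also have "\<dots> \<le> real K * pi / real n" unfolding d using that rn by (simp add: divide_right_mono mult_right_mono)
      finally show "\<bar>X k (swap x \<eta>) - X k \<eta>\<bar> \<le> real K * pi / real n ^ 2"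
        unfolding X_swap[OF x] abs_divide using rn by (simp add: field_simps power2_eq_square)
    qed auto
    then have "\<bar>?Y (swap x \<eta>) - ?Y \<eta>\<bar> \<le> (\<Sum>k<K. 2 * (real K * pi / real n ^ 2))"
      unfolding Yf_diff by (intro order_trans[OF sum_abs] sum_mono) auto
    then show "\<bar>?Y (swap x \<eta>) - ?Y \<eta>\<bar> \<le> 2 * real K ^ 2 * pi / real n ^ 2"
      by (simp add: power2_eq_square mult_ac)
  qed
  have pa: "(?Y (paste l (base \<sigma>) \<xi> \<eta>) - ?Y \<eta>)^2 \<le> (2 * real K * real l / real n)^2" for \<sigma> \<xi>
  proof (rule sq_le_if_abs_le)
    have "\<bar>b k * (X k (paste l (base \<sigma>) \<xi> \<eta>) - X k \<eta>)\<bar> \<le> 2 * (real l / real n)" for k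
      unfolding abs_mult
    proof (intro mult_mono b)
      have "\<bar>\<Sum>j\<in>{1..l}. (of_bool (\<xi> j) - of_bool (?w \<sigma> j)) * cm k (th n (base \<sigma> + j))\<bar> \<le> (\<Sum>j\<in>{1..l}. 1 * 1)"
        by (rule order_trans[OF sum_abs sum_mono], unfold abs_mult, intro mult_mono) auto
      then show "\<bar>X k (paste l (base \<sigma>) \<xi> \<eta>) - X k \<eta>\<bar> \<le> real l / real n"
        unfolding X_paste abs_divide using rn by (simp add: divide_right_mono)
    qed auto
    then have "\<bar>?Y (paste l (base \<sigma>) \<xi> \<eta>) - ?Y \<eta>\<bar> \<le> (\<Sum>k<K. 2 * (real l / real n))"
      unfolding Yf_diff by (intro order_trans[OF sum_abs] sum_mono)
    then show "\<bar>?Y (paste l (base \<sigma>) \<xi> \<eta>) - ?Y \<eta>\<bar> \<le> 2 * real K * real l / real n"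
      by (simp add: mult_ac)
  qed
  have "L (\<lambda>\<eta>. (?Y \<eta>)^2) \<eta> = 2 * ?Y \<eta> * L ?Y \<eta>
     + (real N ^ 2 * (\<Sum>x\<in>{1..<n}. (?Y (swap x \<eta>) - ?Y \<eta>)^2)
     + real N * (\<Sum>\<sigma>\<in>UNIV. \<Sum>\<xi>\<in>configs {1..l}. R \<sigma> (?w \<sigma>) \<xi> * (?Y (paste l (base \<sigma>) \<xi> \<eta>) - ?Y \<eta>)^2))"
    unfolding L_eq sq
    by (simp add: sum.distrib sum_distrib_left distrib_left mult_ac)
  moreover have "real N ^ 2 * (\<Sum>x\<in>{1..<n}. (?Y (swap x \<eta>) - ?Y \<eta>)^2)
     \<le> real N ^ 2 * (\<Sum>x\<in>{1..<n}. (2 * real K ^ 2 * pi / real n ^ 2)^2)"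
    by (intro mult_left_mono sum_mono sw) auto
  moreover have "real N ^ 2 * (\<Sum>x\<in>{1..<n}. (2 * real K ^ 2 * pi / real n ^ 2)^2) \<le> real N ^ 2 * real n * (2 * real K ^ 2 * pi / real n ^ 2)^2"
    unfolding sum_constant mult.assoc by (intro mult_left_mono mult_right_mono) auto
  moreover have "real N * (\<Sum>\<sigma>\<in>UNIV. \<Sum>\<xi>\<in>configs {1..l}. R \<sigma> (?w \<sigma>) \<xi> * (?Y (paste l (base \<sigma>) \<xi> \<eta>) - ?Y \<eta>)^2)
     \<le> real N * (\<Sum>\<sigma>\<in>(UNIV::bool set). \<Sum>\<xi>\<in>configs {1..l}. RB * (2 * real K * real l / real n)^2)"
    using R_bound RB_nonneg R_nonneg by (intro mult_left_mono sum_mono mult_mono pa) auto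
  ultimately show ?thesis
    by (simp add: GB_def card_configs UNIV_bool)
qed

definition errN :: "nat \<Rightarrow> real \<Rightarrow> real" where
  "errN K B = 2 * B * (\<Sum>k<K. 2 * (\<bar>lam k - lamN k\<bar> + EB k)) + GB K"

text \<open>The coefficients run backwards along the heat flow, so their time derivative cancels the
  linear drift of \<open>X k - r k\<close> up to the gap between the discrete and the continuous
  eigenvalue, and the differences of the fluxes remain. The derivative is existentially quantified
  since later steps only integrate its upper bound.\<close>

lemma energy_deriv:
  assumes s: "s \<in> {0..T}" "s \<le> t" and c: "\<And>k. \<bar>c k\<bar> \<le> 2"
    and r: "\<And>k. (r k has_real_derivative - lam k * r k s + (\<Sum>\<sigma>\<in>UNIV. sg \<sigma> ^ k * f \<sigma>)) (at s)"
    and B: "\<And>\<eta>. \<eta> \<in> Omega N \<Longrightarrow> \<bar>Yf K (\<lambda>k. c k * exp (- lam k * (t - s))) (\<lambda>k. r k s) \<eta>\<bar> \<le> B"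
  shows "\<exists>D. ((\<lambda>s. Ex s (\<lambda>\<eta>. (Yf K (\<lambda>k. c k * exp (- lam k * (t - s))) (\<lambda>k. r k s) \<eta>)^2)) has_real_derivative D) (at s) \<and>
    D \<le> 2 * (\<Sum>\<sigma>\<in>UNIV. (\<Sum>k<K. c k * exp (- lam k * (t - s)) * sg \<sigma> ^ k) *
        Ex s (\<lambda>\<eta>. Yf K (\<lambda>k. c k * exp (- lam k * (t - s))) (\<lambda>k. r k s) \<eta> * (cur \<sigma> \<eta> - f \<sigma>))) + errN K B"
proof -
  let ?b = "\<lambda>s k. c k * exp (- lam k * (t - s))"
  define Y where "Y s = Yf K (?b s) (\<lambda>k. r k s)" for s
  define g where "g \<eta> = (\<Sum>k<K. ?b s k * (lam k * (X k \<eta> - r k s) - (- lam k * r k s + (\<Sum>\<sigma>\<in>UNIV. sg \<sigma> ^ k * f \<sigma>))))" for \<eta>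
  have dY: "((\<lambda>s. Y s \<eta>) has_real_derivative g \<eta>) (at s)" for \<eta>
    unfolding Y_def Yf_def g_def
  proof (rule DERIV_sum)
    fix k
    have "((\<lambda>s. c k * exp (- lam k * (t - s))) has_real_derivative ?b s k * lam k) (at s)"
      by (auto intro!: derivative_eq_intros)
    from DERIV_mult[OF this DERIV_diff[OF DERIV_const r[of k]]]
    show "((\<lambda>s. c k * exp (- lam k * (t - s)) * (X k \<eta> - r k s)) has_real_derivative
       ?b s k * (lam k * (X k \<eta> - r k s) - (- lam k * r k s + (\<Sum>\<sigma>\<in>UNIV. sg \<sigma> ^ k * f \<sigma>)))) (at s)"
      by (rule DERIV_cong) (simp add: algebra_simps)
  qed
  have b: "\<bar>?b s k\<bar> \<le> 2" for k
  proof -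
    have "\<bar>c k\<bar> * exp (- lam k * (t - s)) \<le> 2 * 1"
      using s c[of k] by (intro mult_mono) auto
    then show ?thesis by (simp add: abs_mult)
  qed
  have "((\<lambda>s. Ex s (\<lambda>\<eta>. (Y s \<eta>)^2)) has_real_derivative Ex s (\<lambda>\<eta>. L (\<lambda>\<eta>. (Y s \<eta>)^2) \<eta> + 2 * Y s \<eta> * g \<eta>)) (at s)"
  proof (rule Ex_deriv)
    show "((\<lambda>s. (Y s \<eta>)^2) has_real_derivative 2 * Y s \<eta> * g \<eta>) (at s)" for \<eta>
      using DERIV_power[OF dY[of \<eta>], of 2] by (rule DERIV_cong) simp
  qed
  moreover have "Ex s (\<lambda>\<eta>. L (\<lambda>\<eta>. (Y s \<eta>)^2) \<eta> + 2 * Y s \<eta> * g \<eta>)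
     \<le> Ex s (\<lambda>\<eta>. 2 * (\<Sum>\<sigma>\<in>UNIV. (\<Sum>k<K. ?b s k * sg \<sigma> ^ k) * (Y s \<eta> * (cur \<sigma> \<eta> - f \<sigma>))) + errN K B)"
  proof (rule Ex_mono[OF s(1)])
    fix \<eta> assume \<eta>: "\<eta> \<in> Omega N"
    define \<epsilon> where "\<epsilon> = (\<Sum>k<K. ?b s k * ((lam k - lamN k) * X k \<eta> + (L (X k) \<eta> - (- lamN k * X k \<eta> + (\<Sum>\<sigma>\<in>UNIV. sg \<sigma> ^ k * cur \<sigma> \<eta>)))))"
    have "\<bar>\<epsilon>\<bar> \<le> (\<Sum>k<K. 2 * (\<bar>lam k - lamN k\<bar> + EB k))"
      unfolding \<epsilon>_def
    proof (rule order_trans[OF sum_abs sum_mono])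
      fix k
      have "\<bar>(lam k - lamN k) * X k \<eta>\<bar> \<le> \<bar>lam k - lamN k\<bar>"
        unfolding abs_mult using abs_X_le[of k \<eta>] by (intro mult_left_le) auto
      then have "\<bar>(lam k - lamN k) * X k \<eta> + (L (X k) \<eta> - (- lamN k * X k \<eta> + (\<Sum>\<sigma>\<in>UNIV. sg \<sigma> ^ k * cur \<sigma> \<eta>)))\<bar> \<le> \<bar>lam k - lamN k\<bar> + EB k"
        using L_X[of k \<eta>] by linarith
      then show "\<bar>?b s k * ((lam k - lamN k) * X k \<eta> + (L (X k) \<eta> - (- lamN k * X k \<eta> + (\<Sum>\<sigma>\<in>UNIV. sg \<sigma> ^ k * cur \<sigma> \<eta>))))\<bar> \<le> 2 * (\<bar>lam k - lamN k\<bar> + EB k)"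
        unfolding abs_mult using b[of k] by (intro mult_mono) auto
    qed
    moreover have "\<bar>Y s \<eta>\<bar> \<le> B" using B[OF \<eta>] by (simp add: Y_def)
    ultimately have "\<bar>Y s \<eta> * \<epsilon>\<bar> \<le> B * (\<Sum>k<K. 2 * (\<bar>lam k - lamN k\<bar> + EB k))"
      unfolding abs_mult by (intro mult_mono) auto
    then have Y\<epsilon>: "Y s \<eta> * \<epsilon> \<le> B * (\<Sum>k<K. 2 * (\<bar>lam k - lamN k\<bar> + EB k))" by linarith
    have "L (Y s) \<eta> + g \<eta> = (\<Sum>\<sigma>\<in>UNIV. (\<Sum>k<K. ?b s k * sg \<sigma> ^ k) * (cur \<sigma> \<eta> - f \<sigma>)) + \<epsilon>"
    proof -
      have "(\<Sum>\<sigma>\<in>UNIV. (\<Sum>k<K. ?b s k * sg \<sigma> ^ k) * (cur \<sigma> \<eta> - f \<sigma>)) = (\<Sum>k<K. \<Sum>\<sigma>\<in>UNIV. ?b s k * sg \<sigma> ^ k * (cur \<sigma> \<eta> - f \<sigma>))"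
        unfolding sum_distrib_right by (rule sum.swap)
      then show ?thesis
        unfolding Y_def L_Yf g_def \<epsilon>_def
        by (simp only: sum.distrib[symmetric]) (intro sum.cong refl, simp add: UNIV_bool algebra_simps)
    qed
    then have "2 * Y s \<eta> * L (Y s) \<eta> + 2 * Y s \<eta> * g \<eta>
       = 2 * (\<Sum>\<sigma>\<in>UNIV. (\<Sum>k<K. ?b s k * sg \<sigma> ^ k) * (Y s \<eta> * (cur \<sigma> \<eta> - f \<sigma>))) + 2 * (Y s \<eta> * \<epsilon>)"
      by (simp add: UNIV_bool flip: distrib_left mult.assoc) (simp add: algebra_simps)
    moreover have "L (\<lambda>\<eta>. (Y s \<eta>)^2) \<eta> \<le> 2 * Y s \<eta> * L (Y s) \<eta> + GB K"
      unfolding Y_def by (rule carre_du_champ[OF b])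
    ultimately show "L (\<lambda>\<eta>. (Y s \<eta>)^2) \<eta> + 2 * Y s \<eta> * g \<eta> \<le> 2 * (\<Sum>\<sigma>\<in>UNIV. (\<Sum>k<K. ?b s k * sg \<sigma> ^ k) * (Y s \<eta> * (cur \<sigma> \<eta> - f \<sigma>))) + errN K B"
      using Y\<epsilon> unfolding errN_def by linarith
  qed
  moreover have "Ex s (\<lambda>\<eta>. 2 * (\<Sum>\<sigma>\<in>UNIV. (\<Sum>k<K. ?b s k * sg \<sigma> ^ k) * (Y s \<eta> * (cur \<sigma> \<eta> - f \<sigma>))) + errN K B)
    = 2 * (\<Sum>\<sigma>\<in>UNIV. (\<Sum>k<K. ?b s k * sg \<sigma> ^ k) * Ex s (\<lambda>\<eta>. Y s \<eta> * (cur \<sigma> \<eta> - f \<sigma>))) + errN K B"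
    using Ex_const[OF s(1)] by (simp only: Ex_add Ex_cmult Ex_sum)
  ultimately show ?thesis unfolding Y_def by auto
qed

end

text \<open>Fluxes are evaluated at traces, which need not have a limit at time 0 for a merely
  measurable profile; continuity on the half-open interval is what can be guaranteed.\<close>

lemma integrable_on_half_open:
  fixes g :: "real \<Rightarrow> real"
  assumes "continuous_on {0<..T} g" "\<And>s. s \<in> {0<..T} \<Longrightarrow> \<bar>g s\<bar> \<le> C"
  shows "g integrable_on {0..T}"
proof -
  have "g integrable_on {0<..T}"
  proof (rule measurable_bounded_by_integrable_imp_integrable_real[where g = "\<lambda>_. C"])
    show "g \<in> borel_measurable (lebesgue_on {0<..T})"
      using assms(1) by (rule continuous_imp_measurable_on_sets_lebesgue) auto
    show "(\<lambda>_. C) integrable_on {0<..T}"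
      by (rule integrable_spike_set[OF integrable_const_ivl[of C 0 T]])
        (auto intro: negligible_subset[of "{0}"])
  qed (use assms in auto)
  then show ?thesis
    by (rule integrable_spike_set) (auto intro: negligible_subset[of "{0}"])
qed

lemma integral_exp_le:
  fixes t \<mu> :: real
  assumes "0 \<le> t" "0 < \<mu>"
  shows "integral {0..t} (\<lambda>s. exp (- \<mu> * (t - s))) \<le> 1 / \<mu>"
proof -
  have "((\<lambda>s. exp (- \<mu> * (t - s))) has_integral exp (- \<mu> * (t - t)) / \<mu> - exp (- \<mu> * (t - 0)) / \<mu>) {0..t}"
    using assms by (intro fundamental_theorem_of_calculus[where f = "\<lambda>s. exp (- \<mu> * (t - s)) / \<mu>"])
      (auto intro!: derivative_eq_intros simp flip: has_real_derivative_iff_has_vector_derivative)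
  then have "integral {0..t} (\<lambda>s. exp (- \<mu> * (t - s))) = 1 / \<mu> - exp (- \<mu> * t) / \<mu>"
    by (simp add: integral_unique)
  then show ?thesis using assms by simp
qed

text \<open>The modes \<open>r\<close> and the fluxes \<open>f\<close> are data here; that
  \<open>f\<close> is the flux at the trace is measured by \<delta> below. The summand 1 in
  \<open>B_fejer\<close> and \<open>B_mode\<close> is room for the microscopic part. The 8 in the
  condition on \<Lambda> turns the factor 4, with which the Lipschitz part of the drift enters, into
  a contraction by 1/2.\<close>

locale flow_pde = flow +
  fixes K K1 :: nat and r :: "nat \<Rightarrow> real \<Rightarrow> real" and f :: "bool \<Rightarrow> real \<Rightarrow> real" and B \<Lambda> :: real
  assumes K: "1 \<le> K" "K < N - 1" and K1: "1 \<le> K1"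
    and r_cont: "\<And>k. continuous_on {0..T} (r k)"
    and r_deriv: "\<And>k s. s \<in> {0<..<T} \<Longrightarrow> (r k has_real_derivative - lam k * r k s + (\<Sum>\<sigma>\<in>UNIV. sg \<sigma> ^ k * f \<sigma> s)) (at s)"
    and f_cont: "\<And>\<sigma>. continuous_on {0<..T} (f \<sigma>)"
    and f_bound: "\<And>\<sigma> s. \<bar>f \<sigma> s\<bar> \<le> 2 ^ l * RB * real l"
    and B_fejer: "\<And>\<sigma> u s. 0 \<le> u \<Longrightarrow> s \<in> {0..T} \<Longrightarrow> \<bar>\<Sum>k<K. fc K k * sg \<sigma> ^ k * exp (- lam k * u) * r k s\<bar> + 1 \<le> B"
    and B_mode: "\<And>k s. s \<in> {0..T} \<Longrightarrow> \<bar>r k s\<bar> + 1 \<le> B"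
    and \<Lambda>: "0 < \<Lambda>" "8 * (2 * real l * (2 ^ l * RB * real l)) * (\<Sum>k<K. 2 / (\<Lambda> + lam k)) \<le> 1"
begin

abbreviation F :: "bool \<Rightarrow> real \<Rightarrow> real" where "F \<sigma> \<equiv> boundary_flux l (R \<sigma>)"

definition LF :: real where "LF = 2 * real l * Q"

text \<open>The energy estimate bounds one combination of modes by others that have passed through the heat flow, so it
  is closed only on a class of coefficients stable under it.\<close>

definition CC :: "(nat \<Rightarrow> real) set" where
  "CC = {c. (\<forall>k. \<bar>c k\<bar> \<le> 2) \<and> (\<forall>u s \<eta>. 0 \<le> u \<longrightarrow> s \<in> {0..T} \<longrightarrow> \<eta> \<in> Omega N \<longrightarrow>
     \<bar>Yf K (\<lambda>k. c k * exp (- lam k * u)) (\<lambda>k. r k s) \<eta>\<bar> \<le> B)}"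

definition Z :: "(nat \<Rightarrow> real) \<Rightarrow> real \<Rightarrow> real" where
  "Z c s = Ex s (\<lambda>\<eta>. (Yf K c (\<lambda>k. r k s) \<eta>)^2)"

definition fcs :: "bool \<Rightarrow> nat \<Rightarrow> real" where "fcs \<sigma> k = fc K k * sg \<sigma> ^ k"

text \<open>The Fejer mean of the trace at time s; \<open>etab\<close> is the same combination of
  the microscopic modes.\<close>

definition AK :: "bool \<Rightarrow> real \<Rightarrow> real" where "AK \<sigma> s = (\<Sum>k<K. fcs \<sigma> k * r k s)"

definition etab :: "bool \<Rightarrow> config \<Rightarrow> real" where
  "etab \<sigma> \<eta> = (\<Sum>i\<in>{1..N - 1}. fw K n \<sigma> i * of_bool (\<eta> i))"

definition \<omega>K :: real where "\<omega>K = 4 * real K / real n"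
definition \<Delta>K :: real where "\<Delta>K = real n / sqrt (real K) + real l + 1"
definition wmK :: real where "wmK = 2 * real K / real n"

text \<open>The replacement error, not the density. Entropy makes its time integral small and says
  nothing about its supremum; the minimum with the trivial bound keeps it bounded pointwise, for use
  against the high modes of the kernel.\<close>

definition \<rho> :: "real \<Rightarrow> real" where "\<rho> s = min (2 * B * Q) (rep_err s B Q \<omega>K \<Delta>K wmK)"

definition \<delta> :: "bool \<Rightarrow> real \<Rightarrow> real" where "\<delta> \<sigma> s = \<bar>F \<sigma> (AK \<sigma> s) - f \<sigma> s\<bar>"

definition EE :: "real \<Rightarrow> real" where "EE s = 4 * \<rho> s + 2 * B * (\<Sum>\<sigma>\<in>UNIV. \<delta> \<sigma> s)"

section \<open>Admissible coefficients and the drift\<close>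

lemma Kn: "K < n" using K by (simp add: n_def)

lemma B_pos: "1 \<le> B" using B_mode[of 0 0] T abs_ge_zero[of "r 0 0"] by simp

lemma F_bound: "\<bar>F \<sigma> \<alpha>\<bar> \<le> Q"
  unfolding Q_def using R_nonneg R_bound by (intro boundary_flux_bound) auto

lemma F_lipschitz: "\<bar>F \<sigma> \<alpha> - F \<sigma> \<beta>\<bar> \<le> LF * \<bar>\<alpha> - \<beta>\<bar>"
  unfolding LF_def Q_def using R_nonneg R_bound by (intro boundary_flux_lipschitz) auto

lemma LF_nonneg: "0 \<le> LF" using Q_nonneg by (simp add: LF_def)

lemma f_le: "\<bar>f \<sigma> s\<bar> \<le> Q" using f_bound by (simp add: Q_def)

lemma etab_eq: "etab \<sigma> \<eta> = (\<Sum>k<K. fcs \<sigma> k * X k \<eta>)"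
proof -
  have "etab \<sigma> \<eta> = (\<Sum>i\<in>{1..n}. \<Sum>k<K. fcs \<sigma> k / real n * (of_bool (\<eta> i) * cm k (th n i)))"
    unfolding etab_def fw_def Omega_n sum_divide_distrib sum_distrib_right fcs_def
    by (intro sum.cong refl) (simp add: mult_ac)
  also have "\<dots> = (\<Sum>k<K. fcs \<sigma> k * X k \<eta>)"
    unfolding X_def sum_divide_distrib sum_distrib_left by (subst sum.swap) (simp add: mult_ac)
  finally show ?thesis .
qed

lemma etab_AK: "etab \<sigma> \<eta> - AK \<sigma> s = Yf K (fcs \<sigma>) (\<lambda>k. r k s) \<eta>"
  unfolding etab_eq AK_def Yf_def sum_subtractf[symmetric] by (intro sum.cong refl) (simp add: algebra_simps)

text \<open>The Fejer kernel stays positive under the heat flow, so the microscopic combination is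
  an average of occupation variables with nonnegative weights of total mass 1. It lies in [0,1]
  whatever K is, which a bound mode by mode could not give.\<close>

lemma fcs_CC: "fcs \<sigma> \<in> CC"
proof -
  have "\<bar>Yf K (\<lambda>k. fcs \<sigma> k * exp (- lam k * u)) (\<lambda>k. r k s) \<eta>\<bar> \<le> B" if "0 \<le> u" "s \<in> {0..T}" for u s \<eta>
  proof -
    let ?\<phi> = "\<lambda>i. \<Sum>k<K. fc K k * sg \<sigma> ^ k * exp (- lam k * u) * cm k (th n i)"
    have "(\<Sum>k<K. fcs \<sigma> k * exp (- lam k * u) * X k \<eta>) = (\<Sum>i\<in>{1..n}. of_bool (\<eta> i) * ?\<phi> i) / real n"
      unfolding X_def fcs_def sum_divide_distrib sum_distrib_left by (subst sum.swap) (simp add: mult_ac)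
    moreover have "0 \<le> (\<Sum>i\<in>{1..n}. of_bool (\<eta> i) * ?\<phi> i)"
      by (rule sum_nonneg, rule mult_nonneg_nonneg, simp, rule heat_fejer_refl_nonneg[OF that(1)])
    moreover have "(\<Sum>i\<in>{1..n}. of_bool (\<eta> i) * ?\<phi> i) \<le> (\<Sum>i\<in>{1..n}. ?\<phi> i)"
      using heat_fejer_refl_nonneg[OF that(1)] by (intro sum_mono) (auto simp: mult_left_le_one_le)
    moreover have "(\<Sum>i\<in>{1..n}. ?\<phi> i) = real n" using sum_heat_fejer_th[of K n] K Kn by simp
    ultimately have "0 \<le> (\<Sum>k<K. fcs \<sigma> k * exp (- lam k * u) * X k \<eta>)" "(\<Sum>k<K. fcs \<sigma> k * exp (- lam k * u) * X k \<eta>) \<le> 1"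
      using rn by (auto simp: divide_le_eq_1)
    moreover have "Yf K (\<lambda>k. fcs \<sigma> k * exp (- lam k * u)) (\<lambda>k. r k s) \<eta>
      = (\<Sum>k<K. fcs \<sigma> k * exp (- lam k * u) * X k \<eta>) - (\<Sum>k<K. fc K k * sg \<sigma> ^ k * exp (- lam k * u) * r k s)"
      unfolding Yf_def sum_subtractf[symmetric] fcs_def by (intro sum.cong refl) (simp add: algebra_simps)
    ultimately show ?thesis using B_fejer[OF that, of \<sigma>] by linarith
  qed
  moreover have "\<bar>fcs \<sigma> k\<bar> \<le> 2" for k
    using fc_bounds[of K k] by (simp add: fcs_def abs_mult)
  ultimately show ?thesis by (simp add: CC_def)
qed

text \<open>Single modes must belong to the class as well, since they are the quantities whose
  convergence is wanted in the end.\<close>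

lemma unit_CC: "k < K \<Longrightarrow> (\<lambda>j. of_bool (j = k)) \<in> CC"
proof -
  assume k: "k < K"
  have "\<bar>Yf K (\<lambda>j. of_bool (j = k) * exp (- lam j * u)) (\<lambda>k. r k s) \<eta>\<bar> \<le> B" if "0 \<le> u" "s \<in> {0..T}" for u s \<eta>
  proof -
    have "Yf K (\<lambda>j. of_bool (j = k) * exp (- lam j * u)) (\<lambda>k. r k s) \<eta>
      = (\<Sum>j<K. if j = k then exp (- lam k * u) * (X k \<eta> - r k s) else 0)"
      unfolding Yf_def by (intro sum.cong refl) auto
    then have "\<bar>Yf K (\<lambda>j. of_bool (j = k) * exp (- lam j * u)) (\<lambda>k. r k s) \<eta>\<bar> = exp (- lam k * u) * \<bar>X k \<eta> - r k s\<bar>"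
      using k by (simp add: abs_mult)
    also have "\<dots> \<le> 1 * \<bar>X k \<eta> - r k s\<bar>" using that by (intro mult_right_mono) auto
    also have "\<dots> \<le> B" using abs_X_le[of k \<eta>] B_mode[OF that(2), of k] by simp
    finally show ?thesis .
  qed
  then show ?thesis by (simp add: CC_def)
qed

lemma CC_heat:
  assumes "c \<in> CC" "0 \<le> u"
  shows "(\<lambda>k. c k * exp (- lam k * u)) \<in> CC"
proof -
  have e: "c k * exp (- lam k * u) * exp (- lam k * v) = c k * exp (- lam k * (u + v))" for k v
    by (simp add: mult.assoc exp_add[symmetric] algebra_simps)
  have "\<bar>c k * exp (- lam k * u)\<bar> \<le> 2 * 1" for k
    unfolding abs_mult using assms by (intro mult_mono) (auto simp: CC_def)
  then show ?thesis using assms unfolding CC_def mem_Collect_eq e by auto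
qed

text \<open>The spread of the Fejer weights in lattice units plus the width of the window.\<close>

lemma fw_window_dist:
  assumes i: "i \<in> {1..l}"
  shows "(\<Sum>c\<in>{1..N - 1}. fw K n \<sigma> c * \<bar>real (base \<sigma> + i) - real c\<bar>) \<le> \<Delta>K"
proof -
  have d: "\<bar>real (base \<sigma> + i) - real c\<bar> \<le> real n * refl01 \<sigma> (th n c) + (real l + 1)" if c: "c \<in> {1..n}" for c
  proof (cases \<sigma>)
    case False
    have "real n * th n c = real c - 1/2" using rn by (simp add: th_def)
    then have "real n * refl01 \<sigma> (th n c) = real c - 1/2" using False by (simp add: refl01_def)
    moreover have "1 \<le> real i" "real i \<le> real l" "1 \<le> real c" using i c by auto
    ultimately show ?thesis using False by (simp add: base_def abs_le_iff)
  next
    case True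
    have "base \<sigma> + i = n + i - l" using n_pos True by (simp add: base_def n_def)
    then have "real (base \<sigma> + i) = real n + real i - real l" using n_pos by (simp add: of_nat_diff)
    moreover have "real n * (1 - th n c) = real n - real c + 1/2" using rn by (simp add: th_def field_simps)
    moreover have "1 \<le> real i" "real i \<le> real l" "real c \<le> real n" using i c by auto
    ultimately show ?thesis using True by (simp add: refl01_def abs_le_iff)
  qed
  have "(\<Sum>c\<in>{1..n}. fw K n \<sigma> c * \<bar>real (base \<sigma> + i) - real c\<bar>)
    \<le> (\<Sum>c\<in>{1..n}. real n * (fw K n \<sigma> c * refl01 \<sigma> (th n c)) + (real l + 1) * fw K n \<sigma> c)"
    using mult_left_mono[OF d fw_bounds(1)[of K n \<sigma>]] by (intro sum_mono) (simp add: algebra_simps)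
  also have "\<dots> = real n * (\<Sum>c\<in>{1..n}. fw K n \<sigma> c * refl01 \<sigma> (th n c)) + (real l + 1) * (\<Sum>c\<in>{1..n}. fw K n \<sigma> c)"
    by (simp add: sum.distrib sum_distrib_left)
  also have "\<dots> \<le> real n * (1 / sqrt (real K)) + (real l + 1) * 1"
    using fw_spread[OF K(1) Kn] fw_sum[OF K(1), of n] Kn by (intro add_mono mult_left_mono) auto
  finally show ?thesis by (simp add: Omega_n \<Delta>K_def)
qed

lemma current_replacement:
  assumes s: "s \<in> {0..T}" and c: "c \<in> CC"
  shows "\<bar>Ex s (\<lambda>\<eta>. Yf K c (\<lambda>k. r k s) \<eta> * (cur \<sigma> \<eta> - F \<sigma> (etab \<sigma> \<eta>)))\<bar> \<le> \<rho> s"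
proof -
  let ?Y = "Yf K c (\<lambda>k. r k s)"
  have Y: "\<bar>?Y \<eta>\<bar> \<le> B" if "\<eta> \<in> Omega N" for \<eta>
  proof -
    have "\<forall>u s \<eta>. 0 \<le> u \<longrightarrow> s \<in> {0..T} \<longrightarrow> \<eta> \<in> Omega N \<longrightarrow> \<bar>Yf K (\<lambda>k. c k * exp (- lam k * u)) (\<lambda>k. r k s) \<eta>\<bar> \<le> B"
      using c by (simp add: CC_def)
    from this[rule_format, of 0 s \<eta>] s that show ?thesis by simp
  qed
  have c2: "\<bar>c k\<bar> \<le> 2" for k using c by (simp add: CC_def)
  have "\<bar>Ex s (\<lambda>\<eta>. ?Y \<eta> * (cur \<sigma> \<eta> - F \<sigma> (etab \<sigma> \<eta>)))\<bar> \<le> rep_err s B Q \<omega>K \<Delta>K wmK"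
    unfolding cur_def etab_def Q_def
  proof (rule replacement[OF s Y])
    show "\<bar>?Y (\<eta> \<circ> Transposition.transpose x y) - ?Y \<eta>\<bar> \<le> \<omega>K" if "x \<in> {1..N - 1}" "y \<in> {1..N - 1}" for \<eta> x y
      unfolding \<omega>K_def using that unfolding Omega_n by (intro Yf_transpose c2)
    show "sum (fw K n \<sigma>) {1..N - 1} = 1" using fw_sum[OF K(1), of n] Kn by (simp add: Omega_n)
    show "0 \<le> fw K n \<sigma> c \<and> fw K n \<sigma> c \<le> wmK" for c using fw_bounds[of K n \<sigma> c] by (simp add: wmK_def)
    show "(\<Sum>c\<in>{1..N - 1}. fw K n \<sigma> c * \<bar>real (base \<sigma> + i) - real c\<bar>) \<le> \<Delta>K" if "i \<in> {1..l}" for i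
      using that by (rule fw_window_dist)
  qed
  moreover have "\<bar>Ex s (\<lambda>\<eta>. ?Y \<eta> * (cur \<sigma> \<eta> - F \<sigma> (etab \<sigma> \<eta>)))\<bar> \<le> 2 * B * Q"
  proof (rule Ex_abs_le[OF s])
    fix \<eta> assume \<eta>: "\<eta> \<in> Omega N"
    have "\<bar>cur \<sigma> \<eta> - F \<sigma> (etab \<sigma> \<eta>)\<bar> \<le> 2 * Q" using cur_bound[of \<sigma> \<eta>] F_bound[of \<sigma> "etab \<sigma> \<eta>"] by linarith
    then have "\<bar>?Y \<eta> * (cur \<sigma> \<eta> - F \<sigma> (etab \<sigma> \<eta>))\<bar> \<le> B * (2 * Q)"
      unfolding abs_mult using Y[OF \<eta>] by (intro mult_mono) auto
    then show "\<bar>?Y \<eta> * (cur \<sigma> \<eta> - F \<sigma> (etab \<sigma> \<eta>))\<bar> \<le> 2 * B * Q" by simp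
  qed
  ultimately show ?thesis by (simp add: \<rho>_def)
qed

text \<open>The current is compared with \<open>f\<close> through two intermediate fluxes, at the
  microscopic average and at the Fejer mean. In the middle difference the Lipschitz bound produces
  \<open>etab - AK\<close>, which is again a fluctuation with coefficients in \<open>CC\<close>;
  this closes the estimate once the product of the two fluctuations is split into squares.\<close>

lemma drift_bound:
  assumes s: "s \<in> {0..T}" and c: "c \<in> CC" and M: "\<And>c. c \<in> CC \<Longrightarrow> Z c s \<le> m"
  shows "\<bar>Ex s (\<lambda>\<eta>. Yf K c (\<lambda>k. r k s) \<eta> * (cur \<sigma> \<eta> - f \<sigma> s))\<bar> \<le> \<rho> s + LF * m + B * \<delta> \<sigma> s"
proof -
  let ?Y = "Yf K c (\<lambda>k. r k s)"
  have Y: "\<bar>?Y \<eta>\<bar> \<le> B" if "\<eta> \<in> Omega N" for \<eta>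
  proof -
    have "\<forall>u s \<eta>. 0 \<le> u \<longrightarrow> s \<in> {0..T} \<longrightarrow> \<eta> \<in> Omega N \<longrightarrow> \<bar>Yf K (\<lambda>k. c k * exp (- lam k * u)) (\<lambda>k. r k s) \<eta>\<bar> \<le> B"
      using c by (simp add: CC_def)
    from this[rule_format, of 0 s \<eta>] s that show ?thesis by simp
  qed
  have split: "Ex s (\<lambda>\<eta>. ?Y \<eta> * (cur \<sigma> \<eta> - f \<sigma> s)) = Ex s (\<lambda>\<eta>. ?Y \<eta> * (cur \<sigma> \<eta> - F \<sigma> (etab \<sigma> \<eta>)))
     + (Ex s (\<lambda>\<eta>. ?Y \<eta> * (F \<sigma> (etab \<sigma> \<eta>) - F \<sigma> (AK \<sigma> s))) + Ex s (\<lambda>\<eta>. ?Y \<eta> * (F \<sigma> (AK \<sigma> s) - f \<sigma> s)))"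
    unfolding Ex_add[symmetric] by (simp add: algebra_simps)
  have 2: "\<bar>Ex s (\<lambda>\<eta>. ?Y \<eta> * (F \<sigma> (etab \<sigma> \<eta>) - F \<sigma> (AK \<sigma> s)))\<bar> \<le> LF * m"
  proof -
    have "\<bar>Ex s (\<lambda>\<eta>. ?Y \<eta> * (F \<sigma> (etab \<sigma> \<eta>) - F \<sigma> (AK \<sigma> s)))\<bar> \<le> Ex s (\<lambda>\<eta>. LF * ((?Y \<eta>)^2 / 2 + (Yf K (fcs \<sigma>) (\<lambda>k. r k s) \<eta>)^2 / 2))"
    proof -
      have b: "\<bar>?Y \<eta> * (F \<sigma> (etab \<sigma> \<eta>) - F \<sigma> (AK \<sigma> s))\<bar> \<le> LF * ((?Y \<eta>)^2 / 2 + (Yf K (fcs \<sigma>) (\<lambda>k. r k s) \<eta>)^2 / 2)" for \<eta>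
      proof -
        let ?V = "Yf K (fcs \<sigma>) (\<lambda>k. r k s) \<eta>"
        have "\<bar>?Y \<eta> * (F \<sigma> (etab \<sigma> \<eta>) - F \<sigma> (AK \<sigma> s))\<bar> \<le> \<bar>?Y \<eta>\<bar> * (LF * \<bar>?V\<bar>)"
          unfolding abs_mult etab_AK[symmetric] by (intro mult_left_mono F_lipschitz) auto
        also have "\<dots> = LF * (\<bar>?Y \<eta>\<bar> * \<bar>?V\<bar>)" by simp
        also have "\<bar>?Y \<eta>\<bar> * \<bar>?V\<bar> \<le> (?Y \<eta>)^2 / 2 + ?V^2 / 2"
          using zero_le_power2[of "\<bar>?Y \<eta>\<bar> - \<bar>?V\<bar>"] by (simp add: power2_eq_square algebra_simps)
        finally show ?thesis using LF_nonneg by (simp add: mult_left_mono)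
      qed
      show ?thesis
        using Ex_mono[OF s, of "\<lambda>\<eta>. ?Y \<eta> * (F \<sigma> (etab \<sigma> \<eta>) - F \<sigma> (AK \<sigma> s))"] Ex_mono[OF s, of "\<lambda>\<eta>. - (?Y \<eta> * (F \<sigma> (etab \<sigma> \<eta>) - F \<sigma> (AK \<sigma> s)))"]
          b abs_le_iff Ex_cmult[of s "-1" "\<lambda>\<eta>. ?Y \<eta> * (F \<sigma> (etab \<sigma> \<eta>) - F \<sigma> (AK \<sigma> s))"] by (smt (verit, ccfv_SIG) Ex_def sum.cong mult_minus_left mult_1)
    qed
    also have "\<dots> = LF * (Z c s / 2 + Z (fcs \<sigma>) s / 2)"
      unfolding Z_def Ex_cmult Ex_add times_divide_eq_left[symmetric] by (simp only: Ex_cmult Ex_add divide_inverse mult.commute[of _ "inverse 2"])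
    also have "\<dots> \<le> LF * (m / 2 + m / 2)" using M[OF c] M[OF fcs_CC] LF_nonneg by (intro mult_left_mono add_mono) auto
    finally show ?thesis by simp
  qed
  have 3: "\<bar>Ex s (\<lambda>\<eta>. ?Y \<eta> * (F \<sigma> (AK \<sigma> s) - f \<sigma> s))\<bar> \<le> B * \<delta> \<sigma> s"
    unfolding \<delta>_def by (intro Ex_abs_le[OF s], unfold abs_mult, intro mult_right_mono Y) auto
  show ?thesis
    unfolding split using current_replacement[OF s c, of \<sigma>] 2 3 by linarith
qed

section \<open>The contraction in the weighted norm\<close>

definition \<kappa> :: "real \<Rightarrow> real \<Rightarrow> real" where "\<kappa> t s = (\<Sum>k<K. 2 * exp (- lam k * (t - s)))"

text \<open>The part of the kernel that is not bounded uniformly in K. Its time integral is at most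
  a tail of \<open>\<Sum>k. 2 / lam k\<close>, hence small when \<open>K1\<close> is large, so it
  may be paired with the supremum of \<open>EE\<close>.\<close>

definition \<kappa>tail :: "real \<Rightarrow> real \<Rightarrow> real" where "\<kappa>tail t s = (\<Sum>k\<in>{K1..<K}. 2 * exp (- lam k * (t - s)))"

lemma EE_bounds: "s \<in> {0..T} \<Longrightarrow> 0 \<le> EE s" "s \<in> {0..T} \<Longrightarrow> EE s \<le> 16 * B * Q"
proof -
  assume s: "s \<in> {0..T}"
  have d: "\<delta> \<sigma> s \<le> 2 * Q" for \<sigma>
    unfolding \<delta>_def using F_bound[of \<sigma> "AK \<sigma> s"] f_le[of \<sigma> s] by linarith
  have "\<rho> s \<ge> 0"
    using order_trans[OF abs_ge_zero current_replacement[OF s fcs_CC]] .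
  then show "0 \<le> EE s" unfolding EE_def \<delta>_def using B_pos by (auto simp: UNIV_bool)
  have "2 * B * (\<Sum>\<sigma>\<in>UNIV. \<delta> \<sigma> s) \<le> 2 * B * (\<Sum>\<sigma>\<in>(UNIV::bool set). 2 * Q)"
    using B_pos d by (intro mult_left_mono sum_mono) auto
  moreover have "\<rho> s \<le> 2 * B * Q" by (simp add: \<rho>_def)
  ultimately show "EE s \<le> 16 * B * Q" unfolding EE_def by (simp add: UNIV_bool)
qed

lemma \<kappa>_split: 
  assumes "0 \<le> s" "s \<le> t"
  shows "0 \<le> \<kappa> t s" "\<kappa> t s \<le> 2 * real K1 + \<kappa>tail t s"
proof -
  show "0 \<le> \<kappa> t s" unfolding \<kappa>_def by (intro sum_nonneg) auto
  have e: "exp (- lam k * (t - s)) \<le> 1" for k using assms by simp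
  have "\<kappa> t s \<le> (\<Sum>k\<in>{..<K1} \<union> {K1..<K}. 2 * exp (- lam k * (t - s)))"
    unfolding \<kappa>_def by (intro sum_mono2) auto
  also have "\<dots> = (\<Sum>k<K1. 2 * exp (- lam k * (t - s))) + \<kappa>tail t s"
    unfolding \<kappa>tail_def by (intro sum.union_disjoint) auto
  also have "(\<Sum>k<K1. 2 * exp (- lam k * (t - s))) \<le> (\<Sum>k<K1. 2)"
    using e by (intro sum_mono) auto
  finally show "\<kappa> t s \<le> 2 * real K1 + \<kappa>tail t s" by simp
qed

lemma \<rho>_continuous: "continuous_on {0..T} \<rho>"
  unfolding \<rho>_def[abs_def] rep_err_def by (intro continuous_intros Dir_continuous)

lemma AK_continuous: "continuous_on {0..T} (AK \<sigma>)"
  unfolding AK_def[abs_def] by (intro continuous_intros r_cont)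

lemma F_continuous: "continuous_on S (F \<sigma>)"
proof (rule continuous_on_subset[OF _ subset_UNIV])
  have "LF-lipschitz_on UNIV (F \<sigma>)"
    using F_lipschitz LF_nonneg by (intro lipschitz_onI) (auto simp: dist_real_def)
  then show "continuous_on UNIV (F \<sigma>)" by (rule lipschitz_on_continuous_on)
qed

lemma \<delta>_integrable: "\<delta> \<sigma> integrable_on {0..T}"
proof (rule integrable_on_half_open)
  have "{0<..T} \<subseteq> {0..T}" by auto
  then show "continuous_on {0<..T} (\<delta> \<sigma>)"
    unfolding \<delta>_def[abs_def]
    by (intro continuous_intros f_cont continuous_on_compose2[OF F_continuous[of UNIV]] continuous_on_subset[OF AK_continuous]) auto
  show "\<bar>\<delta> \<sigma> s\<bar> \<le> 2 * Q" for s
    unfolding \<delta>_def using F_bound[of \<sigma> "AK \<sigma> s"] f_le[of \<sigma> s] by linarith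
qed

lemma EE_integrable: "EE integrable_on {0..T}"
  unfolding EE_def[abs_def]
proof (intro integrable_add)
  show "(\<lambda>s. 4 * \<rho> s) integrable_on {0..T}"
    by (intro integrable_continuous_interval continuous_intros \<rho>_continuous)
  show "(\<lambda>s. 2 * B * (\<Sum>\<sigma>\<in>UNIV. \<delta> \<sigma> s)) integrable_on {0..T}"
    by (intro integrable_on_cmult_left[where 'b = real, simplified] integrable_sum \<delta>_integrable) auto
qed

text \<open>Cauchy-Schwarz over K modes with \<open>\<bar>c k\<bar> \<le> 2\<close> gives the factor
  \<open>4 * K\<close>.\<close>

definition Ainit :: real where "Ainit = 4 * real K * (\<Sum>k<K. Ex 0 (\<lambda>\<eta>. (X k \<eta> - r k 0)^2))"

definition Atot :: real where
  "Atot = Ainit + 2 * real K1 * integral {0..T} EE + 16 * B * Q * (\<Sum>k\<in>{K1..<K}. 2 / lam k) + errN K B * T"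

lemma Z_init: "c \<in> CC \<Longrightarrow> Z c 0 \<le> Ainit"
proof -
  assume c: "c \<in> CC"
  have s: "0 \<in> {0..T}" using T by simp
  have "Z c 0 \<le> Ex 0 (\<lambda>\<eta>. 4 * real K * (\<Sum>k<K. (X k \<eta> - r k 0)^2))"
    unfolding Z_def
  proof (rule Ex_mono[OF s])
    fix \<eta>
    have "(c k)^2 \<le> 2^2" for k using c by (intro sq_le_if_abs_le) (simp add: CC_def)
    then have "(\<Sum>k<K. (c k)^2) \<le> (\<Sum>k<K. 4)" by (intro sum_mono) simp
    then have "(\<Sum>k<K. (c k)^2) * (\<Sum>k<K. (X k \<eta> - r k 0)^2) \<le> 4 * real K * (\<Sum>k<K. (X k \<eta> - r k 0)^2)"
      by (intro mult_right_mono sum_nonneg) (auto simp: mult.commute)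
    then show "(Yf K c (\<lambda>k. r k 0) \<eta>)^2 \<le> 4 * real K * (\<Sum>k<K. (X k \<eta> - r k 0)^2)"
      using Cauchy_Schwarz_ineq_sum[of c "\<lambda>k. X k \<eta> - r k 0" "{..<K}"] unfolding Yf_def by linarith
  qed
  then show ?thesis unfolding Ainit_def Ex_cmult Ex_sum .
qed

text \<open>The function y interpolates between times 0 and t with coefficients that stay in
  \<open>CC\<close>. Low modes of the kernel meet the integral of \<open>EE\<close> and high modes
  its supremum. The Lipschitz part reproduces half of the assumed bound, because the weight
  \<open>exp (\<Lambda> * s)\<close> adds \<Lambda> to each denominator
  \<open>lam k\<close>.\<close>

lemma contraction_step:
  assumes c: "c \<in> CC" and t: "t \<in> {0..T}" and m0: "0 \<le> m"
    and M: "\<And>c s. c \<in> CC \<Longrightarrow> s \<in> {0..T} \<Longrightarrow> Z c s \<le> m * exp (\<Lambda> * s)"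
    and err: "0 \<le> errN K B"
  shows "Z c t \<le> Atot + m / 2 * exp (\<Lambda> * t)"
proof -
  define b where "b s k = c k * exp (- lam k * (t - s))" for s k
  define y where "y s = Ex s (\<lambda>\<eta>. (Yf K (b s) (\<lambda>k. r k s) \<eta>)^2)" for s
  have bCC: "b s \<in> CC" if "s \<le> t" for s
    unfolding b_def using CC_heat[OF c, of "t - s"] that by simp
  have yZ: "y s = Z (b s) s" for s by (simp add: y_def Z_def)
  define v where "v s = 2 * real K1 * EE s + 16 * B * Q * \<kappa>tail t s + 4 * LF * m * (\<Sum>k<K. 2 * (exp (- (\<Lambda> + lam k) * (t - s)) * exp (\<Lambda> * t))) + errN K B" for s
  have D: "\<exists>D. (y has_real_derivative D) (at s) \<and> D \<le> v s" if s: "s \<in> {0<..<t}" for s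
  proof -
    have sT: "s \<in> {0..T}" "s \<le> t" "s \<in> {0<..<T}" using s t by auto
    have Yb: "\<bar>Yf K (\<lambda>k. c k * exp (- lam k * (t - s))) (\<lambda>k. r k s) \<eta>\<bar> \<le> B" if "\<eta> \<in> Omega N" for \<eta>
      using c sT that unfolding CC_def by auto
    obtain D where D: "(y has_real_derivative D) (at s)"
      "D \<le> 2 * (\<Sum>\<sigma>\<in>UNIV. (\<Sum>k<K. b s k * sg \<sigma> ^ k) * Ex s (\<lambda>\<eta>. Yf K (b s) (\<lambda>k. r k s) \<eta> * (cur \<sigma> \<eta> - f \<sigma> s))) + errN K B"
    proof -
      have "\<bar>c k\<bar> \<le> 2" for k using c by (simp add: CC_def)
      from energy_deriv[where c = c and r = r and f = "\<lambda>\<sigma>. f \<sigma> s" and t = t and K = K, OF sT(1,2) this r_deriv[OF sT(3)] Yb]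
      show ?thesis using that unfolding y_def b_def by blast
    qed
    have \<kappa>1: "\<bar>\<Sum>k<K. b s k * sg \<sigma> ^ k\<bar> \<le> \<kappa> t s" for \<sigma>
      unfolding \<kappa>_def
    proof (rule order_trans[OF sum_abs sum_mono])
      fix k
      have "\<bar>c k\<bar> \<le> 2" using c by (simp add: CC_def)
      then show "\<bar>b s k * sg \<sigma> ^ k\<bar> \<le> 2 * exp (- lam k * (t - s))"
        by (simp add: b_def abs_mult)
    qed
    have each: "(\<Sum>k<K. b s k * sg \<sigma> ^ k) * Ex s (\<lambda>\<eta>. Yf K (b s) (\<lambda>k. r k s) \<eta> * (cur \<sigma> \<eta> - f \<sigma> s))
        \<le> \<kappa> t s * (\<rho> s + LF * (m * exp (\<Lambda> * s)) + B * \<delta> \<sigma> s)" for \<sigma>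
    proof -
      have "(\<Sum>k<K. b s k * sg \<sigma> ^ k) * Ex s (\<lambda>\<eta>. Yf K (b s) (\<lambda>k. r k s) \<eta> * (cur \<sigma> \<eta> - f \<sigma> s))
        \<le> \<bar>\<Sum>k<K. b s k * sg \<sigma> ^ k\<bar> * \<bar>Ex s (\<lambda>\<eta>. Yf K (b s) (\<lambda>k. r k s) \<eta> * (cur \<sigma> \<eta> - f \<sigma> s))\<bar>"
        unfolding abs_mult[symmetric] by (rule abs_ge_self)
      also have "\<dots> \<le> \<kappa> t s * (\<rho> s + LF * (m * exp (\<Lambda> * s)) + B * \<delta> \<sigma> s)"
        using \<kappa>_split(1)[of s t] s by (intro mult_mono \<kappa>1 drift_bound[OF sT(1) bCC[OF sT(2)]] M sT) auto
      finally show ?thesis .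
    qed
    have "D \<le> 2 * (\<Sum>\<sigma>\<in>UNIV. \<kappa> t s * (\<rho> s + LF * (m * exp (\<Lambda> * s)) + B * \<delta> \<sigma> s)) + errN K B"
      by (rule order_trans[OF D(2)]) (intro add_mono mult_left_mono sum_mono each, auto)
    also have "\<dots> = \<kappa> t s * EE s + 4 * LF * m * (\<kappa> t s * exp (\<Lambda> * s)) + errN K B"
      by (simp add: EE_def UNIV_bool algebra_simps)
    also have "\<kappa> t s * EE s \<le> (2 * real K1 + \<kappa>tail t s) * EE s"
      using \<kappa>_split(2)[of s t] s EE_bounds(1)[OF sT(1)] by (intro mult_right_mono) auto
    also have "\<dots> \<le> 2 * real K1 * EE s + 16 * B * Q * \<kappa>tail t s"
    proof -
      have "\<kappa>tail t s * EE s \<le> \<kappa>tail t s * (16 * B * Q)"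
        using EE_bounds(2)[OF sT(1)] by (intro mult_left_mono) (auto simp: \<kappa>tail_def intro: sum_nonneg)
      then show ?thesis by (simp add: algebra_simps)
    qed
    also have "\<kappa> t s * exp (\<Lambda> * s) = (\<Sum>k<K. 2 * (exp (- (\<Lambda> + lam k) * (t - s)) * exp (\<Lambda> * t)))"
      unfolding \<kappa>_def sum_distrib_right
      by (intro sum.cong refl) (simp add: exp_add[symmetric] algebra_simps)
    finally have "D \<le> v s" unfolding v_def by simp
    with D(1) show ?thesis by auto
  qed
  obtain D where D: "\<And>s. s \<in> {0<..<t} \<Longrightarrow> (y has_real_derivative D s) (at s) \<and> D s \<le> v s"
    using D by metis
  \<comment> \<open>The derivative is known in the open interval only. Giving it the value of its
    majorant at the end points makes the comparison with \<open>v\<close> hold on the closed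
    interval.\<close>
  define D' where "D' s = (if s \<in> {0<..<t} then D s else v s)" for s
  have ycont: "continuous_on {0..t} y"
    unfolding y_def Ex_def Yf_def b_def using t
    by (intro continuous_intros p_continuous continuous_on_subset[OF r_cont]) auto
  have Dint: "(D' has_integral y t - y 0) {0..t}"
  proof (rule fundamental_theorem_of_calculus_interior)
    show "(y has_vector_derivative D' s) (at s)" if "s \<in> {0<..<t}" for s
      using D[OF that] that by (simp add: D'_def has_real_derivative_iff_has_vector_derivative)
  qed (use t ycont in auto)
  have vint: "(v has_integral 2 * real K1 * integral {0..t} EE + 16 * B * Q * integral {0..t} (\<kappa>tail t)
      + 4 * LF * m * integral {0..t} (\<lambda>s. \<Sum>k<K. 2 * (exp (- (\<Lambda> + lam k) * (t - s)) * exp (\<Lambda> * t))) + errN K B * t) {0..t}"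
  proof -
    have E: "EE integrable_on {0..t}" using t by (intro integrable_on_subinterval[OF EE_integrable]) auto
    have k: "\<kappa>tail t integrable_on {0..t}" unfolding \<kappa>tail_def
      by (intro integrable_continuous_interval continuous_intros)
    have g: "(\<lambda>s. \<Sum>k<K. 2 * (exp (- (\<Lambda> + lam k) * (t - s)) * exp (\<Lambda> * t))) integrable_on {0..t}"
      by (intro integrable_continuous_interval continuous_intros)
    have c: "((\<lambda>_. a) has_integral a * t) {0..t}" for a :: real
      using has_integral_const_real[of a 0 t] t by (simp add: mult.commute)
    show ?thesis
      unfolding v_def
      by (rule has_integral_add[OF has_integral_add[OF has_integral_add[OF
          has_integral_mult_right[OF integrable_integral[OF E]] has_integral_mult_right[OF integrable_integral[OF k]]]
          has_integral_mult_right[OF integrable_integral[OF g]]] c])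
  qed
  have le: "y t - y 0 \<le> 2 * real K1 * integral {0..t} EE + 16 * B * Q * integral {0..t} (\<kappa>tail t)
      + 4 * LF * m * integral {0..t} (\<lambda>s. \<Sum>k<K. 2 * (exp (- (\<Lambda> + lam k) * (t - s)) * exp (\<Lambda> * t))) + errN K B * t"
    by (rule has_integral_le[OF Dint vint]) (use D in \<open>auto simp: D'_def\<close>)
  have i1: "2 * real K1 * integral {0..t} EE \<le> 2 * real K1 * integral {0..T} EE"
    using t EE_bounds(1) by (intro mult_left_mono integral_subset_le integrable_on_subinterval[OF EE_integrable] EE_integrable) auto
  have "integral {0..t} (\<kappa>tail t) \<le> (\<Sum>k\<in>{K1..<K}. 2 / lam k)"
  proof -
    have "integral {0..t} (\<kappa>tail t) = (\<Sum>k\<in>{K1..<K}. 2 * integral {0..t} (\<lambda>s. exp (- lam k * (t - s))))"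
      unfolding \<kappa>tail_def by (subst integral_sum) (auto intro!: integrable_continuous_interval continuous_intros)
    also have "\<dots> \<le> (\<Sum>k\<in>{K1..<K}. 2 * (1 / lam k))"
      using t K1 by (intro sum_mono mult_left_mono integral_exp_le) (auto simp: lam_def)
    finally show ?thesis by simp
  qed
  then have i2: "16 * B * Q * integral {0..t} (\<kappa>tail t) \<le> 16 * B * Q * (\<Sum>k\<in>{K1..<K}. 2 / lam k)"
    using B_pos Q_nonneg by (intro mult_left_mono) auto
  have "integral {0..t} (\<lambda>s. \<Sum>k<K. 2 * (exp (- (\<Lambda> + lam k) * (t - s)) * exp (\<Lambda> * t))) \<le> exp (\<Lambda> * t) * (\<Sum>k<K. 2 / (\<Lambda> + lam k))"
  proof -
    have "integral {0..t} (\<lambda>s. \<Sum>k<K. 2 * (exp (- (\<Lambda> + lam k) * (t - s)) * exp (\<Lambda> * t)))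
      = (\<Sum>k<K. 2 * (integral {0..t} (\<lambda>s. exp (- (\<Lambda> + lam k) * (t - s))) * exp (\<Lambda> * t)))"
      by (subst integral_sum) (auto intro!: integrable_continuous_interval continuous_intros)
    also have "\<dots> \<le> (\<Sum>k<K. 2 * (1 / (\<Lambda> + lam k) * exp (\<Lambda> * t)))"
      using t \<Lambda>(1) by (intro sum_mono mult_left_mono mult_right_mono integral_exp_le add_pos_nonneg) auto
    finally show ?thesis by (simp add: sum_distrib_left mult.commute)
  qed
  then have "4 * LF * m * integral {0..t} (\<lambda>s. \<Sum>k<K. 2 * (exp (- (\<Lambda> + lam k) * (t - s)) * exp (\<Lambda> * t)))
    \<le> 4 * LF * m * (exp (\<Lambda> * t) * (\<Sum>k<K. 2 / (\<Lambda> + lam k)))"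
    using LF_nonneg m0 by (intro mult_left_mono) auto
  moreover have "4 * LF * m * (exp (\<Lambda> * t) * (\<Sum>k<K. 2 / (\<Lambda> + lam k))) \<le> m / 2 * exp (\<Lambda> * t)"
  proof -
    have "8 * LF * (\<Sum>k<K. 2 / (\<Lambda> + lam k)) \<le> 1"
      using \<Lambda>(2) by (simp add: LF_def Q_def)
    then have "m * exp (\<Lambda> * t) / 2 * (8 * LF * (\<Sum>k<K. 2 / (\<Lambda> + lam k))) \<le> m * exp (\<Lambda> * t) / 2 * 1"
      using m0 by (intro mult_left_mono) auto
    then show ?thesis by (simp only: mult_ac) (simp add: mult_ac)
  qed
  moreover have "errN K B * t \<le> errN K B * T" using err t by (intro mult_left_mono) auto
  ultimately have "y t \<le> y 0 + (2 * real K1 * integral {0..T} EE + 16 * B * Q * (\<Sum>k\<in>{K1..<K}. 2 / lam k) + m / 2 * exp (\<Lambda> * t) + errN K B * T)"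
    using le i1 i2 by linarith
  moreover have "y 0 \<le> Ainit" unfolding yZ using t by (intro Z_init bCC) auto
  moreover have "b t = c" by (auto simp: b_def)
  then have "y t = Z c t" by (simp add: yZ)
  ultimately show ?thesis unfolding Atot_def by linarith
qed

lemma errN_nonneg: "0 \<le> errN K B"
  unfolding errN_def GB_def EB_def using B_pos Q_nonneg RB_nonneg
  by (intro add_nonneg_nonneg mult_nonneg_nonneg sum_nonneg divide_nonneg_nonneg) auto

lemma Atot_nonneg: "0 \<le> Atot"
proof -
  have "0 \<le> Ainit" using T
    unfolding Ainit_def Ex_def by (intro mult_nonneg_nonneg sum_nonneg p_nonneg) auto
  moreover have "0 \<le> integral {0..T} EE" using EE_bounds(1) by (intro integral_nonneg EE_integrable) auto
  ultimately show ?thesis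
    unfolding Atot_def using errN_nonneg B_pos Q_nonneg T
    by (intro add_nonneg_nonneg mult_nonneg_nonneg sum_nonneg) auto
qed

text \<open>Starting from the a priori bound \<open>B^2\<close>, each contraction step halves the
  part of the bound in excess of \<open>2 * Atot\<close>. Iterating uniformly over \<open>CC\<close>
  and time takes the place of a supremum over both.\<close>

lemma micro_bound:
  assumes c: "c \<in> CC" and t: "t \<in> {0..T}"
  shows "Z c t \<le> 2 * Atot * exp (\<Lambda> * T)"
proof -
  have it: "\<forall>c\<in>CC. \<forall>s\<in>{0..T}. Z c s \<le> (2 * Atot + B^2 / 2 ^ j) * exp (\<Lambda> * s)" for j
  proof (induction j)
    case 0
    show ?case
    proof (intro ballI)
      fix c s assume c: "c \<in> CC" and s: "s \<in> {0..T}"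
      have "\<bar>Yf K c (\<lambda>k. r k s) \<eta>\<bar> \<le> B" if "\<eta> \<in> Omega N" for \<eta>
      proof -
        have "\<forall>u s \<eta>. 0 \<le> u \<longrightarrow> s \<in> {0..T} \<longrightarrow> \<eta> \<in> Omega N \<longrightarrow> \<bar>Yf K (\<lambda>k. c k * exp (- lam k * u)) (\<lambda>k. r k s) \<eta>\<bar> \<le> B"
          using c by (simp add: CC_def)
        from this[rule_format, of 0 s \<eta>] s that show ?thesis by simp
      qed
      then have "Z c s \<le> Ex s (\<lambda>_. B^2)"
        unfolding Z_def by (intro Ex_mono[OF s] sq_le_if_abs_le)
      also have "\<dots> = B^2 * 1" using Ex_const[OF s] by simp
      also have "\<dots> \<le> (2 * Atot + B^2) * exp (\<Lambda> * s)"
        using Atot_nonneg \<Lambda>(1) s by (intro mult_mono) auto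
      finally show "Z c s \<le> (2 * Atot + B^2 / 2 ^ 0) * exp (\<Lambda> * s)" by simp
    qed
  next
    case (Suc j)
    show ?case
    proof (intro ballI)
      fix c s assume c: "c \<in> CC" and s: "s \<in> {0..T}"
      have "Z c s \<le> Atot + (2 * Atot + B^2 / 2 ^ j) / 2 * exp (\<Lambda> * s)"
        using Suc Atot_nonneg by (intro contraction_step[OF c s _ _ errN_nonneg]) auto
      also have "\<dots> \<le> Atot * exp (\<Lambda> * s) + (2 * Atot + B^2 / 2 ^ j) / 2 * exp (\<Lambda> * s)"
        using mult_left_mono[OF _ Atot_nonneg, of 1 "exp (\<Lambda> * s)"] \<Lambda>(1) s by simp
      finally show "Z c s \<le> (2 * Atot + B^2 / 2 ^ Suc j) * exp (\<Lambda> * s)" by (simp add: algebra_simps add_divide_distrib)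
    qed
  qed
  have "(\<lambda>j. (2 * Atot + B^2 * (1/2) ^ j) * exp (\<Lambda> * t)) \<longlonglongrightarrow> (2 * Atot + B^2 * 0) * exp (\<Lambda> * t)"
    by (intro tendsto_intros LIMSEQ_power_zero) auto
  then have "Z c t \<le> (2 * Atot + B^2 * 0) * exp (\<Lambda> * t)"
    by (rule LIMSEQ_le_const) (use it c t in \<open>auto simp: power_divide\<close>)
  also have "\<dots> \<le> 2 * Atot * exp (\<Lambda> * T)"
    using Atot_nonneg \<Lambda>(1) t by (simp add: mult_left_mono)
  finally show ?thesis .
qed

text \<open>Only the time integral of \<open>N * Dir s\<close> is bounded, so the square root is
  linearised by sqrt x \<le> 1 + x. The factor \<open>sqrt (\<Delta>K / real N)\<close> that remains
  is of order K to the power -1/4 for large N.\<close>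

lemma integral_EE_le:
  "integral {0..T} EE \<le> 4 * (real l * (4 * B * Q * sqrt (\<Delta>K / real N) * (T + 4 + 2 * CR * T) + (Q * \<omega>K + 4 * real l * B * Q * wmK) * T))
    + 2 * B * (\<Sum>\<sigma>\<in>UNIV. integral {0..T} (\<delta> \<sigma>))"
proof -
  define g where "g s = real l * (4 * B * Q * sqrt (\<Delta>K / real N) * (1 + real N * Dir s) + (Q * \<omega>K + 4 * real l * B * Q * wmK))" for s
  have N0: "0 < real N" using N by simp
  have \<Delta>0: "0 \<le> \<Delta>K" by (simp add: \<Delta>K_def)
  have gi: "(\<lambda>s. real N * Dir s) integrable_on {0..T}"
    by (intro integrable_continuous_interval continuous_intros Dir_continuous)
  have g: "g integrable_on {0..T}"
    unfolding g_def by (intro integrable_continuous_interval continuous_intros Dir_continuous)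
  have gI: "integral {0..T} g = real l * (4 * B * Q * sqrt (\<Delta>K / real N) * (T + integral {0..T} (\<lambda>s. real N * Dir s)) + (Q * \<omega>K + 4 * real l * B * Q * wmK) * T)"
  proof -
    have c: "((\<lambda>_. a) has_integral a * T) {0..T}" for a :: real
      using has_integral_const_real[of a 0 T] T by (simp add: mult.commute)
    have "(g has_integral real l * (4 * B * Q * sqrt (\<Delta>K / real N) * (1 * T + integral {0..T} (\<lambda>s. real N * Dir s)) + (Q * \<omega>K + 4 * real l * B * Q * wmK) * T)) {0..T}"
      unfolding g_def by (intro has_integral_mult_right has_integral_add c integrable_integral gi)
    then show ?thesis by (simp add: integral_unique)
  qed
  have \<rho>g: "\<rho> s \<le> g s" if s: "s \<in> {0..T}" for s
  proof -
    have "sqrt (Dir s * \<Delta>K) = sqrt (\<Delta>K / real N) * sqrt (real N * Dir s)"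
      using N0 by (simp add: real_sqrt_mult[symmetric])
    also have "\<dots> \<le> sqrt (\<Delta>K / real N) * (1 + real N * Dir s)"
    proof (intro mult_left_mono)
      have "0 \<le> real N * Dir s" using Dir_nonneg[OF s] by simp
      then show "sqrt (real N * Dir s) \<le> 1 + real N * Dir s"
        by (intro real_le_lsqrt) (auto simp: power2_eq_square algebra_simps)
    qed (use N0 \<Delta>0 in auto)
    finally have "B * Q * (4 * sqrt (Dir s * \<Delta>K)) \<le> B * Q * (4 * (sqrt (\<Delta>K / real N) * (1 + real N * Dir s)))"
      using B_pos Q_nonneg by (intro mult_left_mono) auto
    then have "rep_err s B Q \<omega>K \<Delta>K wmK \<le> g s"
      unfolding rep_err_def g_def by (intro mult_left_mono) (simp_all add: mult_ac)
    then show ?thesis by (simp add: \<rho>_def)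
  qed
  have "integral {0..T} EE = 4 * integral {0..T} \<rho> + 2 * B * (\<Sum>\<sigma>\<in>UNIV. integral {0..T} (\<delta> \<sigma>))"
    unfolding EE_def
  proof (subst integral_add)
    show "(\<lambda>s. 4 * \<rho> s) integrable_on {0..T}"
      by (intro integrable_continuous_interval continuous_intros \<rho>_continuous)
    show "(\<lambda>s. 2 * B * (\<Sum>\<sigma>\<in>UNIV. \<delta> \<sigma> s)) integrable_on {0..T}"
      by (intro integrable_on_cmult_left[where 'b = real, simplified] integrable_sum \<delta>_integrable) auto
  qed (simp add: integral_sum \<delta>_integrable)
  also have "integral {0..T} \<rho> \<le> integral {0..T} g"
    using \<rho>g by (intro integral_le integrable_continuous_interval \<rho>_continuous g) auto
  also have "\<dots> \<le> real l * (4 * B * Q * sqrt (\<Delta>K / real N) * (T + (4 + 2 * CR * T)) + (Q * \<omega>K + 4 * real l * B * Q * wmK) * T)"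
    unfolding gI using Dir_integral B_pos Q_nonneg N0 \<Delta>0
    by (intro mult_left_mono add_mono order_refl) auto
  finally show ?thesis by (simp add: add.assoc)
qed

end

section \<open>The Volterra equation of the modes\<close>

lemma lam_summable: "0 < \<Lambda> \<Longrightarrow> summable (\<lambda>k. 2 / (\<Lambda> + lam k))" and lam_summable0: "summable (\<lambda>k. 2 / lam k)"
proof -
  have s: "summable (\<lambda>k. 2 * inverse (real k ^ 2))"
    by (intro summable_mult inverse_power_summable) auto
  have b: "norm (2 / (\<Lambda> + lam k)) \<le> 2 * inverse (real k ^ 2)" if "0 \<le> \<Lambda>" "1 \<le> k" for k \<Lambda>
  proof -
    have "0 < real k ^ 2" "real k ^ 2 \<le> \<Lambda> + lam k" using lam_ge[of k] that by auto
    moreover from this have "2 / (\<Lambda> + lam k) \<le> 2 / real k ^ 2"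
      by (intro divide_left_mono mult_pos_pos) linarith+
    moreover have "0 \<le> 2 / (\<Lambda> + lam k)" using that by simp
    ultimately have "norm (2 / (\<Lambda> + lam k)) \<le> 2 / real k ^ 2" unfolding real_norm_def by linarith
    then show ?thesis by (simp only: divide_inverse)
  qed
  show "0 < \<Lambda> \<Longrightarrow> summable (\<lambda>k. 2 / (\<Lambda> + lam k))"
    by (rule summable_comparison_test[OF _ s]) (use b[of \<Lambda>] in auto)
  show "summable (\<lambda>k. 2 / lam k)"
    by (rule summable_comparison_test[OF _ s]) (use b[of 0] in auto)
qed

text \<open>Tannery's theorem, the terms at \<Lambda> = 1 being the majorant. This is the source of
  the smallness in every contraction below.\<close>

lemma lam_suminf_small:
  assumes "0 < \<epsilon>"
  obtains \<Lambda> where "1 \<le> \<Lambda>" "(\<Sum>k. 2 / (\<Lambda> + lam k)) \<le> \<epsilon>"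
proof -
  have "eventually (\<lambda>\<Lambda>. summable (\<lambda>k. norm (2 / (\<Lambda> + lam k)))) at_top \<and> summable (\<lambda>n::nat. norm (0::real)) \<and>
      ((\<lambda>\<Lambda>. \<Sum>k. 2 / (\<Lambda> + lam k)) \<longlongrightarrow> (\<Sum>k::nat. 0)) at_top"
  proof (rule tannerys_theorem)
    fix k
    show "((\<lambda>\<Lambda>. 2 / (\<Lambda> + lam k)) \<longlongrightarrow> 0) at_top"
      by (rule tendsto_divide_0[OF tendsto_const filterlim_at_top_imp_at_infinity])
        (auto intro!: filterlim_tendsto_add_at_top[OF tendsto_const filterlim_ident, of "lam k", simplified add.commute])
  next
    have "eventually (\<lambda>\<Lambda>::real. \<forall>k. norm (2 / (\<Lambda> + lam k)) \<le> 2 / (1 + lam k)) at_top"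
      using eventually_ge_at_top[of 1] by eventually_elim (auto intro!: divide_left_mono mult_pos_pos add_pos_nonneg)
    then show "\<forall>\<^sub>F (k, \<Lambda>) in at_top \<times>\<^sub>F at_top. norm (2 / (\<Lambda> + lam k)) \<le> 2 / (1 + lam k)"
      by (subst (asm) eventually_prod2[symmetric, where A = "at_top :: nat filter"]) (auto elim: eventually_mono)
  qed (auto intro: lam_summable)
  then have "((\<lambda>\<Lambda>. \<Sum>k. 2 / (\<Lambda> + lam k)) \<longlongrightarrow> 0) at_top" by simp
  then have "eventually (\<lambda>\<Lambda>. (\<Sum>k. 2 / (\<Lambda> + lam k)) < \<epsilon>) at_top"
    using assms by (simp add: order_tendsto_iff)
  from eventually_happens'[OF _ eventually_conj[OF this eventually_ge_at_top[of 1]]] that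
  show ?thesis by force
qed

lemma lam_contraction:
  assumes "0 \<le> c"
  obtains \<Lambda> where "1 \<le> \<Lambda>" "c * (\<Sum>k. 2 / (\<Lambda> + lam k)) \<le> 1"
proof -
  obtain \<Lambda> where \<Lambda>: "1 \<le> \<Lambda>" "(\<Sum>k. 2 / (\<Lambda> + lam k)) \<le> 1 / (c + 1)"
    using lam_suminf_small[of "1 / (c + 1)"] assms by auto
  have "c * (\<Sum>k. 2 / (\<Lambda> + lam k)) \<le> c * (1 / (c + 1))"
    using \<Lambda>(2) assms by (intro mult_left_mono) auto
  also have "\<dots> \<le> 1" using assms by (simp add: field_simps)
  finally show ?thesis using that \<Lambda>(1) by blast
qed

lemma suminf_abs_le:
  fixes f g :: "nat \<Rightarrow> real"
  assumes "\<And>k. \<bar>f k\<bar> \<le> g k" "summable g"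
  shows "summable f" "\<bar>suminf f\<bar> \<le> suminf g"
proof -
  have s: "summable (\<lambda>k. \<bar>f k\<bar>)"
    by (rule summable_comparison_test[OF _ assms(2)]) (use assms(1) in auto)
  then show "summable f" by (rule summable_rabs_cancel)
  have "\<bar>suminf f\<bar> \<le> (\<Sum>k. \<bar>f k\<bar>)" using s by (rule summable_rabs)
  also have "\<dots> \<le> suminf g" using assms s by (intro suminf_le) auto
  finally show "\<bar>suminf f\<bar> \<le> suminf g" .
qed

section \<open>Duhamel integrals\<close>

definition duhamel :: "nat \<Rightarrow> (real \<Rightarrow> real) \<Rightarrow> real \<Rightarrow> real" where
  "duhamel k f t = integral {0..t} (\<lambda>s. exp (- lam k * (t - s)) * f s)"

lemma exp_mult_integrable:
  fixes f :: "real \<Rightarrow> real"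
  assumes f: "f integrable_on {0..T}" and C: "\<And>s. s \<in> {0..T} \<Longrightarrow> \<bar>f s\<bar> \<le> C" and t: "t \<le> T" and g: "continuous_on {0..t} g"
  shows "(\<lambda>s. g s * f s) integrable_on {0..t}"
proof -
  have "bounded (g ` {0..t})" using compact_continuous_image[OF g] compact_imp_bounded by auto
  then obtain G where G: "\<And>s. s \<in> {0..t} \<Longrightarrow> \<bar>g s\<bar> \<le> G" by (fastforce simp: bounded_iff)
  show ?thesis
  proof (rule measurable_bounded_by_integrable_imp_integrable_real[where g = "\<lambda>_. G * C"])
    show "(\<lambda>s. g s * f s) \<in> borel_measurable (lebesgue_on {0..t})"
      using continuous_imp_measurable_on_sets_lebesgue[OF g]
        integrable_imp_measurable[OF integrable_on_subinterval[OF f]] t by auto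
    show "\<bar>g s * f s\<bar> \<le> G * C" if "s \<in> {0..t}" for s
      unfolding abs_mult using G[OF that] C[of s] that t by (intro mult_mono) (auto intro: order_trans[OF abs_ge_zero])
  qed auto
qed

lemma duhamel_eq: "duhamel k f t = exp (- lam k * t) * integral {0..t} (\<lambda>s. exp (lam k * s) * f s)"
proof -
  have "exp (- lam k * (t - s)) = exp (- lam k * t) * exp (lam k * s)" for s
    by (subst exp_add[symmetric]) (simp add: algebra_simps)
  then show ?thesis unfolding duhamel_def by (simp add: mult.assoc)
qed

text \<open>Against the weight \<open>exp (\<Lambda> * s)\<close> the heat factor integrates to a
  gain of \<open>1 / (\<Lambda> + lam k)\<close>: the smoothing of mode k and the smallness due to
  \<Lambda> sit in one denominator.\<close>

lemma duhamel_bound: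
  assumes f: "f integrable_on {0..T}" and C: "\<And>s. s \<in> {0..T} \<Longrightarrow> \<bar>f s\<bar> \<le> C"
    and M: "\<And>s. s \<in> {0..t} \<Longrightarrow> \<bar>f s\<bar> \<le> M * exp (\<Lambda> * s)" and t: "t \<in> {0..T}" and \<Lambda>: "0 < \<Lambda>"
  shows "\<bar>duhamel k f t\<bar> \<le> M * exp (\<Lambda> * t) / (\<Lambda> + lam k)"
proof -
  have pos: "0 < \<Lambda> + lam k" using \<Lambda> lam_nonneg[of k] by linarith
  have "0 \<le> M * exp (\<Lambda> * 0)" using order_trans[OF abs_ge_zero M[of 0]] t by auto
  then have M0: "0 \<le> M" by simp
  have "\<bar>duhamel k f t\<bar> \<le> integral {0..t} (\<lambda>s. M * exp (\<Lambda> * t) * exp (- (\<Lambda> + lam k) * (t - s)))"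
    unfolding duhamel_def real_norm_def[symmetric]
  proof (rule integral_norm_bound_integral)
    show "(\<lambda>s. exp (- lam k * (t - s)) * f s) integrable_on {0..t}"
      using t by (intro exp_mult_integrable[OF f C] continuous_intros) auto
    show "(\<lambda>s. M * exp (\<Lambda> * t) * exp (- (\<Lambda> + lam k) * (t - s))) integrable_on {0..t}"
      by (intro integrable_continuous_interval continuous_intros)
    show "norm (exp (- lam k * (t - s)) * f s) \<le> M * exp (\<Lambda> * t) * exp (- (\<Lambda> + lam k) * (t - s))" if "s \<in> {0..t}" for s
    proof -
      have "exp (- lam k * (t - s)) * \<bar>f s\<bar> \<le> exp (- lam k * (t - s)) * (M * exp (\<Lambda> * s))"
        using M[OF that] by (intro mult_left_mono) auto
      also have "\<dots> = M * exp (\<Lambda> * t) * exp (- (\<Lambda> + lam k) * (t - s))"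
      proof -
        have "exp (- lam k * (t - s)) * exp (\<Lambda> * s) = exp (\<Lambda> * t) * exp (- (\<Lambda> + lam k) * (t - s))"
          by (subst (1 2) exp_add[symmetric]) (simp add: algebra_simps)
        then show ?thesis by (simp only: mult_ac)
      qed
      finally show ?thesis by (simp add: abs_mult)
    qed
  qed
  also have "\<dots> = M * exp (\<Lambda> * t) * integral {0..t} (\<lambda>s. exp (- (\<Lambda> + lam k) * (t - s)))" by simp
  also have "\<dots> \<le> M * exp (\<Lambda> * t) * (1 / (\<Lambda> + lam k))"
    using M0 t pos by (intro mult_left_mono integral_exp_le) auto
  finally show ?thesis by simp
qed

lemma duhamel_continuous:
  assumes f: "f integrable_on {0..T}" and C: "\<And>s. s \<in> {0..T} \<Longrightarrow> \<bar>f s\<bar> \<le> C"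
  shows "continuous_on {0..T} (duhamel k f)"
  unfolding duhamel_eq[abs_def]
  by (intro continuous_intros indefinite_integral_continuous_1 exp_mult_integrable[OF f C]) auto

text \<open>Continuity is asked for at the single time t, since the sources are continuous at
  positive times only.\<close>

lemma duhamel_deriv:
  assumes f: "f integrable_on {0..T}" and C: "\<And>s. s \<in> {0..T} \<Longrightarrow> \<bar>f s\<bar> \<le> C"
    and t: "t \<in> {0<..<T}" and cont: "continuous (at t within {0..T}) f"
  shows "(duhamel k f has_real_derivative f t - lam k * duhamel k f t) (at t)"
proof -
  let ?g = "\<lambda>s. exp (lam k * s) * f s"
  have "?g integrable_on {0..T}"
    by (intro exp_mult_integrable[OF f C] continuous_intros) auto
  moreover have "continuous (at t within {0..T}) ?g"
    by (intro continuous_intros cont)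
  ultimately have "((\<lambda>u. integral {0..u} ?g) has_vector_derivative ?g t) (at t within {0..T})"
    using integral_has_vector_derivative_continuous_at[of ?g 0 T t "{}"] t by simp
  moreover have "at t within {0..T} = at t" using t by (intro at_within_interior) (auto simp: interior_atLeastAtMost_real)
  ultimately have d: "((\<lambda>u. integral {0..u} ?g) has_real_derivative ?g t) (at t)"
    by (simp add: has_real_derivative_iff_has_vector_derivative)
  have "((\<lambda>u. exp (- lam k * u) * integral {0..u} ?g) has_real_derivative
      (exp (- lam k * t) * - lam k) * integral {0..t} ?g + ?g t * exp (- lam k * t)) (at t)"
    by (rule DERIV_mult[OF _ d]) (auto intro!: derivative_eq_intros)
  then show ?thesis
    unfolding duhamel_eq[abs_def]
  proof (rule DERIV_cong)
    have "exp (lam k * t) * exp (- lam k * t) = 1" by (subst exp_add[symmetric]) simp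
    then have "exp (lam k * t) * f t * exp (- lam k * t) = f t" by (simp add: mult.commute mult.left_commute)
    then show "(exp (- lam k * t) * - lam k) * integral {0..t} ?g + ?g t * exp (- lam k * t)
      = f t - lam k * (exp (- lam k * t) * integral {0..t} ?g)" by simp
  qed
qed

lemma duhamel_diff:
  assumes f: "f integrable_on {0..T}" "\<And>s. s \<in> {0..T} \<Longrightarrow> \<bar>f s\<bar> \<le> C"
    and g: "g integrable_on {0..T}" "\<And>s. s \<in> {0..T} \<Longrightarrow> \<bar>g s\<bar> \<le> C'" and t: "t \<in> {0..T}"
  shows "duhamel k (\<lambda>s. f s - g s) t = duhamel k f t - duhamel k g t"
proof -
  have "(\<lambda>s. exp (- lam k * (t - s)) * f s) integrable_on {0..t}" "(\<lambda>s. exp (- lam k * (t - s)) * g s) integrable_on {0..t}"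
    using t by (intro exp_mult_integrable[OF f] exp_mult_integrable[OF g] continuous_intros; simp)+
  then show ?thesis
    unfolding duhamel_def by (simp add: right_diff_distrib Henstock_Kurzweil_Integration.integral_diff)
qed

section \<open>The fixed point for the boundary traces\<close>

locale volterra =
  fixes T LF Q :: real and F :: "bool \<Rightarrow> real \<Rightarrow> real" and gam :: "nat \<Rightarrow> real"
  assumes T: "0 < T" and LF: "0 \<le> LF" "\<And>\<sigma> x y. \<bar>F \<sigma> x - F \<sigma> y\<bar> \<le> LF * \<bar>x - y\<bar>"
    and Q: "\<And>\<sigma> x. \<bar>F \<sigma> x\<bar> \<le> Q" and gam: "\<And>k. \<bar>gam k\<bar> \<le> 1"
begin

lemma Q_nonneg: "0 \<le> Q" using order_trans[OF abs_ge_zero Q] .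

lemma F_cont: "continuous_on S (F \<sigma>)"
proof (rule continuous_on_subset[OF _ subset_UNIV])
  have "LF-lipschitz_on UNIV (F \<sigma>)"
    using LF by (intro lipschitz_onI) (auto simp: dist_real_def)
  then show "continuous_on UNIV (F \<sigma>)" by (rule lipschitz_on_continuous_on)
qed

text \<open>The trace, at the end point \<sigma>, of the heat flow with insulated ends started from
  the initial profile. It need not have a limit at time 0.\<close>

definition Gm :: "bool \<Rightarrow> real \<Rightarrow> real" where
  "Gm \<sigma> t = (\<Sum>k. wt k * (sg \<sigma> ^ k * (exp (- lam k * t) * gam k)))"

text \<open>The inequality exp (-x) \<le> 1 / (1 + x) trades exponential decay for the family of
  \<open>lam_summable\<close>, with 1 / t in the role of \<Lambda>, so that one summability lemma
  serves all series.\<close>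

lemma Gm_term_bound:
  assumes "0 < t"
  shows "\<bar>wt k * (sg \<sigma> ^ k * (exp (- lam k * t) * gam k))\<bar> \<le> (2 / t) / (1 / t + lam k)"
proof -
  have p: "0 < 1 + lam k * t" using assms lam_nonneg[of k] by (intro add_pos_nonneg) auto
  have "1 + lam k * t \<le> exp (lam k * t)" by (rule exp_ge_add_one_self)
  then have e: "exp (- lam k * t) \<le> 1 / (1 + lam k * t)"
    using p by (simp add: exp_minus field_simps)
  have "\<bar>wt k * (sg \<sigma> ^ k * (exp (- lam k * t) * gam k))\<bar> = wt k * (exp (- lam k * t) * \<bar>gam k\<bar>)"
    by (simp add: abs_mult)
  also have "\<dots> \<le> 2 * (exp (- lam k * t) * 1)"
    using gam[of k] by (intro mult_mono wt_le_2) auto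
  also have "\<dots> \<le> 2 * (1 / (1 + lam k * t))" using e by simp
  also have "\<dots> = (2 / t) / (1 / t + lam k)" using assms by (simp add: field_simps)
  finally show ?thesis .
qed

lemma Gm_term_summable: "0 < t \<Longrightarrow> summable (\<lambda>k. \<bar>wt k * (sg \<sigma> ^ k * (exp (- lam k * t) * gam k))\<bar>)"
  by (rule summable_comparison_test[OF _ summable_mult[OF lam_summable, of "1/t" "1/t"]])
    (use Gm_term_bound in auto)

lemma Gm_continuous: "continuous_on {0<..} (Gm \<sigma>)"
proof -
  have "isCont (Gm \<sigma>) t" if t: "0 < t" for t
  proof -
    have "uniform_limit {t/2..} (\<lambda>n t. \<Sum>k<n. wt k * (sg \<sigma> ^ k * (exp (- lam k * t) * gam k))) (Gm \<sigma>) sequentially"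
      unfolding Gm_def[abs_def]
    proof (rule Weierstrass_m_test)
      show "norm (wt k * (sg \<sigma> ^ k * (exp (- lam k * s) * gam k))) \<le> (2 / (t/2)) / (1 / (t/2) + lam k)" if "s \<in> {t/2..}" for k s
      proof -
        have "norm (wt k * (sg \<sigma> ^ k * (exp (- lam k * s) * gam k))) \<le> \<bar>wt k * (sg \<sigma> ^ k * (exp (- lam k * (t/2)) * gam k))\<bar>"
          using mult_left_mono[OF _ lam_nonneg[of k], of t "2 * s"] that
          by (auto simp: abs_mult intro!: mult_left_mono mult_right_mono)
        also have "\<dots> \<le> (2 / (t/2)) / (1 / (t/2) + lam k)" using t by (intro Gm_term_bound) auto
        finally show ?thesis .
      qed
      show "summable (\<lambda>k. (2 / (t/2)) / (1 / (t/2) + lam k))"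
        using summable_mult[OF lam_summable[of "1/(t/2)"], of "1/(t/2)"] t by simp
    qed
    then have "continuous_on {t/2..} (Gm \<sigma>)"
      by (rule uniform_limit_theorem[rotated]) (auto intro!: continuous_intros always_eventually)
    moreover have "t \<in> interior {t/2..}" using t by (simp add: interior_real_atLeast)
    ultimately show ?thesis by (rule continuous_on_interior)
  qed
  then show ?thesis by (simp add: continuous_at_imp_continuous_on)
qed

definition src :: "(bool \<Rightarrow> real \<Rightarrow> real) \<Rightarrow> nat \<Rightarrow> real \<Rightarrow> real" where
  "src D k s = (\<Sum>\<tau>\<in>UNIV. sg \<tau> ^ k * F \<tau> (Gm \<tau> s + D \<tau> s))"

text \<open>The unknown \<open>D\<close> is the trace minus \<open>Gm\<close>. This difference is
  continuous up to time 0, so the iteration can run in continuous functions on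
  \<open>{0..T}\<close>, although the traces themselves need not belong to that space.\<close>

definition \<Phi> :: "(bool \<Rightarrow> real \<Rightarrow> real) \<Rightarrow> bool \<Rightarrow> real \<Rightarrow> real" where
  "\<Phi> D \<sigma> t = (\<Sum>k. wt k * (sg \<sigma> ^ k * duhamel k (src D k) t))"

abbreviation good :: "(bool \<Rightarrow> real \<Rightarrow> real) \<Rightarrow> bool" where
  "good D \<equiv> (\<forall>\<sigma>. continuous_on {0..T} (D \<sigma>))"

lemma src_bound: "\<bar>src D k s\<bar> \<le> 2 * Q"
proof -
  have "\<bar>src D k s\<bar> \<le> (\<Sum>\<tau>\<in>(UNIV::bool set). Q)"
    unfolding src_def by (rule order_trans[OF sum_abs sum_mono]) (simp add: abs_mult Q)
  then show ?thesis by (simp add: UNIV_bool)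
qed

lemma flux_continuous: "good D \<Longrightarrow> continuous_on {0<..T} (\<lambda>s. F \<tau> (Gm \<tau> s + D \<tau> s))"
proof -
  assume D: "good D"
  have "continuous_on {0<..T} (\<lambda>s. Gm \<tau> s + D \<tau> s)"
    by (rule continuous_on_add[OF continuous_on_subset[OF Gm_continuous] continuous_on_subset[of "{0..T}" "D \<tau>"]])
      (use D in auto)
  then show ?thesis by (rule continuous_on_compose2[OF F_cont[of UNIV]]) auto
qed

lemma src_continuous: "good D \<Longrightarrow> continuous_on {0<..T} (src D k)"
  unfolding src_def by (intro continuous_intros flux_continuous)

lemma src_integrable: "good D \<Longrightarrow> src D k integrable_on {0..T}"
  by (rule integrable_on_half_open[OF src_continuous src_bound])

text \<open>Uniform convergence with the majorant \<open>2 / (1 + lam k)\<close>. The sources are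
  arbitrary bounded ones, so that the lemma serves the iteration and also the traces of an arbitrary
  weak solution.\<close>

lemma duhamel_series:
  assumes \<psi>: "\<And>k. \<psi> k integrable_on {0..T}" "\<And>k s. \<bar>\<psi> k s\<bar> \<le> 2 * Q"
  shows duhamel_bounded: "t \<in> {0..T} \<Longrightarrow> \<bar>duhamel k (\<psi> k) t\<bar> \<le> 2 * Q * exp T / (1 + lam k)"
    and duhamel_series_term: "t \<in> {0..T} \<Longrightarrow> \<bar>wt k * (sg \<sigma> ^ k * duhamel k (\<psi> k) t)\<bar> \<le> 2 * Q * exp T * (2 / (1 + lam k))"
    and duhamel_series_summable: "t \<in> {0..T} \<Longrightarrow> summable (\<lambda>k. wt k * (sg \<sigma> ^ k * duhamel k (\<psi> k) t))"
    and duhamel_series_continuous: "continuous_on {0..T} (\<lambda>t. \<Sum>k. wt k * (sg \<sigma> ^ k * duhamel k (\<psi> k) t))"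
proof -
  show b: "\<bar>duhamel k (\<psi> k) t\<bar> \<le> 2 * Q * exp T / (1 + lam k)" if t: "t \<in> {0..T}" for k t
  proof -
    have "\<bar>duhamel k (\<psi> k) t\<bar> \<le> 2 * Q * exp (1 * t) / (1 + lam k)"
    proof (rule duhamel_bound[OF \<psi> _ t])
      show "\<bar>\<psi> k s\<bar> \<le> 2 * Q * exp (1 * s)" if "s \<in> {0..t}" for s
      proof -
        have "2 * Q * 1 \<le> 2 * Q * exp (1 * s)" using that Q_nonneg by (intro mult_left_mono) auto
        then show ?thesis using \<psi>(2)[of k s] by linarith
      qed
    qed auto
    also have "\<dots> \<le> 2 * Q * exp T / (1 + lam k)"
      using t Q_nonneg by (intro divide_right_mono mult_left_mono) auto
    finally show ?thesis .
  qed
  show tb: "\<bar>wt k * (sg \<sigma> ^ k * duhamel k (\<psi> k) t)\<bar> \<le> 2 * Q * exp T * (2 / (1 + lam k))" if "t \<in> {0..T}" for k t \<sigma>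
  proof -
    have "\<bar>wt k * (sg \<sigma> ^ k * duhamel k (\<psi> k) t)\<bar> = wt k * \<bar>duhamel k (\<psi> k) t\<bar>" by (simp add: abs_mult)
    also have "\<dots> \<le> 2 * (2 * Q * exp T / (1 + lam k))"
      using b[OF that, of k] by (intro mult_mono wt_le_2) auto
    finally show ?thesis by simp
  qed
  show "summable (\<lambda>k. wt k * (sg \<sigma> ^ k * duhamel k (\<psi> k) t))" if "t \<in> {0..T}" for t
    by (rule suminf_abs_le(1)[OF tb[OF that] summable_mult[OF lam_summable]]) auto
  have "uniform_limit {0..T} (\<lambda>n t. \<Sum>k<n. wt k * (sg \<sigma> ^ k * duhamel k (\<psi> k) t)) (\<lambda>t. \<Sum>k. wt k * (sg \<sigma> ^ k * duhamel k (\<psi> k) t)) sequentially"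
    by (rule Weierstrass_m_test[OF _ summable_mult[OF lam_summable[of 1], of "2 * Q * exp T"]])
      (use tb in auto)
  then show "continuous_on {0..T} (\<lambda>t. \<Sum>k. wt k * (sg \<sigma> ^ k * duhamel k (\<psi> k) t))"
    by (rule uniform_limit_theorem[rotated])
      (auto intro!: continuous_intros always_eventually duhamel_continuous[OF \<psi>])
qed

lemma \<Phi>_good: "good D \<Longrightarrow> good (\<Phi> D)"
  unfolding \<Phi>_def[abs_def] by (intro allI duhamel_series_continuous src_integrable src_bound) auto

lemma \<Phi>_bound: "good D \<Longrightarrow> t \<in> {0..T} \<Longrightarrow> \<bar>\<Phi> D \<sigma> t\<bar> \<le> 2 * Q * exp T * (\<Sum>k. 2 / (1 + lam k))"
  unfolding \<Phi>_def using suminf_abs_le(2)[OF duhamel_series_term[OF src_integrable src_bound] summable_mult[OF lam_summable]]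
    suminf_mult[OF lam_summable[of 1], of "2 * Q * exp T"] by simp

text \<open>A source collects two boundaries, hence \<open>2 * LF\<close>, and \<open>wt\<close>
  adds at most a factor 2; the condition on \<Lambda> makes the total 1/2.\<close>

lemma \<Phi>_contraction:
  assumes D: "good D" "good D'" and M: "\<And>\<sigma> s. s \<in> {0..T} \<Longrightarrow> \<bar>D \<sigma> s - D' \<sigma> s\<bar> \<le> M * exp (\<Lambda> * s)"
    and \<Lambda>: "1 \<le> \<Lambda>" "4 * LF * (\<Sum>k. 2 / (\<Lambda> + lam k)) \<le> 1" and t: "t \<in> {0..T}"
  shows "\<bar>\<Phi> D \<sigma> t - \<Phi> D' \<sigma> t\<bar> \<le> M / 2 * exp (\<Lambda> * t)"
proof -
  have M0: "0 \<le> M" using order_trans[OF abs_ge_zero M[of 0]] T by auto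
  have d: "\<bar>duhamel k (src D k) t - duhamel k (src D' k) t\<bar> \<le> 2 * LF * M * exp (\<Lambda> * t) / (\<Lambda> + lam k)" for k
  proof -
    have "\<bar>src D k s - src D' k s\<bar> \<le> 2 * LF * M * exp (\<Lambda> * s)" if s: "s \<in> {0..T}" for s
    proof -
      have "\<bar>src D k s - src D' k s\<bar> \<le> (\<Sum>\<tau>\<in>(UNIV::bool set). LF * (M * exp (\<Lambda> * s)))"
        unfolding src_def sum_subtractf[symmetric]
      proof (rule order_trans[OF sum_abs sum_mono])
        fix \<tau> :: bool
        have "\<bar>F \<tau> (Gm \<tau> s + D \<tau> s) - F \<tau> (Gm \<tau> s + D' \<tau> s)\<bar> \<le> LF * \<bar>D \<tau> s - D' \<tau> s\<bar>"
          using LF(2)[of \<tau> "Gm \<tau> s + D \<tau> s" "Gm \<tau> s + D' \<tau> s"] by simp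
        also have "\<dots> \<le> LF * (M * exp (\<Lambda> * s))" using LF(1) M[OF s] by (intro mult_left_mono)
        finally show "\<bar>sg \<tau> ^ k * F \<tau> (Gm \<tau> s + D \<tau> s) - sg \<tau> ^ k * F \<tau> (Gm \<tau> s + D' \<tau> s)\<bar> \<le> LF * (M * exp (\<Lambda> * s))"
          by (simp add: abs_mult flip: right_diff_distrib)
      qed
      then show ?thesis by (simp add: UNIV_bool)
    qed
    moreover have "\<bar>src D k s - src D' k s\<bar> \<le> 4 * Q" for s using src_bound[of D k s] src_bound[of D' k s] by linarith
    moreover have "(\<lambda>s. src D k s - src D' k s) integrable_on {0..T}"
      using src_integrable D by (intro integrable_diff) auto
    ultimately have "\<bar>duhamel k (\<lambda>s. src D k s - src D' k s) t\<bar> \<le> 2 * LF * M * exp (\<Lambda> * t) / (\<Lambda> + lam k)"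
      using t \<Lambda>(1) by (intro duhamel_bound[where C = "4 * Q" and T = T]) auto
    then show ?thesis
      using duhamel_diff[OF src_integrable[OF D(1)] src_bound src_integrable[OF D(2)] src_bound t] by simp
  qed
  have tb: "\<bar>wt k * (sg \<sigma> ^ k * duhamel k (src D k) t) - wt k * (sg \<sigma> ^ k * duhamel k (src D' k) t)\<bar>
     \<le> 2 * LF * M * exp (\<Lambda> * t) * (2 / (\<Lambda> + lam k))" for k
  proof -
    have "\<bar>wt k * (sg \<sigma> ^ k * duhamel k (src D k) t) - wt k * (sg \<sigma> ^ k * duhamel k (src D' k) t)\<bar>
      = wt k * \<bar>duhamel k (src D k) t - duhamel k (src D' k) t\<bar>"
      by (simp add: abs_mult flip: right_diff_distrib)
    also have "\<dots> \<le> 2 * (2 * LF * M * exp (\<Lambda> * t) / (\<Lambda> + lam k))"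
      using d[of k] by (intro mult_mono wt_le_2) auto
    finally show ?thesis by (simp add: mult_ac)
  qed
  have "\<Phi> D \<sigma> t - \<Phi> D' \<sigma> t = (\<Sum>k. wt k * (sg \<sigma> ^ k * duhamel k (src D k) t) - wt k * (sg \<sigma> ^ k * duhamel k (src D' k) t))"
    unfolding \<Phi>_def by (rule suminf_diff[OF duhamel_series_summable[OF src_integrable[OF D(1)] src_bound t] duhamel_series_summable[OF src_integrable[OF D(2)] src_bound t]])
  then have "\<bar>\<Phi> D \<sigma> t - \<Phi> D' \<sigma> t\<bar> \<le> (\<Sum>k. 2 * LF * M * exp (\<Lambda> * t) * (2 / (\<Lambda> + lam k)))"
    using suminf_abs_le(2)[OF tb summable_mult[OF lam_summable]] \<Lambda>(1) by simp
  also have "\<dots> = M / 2 * exp (\<Lambda> * t) * (4 * LF * (\<Sum>k. 2 / (\<Lambda> + lam k)))"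
    using suminf_mult[OF lam_summable[of \<Lambda>], of "2 * LF * M * exp (\<Lambda> * t)"] \<Lambda>(1) by simp
  also have "\<dots> \<le> M / 2 * exp (\<Lambda> * t) * 1" using M0 \<Lambda>(2) by (intro mult_left_mono) auto
  finally show ?thesis by simp
qed

text \<open>Picard iteration, written as a telescoping series so that the Weierstrass test yields
  uniform convergence, and with it the continuity of the limit.\<close>

lemma fixed_point: "\<exists>D. good D \<and> (\<forall>\<sigma>. \<forall>t\<in>{0..T}. D \<sigma> t = \<Phi> D \<sigma> t)"
proof -
  obtain \<Lambda> where \<Lambda>: "1 \<le> \<Lambda>" and \<Lambda>2: "4 * LF * (\<Sum>k. 2 / (\<Lambda> + lam k)) \<le> 1"
    using lam_contraction[of "4 * LF"] LF(1) by auto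
  define P where "P n = (\<Phi> ^^ n) (\<lambda>\<sigma> t. 0)" for n
  have P0: "P 0 = (\<lambda>\<sigma> t. 0)" and PS: "P (Suc n) = \<Phi> (P n)" for n by (simp_all add: P_def)
  have gP: "good (P n)" for n
  proof (induction n)
    case (Suc n) then show ?case unfolding PS by (rule \<Phi>_good)
  qed (simp add: P0)
  define M0 where "M0 = 2 * Q * exp T * (\<Sum>k. 2 / (1 + lam k))"
  have step: "\<forall>\<sigma>. \<forall>s\<in>{0..T}. \<bar>P (Suc n) \<sigma> s - P n \<sigma> s\<bar> \<le> M0 / 2^n * exp (\<Lambda> * s)" for n
  proof (induction n)
    case 0
    show ?case
    proof (intro allI ballI)
      fix \<sigma> s assume s: "s \<in> {0..T}"
      have "\<bar>\<Phi> (P 0) \<sigma> s\<bar> \<le> M0" unfolding M0_def by (rule \<Phi>_bound[OF gP s])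
      also have "M0 \<le> M0 * exp (\<Lambda> * s)"
        using order_trans[OF abs_ge_zero calculation] s \<Lambda> by (simp add: mult_le_cancel_left1)
      finally show "\<bar>P (Suc 0) \<sigma> s - P 0 \<sigma> s\<bar> \<le> M0 / 2 ^ 0 * exp (\<Lambda> * s)" by (simp add: PS P0)
    qed
  next
    case (Suc n)
    show ?case
    proof (intro allI ballI)
      fix \<sigma> s assume s: "s \<in> {0..T}"
      have "\<bar>\<Phi> (P (Suc n)) \<sigma> s - \<Phi> (P n) \<sigma> s\<bar> \<le> M0 / 2^n / 2 * exp (\<Lambda> * s)"
        using Suc by (intro \<Phi>_contraction[OF gP gP _ \<Lambda> \<Lambda>2 s]) auto
      then show "\<bar>P (Suc (Suc n)) \<sigma> s - P (Suc n) \<sigma> s\<bar> \<le> M0 / 2^Suc n * exp (\<Lambda> * s)" by (simp add: PS mult.commute)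
    qed
  qed
  have M00: "0 \<le> M0" using Q_nonneg lam_summable[of 1]
    unfolding M0_def by (intro mult_nonneg_nonneg suminf_nonneg) auto
  define D where "D \<sigma> t = (\<Sum>n. P (Suc n) \<sigma> t - P n \<sigma> t)" for \<sigma> t
  define B where "B n = M0 * exp (\<Lambda> * T) * (1/2)^n" for n :: nat
  have Bs: "summable B" unfolding B_def by (intro summable_mult) auto
  have stepB: "\<bar>P (Suc n) \<sigma> s - P n \<sigma> s\<bar> \<le> B n" if "s \<in> {0..T}" for n \<sigma> s
  proof -
    have "M0 / 2^n * exp (\<Lambda> * s) \<le> M0 / 2^n * exp (\<Lambda> * T)"
      using M00 that \<Lambda> by (intro mult_left_mono) auto
    moreover have "\<bar>P (Suc n) \<sigma> s - P n \<sigma> s\<bar> \<le> M0 / 2^n * exp (\<Lambda> * s)"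
      using step[of n] that by blast
    moreover have "B n = M0 / 2^n * exp (\<Lambda> * T)" by (simp add: B_def power_divide)
    ultimately show ?thesis by linarith
  qed
  have tel: "(\<Sum>i<n. P (Suc i) \<sigma> t - P i \<sigma> t) = P n \<sigma> t" for n \<sigma> t
    using sum_lessThan_telescope[of "\<lambda>i. P i \<sigma> t" n] by (simp add: P0)
  have ul: "uniform_limit {0..T} (\<lambda>n t. P n \<sigma> t) (D \<sigma>) sequentially" for \<sigma>
    using Weierstrass_m_test[of "{0..T}" "\<lambda>n t. P (Suc n) \<sigma> t - P n \<sigma> t" B] stepB Bs
    unfolding D_def[abs_def] tel by simp
  have gD: "good D"
    using uniform_limit_theorem[OF always_eventually ul] gP by auto
  have "D \<sigma> t = \<Phi> D \<sigma> t" if t: "t \<in> {0..T}" for \<sigma> t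
  proof -
    have ev: "eventually (\<lambda>n. \<forall>s\<in>{0..T}. \<bar>P n \<tau> s - D \<tau> s\<bar> < \<epsilon>) sequentially" if "0 < \<epsilon>" for \<epsilon> \<tau>
      using uniform_limitD[OF ul that] by (simp add: dist_real_def)
    have "\<bar>D \<sigma> t - \<Phi> D \<sigma> t\<bar> \<le> \<epsilon> * (1 + exp (\<Lambda> * T))" if \<epsilon>: "0 < \<epsilon>" for \<epsilon>
    proof -
      have "eventually (\<lambda>n. \<forall>\<tau>. \<forall>s\<in>{0..T}. \<bar>P n \<tau> s - D \<tau> s\<bar> < \<epsilon>) sequentially"
        using eventually_conj[OF ev[OF \<epsilon>, of True] ev[OF \<epsilon>, of False]]
        by (rule eventually_mono) (rule allI, case_tac \<tau>, simp_all)
      then obtain m where m: "\<And>n \<tau> s. m \<le> n \<Longrightarrow> s \<in> {0..T} \<Longrightarrow> \<bar>P n \<tau> s - D \<tau> s\<bar> < \<epsilon>"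
        unfolding eventually_sequentially by blast
      have "\<bar>P m \<tau> s - D \<tau> s\<bar> \<le> \<epsilon> * exp (\<Lambda> * s)" if "s \<in> {0..T}" for \<tau> s
      proof -
        have "\<epsilon> * 1 \<le> \<epsilon> * exp (\<Lambda> * s)" using \<epsilon> \<Lambda> that by (intro mult_left_mono) auto
        then show ?thesis using m[OF order_refl that, of \<tau>] by linarith
      qed
      then have "\<bar>\<Phi> (P m) \<sigma> t - \<Phi> D \<sigma> t\<bar> \<le> \<epsilon> / 2 * exp (\<Lambda> * t)"
        by (intro \<Phi>_contraction[OF gP gD _ \<Lambda> \<Lambda>2 t])
      also have "\<dots> \<le> \<epsilon> * exp (\<Lambda> * T)" using \<epsilon> \<Lambda> t by (intro mult_mono) auto
      finally have "\<bar>P (Suc m) \<sigma> t - \<Phi> D \<sigma> t\<bar> \<le> \<epsilon> * exp (\<Lambda> * T)" by (simp add: PS)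
      moreover have "\<bar>P (Suc m) \<sigma> t - D \<sigma> t\<bar> < \<epsilon>" using m[of "Suc m" t \<sigma>] t by simp
      ultimately show ?thesis by (simp add: algebra_simps)
    qed
    note * = this
    show ?thesis
    proof (rule ccontr)
      assume ne: "D \<sigma> t \<noteq> \<Phi> D \<sigma> t"
      have p: "0 < 1 + exp (\<Lambda> * T)" by (simp add: add_pos_pos)
      have "x / (2 * c) * c = x / 2" if "0 < c" for x c :: real
        using that by (simp add: field_simps)
      from this[OF p] have eq: "\<bar>D \<sigma> t - \<Phi> D \<sigma> t\<bar> / (2 * (1 + exp (\<Lambda> * T))) * (1 + exp (\<Lambda> * T)) = \<bar>D \<sigma> t - \<Phi> D \<sigma> t\<bar> / 2" .
      have "0 < \<bar>D \<sigma> t - \<Phi> D \<sigma> t\<bar> / (2 * (1 + exp (\<Lambda> * T)))" using ne p by simp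
      from *[OF this] have "\<bar>D \<sigma> t - \<Phi> D \<sigma> t\<bar> \<le> \<bar>D \<sigma> t - \<Phi> D \<sigma> t\<bar> / 2" by (simp only: eq)
      then show False using ne by simp
    qed
  qed
  then show ?thesis using gD by blast
qed

lemma \<Phi>_fixed_unique:
  assumes D: "good D" "good D'" and fp: "\<And>\<sigma> t. t \<in> {0..T} \<Longrightarrow> D \<sigma> t = \<Phi> D \<sigma> t" "\<And>\<sigma> t. t \<in> {0..T} \<Longrightarrow> D' \<sigma> t = \<Phi> D' \<sigma> t"
    and t: "t \<in> {0..T}"
  shows "D \<sigma> t = D' \<sigma> t"
proof -
  obtain \<Lambda> where \<Lambda>: "1 \<le> \<Lambda>" and \<Lambda>2: "4 * LF * (\<Sum>k. 2 / (\<Lambda> + lam k)) \<le> 1"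
    using lam_contraction[of "4 * LF"] LF(1) by auto
  define M0 where "M0 = 2 * Q * exp T * (\<Sum>k. 2 / (1 + lam k))"
  have b: "\<bar>\<Phi> E \<sigma> s\<bar> \<le> M0" if "good E" "s \<in> {0..T}" for E \<sigma> s
    unfolding M0_def by (rule \<Phi>_bound[OF that])
  have M00: "0 \<le> M0" using b[OF D(1) t] order_trans[OF abs_ge_zero] by blast
  have "\<forall>\<sigma>. \<forall>s\<in>{0..T}. \<bar>D \<sigma> s - D' \<sigma> s\<bar> \<le> 2 * M0 / 2^n * exp (\<Lambda> * s)" for n
  proof (induction n)
    case 0
    show ?case
    proof (intro allI ballI)
      fix \<sigma> s assume s: "s \<in> {0..T}"
      have "\<bar>D \<sigma> s - D' \<sigma> s\<bar> \<le> 2 * M0 * 1"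
        unfolding fp(1)[OF s] fp(2)[OF s] using b[OF D(1) s, of \<sigma>] b[OF D(2) s, of \<sigma>] by linarith
      also have "\<dots> \<le> 2 * M0 * exp (\<Lambda> * s)" using M00 \<Lambda> s by (intro mult_left_mono) auto
      finally show "\<bar>D \<sigma> s - D' \<sigma> s\<bar> \<le> 2 * M0 / 2^0 * exp (\<Lambda> * s)" by simp
    qed
  next
    case (Suc n)
    show ?case
    proof (intro allI ballI)
      fix \<sigma> s assume s: "s \<in> {0..T}"
      have "\<bar>\<Phi> D \<sigma> s - \<Phi> D' \<sigma> s\<bar> \<le> 2 * M0 / 2^n / 2 * exp (\<Lambda> * s)"
        using Suc by (intro \<Phi>_contraction[OF D _ \<Lambda> \<Lambda>2 s]) auto
      then show "\<bar>D \<sigma> s - D' \<sigma> s\<bar> \<le> 2 * M0 / 2^Suc n * exp (\<Lambda> * s)"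
        by (simp add: fp(1)[OF s, symmetric] fp(2)[OF s, symmetric] mult.commute)
    qed
  qed
  then have le: "\<bar>D \<sigma> t - D' \<sigma> t\<bar> \<le> 2 * M0 * exp (\<Lambda> * t) * (1 / 2)^n" for n
    using t by (auto simp: power_one_over)
  have "(\<lambda>n. 2 * M0 * exp (\<Lambda> * t) * (1 / 2)^n) \<longlonglongrightarrow> 2 * M0 * exp (\<Lambda> * t) * 0"
    by (intro tendsto_intros LIMSEQ_realpow_zero) auto
  then have "\<bar>D \<sigma> t - D' \<sigma> t\<bar> \<le> 2 * M0 * exp (\<Lambda> * t) * 0"
    by (rule LIMSEQ_le_const) (use le in auto)
  then show ?thesis by simp
qed

text \<open>Whenever the traces are the sums of the modes that they generate, their Duhamel part is
  a fixed point of \<Phi>. The lemma is applied to the constructed solution and to an arbitrary weak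
  one. Nothing is assumed about the sources at time 0, a null set for the integrals.\<close>

lemma trace_fixed_point:
  assumes \<psi>: "\<And>k. \<psi> k integrable_on {0..T}" "\<And>k s. s \<in> {0<..T} \<Longrightarrow> \<psi> k s = (\<Sum>\<sigma>\<in>UNIV. sg \<sigma> ^ k * F \<sigma> (b \<sigma> s))"
    and b: "\<And>\<sigma> t. t \<in> {0<..T} \<Longrightarrow> b \<sigma> t = (\<Sum>k. wt k * (sg \<sigma> ^ k * (exp (- lam k * t) * gam k + duhamel k (\<psi> k) t)))"
    and \<psi>b: "\<And>k s. \<bar>\<psi> k s\<bar> \<le> 2 * Q"
  obtains D where "good D" "\<And>\<sigma> t. t \<in> {0..T} \<Longrightarrow> D \<sigma> t = \<Phi> D \<sigma> t" "\<And>\<sigma> t. t \<in> {0<..T} \<Longrightarrow> b \<sigma> t = Gm \<sigma> t + D \<sigma> t"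
    "\<And>k t. t \<in> {0..T} \<Longrightarrow> duhamel k (\<psi> k) t = duhamel k (src D k) t"
proof -
  define D where "D \<sigma> t = (\<Sum>k. wt k * (sg \<sigma> ^ k * duhamel k (\<psi> k) t))" for \<sigma> t
  have gD: "good D"
    unfolding D_def[abs_def] by (intro allI duhamel_series_continuous \<psi>(1) \<psi>b)
  have bD: "b \<sigma> t = Gm \<sigma> t + D \<sigma> t" if t: "t \<in> {0<..T}" for \<sigma> t
  proof -
    have tT: "t \<in> {0..T}" "0 < t" using t by auto
    have "b \<sigma> t = (\<Sum>k. wt k * (sg \<sigma> ^ k * (exp (- lam k * t) * gam k)) + wt k * (sg \<sigma> ^ k * duhamel k (\<psi> k) t))"
      unfolding b[OF t] by (simp add: distrib_left)
    then show ?thesis unfolding Gm_def D_def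
      using suminf_add[OF summable_rabs_cancel[OF Gm_term_summable[OF tT(2)]] duhamel_series_summable[OF \<psi>(1) \<psi>b tT(1)]] by simp
  qed
  have deq: "duhamel k (\<psi> k) t = duhamel k (src D k) t" if t: "t \<in> {0..T}" for k t
    unfolding duhamel_def
  proof (rule integral_spike[of "{0}"])
    fix s assume "s \<in> {0..t} - {0}"
    then have s: "s \<in> {0<..T}" using t by auto
    show "exp (- lam k * (t - s)) * src D k s = exp (- lam k * (t - s)) * \<psi> k s"
      unfolding \<psi>(2)[OF s] src_def bD[OF s] ..
  qed auto
  have "D \<sigma> t = \<Phi> D \<sigma> t" if "t \<in> {0..T}" for \<sigma> t
    unfolding \<Phi>_def D_def[of \<sigma> t] deq[OF that] ..
  then show ?thesis using that gD bD deq by blast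
qed

text \<open>Modes, traces and fluxes together. The series for the traces is asked for at positive
  times only; the flux at time 0 is some bounded value that no integral sees.\<close>

definition mode_solution :: "(nat \<Rightarrow> real \<Rightarrow> real) \<Rightarrow> (bool \<Rightarrow> real \<Rightarrow> real) \<Rightarrow> (bool \<Rightarrow> real \<Rightarrow> real) \<Rightarrow> bool" where
  "mode_solution r a f \<longleftrightarrow> (\<forall>\<sigma>. continuous_on {0<..T} (f \<sigma>)) \<and> (\<forall>\<sigma> s. f \<sigma> s = F \<sigma> (a \<sigma> s)) \<and>
     (\<forall>k t. r k t = exp (- lam k * t) * gam k + duhamel k (\<lambda>s. \<Sum>\<sigma>\<in>UNIV. sg \<sigma> ^ k * f \<sigma> s) t) \<and>
     (\<forall>\<sigma>. \<forall>t\<in>{0<..T}. a \<sigma> t = (\<Sum>k. wt k * (sg \<sigma> ^ k * r k t)))"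

lemma mode_solution_exists: "\<exists>r a f. mode_solution r a f"
proof -
  obtain D where D: "good D" "\<And>\<sigma> t. t \<in> {0..T} \<Longrightarrow> D \<sigma> t = \<Phi> D \<sigma> t"
    using fixed_point by blast
  define a where "a \<sigma> t = Gm \<sigma> t + D \<sigma> t" for \<sigma> t
  define f where "f \<sigma> s = F \<sigma> (a \<sigma> s)" for \<sigma> s
  define r where "r k t = exp (- lam k * t) * gam k + duhamel k (\<lambda>s. \<Sum>\<sigma>\<in>UNIV. sg \<sigma> ^ k * f \<sigma> s) t" for k t
  have src: "src D k = (\<lambda>s. \<Sum>\<sigma>\<in>UNIV. sg \<sigma> ^ k * f \<sigma> s)" for k
    by (simp add: src_def f_def a_def fun_eq_iff)
  have "a \<sigma> t = (\<Sum>k. wt k * (sg \<sigma> ^ k * r k t))" if t: "t \<in> {0<..T}" for \<sigma> t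
  proof -
    have tT: "t \<in> {0..T}" "0 < t" using t by auto
    have "a \<sigma> t = Gm \<sigma> t + \<Phi> D \<sigma> t" using D(2)[OF tT(1)] by (simp add: a_def)
    also have "\<dots> = (\<Sum>k. wt k * (sg \<sigma> ^ k * (exp (- lam k * t) * gam k)) + wt k * (sg \<sigma> ^ k * duhamel k (src D k) t))"
      unfolding Gm_def \<Phi>_def
      by (rule suminf_add[OF summable_rabs_cancel[OF Gm_term_summable[OF tT(2)]] duhamel_series_summable[OF src_integrable[OF D(1)] src_bound tT(1)]])
    finally show ?thesis unfolding r_def src by (simp add: algebra_simps)
  qed
  moreover have "continuous_on {0<..T} (f \<sigma>)" for \<sigma>
    unfolding f_def a_def by (rule flux_continuous[OF D(1)])
  ultimately have "mode_solution r a f"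
    unfolding mode_solution_def by (simp add: f_def r_def)
  then show ?thesis by blast
qed

end

section \<open>From modes to a weak solution\<close>

lemma nn_integral_lebesgue_on:
  fixes S :: "'a::euclidean_space set"
  assumes "S \<in> sets lebesgue"
  shows "(\<integral>\<^sup>+x. G x \<partial>lebesgue_on S) = (\<integral>\<^sup>+x. G x * indicator S x \<partial>lborel)"
  using assms by (subst nn_integral_restrict_space) (auto simp: nn_integral_completion)

lemma lebesgue_on_measurable_AE_eq:
  fixes f g :: "'a::euclidean_space \<Rightarrow> real"
  assumes "AE x in lebesgue_on S. f x = g x" "S \<in> sets lebesgue"
  shows "f \<in> borel_measurable (lebesgue_on S) \<longleftrightarrow> g \<in> borel_measurable (lebesgue_on S)"
proof -
  obtain N where N: "N \<in> null_sets (lebesgue_on S)" "{x \<in> space (lebesgue_on S). \<not> f x = g x} \<subseteq> N"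
    using assms(1) by (auto elim!: AE_E simp: null_sets_def)
  have "f \<in> borel_measurable (lebesgue_on S) \<longleftrightarrow> f \<in> borel_measurable (lebesgue_on (S - N))"
    using borel_measurable_diff_null[OF N(1) assms(2)] by blast
  also have "\<dots> \<longleftrightarrow> g \<in> borel_measurable (lebesgue_on (S - N))"
    using N(2) by (intro measurable_cong) auto
  also have "\<dots> \<longleftrightarrow> g \<in> borel_measurable (lebesgue_on S)"
    using borel_measurable_diff_null[OF N(1) assms(2)] by blast
  finally show ?thesis .
qed

text \<open>Lebesgue measure is complete, so equality almost everywhere transfers measurability. If
  it fails for one function it fails for the other, and both integrals have the default value
  0.\<close>

lemma lebesgue_on_integral_AE_eq:
  fixes f g :: "'a::euclidean_space \<Rightarrow> real"
  assumes ae: "AE x in lebesgue_on S. f x = g x" and S: "S \<in> sets lebesgue"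
  shows "integrable (lebesgue_on S) f \<longleftrightarrow> integrable (lebesgue_on S) g"
    "(LINT x|lebesgue_on S. f x) = (LINT x|lebesgue_on S. g x)"
proof -
  have m: "f \<in> borel_measurable (lebesgue_on S) \<longleftrightarrow> g \<in> borel_measurable (lebesgue_on S)"
    by (rule lebesgue_on_measurable_AE_eq[OF assms])
  show 1: "integrable (lebesgue_on S) f \<longleftrightarrow> integrable (lebesgue_on S) g"
    using m integrable_cong_AE[OF _ _ ae] by blast
  show "(LINT x|lebesgue_on S. f x) = (LINT x|lebesgue_on S. g x)"
  proof (cases "f \<in> borel_measurable (lebesgue_on S)")
    case True
    then show ?thesis using m ae by (intro integral_cong_AE) auto
  next
    case False
    then have "\<not> integrable (lebesgue_on S) f" "\<not> integrable (lebesgue_on S) g" using m by auto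
    then show ?thesis by (simp add: not_integrable_integral_eq)
  qed
qed

lemma AE_lebesgue_on_interior: "AE s in lebesgue_on {0..t::real}. s \<in> {0<..<t}"
proof -
  have "AE s in lebesgue. s \<notin> {0, t}"
    by (intro AE_not_in) (simp flip: negligible_iff_null_sets)
  then have "AE s in lebesgue. s \<in> {0..t} \<longrightarrow> s \<in> {0<..<t}"
    by eventually_elim auto
  moreover have "{0..t} \<inter> space lebesgue \<in> sets lebesgue" by simp
  ultimately show ?thesis using AE_restrict_space_iff by blast
qed

lemma lebesgue_integrable_half_open:
  fixes g :: "real \<Rightarrow> real"
  assumes "continuous_on {0<..T} g" "\<And>s. s \<in> {0<..T} \<Longrightarrow> \<bar>g s\<bar> \<le> C"
  shows "integrable (lebesgue_on {0..T}) g"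
proof (rule measurable_bounded_by_integrable_imp_lebesgue_integrable[where g = "\<lambda>_. max C \<bar>g 0\<bar>"])
  show "g \<in> borel_measurable (lebesgue_on {0..T})"
    by (rule integrable_imp_measurable[OF integrable_on_half_open[OF assms]])
  show "norm (g s) \<le> max C \<bar>g 0\<bar>" if "s \<in> {0..T}" for s
    using assms(2)[of s] that by (cases "s = 0") auto
qed (auto simp: integrable_const_ivl)

text \<open>The size of mode k at time s up to a constant: heat decay of the initial value plus the
  Duhamel part. It is summable in k for each s > 0, though not at s = 0, and its time integrals are
  summable too, which is what exchanging the sum with a time integral requires.\<close>

definition bk :: "nat \<Rightarrow> real \<Rightarrow> real" where "bk k s = exp (- lam k * s) + 1 / (1 + lam k)"

lemma bk_nonneg: "0 \<le> bk k s"
  using lam_nonneg[of k] by (simp add: bk_def add_nonneg_nonneg)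

lemma bk_le_2: "0 \<le> s \<Longrightarrow> bk k s \<le> 2"
proof -
  assume s: "0 \<le> s"
  have "exp (- lam k * s) \<le> 1" using s by simp
  moreover have "1 / (1 + lam k) \<le> 1" using lam_nonneg[of k] by (simp add: field_simps add_pos_nonneg)
  ultimately show ?thesis unfolding bk_def by linarith
qed

lemma exp_lam_le: "0 < s \<Longrightarrow> exp (- lam k * s) \<le> (1 / s) / (1 / s + lam k)"
proof -
  assume s: "0 < s"
  have p: "0 < 1 + lam k * s" using s lam_nonneg[of k] by (intro add_pos_nonneg) auto
  have "1 + lam k * s \<le> exp (lam k * s)" by (rule exp_ge_add_one_self)
  then have "exp (- lam k * s) \<le> 1 / (1 + lam k * s)"
    using p by (simp add: exp_minus field_simps)
  also have "\<dots> = (1 / s) / (1 / s + lam k)" using s by (simp add: field_simps)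
  finally show ?thesis .
qed

lemma bk_summable: "0 < s \<Longrightarrow> summable (\<lambda>k. bk k s)"
proof -
  assume s: "0 < s"
  show ?thesis
    unfolding bk_def
  proof (rule summable_add)
    show "summable (\<lambda>k. exp (- lam k * s))"
      by (rule summable_comparison_test[OF _ summable_mult[OF lam_summable, of "1 / s" "1 / s / 2"]])
        (use exp_lam_le[OF s] s in auto)
    show "summable (\<lambda>k. 1 / (1 + lam k))"
      using summable_mult[OF lam_summable[of 1], of "1/2"] by simp
  qed
qed

lemma integral_exp_minus_le:
  fixes t \<mu> :: real
  assumes "0 \<le> t" "0 < \<mu>"
  shows "integral {0..t} (\<lambda>s. exp (- \<mu> * s)) \<le> 1 / \<mu>"
proof -
  have "((\<lambda>s. exp (- \<mu> * s)) has_integral (- exp (- \<mu> * t) / \<mu>) - (- exp (- \<mu> * 0) / \<mu>)) {0..t}"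
    using assms by (intro fundamental_theorem_of_calculus[where f = "\<lambda>s. - exp (- \<mu> * s) / \<mu>"])
      (auto intro!: derivative_eq_intros simp flip: has_real_derivative_iff_has_vector_derivative)
  then have "integral {0..t} (\<lambda>s. exp (- \<mu> * s)) = 1 / \<mu> - exp (- \<mu> * t) / \<mu>"
    by (simp add: integral_unique)
  then show ?thesis using assms by simp
qed

lemma bk_integral:
  assumes t: "0 \<le> t" "t \<le> T"
  shows "(LINT s|lebesgue_on {0..t}. bk k s) \<le> (exp T + T) / (1 + lam k)"
proof -
  have pos: "0 < 1 + lam k" using lam_nonneg[of k] by (simp add: add_pos_nonneg)
  have "(LINT s|lebesgue_on {0..t}. bk k s) = integral {0..t} (bk k)"
    unfolding bk_def by (intro lebesgue_integral_eq_integral continuous_imp_integrable_real continuous_intros) auto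
  also have "\<dots> \<le> integral {0..t} (\<lambda>s. exp T * exp (- (1 + lam k) * s) + 1 / (1 + lam k))"
  proof (intro integral_le integrable_continuous_interval)
    \<comment> \<open>Shifting the rate from \<open>lam k\<close> to \<open>1 + lam k\<close> costs
      a factor \<open>exp T\<close> and includes mode 0, where \<open>lam\<close> vanishes.\<close>
    show "bk k s \<le> exp T * exp (- (1 + lam k) * s) + 1 / (1 + lam k)" if "s \<in> {0..t}" for s
      using that t by (auto simp: bk_def exp_add[symmetric] algebra_simps)
  qed (auto intro!: continuous_intros simp: bk_def)
  also have "\<dots> = exp T * integral {0..t} (\<lambda>s. exp (- (1 + lam k) * s)) + t / (1 + lam k)"
    using t by (subst integral_add) (auto intro!: integrable_continuous_interval continuous_intros)
  also have "integral {0..t} (\<lambda>s. exp (- (1 + lam k) * s)) \<le> 1 / (1 + lam k)"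
    using t(1) pos by (rule integral_exp_minus_le)
  finally have "(LINT s|lebesgue_on {0..t}. bk k s) \<le> exp T * (1 / (1 + lam k)) + t / (1 + lam k)" by simp
  also have "\<dots> \<le> exp T * (1 / (1 + lam k)) + T / (1 + lam k)"
    using t pos by (intro add_left_mono divide_right_mono) auto
  finally show ?thesis by (simp add: add_divide_distrib)
qed

text \<open>The bound by \<open>bk\<close> makes the series of integrals converge. The bound
  \<open>C' k\<close> may grow with k; it makes each single term integrable.\<close>

lemma mode_series_lint:
  fixes f :: "nat \<Rightarrow> real \<Rightarrow> real"
  assumes t: "0 \<le> t" "t \<le> T" and f: "\<And>k. continuous_on {0<..t} (f k)"
    and b: "\<And>k s. s \<in> {0<..<t} \<Longrightarrow> \<bar>f k s\<bar> \<le> C * bk k s" and b2: "\<And>k s. s \<in> {0<..t} \<Longrightarrow> \<bar>f k s\<bar> \<le> C' k"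
  shows "integrable (lebesgue_on {0..t}) (\<lambda>s. \<Sum>k. f k s)"
    "(\<lambda>k. LINT s|lebesgue_on {0..t}. f k s) sums (LINT s|lebesgue_on {0..t}. (\<Sum>k. f k s))"
proof -
  have fi: "integrable (lebesgue_on {0..t}) (f k)" for k
    by (rule lebesgue_integrable_half_open[OF f b2])
  have bi: "integrable (lebesgue_on {0..t}) (bk k)" for k
    unfolding bk_def[abs_def] by (intro continuous_imp_integrable_real continuous_intros)
  have s1: "AE s in lebesgue_on {0..t}. summable (\<lambda>k. norm (f k s))"
    using AE_lebesgue_on_interior[of t]
  proof eventually_elim
    case (elim s)
    then have "summable (\<lambda>k. C * bk k s)" by (intro summable_mult bk_summable) auto
    then show ?case by (rule summable_comparison_test[rotated]) (use b elim in auto)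
  qed
  have s2: "summable (\<lambda>k. LINT s|lebesgue_on {0..t}. norm (f k s))"
  proof (rule summable_comparison_test[OF _ summable_mult[OF lam_summable[of 1], of "\<bar>C\<bar> * (exp T + T) / 2"]], intro exI allI impI)
    fix k
    have "(LINT s|lebesgue_on {0..t}. norm (f k s)) \<le> (LINT s|lebesgue_on {0..t}. \<bar>C\<bar> * bk k s)"
    proof (rule integral_mono_AE)
      show "AE s in lebesgue_on {0..t}. norm (f k s) \<le> \<bar>C\<bar> * bk k s"
        using AE_lebesgue_on_interior[of t]
      proof eventually_elim
        case (elim s)
        have "C * bk k s \<le> \<bar>C\<bar> * bk k s" using bk_nonneg by (intro mult_right_mono) auto
        then show ?case using b[OF elim, of k] by simp
      qed
    qed (use fi bi in auto)
    also have "\<dots> \<le> \<bar>C\<bar> * ((exp T + T) / (1 + lam k))"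
      using mult_left_mono[OF bk_integral[OF t, of k], of "\<bar>C\<bar>"] by simp
    finally show "norm (LINT s|lebesgue_on {0..t}. norm (f k s)) \<le> \<bar>C\<bar> * (exp T + T) / 2 * (2 / (1 + lam k))"
      by simp
  qed auto
  show "integrable (lebesgue_on {0..t}) (\<lambda>s. \<Sum>k. f k s)"
    by (rule integrable_suminf[OF fi s1 s2])
  show "(\<lambda>k. LINT s|lebesgue_on {0..t}. f k s) sums (LINT s|lebesgue_on {0..t}. (\<Sum>k. f k s))"
    by (rule sums_integral[OF fi s1 s2])
qed

text \<open>Summing the gradient series in dyadic blocks makes it absolutely convergent almost everywhere: the norms of the
  blocks in \<open>L\<^sup>1\<close> decay geometrically.\<close>

definition sblk :: "(nat \<Rightarrow> real) \<Rightarrow> nat \<Rightarrow> real \<Rightarrow> real" where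
  "sblk c j x = (\<Sum>k\<in>{2^j..<2^Suc j}. 2 * (real k * pi) * c k * sm k x)"

definition sgrad :: "(nat \<Rightarrow> real) \<Rightarrow> real \<Rightarrow> real" where "sgrad c x = (\<Sum>j. sblk c j x)"

lemma sm_integrable: "integrable I01 (\<lambda>x. sm j x * sm k x)"
  by (intro continuous_imp_integrable_real continuous_intros)

lemma sine_sum_square:
  assumes "finite A" "0 \<notin> A"
  shows "(LINT x|I01. (\<Sum>k\<in>A. 2 * (real k * pi) * c k * sm k x)^2) = (\<Sum>k\<in>A. 2 * lam k * (c k)^2)"
proof -
  have "(\<Sum>k\<in>A. 2 * (real k * pi) * c k * sm k x)^2
     = (\<Sum>j\<in>A. \<Sum>k\<in>A. (2 * (real j * pi) * c j) * (2 * (real k * pi) * c k) * (sm j x * sm k x))" for x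
    unfolding power2_eq_square sum_product by (simp add: mult_ac)
  then have "(LINT x|I01. (\<Sum>k\<in>A. 2 * (real k * pi) * c k * sm k x)^2)
     = (\<Sum>j\<in>A. \<Sum>k\<in>A. (2 * (real j * pi) * c j) * (2 * (real k * pi) * c k) * (LINT x|I01. sm j x * sm k x))"
    using sm_integrable by simp
  also have "\<dots> = (\<Sum>j\<in>A. \<Sum>k\<in>A. if j = k then 2 * lam k * (c k)^2 else 0)"
    using assms by (intro sum.cong refl) (auto simp: integral_sm_sm lam_def power2_eq_square)
  finally show ?thesis using assms by simp
qed

lemma sblk_sum: "(\<Sum>j<J. sblk c j x) = (\<Sum>k\<in>{1..<2^J}. 2 * (real k * pi) * c k * sm k x)"
proof (induction J)
  case (Suc J)
  have "{1..<2^Suc J} = {1..<2^J} \<union> {2^J..<2^Suc J::nat}" by (intro ivl_disj_un_two(3)[symmetric]) auto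
  then have "(\<Sum>k\<in>{1..<2^Suc J}. 2 * (real k * pi) * c k * sm k x)
    = (\<Sum>k\<in>{1..<2^J}. 2 * (real k * pi) * c k * sm k x) + sblk c J x"
    unfolding sblk_def by (simp only:) (rule sum.union_disjoint, auto)
  then show ?case using Suc by simp
qed simp

lemma sblk_continuous [continuous_intros]: "continuous_on A (sblk c j)"
  unfolding sblk_def[abs_def] by (intro continuous_intros)

text \<open>Coefficients of order \<open>1 / lam k\<close>, as the modes have at a fixed positive
  time. The sine series of the gradient then has coefficients of order 1 / k only, so absolute
  convergence cannot be expected term by term.\<close>

locale sine_series =
  fixes c :: "nat \<Rightarrow> real" and C :: real
  assumes c: "\<And>k. lam k * \<bar>c k\<bar> \<le> C"
begin

text \<open>A block has \<open>2 ^ j\<close> orthogonal terms, each contributing at most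
  \<open>2 * C^2 / 4 ^ j\<close>.\<close>

lemma sblk_square: "(LINT x|I01. (sblk c j x)^2) \<le> 2 * C^2 * (1/2)^j"
proof -
  have "(LINT x|I01. (sblk c j x)^2) = (\<Sum>k\<in>{2^j..<2^Suc j}. 2 * lam k * (c k)^2)"
    unfolding sblk_def by (rule sine_sum_square) auto
  also have "\<dots> \<le> (\<Sum>k\<in>{2^j..<2^Suc j::nat}. 2 * C^2 / 4^j)"
  proof (rule sum_mono)
    fix k :: nat assume k: "k \<in> {2^j..<2^Suc j}"
    have "real (2^j) \<le> real k" using k by (subst of_nat_le_iff) auto
    then have "(2^j)^2 \<le> (real k)^2" by (intro power_mono) auto
    also have "\<dots> \<le> lam k" by (rule lam_ge)
    finally have l: "4^j \<le> lam k" by (simp add: power_mult[symmetric] mult.commute[of j 2]) (simp add: power_mult)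
    then have lp: "0 < lam k" by (rule less_le_trans[rotated]) simp
    have "(lam k * \<bar>c k\<bar>)^2 \<le> C^2" using c[of k] by (intro power_mono) auto
    then have "lam k * (2 * lam k * (c k)^2) \<le> 2 * C^2" by (simp add: power2_eq_square mult_ac)
    then have "2 * lam k * (c k)^2 \<le> 2 * C^2 / lam k" using lp by (simp add: field_simps)
    also have "\<dots> \<le> 2 * C^2 / 4^j" using l lp by (intro divide_left_mono) auto
    finally show "2 * lam k * (c k)^2 \<le> 2 * C^2 / 4^j" .
  qed
  also have "\<dots> = 2 * C^2 * (2^j / 4^j)" by simp
  also have "(2::real)^j / 4^j = (1/2)^j" by (simp add: power_divide[symmetric])
  finally show ?thesis .
qed

lemma sblk_integrable: "integrable I01 (\<lambda>x. sblk c j x)" "integrable I01 (\<lambda>x. (sblk c j x)^2)"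
  by (intro continuous_imp_integrable_real continuous_intros)+

text \<open>The bound h \<le> e + h^2 / e with e = (2/3)^j. The first term is geometric, and the
  second still decays after multiplication by (3/2)^j, because the squares decay like
  (1/2)^j.\<close>

lemma sblk_abs: "(LINT x|I01. \<bar>sblk c j x\<bar>) \<le> (1 + 2 * C^2) * (3/4)^j"
proof -
  have "(LINT x|I01. \<bar>sblk c j x\<bar>) \<le> (LINT x|I01. (2/3)^j + (3/2)^j * (sblk c j x)^2)"
  proof (intro integral_mono)
    show "\<bar>sblk c j x\<bar> \<le> (2/3)^j + (3/2)^j * (sblk c j x)^2" for x
    proof -
      define e :: real where "e = (2/3)^j"
      define h where "h = \<bar>sblk c j x\<bar>"
      have e: "0 < e" "(3/2)^j = 1 / e" by (auto simp: e_def power_divide)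
      have "2 * e * h \<le> e^2 + h^2" using zero_le_power2[of "e - h"] by (simp add: power2_eq_square algebra_simps)
      then have "h \<le> e / 2 + h^2 / (2 * e)" using e(1) by (simp add: field_simps power2_eq_square)
      also have "\<dots> \<le> e + 1 / e * h^2" using e(1) by (simp add: field_simps)
      finally show ?thesis unfolding e(2) by (simp add: h_def e_def)
    qed
  qed (use sblk_integrable in \<open>auto simp: integrable_const_ivl\<close>)
  also have "\<dots> = (2/3)^j + (3/2)^j * (LINT x|I01. (sblk c j x)^2)"
    using sblk_integrable(2)[of j] by (simp add: integrable_const_ivl measure_restrict_space)
  also have "\<dots> \<le> (2/3)^j + (3/2)^j * (2 * C^2 * (1/2)^j)"
    by (intro add_left_mono mult_left_mono sblk_square) auto
  also have "\<dots> = (2/3)^j + 2 * C^2 * (3/4)^j"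
    by (simp add: power_mult_distrib[symmetric])
  also have "\<dots> \<le> (3/4)^j + 2 * C^2 * (3/4)^j"
    by (intro add_right_mono power_mono) auto
  finally show ?thesis by (simp add: algebra_simps)
qed

lemma sblk_abs_summable: "summable (\<lambda>j. LINT x|I01. norm (sblk c j x))"
proof (rule summable_comparison_test)
  show "summable (\<lambda>j. (1 + 2 * C^2) * (3/4)^j)" by (intro summable_mult summable_geometric) auto
qed (use sblk_abs in auto)

lemma sblk_AE_summable: "AE x in I01. summable (\<lambda>j. norm (sblk c j x))"
proof -
  have m: "(\<lambda>x. sblk c j x) \<in> borel_measurable I01" for j using sblk_integrable(1)[of j] by auto
  have "(\<integral>\<^sup>+x. (\<Sum>j. ennreal (norm (sblk c j x))) \<partial>I01) = (\<Sum>j. \<integral>\<^sup>+x. ennreal (norm (sblk c j x)) \<partial>I01)"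
    using m by (intro nn_integral_suminf) auto
  also have "\<dots> = (\<Sum>j. ennreal (LINT x|I01. norm (sblk c j x)))"
    using sblk_integrable(1) by (intro suminf_cong nn_integral_eq_integral) auto
  also have "\<dots> \<noteq> \<infinity>"
    using sblk_abs_summable by (simp add: ennreal_suminf_neq_top)
  finally have "AE x in I01. (\<Sum>j. ennreal (norm (sblk c j x))) \<noteq> \<infinity>"
    using m by (intro nn_integral_PInf_AE) auto
  then show ?thesis
  proof eventually_elim
    case (elim x)
    then show ?case by (intro summable_suminf_not_top) auto
  qed
qed

lemma sgrad_measurable: "sgrad c \<in> borel_measurable I01"
  unfolding sgrad_def[abs_def] using sblk_integrable(1) by (intro borel_measurable_suminf) auto

lemma sgrad_limit: "AE x in I01. (\<lambda>J. \<Sum>j<J. sblk c j x) \<longlonglongrightarrow> sgrad c x"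
  using sblk_AE_summable
proof eventually_elim
  case (elim x)
  then have "summable (\<lambda>j. sblk c j x)" by (rule summable_norm_cancel)
  then show ?case unfolding sgrad_def by (rule summable_LIMSEQ)
qed

text \<open>Fatou's lemma along the dyadic partial sums. The bound is an extended real, so that the
  lemma serves both a fixed time, where it is finite, and the estimate jointly in space and
  time.\<close>

lemma sgrad_square:
  assumes E: "\<And>J. ennreal (\<Sum>k\<in>{1..<2^J}. 2 * lam k * (c k)^2) \<le> E"
  shows "(\<integral>\<^sup>+x. ennreal ((sgrad c x)^2) \<partial>I01) \<le> E"
proof -
  let ?G = "\<lambda>J x. \<Sum>j<J. sblk c j x"
  have Gc: "continuous_on {0..1} (?G J)" for J by (intro continuous_intros)
  have m: "(\<lambda>x. ?G J x) \<in> borel_measurable I01" for J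
    using continuous_imp_integrable_real[OF Gc[of J]] by auto
  have "(\<integral>\<^sup>+x. ennreal ((sgrad c x)^2) \<partial>I01) = (\<integral>\<^sup>+x. liminf (\<lambda>J. ennreal ((?G J x)^2)) \<partial>I01)"
    using sgrad_limit
  proof (intro nn_integral_cong_AE, eventually_elim)
    case (elim x)
    then have "(\<lambda>J. ennreal ((?G J x)^2)) \<longlonglongrightarrow> ennreal ((sgrad c x)^2)"
      by (intro tendsto_ennrealI tendsto_intros)
    then show ?case by (rule lim_imp_Liminf[OF sequentially_bot, symmetric])
  qed
  also have "\<dots> \<le> liminf (\<lambda>J. \<integral>\<^sup>+x. ennreal ((?G J x)^2) \<partial>I01)"
    using m by (intro nn_integral_liminf) auto
  also have "\<dots> \<le> liminf (\<lambda>J. E)"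
  proof (intro Liminf_mono always_eventually allI)
    fix J
    have "integrable I01 (\<lambda>x. (?G J x)^2)"
      by (intro continuous_imp_integrable_real continuous_intros)
    then have "(\<integral>\<^sup>+x. ennreal ((?G J x)^2) \<partial>I01) = ennreal (LINT x|I01. (?G J x)^2)"
      by (intro nn_integral_eq_integral) auto
    also have "(LINT x|I01. (?G J x)^2) = (\<Sum>k\<in>{1..<2^J}. 2 * lam k * (c k)^2)"
      unfolding sblk_sum by (rule sine_sum_square) auto
    finally show "(\<integral>\<^sup>+x. ennreal ((?G J x)^2) \<partial>I01) \<le> E" using E[of J] by simp
  qed
  finally show ?thesis by (simp add: Liminf_const)
qed

lemma sgrad_square_integrable: "integrable I01 (\<lambda>x. (sgrad c x)^2)"
proof (rule integrableI_bounded)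
  have "(\<Sum>k\<in>{1..<2^J}. 2 * lam k * (c k)^2) \<le> C^2 * (\<Sum>k. 2 / lam k)" for J :: nat
  proof -
    have "2 * lam k * (c k)^2 \<le> C^2 * (2 / lam k)" if "k \<ge> 1" for k
    proof -
      have lp: "0 < lam k" using that by (simp add: lam_def)
      have "(lam k * \<bar>c k\<bar>)^2 \<le> C^2" using c[of k] by (intro power_mono) auto
      then have "lam k * (2 * lam k * (c k)^2) \<le> 2 * C^2" by (simp add: power2_eq_square mult_ac)
      then show ?thesis using lp by (simp add: field_simps)
    qed
    then have "(\<Sum>k\<in>{1..<2^J}. 2 * lam k * (c k)^2) \<le> (\<Sum>k\<in>{1..<2^J}. C^2 * (2 / lam k))"
      by (intro sum_mono) auto
    also have "\<dots> = C^2 * (\<Sum>k\<in>{1..<2^J}. 2 / lam k)" by (simp only: sum_distrib_left)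
    also have "\<dots> \<le> C^2 * (\<Sum>k. 2 / lam k)"
      using lam_summable0 by (intro mult_left_mono sum_le_suminf) auto
    finally show ?thesis .
  qed
  then have "(\<integral>\<^sup>+x. ennreal ((sgrad c x)^2) \<partial>I01) \<le> ennreal (C^2 * (\<Sum>k. 2 / lam k))"
    by (intro sgrad_square ennreal_leI)
  then show "(\<integral>\<^sup>+x. ennreal (norm ((sgrad c x)^2)) \<partial>I01) < \<infinity>"
    by (simp add: order_le_less_trans)
qed (use sgrad_measurable in auto)

text \<open>Block by block the series may be integrated termwise. The limit so obtained runs along
  the partial sums up to \<open>2 ^ J\<close>; with summability assumed, it is the sum of the whole
  series.\<close>

lemma sgrad_test:
  assumes \<psi>: "continuous_on {0..1} \<psi>" and s: "summable (\<lambda>k. 2 * (real k * pi) * c k * (LINT x|I01. sm k x * \<psi> x))"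
  shows "(LINT x|I01. sgrad c x * \<psi> x) = (\<Sum>k. 2 * (real k * pi) * c k * (LINT x|I01. sm k x * \<psi> x))"
proof -
  let ?d = "\<lambda>k. 2 * (real k * pi) * c k * (LINT x|I01. sm k x * \<psi> x)"
  have "bounded (\<psi> ` {0..1})" using compact_continuous_image[OF \<psi>] compact_imp_bounded by auto
  then obtain B where B: "\<And>x. x \<in> {0..1} \<Longrightarrow> \<bar>\<psi> x\<bar> \<le> B" by (fastforce simp: bounded_iff)
  have i: "integrable I01 (\<lambda>x. sblk c j x * \<psi> x)" for j
    by (intro continuous_mult_integrable sblk_integrable \<psi>)
  have 1: "AE x in I01. summable (\<lambda>j. norm (sblk c j x * \<psi> x))"
    using sblk_AE_summable
  proof eventually_elim
    case (elim x)
    then show ?case unfolding norm_mult by (rule summable_mult2)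
  qed
  have 2: "summable (\<lambda>j. LINT x|I01. norm (sblk c j x * \<psi> x))"
  proof (rule summable_comparison_test[OF _ summable_mult[OF sblk_abs_summable, of B]], intro exI allI impI)
    fix j
    have "(LINT x|I01. norm (sblk c j x * \<psi> x)) \<le> (LINT x|I01. B * norm (sblk c j x))"
    proof (intro integral_mono)
      show "norm (sblk c j x * \<psi> x) \<le> B * norm (sblk c j x)" if "x \<in> space I01" for x
        using mult_right_mono[OF B[of x], of "\<bar>sblk c j x\<bar>"] that by (simp add: abs_mult mult.commute)
    qed (use i sblk_integrable(1)[of j] in auto)
    then show "norm (LINT x|I01. norm (sblk c j x * \<psi> x)) \<le> B * (LINT x|I01. norm (sblk c j x))" by simp
  qed
  have "(\<lambda>j. LINT x|I01. sblk c j x * \<psi> x) sums (LINT x|I01. (\<Sum>j. sblk c j x * \<psi> x))"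
    by (rule sums_integral[OF i 1 2])
  also have "(LINT x|I01. (\<Sum>j. sblk c j x * \<psi> x)) = (LINT x|I01. sgrad c x * \<psi> x)"
  proof (rule lebesgue_on_integral_AE_eq(2))
    show "AE x in I01. (\<Sum>j. sblk c j x * \<psi> x) = sgrad c x * \<psi> x"
      using sblk_AE_summable
    proof eventually_elim
      case (elim x)
      then have "summable (\<lambda>j. sblk c j x)" by (rule summable_norm_cancel)
      then show ?case unfolding sgrad_def by (rule suminf_mult2[symmetric])
    qed
  qed auto
  finally have l1: "(\<lambda>J. \<Sum>j<J. LINT x|I01. sblk c j x * \<psi> x) \<longlonglongrightarrow> (LINT x|I01. sgrad c x * \<psi> x)"
    by (simp add: sums_def)
  have e: "(\<Sum>j<J. LINT x|I01. sblk c j x * \<psi> x) = (\<Sum>k<2^J. ?d k)" for J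
  proof -
    have si: "integrable I01 (\<lambda>x. sm k x * \<psi> x)" for k
      by (intro continuous_mult_integrable continuous_imp_integrable_real continuous_intros \<psi>)
    have "(\<Sum>j<J. LINT x|I01. sblk c j x * \<psi> x) = (LINT x|I01. (\<Sum>j<J. sblk c j x) * \<psi> x)"
      using i by (simp add: sum_distrib_right)
    also have "\<dots> = (LINT x|I01. (\<Sum>k\<in>{1..<2^J}. 2 * (real k * pi) * c k * (sm k x * \<psi> x)))"
      unfolding sblk_sum sum_distrib_right by (simp only: mult.assoc)
    also have "\<dots> = (\<Sum>k\<in>{1..<2^J}. ?d k)" using si by simp
    also have "\<dots> = (\<Sum>k<2^J. ?d k)" by (rule sum.mono_neutral_left) auto
    finally show ?thesis .
  qed
  have "(\<lambda>J::nat. \<Sum>k<2^J. ?d k) \<longlonglongrightarrow> (\<Sum>k. ?d k)"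
    using LIMSEQ_subseq_LIMSEQ[OF summable_LIMSEQ[OF s], of "\<lambda>J. 2^J"]
    by (simp add: o_def strict_mono_def)
  with l1 show ?thesis unfolding e by (rule LIMSEQ_unique)
qed

end

section \<open>Integration by parts, boundary values and test functions\<close>

lemma lint_continuous_eq: "continuous_on {a..b} h \<Longrightarrow> (LINT x|lebesgue_on {a..b}. h x) = integral {a..b} h" for h :: "real \<Rightarrow> real"
  by (intro lebesgue_integral_eq_integral continuous_imp_integrable_real) auto

lemma lint_by_parts:
  fixes u v u' v' :: "real \<Rightarrow> real"
  assumes c: "continuous_on {0..1} u" "continuous_on {0..1} v" "continuous_on {0..1} u'" "continuous_on {0..1} v'"
    and d: "\<And>x. x \<in> {0<..<1} \<Longrightarrow> (u has_real_derivative u' x) (at x)" "\<And>x. x \<in> {0<..<1} \<Longrightarrow> (v has_real_derivative v' x) (at x)"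
  shows "(LINT x|I01. u x * v' x) = u 1 * v 1 - u 0 * v 0 - (LINT x|I01. u' x * v x)"
proof -
  have "((\<lambda>x. u' x * v x + v' x * u x) has_integral u 1 * v 1 - u 0 * v 0) {0..1}"
    using d by (intro fundamental_theorem_of_calculus_interior)
      (auto intro!: continuous_intros c DERIV_mult simp flip: has_real_derivative_iff_has_vector_derivative)
  then have "integral {0..1} (\<lambda>x. u' x * v x + v' x * u x) = u 1 * v 1 - u 0 * v 0" by (rule integral_unique)
  moreover have "integral {0..1} (\<lambda>x. u' x * v x + v' x * u x) = integral {0..1} (\<lambda>x. u' x * v x) + integral {0..1} (\<lambda>x. u x * v' x)"
    by (subst integral_add) (auto intro!: integrable_continuous_interval continuous_intros c simp: mult.commute)
  moreover have "(LINT x|I01. u x * v' x) = integral {0..1} (\<lambda>x. u x * v' x)" "(LINT x|I01. u' x * v x) = integral {0..1} (\<lambda>x. u' x * v x)"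
    by (intro lint_continuous_eq continuous_intros c)+
  ultimately show ?thesis by linarith
qed

lemma lint_abs_le:
  assumes "continuous_on {0..1} h" "\<And>x. x \<in> {0..1} \<Longrightarrow> \<bar>h x\<bar> \<le> A"
  shows "\<bar>LINT x|I01. h x\<bar> \<le> (A::real)"
proof -
  have "\<bar>LINT x|I01. h x\<bar> \<le> (LINT x|I01. \<bar>h x\<bar>)" by (rule integral_abs_bound)
  also have "\<dots> \<le> (LINT x|I01. A)"
    using assms by (intro integral_mono continuous_imp_integrable_real continuous_intros) auto
  finally show ?thesis by (simp add: measure_restrict_space)
qed

lemma boundary_value_continuous:
  assumes v: "continuous_on {0..1} v" "AE x in I01. f x = v x" and a: "a \<in> {0..1}"
  shows "boundary_value f a = v a"
  unfolding boundary_value_def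
proof (rule the_equality)
  show "\<exists>w. continuous_on {0..1} w \<and> (AE x in I01. f x = w x) \<and> w a = v a" using v by blast
  fix c assume "\<exists>w. continuous_on {0..1} w \<and> (AE x in I01. f x = w x) \<and> w a = c"
  then obtain w where w: "continuous_on {0..1} w" "AE x in I01. f x = w x" "w a = c" by blast
  have "AE x in I01. w x = v x" using w(2) v(2) by eventually_elim simp
  then show "c = v a" using continuous_AE_eq_imp_eq[OF w(1) v(1) _ a] w(3) by simp
qed

lemma test_function_props:
  assumes "test_function \<phi>"
  shows "continuous_on A \<phi>" "continuous_on A (deriv \<phi>)" "(\<phi> has_real_derivative deriv \<phi> x) (at x)" "\<phi> 0 = 0" "\<phi> 1 = 0"
proof -
  have d: "(deriv ^^ n) \<phi> field_differentiable at x" for n x using assms by (simp add: test_function_def)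
  from d[of 0] show "(\<phi> has_real_derivative deriv \<phi> x) (at x)" by (simp add: DERIV_deriv_iff_field_differentiable)
  show "continuous_on A \<phi>"
    using d[of 0] by (intro continuous_at_imp_continuous_on ballI field_differentiable_imp_continuous_at) simp
  show "continuous_on A (deriv \<phi>)"
    using d[of 1] by (intro continuous_at_imp_continuous_on ballI field_differentiable_imp_continuous_at) (simp add: One_nat_def)
  obtain a b where "0 < a" "b < 1" "\<forall>x. x \<notin> {a..b} \<longrightarrow> \<phi> x = 0" using assms by (auto simp: test_function_def)
  then show "\<phi> 0 = 0" "\<phi> 1 = 0" by auto
qed

locale modes = volterra +
  fixes \<gamma> :: "real \<Rightarrow> real" and r :: "nat \<Rightarrow> real \<Rightarrow> real" and a f :: "bool \<Rightarrow> real \<Rightarrow> real"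
  assumes \<gamma>_meas: "\<gamma> \<in> borel_measurable I01" and \<gamma>_range: "\<gamma> ` {0..1} \<subseteq> {0..1}"
    and gam_eq: "\<And>k. gam k = (LINT x|I01. \<gamma> x * cm k x)"
    and ms: "mode_solution r a f"
begin

lemma \<gamma>_integrable: "integrable I01 \<gamma>"
  by (rule measurable_bounded_by_integrable_imp_lebesgue_integrable[OF \<gamma>_meas, of "\<lambda>_. 1"])
    (use \<gamma>_range in \<open>auto simp: integrable_const_ivl image_subset_iff\<close>)

definition \<phi> :: "nat \<Rightarrow> real \<Rightarrow> real" where "\<phi> k s = (\<Sum>\<sigma>\<in>UNIV. sg \<sigma> ^ k * f \<sigma> s)"

lemma f_bound: "\<bar>f \<sigma> s\<bar> \<le> Q" and f_cont: "continuous_on {0<..T} (f \<sigma>)"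
  using ms Q by (auto simp: mode_solution_def)

lemma \<phi>_bound: "\<bar>\<phi> k s\<bar> \<le> 2 * Q"
proof -
  have "\<bar>\<phi> k s\<bar> \<le> (\<Sum>\<tau>\<in>(UNIV::bool set). Q)"
    unfolding \<phi>_def by (rule order_trans[OF sum_abs sum_mono]) (simp add: abs_mult f_bound)
  then show ?thesis by (simp add: UNIV_bool)
qed

lemma \<phi>_cont: "continuous_on {0<..T} (\<phi> k)"
  unfolding \<phi>_def[abs_def] by (intro continuous_intros f_cont)

lemma \<phi>_integrable: "\<phi> k integrable_on {0..T}"
  by (rule integrable_on_half_open[OF \<phi>_cont \<phi>_bound])

lemma r_eq: "r k t = exp (- lam k * t) * gam k + duhamel k (\<phi> k) t"
  using ms by (simp add: mode_solution_def \<phi>_def[abs_def])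

definition C0 :: real where "C0 = 1 + 2 * Q * exp T"

lemma C0_pos: "0 < C0" using Q_nonneg by (simp add: C0_def add_pos_nonneg)

lemma duhamel_\<phi>_bound: "t \<in> {0..T} \<Longrightarrow> \<bar>duhamel k (\<phi> k) t\<bar> \<le> 2 * Q * exp T / (1 + lam k)"
  by (rule duhamel_bounded[OF \<phi>_integrable \<phi>_bound])

lemma mode_bound:
  assumes "\<bar>x\<bar> \<le> exp (- lam k * t) * 1 + 2 * Q * exp T / (1 + lam k)"
  shows "\<bar>x\<bar> \<le> C0 * bk k t"
proof -
  have "exp (- lam k * t) * 1 + 2 * Q * exp T / (1 + lam k) \<le> exp (- lam k * t) * C0 + C0 * (1 / (1 + lam k))"
  proof (rule add_mono)
    show "exp (- lam k * t) * 1 \<le> exp (- lam k * t) * C0" using Q_nonneg by (intro mult_left_mono) (auto simp: C0_def)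
    have "2 * Q * exp T * (1 / (1 + lam k)) \<le> C0 * (1 / (1 + lam k))"
      by (intro mult_right_mono) (auto simp: C0_def add_nonneg_nonneg)
    then show "2 * Q * exp T / (1 + lam k) \<le> C0 * (1 / (1 + lam k))" by simp
  qed
  then show ?thesis using assms by (simp add: bk_def algebra_simps)
qed

lemma mode_summable:
  assumes "t \<in> {0<..T}" "\<And>k. \<bar>x k\<bar> \<le> C0 * bk k t"
  shows "summable (\<lambda>k. \<bar>x k\<bar>)"
proof -
  have "summable (\<lambda>k. C0 * bk k t)" using assms(1) by (intro summable_mult bk_summable) auto
  then show ?thesis by (rule summable_comparison_test[rotated]) (use assms in auto)
qed

lemma r_bound: "t \<in> {0..T} \<Longrightarrow> \<bar>r k t\<bar> \<le> C0 * bk k t"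
proof -
  assume t: "t \<in> {0..T}"
  have "\<bar>r k t\<bar> \<le> \<bar>exp (- lam k * t) * gam k\<bar> + \<bar>duhamel k (\<phi> k) t\<bar>" unfolding r_eq by (rule abs_triangle_ineq)
  also have "\<bar>exp (- lam k * t) * gam k\<bar> \<le> exp (- lam k * t) * 1"
    unfolding abs_mult using gam[of k] by (intro mult_mono) auto
  also note duhamel_\<phi>_bound[OF t, of k]
  finally show ?thesis by (intro mode_bound) simp
qed

lemma r_cont: "continuous_on {0..T} (r k)"
proof -
  have "r k = (\<lambda>t. exp (- lam k * t) * gam k + duhamel k (\<phi> k) t)" by (rule ext) (rule r_eq)
  then show ?thesis
    by (simp only:) (intro continuous_intros duhamel_continuous[OF \<phi>_integrable \<phi>_bound])
qed

lemma r_deriv: "t \<in> {0<..<T} \<Longrightarrow> (r k has_real_derivative - lam k * r k t + \<phi> k t) (at t)"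
proof -
  assume t: "t \<in> {0<..<T}"
  have "continuous (at t within {0<..T}) (\<phi> k)"
    using \<phi>_cont t by (auto simp: continuous_on_eq_continuous_within)
  moreover have "at t within {0<..T} = at t" "at t within {0..T} = at t"
    using t by (auto intro!: at_within_interior simp: interior_atLeastAtMost_real) 
  ultimately have c: "continuous (at t within {0..T}) (\<phi> k)" by simp
  have "r k = (\<lambda>t. exp (- lam k * t) * gam k + duhamel k (\<phi> k) t)" by (rule ext) (rule r_eq)
  moreover have "((\<lambda>t. exp (- lam k * t) * gam k + duhamel k (\<phi> k) t) has_real_derivative
     exp (- lam k * t) * - lam k * gam k + (\<phi> k t - lam k * duhamel k (\<phi> k) t)) (at t)"
    by (rule DERIV_add[OF _ duhamel_deriv[OF \<phi>_integrable \<phi>_bound t c]]) (auto intro!: derivative_eq_intros)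
  ultimately show ?thesis by (simp add: r_eq algebra_simps)
qed

lemma r_0: "r k 0 = gam k" by (simp add: r_eq duhamel_def)

lemma r_summable: "t \<in> {0<..T} \<Longrightarrow> summable (\<lambda>k. \<bar>r k t\<bar>)"
  by (rule mode_summable) (auto intro: r_bound)

text \<open>At time 0 the series need not converge to the profile, so \<gamma> itself is taken. Then
  the coefficients, the weak formulation and the convergence statement are right at t = 0 as
  well.\<close>

definition \<rho> :: "real \<Rightarrow> real \<Rightarrow> real" where
  "\<rho> t x = (if t \<le> 0 then \<gamma> x else (\<Sum>k. wt k * r k t * cm k x))"

lemma \<rho>_cont: "t \<in> {0<..T} \<Longrightarrow> continuous_on A (\<rho> t)"
  using cos_series_continuous[OF r_summable, of t A] by (simp add: \<rho>_def[abs_def])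

lemma \<rho>_integrable: "t \<in> {0..T} \<Longrightarrow> integrable I01 (\<rho> t)"
  using \<gamma>_integrable continuous_imp_integrable_real[OF \<rho>_cont[of t]]
  by (cases "t = 0") (auto simp: \<rho>_def[abs_def])

lemma \<rho>_coeff: "t \<in> {0..T} \<Longrightarrow> (LINT x|I01. \<rho> t x * cm k x) = r k t"
  using cos_series_coeff[OF r_summable, of t k] gam_eq[of k] r_0[of k]
  by (cases "t = 0") (auto simp: \<rho>_def)

lemma \<rho>_pair_sums:
  "t \<in> {0<..T} \<Longrightarrow> integrable I01 u \<Longrightarrow> (\<lambda>k. wt k * r k t * (LINT x|I01. u x * cm k x)) sums (LINT x|I01. \<rho> t x * u x)"
  using cos_series_sums[OF r_summable, of t u] by (simp add: \<rho>_def mult.commute[of "u _"] if_distrib cong: if_cong)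

lemma \<rho>_boundary: "t \<in> {0<..T} \<Longrightarrow> boundary_value (\<rho> t) (if \<sigma> then 1 else 0) = a \<sigma> t"
proof -
  assume t: "t \<in> {0<..T}"
  have "boundary_value (\<rho> t) (if \<sigma> then 1 else 0) = \<rho> t (if \<sigma> then 1 else 0)"
    by (rule boundary_value_continuous[OF \<rho>_cont[OF t]]) auto
  also have "\<dots> = a \<sigma> t"
    using t ms by (cases \<sigma>) (auto simp: \<rho>_def mode_solution_def sg_def mult_ac)
  finally show ?thesis .
qed

definition g :: "real \<Rightarrow> real \<Rightarrow> real" where "g t x = - sgrad (\<lambda>k. r k t) x"

lemma lam_bk_le: "0 < t \<Longrightarrow> lam k * bk k t \<le> 1 / t + 1"
proof -
  assume t: "0 < t"
  have p: "0 < 1 / t + lam k" "0 < 1 + lam k" using t lam_nonneg[of k] by (auto intro: add_pos_nonneg)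
  have "lam k * exp (- lam k * t) \<le> lam k * ((1 / t) / (1 / t + lam k))"
    using exp_lam_le[OF t, of k] by (intro mult_left_mono) auto
  also have "\<dots> = (1 / t) * (lam k / (1 / t + lam k))" by simp
  also have "\<dots> \<le> (1 / t) * 1" using t p by (intro mult_left_mono) (auto simp: divide_le_eq)
  finally have "lam k * exp (- lam k * t) \<le> 1 / t" by simp
  moreover have "lam k * (1 / (1 + lam k)) \<le> 1" using p by (simp add: divide_le_eq)
  ultimately show ?thesis unfolding bk_def distrib_left by linarith
qed

lemma sine_series_r: "t \<in> {0<..T} \<Longrightarrow> sine_series (\<lambda>k. r k t) (C0 * (1 / t + 1))"
proof
  fix k assume t: "t \<in> {0<..T}"
  have "lam k * \<bar>r k t\<bar> \<le> lam k * (C0 * bk k t)" using r_bound[of t k] t by (intro mult_left_mono) auto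
  also have "\<dots> = C0 * (lam k * bk k t)" by simp
  also have "\<dots> \<le> C0 * (1 / t + 1)" using C0_pos t by (intro mult_left_mono lam_bk_le) auto
  finally show "lam k * \<bar>r k t\<bar> \<le> C0 * (1 / t + 1)" .
qed

text \<open>Integrating each mode by parts against the test function turns the cosine series of the
  density into the sine series of the gradient. Summability comes from pairing the density with the
  derivative of the test function.\<close>

lemma \<rho>_H1: 
  assumes t: "t \<in> {0<..T}"
  shows "H1_with_gradient (\<rho> t) (g t)"
proof -
  interpret sine_series "\<lambda>k. r k t" "C0 * (1 / t + 1)" by (rule sine_series_r[OF t])
  have tT: "t \<in> {0..T}" using t by auto
  have "(LINT x|I01. \<rho> t x * deriv \<psi> x) = - (LINT x|I01. g t x * \<psi> x)" if \<psi>: "test_function \<psi>" for \<psi>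
  proof -
    note p = test_function_props[OF \<psi>]
    have ibp: "(LINT x|I01. deriv \<psi> x * cm k x) = real k * pi * (LINT x|I01. sm k x * \<psi> x)" for k
    proof -
      have "(LINT x|I01. cm k x * deriv \<psi> x) = cm k 1 * \<psi> 1 - cm k 0 * \<psi> 0 - (LINT x|I01. - (real k * pi * sm k x) * \<psi> x)"
        by (rule lint_by_parts) (auto intro!: continuous_intros p(1-3) derivative_eq_intros)
      moreover have "(\<lambda>x. - (real k * pi * sm k x) * \<psi> x) = (\<lambda>x. - (real k * pi) * (sm k x * \<psi> x))" by auto
      then have "(LINT x|I01. - (real k * pi * sm k x) * \<psi> x) = - (real k * pi) * (LINT x|I01. sm k x * \<psi> x)"
        by (simp only: integral_mult_right_zero)
      ultimately show ?thesis by (simp add: p mult.commute[of "deriv \<psi> _"])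
    qed
    have e: "wt k * r k t * (LINT x|I01. deriv \<psi> x * cm k x) = 2 * (real k * pi) * r k t * (LINT x|I01. sm k x * \<psi> x)" for k
      unfolding ibp by (simp add: wt_def)
    have "integrable I01 (deriv \<psi>)" by (intro continuous_imp_integrable_real p)
    from \<rho>_pair_sums[OF t this]
    have s: "(\<lambda>k. 2 * (real k * pi) * r k t * (LINT x|I01. sm k x * \<psi> x)) sums (LINT x|I01. \<rho> t x * deriv \<psi> x)"
      unfolding e .
    have "(LINT x|I01. sgrad (\<lambda>k. r k t) x * \<psi> x) = (LINT x|I01. \<rho> t x * deriv \<psi> x)"
      using sgrad_test[OF p(1) sums_summable[OF s]] sums_unique[OF s] by simp
    then show ?thesis by (simp add: g_def)
  qed
  moreover have "integrable I01 (\<lambda>x. (\<rho> t x)^2)"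
    by (intro continuous_imp_integrable_real continuous_intros \<rho>_cont[OF t])
  ultimately show ?thesis
    using \<rho>_integrable[OF tT] sgrad_measurable sgrad_square_integrable
    unfolding H1_with_gradient_def g_def[abs_def] by auto
qed

definition pt :: "bool \<Rightarrow> real" where "pt \<sigma> = (if \<sigma> then 1 else 0)"

lemma cm_pt: "cm k (pt \<sigma>) = sg \<sigma> ^ k" by (simp add: pt_def sg_def)

section \<open>The weak formulation, mode by mode\<close>

lemma rectangle_slice_continuous:
  fixes W :: "real \<Rightarrow> real \<Rightarrow> real"
  assumes "continuous_on ({0..T} \<times> {0..1}) (\<lambda>(t, x). W t x)" "s \<in> {0..T}"
  shows "continuous_on {0..1} (W s)"
proof -
  have "continuous_on {0..1} (\<lambda>x. (s, x))" by (intro continuous_intros)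
  then have "continuous_on {0..1} (\<lambda>x. (\<lambda>(t, x). W t x) (s, x))"
    by (rule continuous_on_compose2[OF assms(1)]) (use assms(2) in auto)
  then show ?thesis by simp
qed

lemma rectangle_lint_continuous:
  fixes W :: "real \<Rightarrow> real \<Rightarrow> real"
  assumes W: "continuous_on ({0..T} \<times> {0..1}) (\<lambda>(t, x). W t x)" and e: "continuous_on {0..1} e"
  shows "continuous_on {0..T} (\<lambda>s. LINT x|I01. W s x * e x)"
proof -
  have c: "continuous_on ({0..T} \<times> cbox 0 1) (\<lambda>(s, x). W s x * e x)"
  proof -
    have "continuous_on ({0..T} \<times> {0..1}) (\<lambda>z. e (snd z))"
      by (rule continuous_on_compose2[OF e continuous_on_snd[OF continuous_on_id]]) auto
    from continuous_on_mult[OF W this] show ?thesis by (simp add: case_prod_beta)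
  qed
  have "continuous_on {0..T} (\<lambda>s. integral {0..1} (\<lambda>x. W s x * e x))"
    using integral_continuous_on_param[OF c] by simp
  moreover have "(LINT x|I01. W s x * e x) = integral {0..1} (\<lambda>x. W s x * e x)" if "s \<in> {0..T}" for s
    by (intro lint_continuous_eq continuous_intros rectangle_slice_continuous[OF W that] e)
  ultimately show ?thesis by (subst continuous_on_cong[OF refl]) auto
qed

lemma rectangle_bounded:
  fixes W :: "real \<Rightarrow> real \<Rightarrow> real"
  assumes "continuous_on ({0..T} \<times> {0..1}) (\<lambda>(t, x). W t x)"
  obtains A where "\<And>s x. s \<in> {0..T} \<Longrightarrow> x \<in> {0..1} \<Longrightarrow> \<bar>W s x\<bar> \<le> A"
proof -
  have "bounded ((\<lambda>(t, x). W t x) ` ({0..T} \<times> {0..1}))"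
    using compact_continuous_image[OF assms] compact_imp_bounded by (auto intro: compact_Times)
  then obtain A where "\<forall>y\<in>(\<lambda>(t, x). W t x) ` ({0..T} \<times> {0..1}). \<bar>y\<bar> \<le> A"
    by (auto simp: bounded_iff)
  then show ?thesis by (intro that) force
qed

text \<open>For a single mode the identity is the fundamental theorem of calculus applied to
  \<open>r k * h k\<close> in time. The work lies in summing over k: two integrations by parts in
  space bound \<open>lam k * h k\<close>, and then all three series of integrands are dominated by
  \<open>bk\<close>.\<close>

lemma weak_identity:
  assumes H: "C12 T H Ht Hx" and t: "t \<in> {0..T}"
  shows "(LINT x|I01. \<rho> t x * H t x) - (LINT x|I01. \<gamma> x * H 0 x)
     = (LINT s|lebesgue_on {0..t}. LINT x|I01. \<rho> s x * Ht s x)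
       - (LINT s|lebesgue_on {0..t}. LINT x|I01. g s x * Hx s x)
       + (LINT s|lebesgue_on {0..t}. F True (boundary_value (\<rho> s) 1) * H s 1 + F False (boundary_value (\<rho> s) 0) * H s 0)"
proof -
  obtain Hxx where c: "\<And>G. G \<in> {H, Ht, Hx, Hxx} \<Longrightarrow> continuous_on ({0..T} \<times> {0..1}) (\<lambda>(t, x). G t x)"
    and d: "\<And>t x. t \<in> {0<..<T} \<Longrightarrow> x \<in> {0<..<1} \<Longrightarrow> ((\<lambda>s. H s x) has_real_derivative Ht t x) (at t)"
      "\<And>t x. t \<in> {0<..<T} \<Longrightarrow> x \<in> {0<..<1} \<Longrightarrow> ((\<lambda>y. H t y) has_real_derivative Hx t x) (at x)"
      "\<And>t x. t \<in> {0<..<T} \<Longrightarrow> x \<in> {0<..<1} \<Longrightarrow> ((\<lambda>y. Hx t y) has_real_derivative Hxx t x) (at x)"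
    using H unfolding C12_def by blast
  note sl = rectangle_slice_continuous[OF c]
  have slH: "continuous_on {0..1} (H s)" "continuous_on {0..1} (Ht s)" "continuous_on {0..1} (Hx s)" "continuous_on {0..1} (Hxx s)"
    if "s \<in> {0..T}" for s
    by (rule sl[OF _ that], simp)+
  obtain A where A: "\<And>G s x. G \<in> {H, Ht, Hx, Hxx} \<Longrightarrow> s \<in> {0..T} \<Longrightarrow> x \<in> {0..1} \<Longrightarrow> \<bar>G s x\<bar> \<le> A"
  proof -
    obtain A1 where A1: "\<And>s x. s \<in> {0..T} \<Longrightarrow> x \<in> {0..1} \<Longrightarrow> \<bar>H s x\<bar> \<le> A1" using rectangle_bounded[OF c[of H]] by auto
    obtain A2 where A2: "\<And>s x. s \<in> {0..T} \<Longrightarrow> x \<in> {0..1} \<Longrightarrow> \<bar>Ht s x\<bar> \<le> A2" using rectangle_bounded[OF c[of Ht]] by auto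
    obtain A3 where A3: "\<And>s x. s \<in> {0..T} \<Longrightarrow> x \<in> {0..1} \<Longrightarrow> \<bar>Hx s x\<bar> \<le> A3" using rectangle_bounded[OF c[of Hx]] by auto
    obtain A4 where A4: "\<And>s x. s \<in> {0..T} \<Longrightarrow> x \<in> {0..1} \<Longrightarrow> \<bar>Hxx s x\<bar> \<le> A4" using rectangle_bounded[OF c[of Hxx]] by auto
    show ?thesis
      by (rule that[of "max (max A1 A2) (max A3 A4)"]) (use A1 A2 A3 A4 in \<open>fastforce simp: le_max_iff_disj\<close>)
  qed
  have A0: "0 \<le> A" using order_trans[OF abs_ge_zero A[of H 0 0]] T by auto
  define h where "h k s = (LINT x|I01. H s x * cm k x)" for k s
  define ht where "ht k s = (LINT x|I01. Ht s x * cm k x)" for k s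
  define hx where "hx k s = (LINT x|I01. Hx s x * sm k x)" for k s
  have hc: "continuous_on {0..T} (h k)" "continuous_on {0..T} (ht k)" "continuous_on {0..T} (hx k)" for k
    unfolding h_def[abs_def] ht_def[abs_def] hx_def[abs_def]
    by (intro rectangle_lint_continuous c continuous_intros; simp)+
  have prod_le: "\<bar>G s x * e\<bar> \<le> A" if "G \<in> {H, Ht, Hx, Hxx}" "s \<in> {0..T}" "x \<in> {0..1}" "\<bar>e\<bar> \<le> 1" for G s x e
    using mult_mono[OF A[OF that(1-3)] that(4)] A0 by (simp add: abs_mult)
  have hb: "\<bar>h k s\<bar> \<le> A" "\<bar>ht k s\<bar> \<le> A" "\<bar>hx k s\<bar> \<le> A" if "s \<in> {0..T}" for k s
    unfolding h_def ht_def hx_def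
    by (intro lint_abs_le continuous_intros sl[OF _ that] prod_le that; simp)+
  \<comment> \<open>The spatial derivatives of H are available at interior times only; the resulting
    bound of \<open>h k\<close> is carried to the closed interval by continuity in
    \<open>e3\<close>.\<close>
  have e1: "real k * pi * h k s = - hx k s" if s: "s \<in> {0<..<T}" for k s
  proof -
    have sT: "s \<in> {0..T}" using s by auto
    have "(LINT x|I01. sm k x * Hx s x) = sm k 1 * H s 1 - sm k 0 * H s 0 - (LINT x|I01. real k * pi * cm k x * H s x)"
      by (rule lint_by_parts) (auto intro!: continuous_intros slH[OF sT] d(2)[OF s] derivative_eq_intros)
    moreover have "(\<lambda>x. real k * pi * cm k x * H s x) = (\<lambda>x. real k * pi * (H s x * cm k x))" by auto
    then have "(LINT x|I01. real k * pi * cm k x * H s x) = real k * pi * h k s"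
      unfolding h_def by (simp only: integral_mult_right_zero)
    ultimately show ?thesis by (simp add: hx_def mult.commute[of "sm k _"])
  qed
  have e2: "\<bar>real k * pi * hx k s\<bar> \<le> 3 * A" if s: "s \<in> {0<..<T}" for k s
  proof -
    have sT: "s \<in> {0..T}" using s by auto
    have "(LINT x|I01. Hx s x * (real k * pi * sm k x)) = Hx s 1 * - cm k 1 - Hx s 0 * - cm k 0 - (LINT x|I01. Hxx s x * - cm k x)"
      by (rule lint_by_parts) (auto intro!: continuous_intros slH[OF sT] d(3)[OF s] derivative_eq_intros)
    moreover have "(\<lambda>x. Hx s x * (real k * pi * sm k x)) = (\<lambda>x. real k * pi * (Hx s x * sm k x))" by auto
    then have "(LINT x|I01. Hx s x * (real k * pi * sm k x)) = real k * pi * hx k s"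
      unfolding hx_def by (simp only: integral_mult_right_zero)
    moreover have "\<bar>LINT x|I01. Hxx s x * - cm k x\<bar> \<le> A"
      by (intro lint_abs_le continuous_intros sl sT prod_le; simp)
    moreover have "\<bar>Hx s 1 * - cm k 1\<bar> \<le> A" "\<bar>Hx s 0 * - cm k 0\<bar> \<le> A"
      by (intro prod_le sT; simp add: power_abs)+
    ultimately show ?thesis by linarith
  qed
  have e3: "(1 + lam k) * \<bar>h k s\<bar> \<le> 4 * A" if s: "s \<in> {0..T}" for k s
  proof -
    have int: "(1 + lam k) * \<bar>h k s\<bar> \<le> 4 * A" if s: "s \<in> {0<..<T}" for s
    proof -
      have "lam k * h k s = - (real k * pi * hx k s)"
        using e1[OF s, of k] by (simp add: lam_def power2_eq_square mult.assoc)
      then have "lam k * \<bar>h k s\<bar> = \<bar>real k * pi * hx k s\<bar>"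
        using abs_mult[of "lam k" "h k s"] by simp
      then show ?thesis using e2[OF s, of k] hb(1)[of s k] s by (simp add: distrib_right)
    qed
    have cl: "closure {0<..<T} = {0..T}" using T by (rule closure_greaterThanLessThan)
    show ?thesis
    proof (rule continuous_ge_on_closure[of "{0<..<T}" "\<lambda>s. 4 * A - (1 + lam k) * \<bar>h k s\<bar>" s 0, simplified, unfolded cl])
      show "continuous_on {0..T} (\<lambda>s. 4 * A - (1 + lam k) * \<bar>h k s\<bar>)" by (intro continuous_intros hc)
    qed (use s int in auto)
  qed
  have hsum: "summable (\<lambda>k. \<bar>h k s\<bar>)" if s: "s \<in> {0..T}" for s
  proof (rule summable_comparison_test[OF _ summable_mult[OF lam_summable[of 1], of "2 * A"]], intro exI allI impI)
    fix k
    have "0 < 1 + lam k" by (simp add: add_pos_nonneg)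
    then show "norm \<bar>h k s\<bar> \<le> 2 * A * (2 / (1 + lam k))" using e3[OF s, of k] by (simp add: field_simps)
  qed auto
  have inv: "H s x = (\<Sum>k. wt k * h k s * cm k x)" if "s \<in> {0..T}" "x \<in> {0..1}" for s x
    using cos_inversion[OF sl[OF _ that(1), of H], of "\<lambda>k. h k s" x] hsum[OF that(1)] that(2) by (simp add: h_def)
  \<comment> \<open>The time derivative of H exists at interior points only. So the coefficient is
    first written as an integral, by the fundamental theorem at each interior x and an exchange of
    integrals, and differentiated afterwards.\<close>
  have h_int: "h k s = h k 0 + integral {0..s} (ht k)" if s: "s \<in> {0..T}" for k s
  proof -
    have ftc: "H s x - H 0 x = integral {0..s} (\<lambda>u. Ht u x)" if x: "x \<in> {0<..<1}" for x
    proof -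
      have "((\<lambda>u. Ht u x) has_integral H s x - H 0 x) {0..s}"
      proof (rule fundamental_theorem_of_calculus_interior)
        show "continuous_on {0..s} (\<lambda>u. H u x)"
        proof -
          have "continuous_on {0..s} (\<lambda>u. (u, x))" by (intro continuous_intros)
          then have "continuous_on {0..s} (\<lambda>u. (\<lambda>(t, x). H t x) (u, x))"
            by (rule continuous_on_compose2[OF c[of H], rotated]) (use s x in auto)
          then show ?thesis by simp
        qed
        show "((\<lambda>u. H u x) has_vector_derivative Ht u x) (at u)" if "u \<in> {0<..<s}" for u
          using d(1)[of u x] that s x by (auto simp flip: has_real_derivative_iff_has_vector_derivative)
      qed (use s in auto)
      then show ?thesis by (simp add: integral_unique)
    qed
    have cc: "continuous_on {0..1} (\<lambda>x. H u x * cm k x)" "continuous_on {0..1} (\<lambda>x. Ht u x * cm k x)" if "u \<in> {0..T}" for u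
      by (intro continuous_intros sl that; simp)+
    have T0: "0 \<in> {0..T}" using T by simp
    have "h k s - h k 0 = integral {0..1} (\<lambda>x. H s x * cm k x - H 0 x * cm k x)"
      unfolding h_def lint_continuous_eq[OF cc(1)[OF s]] lint_continuous_eq[OF cc(1)[OF T0]]
      by (intro Henstock_Kurzweil_Integration.integral_diff[symmetric] integrable_continuous_interval cc s T0)
    also have "\<dots> = integral {0..1} (\<lambda>x. integral {0..s} (\<lambda>u. Ht u x * cm k x))"
    proof (rule integral_spike[of "{0, 1}"])
      show "integral {0..s} (\<lambda>u. Ht u x * cm k x) = H s x * cm k x - H 0 x * cm k x" if "x \<in> {0..1} - {0, 1}" for x
        using ftc[of x] that by (simp add: left_diff_distrib[symmetric])
    qed auto
    also have "\<dots> = integral {0..s} (\<lambda>u. integral {0..1} (\<lambda>x. Ht u x * cm k x))"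
    proof -
      have "continuous_on (cbox (0, 0) (1, s)) (\<lambda>(x, u). Ht u x * cm k x)"
      proof -
        have "continuous_on ({0..1} \<times> {0..s}) (\<lambda>z. (snd z, fst z))" by (intro continuous_intros)
        then have "continuous_on ({0..1} \<times> {0..s}) (\<lambda>z. (\<lambda>(t, x). Ht t x) (snd z, fst z))"
          by (rule continuous_on_compose2[OF c[of Ht], rotated]) (use s in auto)
        moreover have "continuous_on ({0..1} \<times> {0..s}) (\<lambda>z. cm k (fst z))" by (intro continuous_intros)
        ultimately have "continuous_on ({0..1} \<times> {0..s}) (\<lambda>z. (\<lambda>(t, x). Ht t x) (snd z, fst z) * cm k (fst z))"
          by (rule continuous_on_mult)
        then show ?thesis by (simp add: cbox_Pair_eq case_prod_beta)
      qed
      from integral_swap_continuous[OF this] show ?thesis by simp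
    qed
    also have "\<dots> = integral {0..s} (ht k)"
      using s cc(2) by (intro integral_cong) (simp add: ht_def lint_continuous_eq)
    finally show ?thesis by simp
  qed
  have h_deriv: "(h k has_real_derivative ht k s) (at s)" if s: "s \<in> {0<..<T}" for k s
  proof -
    have "((\<lambda>u. integral {0..u} (ht k)) has_vector_derivative ht k s) (at s within {0..T})"
      using hc(2)[of k] s by (intro integral_has_vector_derivative) auto
    moreover have at: "at s within {0..T} = at s" using s by (intro at_within_interior) (auto simp: interior_atLeastAtMost_real)
    ultimately have "((\<lambda>u. h k 0 + integral {0..u} (ht k)) has_real_derivative 0 + ht k s) (at s)"
      by (intro DERIV_add DERIV_const) (simp add: has_real_derivative_iff_has_vector_derivative)
    then have D: "((\<lambda>u. h k 0 + integral {0..u} (ht k)) has_real_derivative ht k s) (at s)" by simp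
    have E: "h k 0 + integral {0..u} (ht k) = h k u" if "u \<in> {0<..<T}" for u
      using h_int[of u k] that by simp
    show ?thesis
      by (rule has_field_derivative_transform_within_open[OF D, where S = "{0<..<T}"]) (use s E in auto)
  qed
  show ?thesis
  proof (cases "t = 0")
    case True
    have z: "(LINT s|lebesgue_on {0..t}. G s) = 0" for G :: "real \<Rightarrow> real"
      using AE_lebesgue_on_interior[of t] True by (intro integral_eq_zero_AE) auto
    show ?thesis unfolding z using True by (simp add: \<rho>_def)
  next
    case False
    then have tp: "t \<in> {0<..T}" "0 \<le> t" "t \<le> T" using t by auto
    \<comment> \<open>The three integrands: \<open>fa\<close> belongs to the gradient,
      \<open>fb\<close> to the fluxes and \<open>fd\<close> to the time derivative of H.\<close>
    define fa where "fa k s = 2 * (real k * pi) * r k s * hx k s" for k s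
    define fb where "fb k s = wt k * \<phi> k s * h k s" for k s
    define fd where "fd k s = wt k * r k s * ht k s" for k s
    have sub: "{0<..t} \<subseteq> {0..T}" "{0<..t} \<subseteq> {0<..T}" using tp by auto
    have fc: "continuous_on {0<..t} (fa k)" "continuous_on {0<..t} (fb k)" "continuous_on {0<..t} (fd k)" for k
      unfolding fa_def[abs_def] fb_def[abs_def] fd_def[abs_def]
      by (intro continuous_intros continuous_on_subset[OF r_cont] continuous_on_subset[OF \<phi>_cont]
          continuous_on_subset[OF hc(1)] continuous_on_subset[OF hc(2)] continuous_on_subset[OF hc(3)] sub)+
    have r2: "\<bar>r k s\<bar> \<le> 2 * C0" if "s \<in> {0<..t}" for k s
    proof -
      have s: "s \<in> {0..T}" using that sub by auto
      have "C0 * bk k s \<le> C0 * 2" using C0_pos bk_le_2[of s k] s by (intro mult_left_mono) auto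
      then show ?thesis using r_bound[OF s, of k] by simp
    qed
    have b2: "\<bar>fa k s\<bar> \<le> 2 * (real k * pi) * (2 * C0) * A" "\<bar>fb k s\<bar> \<le> 2 * (2 * Q) * A" "\<bar>fd k s\<bar> \<le> 2 * (2 * C0) * A"
      if s: "s \<in> {0<..t}" for k s
      unfolding fa_def fb_def fd_def abs_mult
      using hb[of s k] s sub r2[OF s, of k] \<phi>_bound[of k s] C0_pos A0 Q_nonneg wt_le_2[of k]
      by (intro mult_mono; auto)+
    have b1: "\<bar>fa k s\<bar> \<le> 2 * C0 * (3 * A) * bk k s" "\<bar>fb k s\<bar> \<le> 2 * (2 * Q) * (4 * A) * bk k s" "\<bar>fd k s\<bar> \<le> 2 * C0 * A * bk k s"
      if s: "s \<in> {0<..<t}" for k s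
    proof -
      have s': "s \<in> {0<..<T}" "s \<in> {0..T}" using s tp by auto
      have "\<bar>fa k s\<bar> = 2 * \<bar>r k s\<bar> * \<bar>real k * pi * hx k s\<bar>" by (simp add: fa_def abs_mult)
      also have "\<dots> \<le> 2 * (C0 * bk k s) * (3 * A)"
        using r_bound[OF s'(2), of k] e2[OF s'(1), of k] C0_pos bk_nonneg[of k s] by (intro mult_mono) auto
      finally show "\<bar>fa k s\<bar> \<le> 2 * C0 * (3 * A) * bk k s" by (simp add: mult_ac)
      have p: "0 < 1 + lam k" by (simp add: add_pos_nonneg)
      have "\<bar>h k s\<bar> \<le> 4 * A * (1 / (1 + lam k))" using e3[OF s'(2), of k] p by (simp add: field_simps)
      also have "\<dots> \<le> 4 * A * bk k s" using A0 by (intro mult_left_mono) (auto simp: bk_def)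
      finally have "wt k * \<bar>\<phi> k s\<bar> * \<bar>h k s\<bar> \<le> 2 * (2 * Q) * (4 * A * bk k s)"
        using \<phi>_bound[of k s] wt_le_2[of k] Q_nonneg by (intro mult_mono) auto
      then show "\<bar>fb k s\<bar> \<le> 2 * (2 * Q) * (4 * A) * bk k s" by (simp add: fb_def abs_mult mult_ac)
      have "wt k * \<bar>r k s\<bar> * \<bar>ht k s\<bar> \<le> 2 * (C0 * bk k s) * A"
        using r_bound[OF s'(2), of k] hb(2)[OF s'(2), of k] wt_le_2[of k] C0_pos bk_nonneg[of k s] by (intro mult_mono) auto
      then show "\<bar>fd k s\<bar> \<le> 2 * C0 * A * bk k s" by (simp add: fd_def abs_mult mult_ac)
    qed
    note SA = mode_series_lint[OF tp(2,3) fc(1) b1(1) b2(1)]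
    note SB = mode_series_lint[OF tp(2,3) fc(2) b1(2) b2(2)]
    note SD = mode_series_lint[OF tp(2,3) fc(3) b1(3) b2(3)]
    have ii: "integrable (lebesgue_on {0..t}) (fa k)" "integrable (lebesgue_on {0..t}) (fb k)" "integrable (lebesgue_on {0..t}) (fd k)" for k
    proof -
      show "integrable (lebesgue_on {0..t}) (fa k)" by (rule lebesgue_integrable_half_open[OF fc(1) b2(1)])
      show "integrable (lebesgue_on {0..t}) (fb k)" by (rule lebesgue_integrable_half_open[OF fc(2) b2(2)])
      show "integrable (lebesgue_on {0..t}) (fd k)" by (rule lebesgue_integrable_half_open[OF fc(3) b2(3)])
    qed
    have lin: "(LINT s|lebesgue_on {0..t}. fa k s + fb k s + fd k s) = wt k * r k t * h k t - wt k * gam k * h k 0" for k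
    proof -
      have "((\<lambda>s. fa k s + fb k s + fd k s) has_integral wt k * (r k t * h k t) - wt k * (r k 0 * h k 0)) {0..t}"
      proof (rule fundamental_theorem_of_calculus_interior)
        show "continuous_on {0..t} (\<lambda>s. wt k * (r k s * h k s))"
          using tp by (intro continuous_intros continuous_on_subset[OF r_cont] continuous_on_subset[OF hc(1)]) auto
        fix s assume s: "s \<in> {0<..<t}"
        then have s': "s \<in> {0<..<T}" using tp by auto
        have D: "((\<lambda>s. wt k * (r k s * h k s)) has_real_derivative wt k * ((- lam k * r k s + \<phi> k s) * h k s + ht k s * r k s)) (at s)"
          by (intro DERIV_cmult DERIV_mult r_deriv h_deriv s')
        have "- lam k * h k s = real k * pi * hx k s"
          using e1[OF s', of k] by (simp add: lam_def power2_eq_square mult.assoc)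
        then have E: "wt k * (- lam k * r k s * h k s) = fa k s"
        proof -
          assume e: "- lam k * h k s = real k * pi * hx k s"
          have "wt k * (- lam k * r k s * h k s) = wt k * r k s * (- lam k * h k s)" by (simp only: mult_ac)
          also have "\<dots> = wt k * r k s * (real k * pi * hx k s)" by (simp only: e)
          also have "\<dots> = fa k s" by (cases "k = 0") (simp_all add: fa_def wt_def)
          finally show ?thesis .
        qed
        have "wt k * ((- lam k * r k s + \<phi> k s) * h k s + ht k s * r k s)
          = wt k * (- lam k * r k s * h k s) + wt k * \<phi> k s * h k s + wt k * r k s * ht k s" by (simp add: algebra_simps)
        then have "wt k * ((- lam k * r k s + \<phi> k s) * h k s + ht k s * r k s) = fa k s + fb k s + fd k s"
          unfolding E fb_def fd_def .
        with D have "((\<lambda>s. wt k * (r k s * h k s)) has_real_derivative fa k s + fb k s + fd k s) (at s)"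
          by simp
        then show "((\<lambda>s. wt k * (r k s * h k s)) has_vector_derivative fa k s + fb k s + fd k s) (at s)"
          by (simp add: has_real_derivative_iff_has_vector_derivative)
      qed (use tp in auto)
      then show ?thesis
        using ii by (subst lebesgue_integral_eq_integral) (auto simp: integral_unique r_0)
    qed
    have "(\<lambda>k. (LINT s|lebesgue_on {0..t}. fa k s) + (LINT s|lebesgue_on {0..t}. fb k s) + (LINT s|lebesgue_on {0..t}. fd k s))
      sums ((LINT s|lebesgue_on {0..t}. (\<Sum>k. fa k s)) + (LINT s|lebesgue_on {0..t}. (\<Sum>k. fb k s)) + (LINT s|lebesgue_on {0..t}. (\<Sum>k. fd k s)))"
      by (intro sums_add SA(2) SB(2) SD(2))
    moreover have "(LINT s|lebesgue_on {0..t}. fa k s) + (LINT s|lebesgue_on {0..t}. fb k s) + (LINT s|lebesgue_on {0..t}. fd k s)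
      = wt k * r k t * h k t - wt k * gam k * h k 0" for k
      using lin[of k] ii[of k] by simp
    moreover have "(\<lambda>k. wt k * r k t * h k t - wt k * gam k * h k 0) sums ((LINT x|I01. \<rho> t x * H t x) - (LINT x|I01. \<gamma> x * H 0 x))"
    proof (rule sums_diff)
      have "integrable I01 (H t)" by (intro continuous_imp_integrable_real slH t)
      from \<rho>_pair_sums[OF tp(1) this] show "(\<lambda>k. wt k * r k t * h k t) sums (LINT x|I01. \<rho> t x * H t x)"
        by (simp add: h_def)
      have T0: "0 \<in> {0..T}" using T by simp
      have "(\<lambda>k. wt k * h k 0 * (LINT x|I01. \<gamma> x * cm k x)) sums (LINT x|I01. \<gamma> x * (\<Sum>k. wt k * h k 0 * cm k x))"
        by (rule cos_series_sums[OF hsum[OF T0] \<gamma>_integrable])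
      moreover have "(LINT x|I01. \<gamma> x * (\<Sum>k. wt k * h k 0 * cm k x)) = (LINT x|I01. \<gamma> x * H 0 x)"
        by (rule Bochner_Integration.integral_cong) (auto simp: inv[OF T0])
      ultimately show "(\<lambda>k. wt k * gam k * h k 0) sums (LINT x|I01. \<gamma> x * H 0 x)"
        by (simp add: gam_eq mult_ac)
    qed
    ultimately have eq: "(LINT x|I01. \<rho> t x * H t x) - (LINT x|I01. \<gamma> x * H 0 x)
      = (LINT s|lebesgue_on {0..t}. (\<Sum>k. fa k s)) + (LINT s|lebesgue_on {0..t}. (\<Sum>k. fb k s)) + (LINT s|lebesgue_on {0..t}. (\<Sum>k. fd k s))"
      using sums_unique2 by simp
    have sf: "summable (\<lambda>k. fa k s)" "summable (\<lambda>k. fb k s)" "summable (\<lambda>k. fd k s)" if "s \<in> {0<..<t}" for s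
      using summable_comparison_test[OF exI, OF allI, OF impI, OF b1(1)[unfolded real_norm_def[symmetric], OF that] summable_mult[OF bk_summable]]
        summable_comparison_test[OF exI, OF allI, OF impI, OF b1(2)[unfolded real_norm_def[symmetric], OF that] summable_mult[OF bk_summable]]
        summable_comparison_test[OF exI, OF allI, OF impI, OF b1(3)[unfolded real_norm_def[symmetric], OF that] summable_mult[OF bk_summable]] that by auto
    have LA: "(LINT s|lebesgue_on {0..t}. (\<Sum>k. fa k s)) = - (LINT s|lebesgue_on {0..t}. LINT x|I01. g s x * Hx s x)"
    proof -
      have "(LINT s|lebesgue_on {0..t}. (\<Sum>k. fa k s)) = (LINT s|lebesgue_on {0..t}. - (LINT x|I01. g s x * Hx s x))"
      proof (rule lebesgue_on_integral_AE_eq(2))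
        show "AE s in lebesgue_on {0..t}. (\<Sum>k. fa k s) = - (LINT x|I01. g s x * Hx s x)"
          using AE_lebesgue_on_interior[of t]
        proof eventually_elim
          case (elim s)
          then have s: "s \<in> {0..T}" "s \<in> {0<..T}" using tp by auto
          interpret sine_series "\<lambda>k. r k s" "C0 * (1 / s + 1)" by (rule sine_series_r[OF s(2)])
          have e: "2 * (real k * pi) * r k s * (LINT x|I01. sm k x * Hx s x) = fa k s" for k
            by (simp add: fa_def hx_def mult.commute[of "sm k _"])
          show ?case
            using sgrad_test[OF slH(3)[OF s(1)]] sf(1)[OF elim] unfolding e by (simp add: g_def)
        qed
      qed auto
      then show ?thesis by simp
    qed
    have LB: "(LINT s|lebesgue_on {0..t}. (\<Sum>k. fb k s))
      = (LINT s|lebesgue_on {0..t}. F True (boundary_value (\<rho> s) 1) * H s 1 + F False (boundary_value (\<rho> s) 0) * H s 0)"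
    proof (rule lebesgue_on_integral_AE_eq(2))
      show "AE s in lebesgue_on {0..t}. (\<Sum>k. fb k s) = F True (boundary_value (\<rho> s) 1) * H s 1 + F False (boundary_value (\<rho> s) 0) * H s 0"
        using AE_lebesgue_on_interior[of t]
      proof eventually_elim
        case (elim s)
        then have s: "s \<in> {0..T}" "s \<in> {0<..T}" using tp by auto
        have hs: "(\<lambda>k. f \<sigma> s * (wt k * h k s * cm k (pt \<sigma>))) sums (f \<sigma> s * H s (pt \<sigma>))" for \<sigma>
        proof (rule sums_mult)
          have "summable (\<lambda>k. wt k * h k s * cm k (pt \<sigma>))"
          proof (rule summable_comparison_test[OF _ summable_mult[OF hsum[OF s(1)], of 2]], intro exI allI impI)
            show "norm (wt k * h k s * cm k (pt \<sigma>)) \<le> 2 * \<bar>h k s\<bar>" for k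
              using mult_right_mono[OF wt_le_2[of k], of "\<bar>h k s\<bar>"] by (simp add: abs_mult cm_pt)
          qed
          then show "(\<lambda>k. wt k * h k s * cm k (pt \<sigma>)) sums H s (pt \<sigma>)"
            using inv[OF s(1), of "pt \<sigma>"] by (simp add: pt_def summable_sums)
        qed
        have "(\<lambda>k. f True s * (wt k * h k s * cm k (pt True)) + f False s * (wt k * h k s * cm k (pt False)))
           sums (f True s * H s (pt True) + f False s * H s (pt False))"
          by (intro sums_add hs)
        moreover have "(\<lambda>k. f True s * (wt k * h k s * cm k (pt True)) + f False s * (wt k * h k s * cm k (pt False))) = (\<lambda>k. fb k s)"
          by (rule ext) (simp add: fb_def \<phi>_def cm_pt UNIV_bool algebra_simps)
        ultimately have "(\<Sum>k. fb k s) = f True s * H s 1 + f False s * H s 0"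
          by (simp add: sums_iff pt_def)
        moreover have "f \<sigma> s = F \<sigma> (a \<sigma> s)" for \<sigma> using ms by (simp add: mode_solution_def)
        ultimately show ?case
          using \<rho>_boundary[OF s(2), of True] \<rho>_boundary[OF s(2), of False] by simp
      qed
    qed auto
    have LD: "(LINT s|lebesgue_on {0..t}. (\<Sum>k. fd k s)) = (LINT s|lebesgue_on {0..t}. LINT x|I01. \<rho> s x * Ht s x)"
    proof (rule lebesgue_on_integral_AE_eq(2))
      show "AE s in lebesgue_on {0..t}. (\<Sum>k. fd k s) = (LINT x|I01. \<rho> s x * Ht s x)"
        using AE_lebesgue_on_interior[of t]
      proof eventually_elim
        case (elim s)
        then have s: "s \<in> {0..T}" "s \<in> {0<..T}" using tp by auto
        have "integrable I01 (Ht s)" by (intro continuous_imp_integrable_real slH s)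
        from \<rho>_pair_sums[OF s(2) this] show ?case by (simp add: fd_def ht_def sums_iff)
      qed
    qed auto
    show ?thesis unfolding eq LA LB LD by simp
  qed
qed

section \<open>Measurability and energy on the space-time rectangle\<close>

abbreviation Rect :: "(real \<times> real) set" where "Rect \<equiv> {0..T} \<times> {0..1}"

lemma Rect_lebesgue: "Rect \<in> sets lebesgue" and Rect_lmeasurable: "Rect \<in> lmeasurable"
proof -
  have "Rect = cbox (0, 0) (T, 1)" by (simp add: cbox_Pair_eq)
  then show "Rect \<in> lmeasurable" by (simp only: lmeasurable_cbox)
  then show "Rect \<in> sets lebesgue" by auto
qed

lemma AE_Rect: "AE z in lebesgue_on Rect. fst z \<in> {0<..T} \<and> snd z \<in> {0..1}"
proof -
  have "negligible {z :: real \<times> real. z \<bullet> (1, 0) = 0}"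
    by (rule negligible_standard_hyperplane) (simp add: Basis_prod_def)
  then have "AE z in lebesgue. z \<notin> {z :: real \<times> real. z \<bullet> (1, 0) = 0}"
    by (intro AE_not_in) (simp add: negligible_iff_null_sets)
  then have "AE z in lebesgue. z \<in> Rect \<longrightarrow> fst z \<in> {0<..T} \<and> snd z \<in> {0..1}"
    by eventually_elim (auto simp: inner_prod_def)
  moreover have "Rect \<inter> space lebesgue \<in> sets lebesgue" using Rect_lebesgue by simp
  ultimately show ?thesis using AE_restrict_space_iff by blast
qed

lemma Rect_measurable_mode:
  fixes e :: "real \<Rightarrow> real"
  assumes "continuous_on {0..1} e"
  shows "(\<lambda>z. r k (fst z) * e (snd z)) \<in> borel_measurable (lebesgue_on Rect)"
proof (rule continuous_imp_measurable_on_sets_lebesgue[OF _ Rect_lebesgue])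
  have "continuous_on Rect (\<lambda>z. r k (fst z))"
    by (rule continuous_on_compose2[OF r_cont continuous_on_fst[OF continuous_on_id]]) auto
  moreover have "continuous_on Rect (\<lambda>z. e (snd z))"
    by (rule continuous_on_compose2[OF assms continuous_on_snd[OF continuous_on_id]]) auto
  ultimately show "continuous_on Rect (\<lambda>z. r k (fst z) * e (snd z))" by (rule continuous_on_mult)
qed

lemma \<rho>_Rect_measurable: "(\<lambda>(t, x). \<rho> t x) \<in> borel_measurable (lebesgue_on Rect)"
proof -
  have "(\<lambda>z. \<Sum>k. wt k * (r k (fst z) * cm k (snd z))) \<in> borel_measurable (lebesgue_on Rect)"
    by (intro borel_measurable_suminf borel_measurable_times borel_measurable_const Rect_measurable_mode continuous_intros)
  moreover have "AE z in lebesgue_on Rect. (case z of (t, x) \<Rightarrow> \<rho> t x) = (\<Sum>k. wt k * (r k (fst z) * cm k (snd z)))"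
    using AE_Rect
  proof eventually_elim
    case (elim z)
    then show ?case by (cases z) (simp add: \<rho>_def mult.assoc)
  qed
  ultimately show ?thesis
    using lebesgue_on_measurable_AE_eq[OF _ Rect_lebesgue, of "\<lambda>(t, x). \<rho> t x"] by simp
qed

lemma g_Rect_measurable: "(\<lambda>(t, x). g t x) \<in> borel_measurable (lebesgue_on Rect)"
proof -
  have "(\<lambda>z. - (\<Sum>j. \<Sum>k\<in>{2^j..<2^Suc j}. 2 * (real k * pi) * (r k (fst z) * sm k (snd z)))) \<in> borel_measurable (lebesgue_on Rect)"
    by (intro borel_measurable_uminus borel_measurable_suminf borel_measurable_sum borel_measurable_times borel_measurable_const Rect_measurable_mode continuous_intros)
  moreover have "(\<lambda>z. - (\<Sum>j. \<Sum>k\<in>{2^j..<2^Suc j}. 2 * (real k * pi) * (r k (fst z) * sm k (snd z)))) = (\<lambda>(t, x). g t x)"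
    by (auto simp: g_def sgrad_def sblk_def mult.assoc)
  ultimately show ?thesis by (simp only:)
qed

text \<open>Freezing the modes outside \<open>{0..T}\<close> makes them Borel on the whole line; the
  iterated integral is taken with respect to Borel measures rather than completed ones.\<close>

definition rc :: "nat \<Rightarrow> real \<Rightarrow> real" where "rc k t = r k (max 0 (min T t))"

lemma rc_eq: "t \<in> {0..T} \<Longrightarrow> rc k t = r k t" by (simp add: rc_def min_absorb2)

lemma rc_continuous: "continuous_on A (rc k)"
  unfolding rc_def[abs_def] using T
  by (intro continuous_on_compose2[OF r_cont[of k]] continuous_intros) auto

lemma rc_measurable [measurable]: "rc k \<in> borel_measurable borel"
  by (intro borel_measurable_continuous_onI rc_continuous)

definition EBd :: "nat \<Rightarrow> real" where "EBd k = 2 * (gam k)^2 + 4 * (2 * Q * exp T)^2 * T / (1 + lam k)"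

lemma EBd_summable: "summable EBd"
proof -
  have "summable (\<lambda>k. (LINT x|I01. \<gamma> x * cm k x)^2)"
    using \<gamma>_range by (intro cos_bessel[OF \<gamma>_meas, of 1]) (auto simp: image_subset_iff)
  then have "summable (\<lambda>k. 2 * (gam k)^2)" by (intro summable_mult) (simp add: gam_eq)
  moreover have "summable (\<lambda>k. 4 * (2 * Q * exp T)^2 * T / 2 * (2 / (1 + lam k)))"
    by (intro summable_mult lam_summable) auto
  ultimately show ?thesis unfolding EBd_def[abs_def] by (intro summable_add) (auto simp: mult_ac)
qed

text \<open>The parabolic gain: \<open>lam k\<close> times the time integral of exp (- 2 lam t) is
  at most 1/2, so the initial value contributes a multiple of \<open>(gam k)^2\<close>, which
  Bessel's inequality sums. The Duhamel part is of order \<open>1 / (1 + lam k)\<close>.\<close>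

lemma mode_energy: "(\<integral>\<^sup>+t. ennreal (2 * lam k * (rc k t)^2) * indicator {0..T} t \<partial>lborel) \<le> ennreal (EBd k)"
proof -
  let ?D = "2 * Q * exp T"
  define b where "b t = 4 * (gam k)^2 * lam k * exp (- (2 * lam k) * t) + 4 * ?D^2 / (1 + lam k)" for t
  have p: "0 < 1 + lam k" by (simp add: add_pos_nonneg)
  have le: "2 * lam k * (rc k t)^2 \<le> b t" if t: "t \<in> {0..T}" for t
  proof -
    have "(rc k t)^2 \<le> 2 * (exp (- lam k * t) * gam k)^2 + 2 * (duhamel k (\<phi> k) t)^2"
      unfolding rc_eq[OF t] r_eq using zero_le_power2[of "exp (- lam k * t) * gam k - duhamel k (\<phi> k) t"]
      by (simp add: power2_eq_square algebra_simps)
    moreover have "(exp (- lam k * t) * gam k)^2 = exp (- (2 * lam k) * t) * (gam k)^2"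
      by (simp add: power_mult_distrib exp_double[symmetric] power2_eq_square[of "exp _"] exp_add[symmetric])
    moreover have "(duhamel k (\<phi> k) t)^2 \<le> (?D / (1 + lam k))^2"
      by (rule sq_le_if_abs_le[OF duhamel_\<phi>_bound[OF t]])
    ultimately have "(rc k t)^2 \<le> 2 * (exp (- (2 * lam k) * t) * (gam k)^2) + 2 * (?D / (1 + lam k))^2" by simp
    then have "2 * lam k * (rc k t)^2 \<le> 2 * lam k * (2 * (exp (- (2 * lam k) * t) * (gam k)^2) + 2 * (?D / (1 + lam k))^2)"
      by (intro mult_left_mono) auto
    also have "\<dots> = 4 * (gam k)^2 * lam k * exp (- (2 * lam k) * t) + 4 * ?D^2 / (1 + lam k) * (lam k / (1 + lam k))"
      by (simp add: power_divide power2_eq_square algebra_simps)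
    also have "\<dots> \<le> 4 * (gam k)^2 * lam k * exp (- (2 * lam k) * t) + 4 * ?D^2 / (1 + lam k) * 1"
      using p by (intro add_left_mono mult_left_mono) (auto simp: divide_le_eq)
    finally show ?thesis by (simp add: b_def)
  qed
  have b0: "0 \<le> b t" for t using p by (simp add: b_def)
  have bI: "(b has_integral integral {0..T} b) {0..T}"
    unfolding b_def by (intro integrable_integral integrable_continuous_interval continuous_intros)
  have "(\<integral>\<^sup>+t. ennreal (2 * lam k * (rc k t)^2) * indicator {0..T} t \<partial>lborel) \<le> (\<integral>\<^sup>+t. ennreal (b t) * indicator {0..T} t \<partial>lborel)"
    by (intro nn_integral_mono) (auto simp: indicator_def intro!: ennreal_leI le)
  also have "\<dots> = (\<integral>\<^sup>+t. ennreal (indicator {0..T} t * b t) \<partial>lborel)"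
    by (intro nn_integral_cong) (auto simp: indicator_def)
  also have "\<dots> = ennreal (integral {0..T} b)"
    using b0 bI by (intro nn_integral_has_integral_lebesgue) auto
  also have "integral {0..T} b \<le> EBd k"
  proof -
    have i1: "(\<lambda>t. exp (- (2 * lam k) * t)) integrable_on {0..T}"
      by (intro integrable_continuous_interval continuous_intros)
    have c: "((\<lambda>_. a) has_integral a * T) {0..T}" for a :: real
      using has_integral_const_real[of a 0 T] T by (simp add: mult.commute)
    have "(b has_integral 4 * (gam k)^2 * lam k * integral {0..T} (\<lambda>t. exp (- (2 * lam k) * t)) + 4 * ?D^2 / (1 + lam k) * T) {0..T}"
      unfolding b_def by (intro has_integral_add has_integral_mult_right integrable_integral i1 c)
    then have "integral {0..T} b = 4 * (gam k)^2 * lam k * integral {0..T} (\<lambda>t. exp (- (2 * lam k) * t)) + 4 * ?D^2 / (1 + lam k) * T"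
      by (rule integral_unique)
    also have "4 * (gam k)^2 * lam k * integral {0..T} (\<lambda>t. exp (- (2 * lam k) * t)) \<le> 2 * (gam k)^2"
    proof (cases "lam k = 0")
      case False
      then have l: "0 < 2 * lam k" using lam_nonneg[of k] by linarith
      have "4 * (gam k)^2 * lam k * integral {0..T} (\<lambda>t. exp (- (2 * lam k) * t)) \<le> 4 * (gam k)^2 * lam k * (1 / (2 * lam k))"
        using T l by (intro mult_left_mono integral_exp_minus_le) auto
      then show ?thesis using False by simp
    qed simp
    finally show ?thesis by (simp add: EBd_def)
  qed
  finally show ?thesis by (simp add: ennreal_leI)
qed

lemma g_square_nn:
  assumes t: "t \<in> {0<..T}"
  shows "(\<integral>\<^sup>+x. ennreal ((g t x)^2) \<partial>I01) \<le> (\<Sum>k. ennreal (2 * lam k * (rc k t)^2))"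
proof -
  interpret sine_series "\<lambda>k. r k t" "C0 * (1 / t + 1)" by (rule sine_series_r[OF t])
  have "(\<integral>\<^sup>+x. ennreal ((sgrad (\<lambda>k. r k t) x)^2) \<partial>I01) \<le> (\<Sum>k. ennreal (2 * lam k * (rc k t)^2))"
  proof (rule sgrad_square)
    fix J :: nat
    have "ennreal (\<Sum>k\<in>{1..<2^J}. 2 * lam k * (r k t)^2) = (\<Sum>k\<in>{1..<2^J}. ennreal (2 * lam k * (rc k t)^2))"
      using t by (subst sum_ennreal[symmetric]) (auto simp: rc_eq)
    also have "\<dots> \<le> (\<Sum>k. ennreal (2 * lam k * (rc k t)^2))"
      by (rule sum_le_suminf) auto
    finally show "ennreal (\<Sum>k\<in>{1..<2^J}. 2 * lam k * (r k t)^2) \<le> (\<Sum>k. ennreal (2 * lam k * (rc k t)^2))" .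
  qed
  then show ?thesis by (simp add: g_def)
qed

lemma g_square_integrable: "integrable (lebesgue_on Rect) (\<lambda>(t, x). (g t x)^2)"
proof (rule integrableI_bounded)
  have "(\<lambda>z. (case z of (t, x) \<Rightarrow> g t x)^2) \<in> borel_measurable (lebesgue_on Rect)"
    using g_Rect_measurable by (rule borel_measurable_power)
  moreover have "(\<lambda>z. (case z of (t, x) \<Rightarrow> g t x)^2) = (\<lambda>(t, x). (g t x)^2)" by auto
  ultimately show "(\<lambda>(t, x). (g t x)^2) \<in> borel_measurable (lebesgue_on Rect)" by simp
  define gb where "gb t x = - (\<Sum>j. \<Sum>k\<in>{2^j..<2^Suc j}. 2 * (real k * pi) * (rc k t * sm k x))" for t x
  have gb: "gb t x = g t x" if "t \<in> {0..T}" for t x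
    using that by (simp add: gb_def g_def sgrad_def sblk_def mult.assoc rc_eq)
  have gbm [measurable]: "(\<lambda>(t, x). gb t x) \<in> borel_measurable (borel \<Otimes>\<^sub>M borel)"
    unfolding gb_def by measurable
  have "(\<integral>\<^sup>+z. ennreal (norm (case z of (t, x) \<Rightarrow> (g t x)^2)) \<partial>lebesgue_on Rect)
     = (\<integral>\<^sup>+z. ennreal (norm (case z of (t, x) \<Rightarrow> (g t x)^2)) * indicator Rect z \<partial>lborel)"
    by (rule nn_integral_lebesgue_on[OF Rect_lebesgue])
  also have "\<dots> = (\<integral>\<^sup>+z. (case z of (t, x) \<Rightarrow> ennreal ((gb t x)^2) * indicator {0..1} x * indicator {0..T} t) \<partial>(lborel \<Otimes>\<^sub>M lborel))"
    unfolding lborel_prod by (intro nn_integral_cong) (auto simp: gb indicator_def)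
  also have "\<dots> = (\<integral>\<^sup>+t. \<integral>\<^sup>+x. ennreal ((gb t x)^2) * indicator {0..1} x * indicator {0..T} t \<partial>lborel \<partial>lborel)"
    by (subst lborel.nn_integral_fst[symmetric]) auto
  also have "\<dots> \<le> (\<integral>\<^sup>+t. (\<Sum>k. ennreal (2 * lam k * (rc k t)^2) * indicator {0..T} t) \<partial>lborel)"
  proof (rule nn_integral_mono_AE)
    have "AE t in lborel. t \<noteq> (0::real)" by (rule AE_lborel_singleton)
    then show "AE t in lborel. (\<integral>\<^sup>+x. ennreal ((gb t x)^2) * indicator {0..1} x * indicator {0..T} t \<partial>lborel)
      \<le> (\<Sum>k. ennreal (2 * lam k * (rc k t)^2) * indicator {0..T} t)"
    proof eventually_elim
      case (elim t)
      show ?case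
      proof (cases "t \<in> {0..T}")
        case True
        then have t: "t \<in> {0<..T}" using elim by auto
        have "(\<integral>\<^sup>+x. ennreal ((gb t x)^2) * indicator {0..1} x \<partial>lborel) = (\<integral>\<^sup>+x. ennreal ((g t x)^2) \<partial>I01)"
          using True by (subst nn_integral_lebesgue_on) (auto simp: gb)
        then show ?thesis using g_square_nn[OF t] True by simp
      qed simp
    qed
  qed
  also have "\<dots> = (\<Sum>k. \<integral>\<^sup>+t. ennreal (2 * lam k * (rc k t)^2) * indicator {0..T} t \<partial>lborel)"
    by (rule nn_integral_suminf) measurable
  also have "\<dots> \<le> (\<Sum>k. ennreal (EBd k))"
    by (intro suminf_le mode_energy) auto
  also have "\<dots> < \<infinity>"
  proof -
    have "0 \<le> EBd k" for k using T by (simp add: EBd_def add_nonneg_nonneg)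
    then show ?thesis using EBd_summable by (simp add: less_top[symmetric] ennreal_suminf_neq_top)
  qed
  finally show "(\<integral>\<^sup>+z. ennreal (norm (case z of (t, x) \<Rightarrow> (g t x)^2)) \<partial>lebesgue_on Rect) < \<infinity>" .
qed

text \<open>The bounds 0 and 1 enter as a hypothesis; they are supplied later by the particle
  system.\<close>

lemma modes_weak_solution:
  assumes range: "\<And>t x. t \<in> {0<..T} \<Longrightarrow> x \<in> {0..1} \<Longrightarrow> 0 \<le> \<rho> t x \<and> \<rho> t x \<le> 1"
  shows "weak_solution T (F False) (F True) \<gamma> \<rho>"
proof -
  have ae: "AE z in lebesgue_on Rect. 0 \<le> (case z of (t, x) \<Rightarrow> \<rho> t x) \<and> (case z of (t, x) \<Rightarrow> \<rho> t x) \<le> 1"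
    using AE_Rect by eventually_elim (use range in \<open>auto split: prod.splits\<close>)
  have sq: "integrable (lebesgue_on Rect) (\<lambda>(t, x). (\<rho> t x)^2)"
  proof -
    interpret finite_measure "lebesgue_on Rect" by (rule finite_measure_lebesgue_on[OF Rect_lmeasurable])
    have "integrable (lebesgue_on Rect) (\<lambda>z. (case z of (t, x) \<Rightarrow> \<rho> t x)^2)"
    proof (rule integrable_const_bound[of _ 1])
      show "AE z in lebesgue_on Rect. norm ((case z of (t, x) \<Rightarrow> \<rho> t x)^2) \<le> 1"
        using ae by eventually_elim (simp add: abs_square_le_1)
    qed (use \<rho>_Rect_measurable in auto)
    moreover have "(\<lambda>z. (case z of (t, x) \<Rightarrow> \<rho> t x)^2) = (\<lambda>(t, x). (\<rho> t x)^2)" by auto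
    ultimately show ?thesis by simp
  qed
  have "AE t in lebesgue_on {0..T}. H1_with_gradient (\<rho> t) (g t)"
    using AE_lebesgue_on_interior[of T] by eventually_elim (auto intro: \<rho>_H1)
  then have L2: "L2_H1_with_gradient T \<rho> g"
    unfolding L2_H1_with_gradient_def
    using \<rho>_Rect_measurable g_Rect_measurable sq g_square_integrable by auto
  show ?thesis
    unfolding weak_solution_def
  proof (intro conjI exI[of _ g] allI impI ballI)
    show "AE (t, x) in lebesgue_on Rect. 0 \<le> \<rho> t x \<and> \<rho> t x \<le> 1"
      using ae by eventually_elim (auto split: prod.splits)
  qed (use \<rho>_integrable L2 weak_identity in auto)
qed

end

section \<open>Uniqueness of weak solutions\<close>

text \<open>The span of these functions over all m is closed under differentiation, the derivative
  being \<open>- m * bump (m + 1) + bump (m + 2)\<close>. Smoothness thereby becomes an algebraic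
  matter.\<close>

definition bump :: "nat \<Rightarrow> real \<Rightarrow> real" where
  "bump m y = (if y \<le> 0 then 0 else exp (- 1 / y) / y ^ m)"

lemma power_le_fact_exp: "z ^ n \<le> fact n * exp z" if "0 \<le> z" for z :: real
proof -
  have "(\<Sum>k\<in>{n}. z ^ k /\<^sub>R fact k) \<le> (\<Sum>k. z ^ k /\<^sub>R fact k)"
    using that by (intro sum_le_suminf summable_exp_generic) auto
  then have "z ^ n / fact n \<le> exp z" by (simp add: exp_def divide_inverse mult.commute)
  then show ?thesis by (simp add: divide_le_eq mult.commute)
qed

lemma bump_nonneg: "0 \<le> bump m y"
  by (simp add: bump_def)

lemma bump_eq: "0 < y \<Longrightarrow> bump m y = (1 / y) ^ m * exp (- (1 / y))"
  by (simp add: bump_def power_divide)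

text \<open>From \<open>z ^ n \<le> fact n * exp z\<close> at z = 1 / y and n = m + j. The case j =
  2 gives the derivative at the origin, the case j = 0 the uniform bounds.\<close>

lemma bump_le: "bump m y \<le> fact (m + j) * \<bar>y\<bar> ^ j"
proof (cases "0 < y")
  case True
  have "(1 / y) ^ (m + j) * exp (- (1 / y)) \<le> fact (m + j) * exp (1 / y) * exp (- (1 / y))"
    using True by (intro mult_right_mono power_le_fact_exp) auto
  also have "\<dots> = fact (m + j)" by (simp add: mult.assoc flip: exp_add)
  finally have "(1 / y) ^ (m + j) * exp (- (1 / y)) * y ^ j \<le> fact (m + j) * y ^ j"
    using True by (intro mult_right_mono) auto
  moreover have "(1 / y) ^ (m + j) * exp (- (1 / y)) * y ^ j = bump m y"
    using True by (simp add: bump_eq power_add power_one_over)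
  ultimately show ?thesis using True by simp
qed (simp add: bump_def)

lemma bump_has_derivative: "(bump m has_real_derivative - real m * bump (m + 1) y + bump (m + 2) y) (at y)"
proof -
  consider "y < 0" | "y = 0" | "0 < y" by linarith
  then show ?thesis
  proof cases
    case 1
    have "((\<lambda>_. 0) has_real_derivative 0) (at y)" by simp
    then have "(bump m has_real_derivative 0) (at y)"
      by (rule has_field_derivative_transform_within_open[of _ _ _ "{..<0}"]) (use 1 in \<open>auto simp: bump_def\<close>)
    then show ?thesis using 1 by (simp add: bump_def)
  next
    case 2
    have "((\<lambda>h. fact (m + 2) * \<bar>h\<bar>) \<longlongrightarrow> fact (m + 2) * \<bar>0\<bar>) (at (0::real))"
      by (intro tendsto_intros)
    then have lim: "((\<lambda>h::real. fact (m + 2) * \<bar>h\<bar>) \<longlongrightarrow> 0) (at 0)" by simp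
    have "((\<lambda>h. bump m h / h) \<longlongrightarrow> 0) (at 0)"
    proof (rule Lim_null_comparison[OF _ lim])
      have "norm (bump m h / h) \<le> fact (m + 2) * \<bar>h\<bar>" for h
      proof (cases "h = 0")
        case False
        have "bump m h \<le> fact (m + 2) * \<bar>h\<bar> * \<bar>h\<bar>" using bump_le[of m h 2] by (simp add: power2_eq_square mult.assoc)
        then show ?thesis using False bump_nonneg[of m h] by (simp add: abs_divide divide_le_eq)
      qed simp
      then show "\<forall>\<^sub>F h in at 0. norm (bump m h / h) \<le> fact (m + 2) * \<bar>h\<bar>" by simp
    qed
    then show ?thesis using 2 by (simp add: bump_def[of _ 0] has_field_derivative_iff)
  next
    case 3
    let ?e = "\<lambda>y. exp (- 1 / y) / y ^ m"
    have "(?e has_real_derivative (exp (- 1 / y) * (1 / y^2) * y ^ m - exp (- 1 / y) * (real m * y ^ (m - 1))) / (y ^ m * y ^ m)) (at y)"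
      using 3 by (auto intro!: derivative_eq_intros simp: power2_eq_square One_nat_def)
    moreover have "(exp (- 1 / y) * (1 / y^2) * y ^ m - exp (- 1 / y) * (real m * y ^ (m - 1))) / (y ^ m * y ^ m)
      = - real m * bump (m + 1) y + bump (m + 2) y"
      using 3 by (cases m) (simp_all add: bump_def field_simps power2_eq_square One_nat_def)
    ultimately have "(?e has_real_derivative - real m * bump (m + 1) y + bump (m + 2) y) (at y)" by simp
    then show ?thesis
      by (rule has_field_derivative_transform_within_open[of _ _ _ "{0<..}"]) (use 3 in \<open>auto simp: bump_def\<close>)
  qed
qed

text \<open>A set of functions closed under differentiation consists of smooth functions.\<close>

inductive smooth_term :: "(real \<Rightarrow> real) \<Rightarrow> bool" where
  const: "smooth_term (\<lambda>_. c)"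
| sin: "smooth_term (\<lambda>x. sin (a * x))"
| cos: "smooth_term (\<lambda>x. cos (a * x))"
| bump: "smooth_term (\<lambda>x. bump m (a * x + b))"
| add: "smooth_term u \<Longrightarrow> smooth_term v \<Longrightarrow> smooth_term (\<lambda>x. u x + v x)"
| mult: "smooth_term u \<Longrightarrow> smooth_term v \<Longrightarrow> smooth_term (\<lambda>x. u x * v x)"

lemma smooth_term_deriv:
  "smooth_term u \<Longrightarrow> \<exists>u'. smooth_term u' \<and> (\<forall>x. (u has_real_derivative u' x) (at x))"
proof (induction rule: smooth_term.induct)
  case (const c)
  then show ?case by (intro exI[of _ "\<lambda>_. 0"]) (auto intro: smooth_term.const)
next
  case (sin a)
  then show ?case
    by (intro exI[of _ "\<lambda>x. a * cos (a * x)"])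
      (auto intro!: smooth_term.mult smooth_term.const smooth_term.cos derivative_eq_intros)
next
  case (cos a)
  then show ?case
    by (intro exI[of _ "\<lambda>x. - a * sin (a * x)"])
      (intro conjI allI smooth_term.mult[of "\<lambda>_. - a"] smooth_term.intros, auto intro!: derivative_eq_intros)
next
  case (bump m a b)
  show ?case
  proof (intro exI conjI allI)
    show "smooth_term (\<lambda>x. (- real m * bump (m + 1) (a * x + b) + bump (m + 2) (a * x + b)) * a)"
      by (intro smooth_term.intros smooth_term.mult[of "\<lambda>_. - real m"])
    show "((\<lambda>x. bump m (a * x + b)) has_real_derivative (- real m * bump (m + 1) (a * x + b) + bump (m + 2) (a * x + b)) * a) (at x)" for x
      by (rule DERIV_chain2[OF bump_has_derivative]) (auto intro!: derivative_eq_intros)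
  qed
next
  case (add u v)
  then obtain u' v' where uv: "smooth_term u'" "smooth_term v'"
      "\<And>x. (u has_real_derivative u' x) (at x)" "\<And>x. (v has_real_derivative v' x) (at x)" by blast
  then show ?case
    by (intro exI[of _ "\<lambda>x. u' x + v' x"]) (auto intro!: smooth_term.add DERIV_add)
next
  case (mult u v)
  then obtain u' v' where uv: "smooth_term u'" "smooth_term v'"
      "\<And>x. (u has_real_derivative u' x) (at x)" "\<And>x. (v has_real_derivative v' x) (at x)" by blast
  have "smooth_term (\<lambda>x. u' x * v x + v' x * u x)"
    by (rule smooth_term.add[OF smooth_term.mult smooth_term.mult]) (use mult uv in auto)
  then show ?case
    using DERIV_mult[OF uv(3,4)] by (intro exI[of _ "\<lambda>x. u' x * v x + v' x * u x"]) auto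
qed

lemma smooth_term_higher_deriv: "smooth_term u \<Longrightarrow> smooth_term ((deriv ^^ n) u)"
proof (induction n)
  case (Suc n)
  then obtain u' where u': "smooth_term u'" "\<And>x. (((deriv ^^ n) u) has_real_derivative u' x) (at x)"
    using smooth_term_deriv[of "(deriv ^^ n) u"] by blast
  then have "deriv ((deriv ^^ n) u) = u'" by (intro ext DERIV_imp_deriv)
  then show ?case using u'(1) by simp
qed simp

lemma smooth_term_test_function:
  assumes "smooth_term u" "0 < a" "b < 1" "\<And>x. x \<notin> {a..b} \<Longrightarrow> u x = 0"
  shows "test_function u"
  unfolding test_function_def
proof (intro conjI allI)
  fix n x
  obtain u' where "(((deriv ^^ n) u) has_real_derivative u' x) (at x)"
    using smooth_term_deriv[OF smooth_term_higher_deriv[OF assms(1), of n]] by blast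
  then show "(deriv ^^ n) u field_differentiable at x" by (auto simp: field_differentiable_def)
qed (use assms in blast)

text \<open>The derivative of the cutoff is of order \<open>n\<close> within distance \<open>1 / n\<close> of the boundary, which is harmless against
  a sine, that vanishes there.\<close>

definition cutoff :: "nat \<Rightarrow> real \<Rightarrow> real" where
  "cutoff n x = bump 0 ((real n + 3) * x - 1) * bump 0 ((real n + 3) * (1 - x) - 1)"

definition dcutoff :: "nat \<Rightarrow> real \<Rightarrow> real" where
  "dcutoff n x = (real n + 3) * (bump 2 ((real n + 3) * x - 1) * bump 0 ((real n + 3) * (1 - x) - 1)
     - bump 0 ((real n + 3) * x - 1) * bump 2 ((real n + 3) * (1 - x) - 1))"

lemma bump_0_le: "bump 0 y \<le> 1"
  using bump_le[of 0 y 0] by simp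

lemma cutoff_nonneg: "0 \<le> cutoff n x" and cutoff_le: "cutoff n x \<le> 1"
  by (auto simp: cutoff_def bump_nonneg mult_le_one bump_0_le)

lemma cutoff_has_derivative: "(cutoff n has_real_derivative dcutoff n x) (at x)"
proof -
  let ?c = "real n + 3"
  have d: "(bump 0 has_real_derivative bump 2 y) (at y)" for y
    using bump_has_derivative[of 0 y] by (simp add: numeral_2_eq_2)
  have "((\<lambda>x. bump 0 (?c * x - 1)) has_real_derivative bump 2 (?c * x - 1) * ?c) (at x)"
    by (rule DERIV_chain2[OF d]) (auto intro!: derivative_eq_intros)
  moreover have "((\<lambda>x. bump 0 (?c * (1 - x) - 1)) has_real_derivative bump 2 (?c * (1 - x) - 1) * - ?c) (at x)"
    by (rule DERIV_chain2[OF d]) (auto intro!: derivative_eq_intros)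
  ultimately have "((\<lambda>x. bump 0 (?c * x - 1) * bump 0 (?c * (1 - x) - 1)) has_real_derivative
      bump 2 (?c * x - 1) * ?c * bump 0 (?c * (1 - x) - 1) + bump 2 (?c * (1 - x) - 1) * - ?c * bump 0 (?c * x - 1)) (at x)"
    by (rule DERIV_mult)
  then show ?thesis
    unfolding cutoff_def[abs_def] by (rule DERIV_cong) (simp add: dcutoff_def algebra_simps)
qed

lemma cutoff_test_function: "test_function (\<lambda>x. sm k x * cutoff n x)"
proof (rule smooth_term_test_function)
  have "smooth_term (\<lambda>x. sin (real k * pi * x) * (bump 0 ((real n + 3) * x + - 1) * bump 0 (- (real n + 3) * x + (real n + 2))))"
    by (intro smooth_term.intros)
  moreover have "(\<lambda>x. sin (real k * pi * x) * (bump 0 ((real n + 3) * x + - 1) * bump 0 (- (real n + 3) * x + (real n + 2))))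
     = (\<lambda>x. sm k x * cutoff n x)"
    by (auto simp: sm_def cutoff_def algebra_simps)
  ultimately show "smooth_term (\<lambda>x. sm k x * cutoff n x)" by simp
  show "0 < 1 / (real n + 3)" "1 - 1 / (real n + 3) < 1" by auto
  fix x assume "x \<notin> {1 / (real n + 3)..1 - 1 / (real n + 3)}"
  then have "(real n + 3) * x - 1 \<le> 0 \<or> (real n + 3) * (1 - x) - 1 \<le> 0"
    by (auto simp: not_le field_simps)
  then show "sm k x * cutoff n x = 0" by (auto simp: cutoff_def bump_def)
qed

lemma bump_tendsto:
  assumes "0 < x"
  shows "(\<lambda>n. bump 0 ((real n + 3) * x - 1)) \<longlonglongrightarrow> 1" "(\<lambda>n. ((real n + 3) * x) * bump 2 ((real n + 3) * x - 1)) \<longlonglongrightarrow> 0"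
proof -
  let ?y = "\<lambda>n. (real n + 3) * x - 1"
  have "filterlim (\<lambda>n. (3 * x - 1) + x * real n) at_top sequentially"
    using assms by (intro filterlim_tendsto_add_at_top[OF tendsto_const]
      filterlim_tendsto_pos_mult_at_top[OF tendsto_const _ filterlim_real_sequentially])
  moreover have "(\<lambda>n. (3 * x - 1) + x * real n) = ?y" by (auto simp: algebra_simps)
  ultimately have y: "filterlim ?y at_top sequentially" by simp
  then have inv: "(\<lambda>n. 1 / ?y n) \<longlonglongrightarrow> 0"
    by (intro tendsto_divide_0[OF tendsto_const] filterlim_at_top_imp_at_infinity)
  have pos: "\<forall>\<^sub>F n in sequentially. 0 < ?y n"
    using y unfolding filterlim_at_top_dense by blast
  have "(\<lambda>n. exp (- (1 / ?y n))) \<longlonglongrightarrow> exp (- 0)"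
    by (intro tendsto_intros inv)
  moreover have "\<forall>\<^sub>F n in sequentially. exp (- (1 / ?y n)) = bump 0 (?y n)"
    using pos by eventually_elim (simp add: bump_def)
  ultimately show "(\<lambda>n. bump 0 (?y n)) \<longlonglongrightarrow> 1" by (simp add: Lim_transform_eventually)
  have "(\<lambda>n. 1 / ?y n + (1 / ?y n)^2) \<longlonglongrightarrow> 0 + 0^2" by (intro tendsto_intros inv)
  then have "(\<lambda>n. 1 / ?y n + (1 / ?y n)^2) \<longlonglongrightarrow> 0" by simp
  moreover have "\<forall>\<^sub>F n in sequentially. norm ((?y n + 1) * bump 2 (?y n)) \<le> 1 / ?y n + (1 / ?y n)^2"
    using pos
  proof eventually_elim
    case (elim n)
    have "bump 2 (?y n) \<le> (1 / ?y n)^2 * 1" using elim unfolding bump_eq[OF elim] by (intro mult_left_mono) auto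
    then have "(?y n + 1) * bump 2 (?y n) \<le> (?y n + 1) * (1 / ?y n)^2" using elim by (intro mult_left_mono) auto
    also have "(z + 1) * (1 / z)^2 = 1 / z + (1 / z)^2" if "0 < z" for z :: real
      using that by (simp add: power2_eq_square field_simps)
    note this[OF elim]
    finally show ?case using elim bump_nonneg[of 2 "?y n"] by simp
  qed
  ultimately have "(\<lambda>n. (?y n + 1) * bump 2 (?y n)) \<longlonglongrightarrow> 0" by (rule Lim_null_comparison[rotated])
  then show "(\<lambda>n. ((real n + 3) * x) * bump 2 (?y n)) \<longlonglongrightarrow> 0" by simp
qed

text \<open>Here \<open>y * bump 2 y = bump 1 y\<close>, and \<open>bump 1\<close> and
  \<open>bump 2\<close> are at most 1! and 2!.\<close>

lemma bump_2_le: "(y + 1) * bump 2 y \<le> 3"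
proof (cases "0 < y")
  case True
  have "y * bump 2 y = bump 1 y" using True by (simp add: bump_def power2_eq_square)
  then have "(y + 1) * bump 2 y = bump 1 y + bump 2 y" by (simp add: algebra_simps)
  then show ?thesis using bump_le[of 1 y 0] bump_le[of 2 y 0] by simp
qed (simp add: bump_def)

lemma abs_sm_boundary:
  assumes "x \<in> {0..1}"
  shows "\<bar>sm k x\<bar> \<le> real k * pi * x" "\<bar>sm k x\<bar> \<le> real k * pi * (1 - x)"
proof -
  show "\<bar>sm k x\<bar> \<le> real k * pi * x" using abs_sin_x_le_abs_x[of "real k * pi * x"] assms by (simp add: sm_def abs_mult)
  have "sm k x = - ((-1) ^ k * sin (real k * pi * (1 - x)))"
    using sin_diff[of "pi * real k" "real k * pi * x"] by (simp add: sm_def right_diff_distrib mult.commute[of "real k" pi])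
  then show "\<bar>sm k x\<bar> \<le> real k * pi * (1 - x)"
    using abs_sin_x_le_abs_x[of "real k * pi * (1 - x)"] assms by (simp add: abs_mult)
qed

text \<open>Near each end the sine is at most \<open>k * pi\<close> times the distance to that end,
  which turns the large factor n + 3 into the products controlled by \<open>bump_tendsto\<close> and
  \<open>bump_2_le\<close>.\<close>

lemma dcutoff_sm_le:
  assumes "x \<in> {0..1}"
  shows "\<bar>dcutoff n x * sm k x\<bar> \<le> real k * pi * (((real n + 3) * x) * bump 2 ((real n + 3) * x - 1)
    + ((real n + 3) * (1 - x)) * bump 2 ((real n + 3) * (1 - x) - 1))" (is "_ \<le> _ * (?c * x * ?A + ?c * (1 - x) * ?B)")
proof -
  let ?a = "bump 0 (?c * (1 - x) - 1)" and ?b = "bump 0 (?c * x - 1)"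
  have n: "0 \<le> ?A" "0 \<le> ?B" "0 \<le> ?a" "0 \<le> ?b" "?a \<le> 1" "?b \<le> 1" by (auto simp: bump_nonneg bump_0_le)
  have "\<bar>dcutoff n x * sm k x\<bar> = \<bar>?c * (?A * ?a) * sm k x - ?c * (?b * ?B) * sm k x\<bar>"
    by (simp add: dcutoff_def algebra_simps)
  moreover have "\<bar>?c * (?A * ?a) * sm k x - ?c * (?b * ?B) * sm k x\<bar> \<le> \<bar>?c * (?A * ?a) * sm k x\<bar> + \<bar>?c * (?b * ?B) * sm k x\<bar>"
    by (rule abs_triangle_ineq4)
  moreover have "\<bar>?c * (?A * ?a) * sm k x\<bar> \<le> ?c * (?A * 1) * (real k * pi * x)"
    unfolding abs_mult using n abs_sm_boundary[OF assms, of k] by (intro mult_mono) auto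
  moreover have "\<bar>?c * (?b * ?B) * sm k x\<bar> \<le> ?c * (1 * ?B) * (real k * pi * (1 - x))"
    unfolding abs_mult using n abs_sm_boundary[OF assms, of k] by (intro mult_mono) auto
  ultimately have "\<bar>dcutoff n x * sm k x\<bar> \<le> ?c * (?A * 1) * (real k * pi * x) + ?c * (1 * ?B) * (real k * pi * (1 - x))"
    by linarith
  then show ?thesis by (simp add: algebra_simps)
qed

section \<open>Cosine coefficients of functions with a weak gradient\<close>

lemma integrable_if_square_integrable:
  assumes "f \<in> borel_measurable I01" "integrable I01 (\<lambda>x. (f x)\<^sup>2)"
  shows "integrable I01 (f :: real \<Rightarrow> real)"
proof (rule Bochner_Integration.integrable_bound)
  have "integrable I01 (\<lambda>x. 1 :: real)" by (intro continuous_imp_integrable_real continuous_intros)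
  then show "integrable I01 (\<lambda>x. 1 + (f x)\<^sup>2)" using assms(2) by (rule Bochner_Integration.integrable_add)
  have "\<bar>y\<bar> \<le> 1 + y^2" for y :: real
    using zero_le_power2[of "\<bar>y\<bar> - 1/2"] by (simp add: power2_eq_square algebra_simps)
  then show "AE x in I01. norm (f x) \<le> norm (1 + (f x)\<^sup>2)" by simp
qed fact

text \<open>Weak gradients are tested with functions supported inside (0,1), whereas
  \<open>sm k\<close> merely vanishes at the ends. Multiply it by the cutoffs: the term with their
  derivative is bounded and tends to 0 at each interior point, so dominated convergence removes it,
  and no traces are needed.\<close>

lemma H1_cos_coeff:
  assumes "H1_with_gradient f g"
  shows "real k * pi * (LINT x|I01. f x * cm k x) = - (LINT x|I01. g x * sm k x)"
proof -
  define \<psi>' where "\<psi>' n x = real k * pi * cm k x * cutoff n x + dcutoff n x * sm k x" for n x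
  have fm: "f \<in> borel_measurable I01" and gm: "g \<in> borel_measurable I01" and fi: "integrable I01 f" and gi: "integrable I01 g"
    using assms by (auto simp: H1_with_gradient_def intro: integrable_if_square_integrable)
  have d: "((\<lambda>x. sm k x * cutoff n x) has_real_derivative \<psi>' n x) (at x)" for n x
    unfolding \<psi>'_def sm_def[abs_def] cm_def
    by (rule derivative_eq_intros cutoff_has_derivative refl | simp add: algebra_simps)+
  have cont: "continuous_on UNIV (cutoff n)" "continuous_on UNIV (bump m)" for n m
    using cutoff_has_derivative bump_has_derivative
    by (auto intro!: continuous_at_imp_continuous_on DERIV_isCont)
  have bc: "continuous_on UNIV (\<lambda>x. bump m (u x))" if "continuous_on UNIV u" for u :: "real \<Rightarrow> real" and m
    by (rule continuous_on_compose2[OF cont(2) that]) auto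
  have dc: "continuous_on UNIV (dcutoff n)" for n
    unfolding dcutoff_def[abs_def] by (intro continuous_intros bc)
  have eq: "(LINT x|I01. f x * \<psi>' n x) = - (LINT x|I01. g x * (sm k x * cutoff n x))" for n
  proof -
    have "deriv (\<lambda>x. sm k x * cutoff n x) = \<psi>' n" by (intro ext DERIV_imp_deriv d)
    then show ?thesis using assms cutoff_test_function[of k n] by (auto simp: H1_with_gradient_def)
  qed
  have m: "\<psi>' n \<in> borel_measurable I01" "(\<lambda>x. sm k x * cutoff n x) \<in> borel_measurable I01" for n
  proof -
    have "continuous_on UNIV (\<psi>' n)" "continuous_on UNIV (\<lambda>x. sm k x * cutoff n x)"
      unfolding \<psi>'_def[abs_def] sm_def by (intro continuous_intros cont dc)+
    then show "\<psi>' n \<in> borel_measurable I01" "(\<lambda>x. sm k x * cutoff n x) \<in> borel_measurable I01"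
      by (auto intro!: continuous_imp_measurable_on_sets_lebesgue intro: continuous_on_subset)
  qed
  have cl: "(\<lambda>n. cutoff n x) \<longlonglongrightarrow> 1" if "x \<in> {0<..<1}" for x
    using tendsto_mult[OF bump_tendsto(1)[of x] bump_tendsto(1)[of "1 - x"]] that by (simp add: cutoff_def)
  have pl: "(\<lambda>n. \<psi>' n x) \<longlonglongrightarrow> real k * pi * cm k x" if x: "x \<in> {0<..<1}" for x
  proof -
    have "(\<lambda>n. real k * pi * (((real n + 3) * x) * bump 2 ((real n + 3) * x - 1)
      + ((real n + 3) * (1 - x)) * bump 2 ((real n + 3) * (1 - x) - 1))) \<longlonglongrightarrow> real k * pi * (0 + 0)"
      using x by (intro tendsto_intros bump_tendsto) auto
    then have "(\<lambda>n. real k * pi * (((real n + 3) * x) * bump 2 ((real n + 3) * x - 1)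
      + ((real n + 3) * (1 - x)) * bump 2 ((real n + 3) * (1 - x) - 1))) \<longlonglongrightarrow> 0" by simp
    then have "(\<lambda>n. dcutoff n x * sm k x) \<longlonglongrightarrow> 0"
      by (rule Lim_null_comparison[rotated]) (use dcutoff_sm_le[of x] x in auto)
    from tendsto_add[OF tendsto_mult[OF tendsto_const cl[OF x]] this] show ?thesis by (simp add: \<psi>'_def)
  qed
  have bd: "\<bar>\<psi>' n x\<bar> \<le> 7 * (real k * pi)" if x: "x \<in> {0..1}" for n x
  proof -
    have "\<bar>dcutoff n x * sm k x\<bar> \<le> real k * pi * (3 + 3)"
      using bump_2_le[of "(real n + 3) * x - 1"] bump_2_le[of "(real n + 3) * (1 - x) - 1"]
      by (intro order_trans[OF dcutoff_sm_le[OF x]] mult_left_mono add_mono) auto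
    moreover have "\<bar>real k * pi * cm k x * cutoff n x\<bar> \<le> real k * pi * 1 * 1"
      unfolding abs_mult[of _ "cutoff n x"] abs_mult[of _ "cm k x"]
      using cutoff_nonneg[of n x] cutoff_le[of n x] by (intro mult_mono) auto
    ultimately show ?thesis
      using abs_triangle_ineq[of "real k * pi * cm k x * cutoff n x" "dcutoff n x * sm k x"] unfolding \<psi>'_def mult_1_right distrib_left by linarith
  qed
  have cmm: "cm k \<in> borel_measurable I01" and smm: "sm k \<in> borel_measurable I01"
    by (intro continuous_imp_measurable_on_sets_lebesgue continuous_intros; simp add: sm_def[abs_def] continuous_intros)+
  have L1: "(\<lambda>n. LINT x|I01. f x * \<psi>' n x) \<longlonglongrightarrow> (LINT x|I01. f x * (real k * pi * cm k x))"
  proof (rule integral_dominated_convergence[where w = "\<lambda>x. 7 * (real k * pi) * \<bar>f x\<bar>"])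
    show "AE x in I01. (\<lambda>n. f x * \<psi>' n x) \<longlonglongrightarrow> f x * (real k * pi * cm k x)"
      using AE_lebesgue_on_interior[of 1] by eventually_elim (intro tendsto_intros pl)
    show "AE x in I01. norm (f x * \<psi>' n x) \<le> 7 * (real k * pi) * \<bar>f x\<bar>" for n
      using AE_lebesgue_on_interior[of 1]
      by eventually_elim (use bd[THEN mult_right_mono[of _ _ "\<bar>f _\<bar>"]] in \<open>auto simp: abs_mult mult.commute\<close>)
  qed (use fm fi m cmm in auto)
  have L2: "(\<lambda>n. LINT x|I01. g x * (sm k x * cutoff n x)) \<longlonglongrightarrow> (LINT x|I01. g x * (sm k x * 1))"
  proof (rule integral_dominated_convergence[where w = "\<lambda>x. \<bar>g x\<bar>"])
    show "AE x in I01. (\<lambda>n. g x * (sm k x * cutoff n x)) \<longlonglongrightarrow> g x * (sm k x * 1)"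
      using AE_lebesgue_on_interior[of 1] by eventually_elim (intro tendsto_intros cl)
    show "AE x in I01. norm (g x * (sm k x * cutoff n x)) \<le> \<bar>g x\<bar>" for n
    proof (rule AE_I2)
      fix x
      have "\<bar>g x\<bar> * (\<bar>sm k x\<bar> * cutoff n x) \<le> \<bar>g x\<bar> * (1 * 1)"
        by (intro mult_left_mono mult_mono cutoff_le cutoff_nonneg) auto
      then show "norm (g x * (sm k x * cutoff n x)) \<le> \<bar>g x\<bar>" by (simp add: abs_mult cutoff_nonneg)
    qed
  qed (use gm gi m smm in auto)
  have "(LINT x|I01. f x * (real k * pi * cm k x)) = - (LINT x|I01. g x * (sm k x * 1))"
    using LIMSEQ_unique[OF L1[unfolded eq] tendsto_minus[OF L2]] .
  moreover have "(LINT x|I01. f x * (real k * pi * cm k x)) = real k * pi * (LINT x|I01. f x * cm k x)"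
    by (simp add: mult.left_commute[of "f _"])
  ultimately show ?thesis by simp
qed

text \<open>No measurability of the integrand is assumed: the Bochner integral is 0 where it fails.\<close>

lemma indefinite_lint_measurable:
  fixes h :: "real \<Rightarrow> real"
  assumes T: "0 < T" and B: "\<And>s. s \<in> {0..T} \<Longrightarrow> \<bar>h s\<bar> \<le> B"
  shows "(\<lambda>t. LINT s|lebesgue_on {0..t}. h s) \<in> borel_measurable (lebesgue_on {0..T})"
proof -
  \<comment> \<open>Measurability of \<open>h\<close> on \<open>{0..t}\<close> is inherited by
    smaller t. As long as it holds, the integral plus \<open>B * t\<close> is nondecreasing;
    afterwards \<open>m\<close> jumps above all earlier values. So \<open>m\<close> is monotone,
    hence Borel, and the threshold \<open>2 * B * T\<close> tells the two regimes apart.\<close>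
  define J where "J t \<longleftrightarrow> h \<in> borel_measurable (lebesgue_on {0..t})" for t
  define u where "u t = (LINT s|lebesgue_on {0..t}. h s)" for t
  define m where "m t = (if J t then u t + B * t else 2 * B * T + 1)" for t
  have B0: "0 \<le> B" using order_trans[OF abs_ge_zero B[of 0]] T by simp
  have J: "J s" if "J t" "s \<le> t" for s t
    unfolding J_def by (rule measurable_restrict_mono[OF that(1)[unfolded J_def]]) (use that(2) in auto)
  have i: "integrable (lebesgue_on {0..t}) h" if "J t" "t \<le> T" for t
    by (rule measurable_bounded_by_integrable_imp_lebesgue_integrable[of _ _ "\<lambda>_. B"])
      (use that B in \<open>auto simp: J_def integrable_const_ivl\<close>)
  have hi: "h integrable_on {0..t}" if "J t" "t \<le> T" for t
    by (rule integrable_on_lebesgue_on[OF i[OF that]]) simp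
  have u: "u t = integral {0..t} h" if "J t" "t \<le> T" for t
    using i[OF that] by (simp add: u_def lebesgue_integral_eq_integral)
  have ub: "u t + B * t \<le> 2 * B * T" if "J t" "t \<in> {0..T}" for t
  proof -
    have "u t \<le> integral {0..t} (\<lambda>_. B)"
      unfolding u[OF that(1) atLeastAtMost_iff[THEN iffD1, OF that(2), THEN conjunct2]]
      using that B by (intro integral_le hi) (auto simp: abs_le_iff)
    moreover have "B * t \<le> B * T" using B0 that by (intro mult_left_mono) auto
    ultimately show ?thesis using that by (simp add: mult_ac)
  qed
  have "mono_on {0..T} m"
  proof (rule mono_onI)
    fix s t assume st: "s \<in> {0..T}" "t \<in> {0..T}" "s \<le> t"
    show "m s \<le> m t"
    proof (cases "J t")
      case True
      have tT: "t \<le> T" "s \<le> T" using st by auto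
      have "integral {0..s} h + integral {s..t} h = integral {0..t} h"
        using st by (intro Henstock_Kurzweil_Integration.integral_combine hi[OF True tT(1)]) auto
      moreover have "integral {s..t} (\<lambda>_. - B) \<le> integral {s..t} h"
        using st B by (intro integral_le integrable_on_subinterval[OF hi[OF True tT(1)]]) (auto simp: abs_le_iff minus_le_iff)
      ultimately show ?thesis
        using st True J[OF True st(3)] u[OF True tT(1)] u[OF J[OF True st(3)] tT(2)]
        by (simp add: m_def algebra_simps)
    qed (use ub[of s] st in \<open>auto simp: m_def\<close>)
  qed
  then have m: "m \<in> borel_measurable (restrict_space borel {0..T})"
    by (rule borel_measurable_mono_on_fnc)
  have m': "m \<in> borel_measurable (lebesgue_on {0..T})"
    using m measurable_completion[of "\<lambda>x. indicator {0..T} x *\<^sub>R m x" lborel borel]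
    by (simp add: borel_measurable_restrict_space_iff)
  have "(\<lambda>t. if m t \<le> 2 * B * T then m t - B * t else 0) \<in> borel_measurable (lebesgue_on {0..T})"
  proof (rule measurable_If)
    have "(\<lambda>x::real. x) \<in> borel_measurable (lebesgue_on {0..T})"
      by (intro continuous_imp_measurable_on_sets_lebesgue continuous_on_id) simp
    then show "(\<lambda>t. m t - B * t) \<in> borel_measurable (lebesgue_on {0..T})"
      by (intro borel_measurable_diff borel_measurable_times borel_measurable_const m')
    show "{t \<in> space (lebesgue_on {0..T}). m t \<le> 2 * B * T} \<in> sets (lebesgue_on {0..T})"
      by (intro borel_measurable_le m' borel_measurable_const)
  qed simp
  moreover have "(if m t \<le> 2 * B * T then m t - B * t else 0) = u t" if "t \<in> {0..T}" for t
  proof (cases "J t")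
    case False
    then have "u t = 0" unfolding u_def J_def by (intro not_integrable_integral_eq) (auto dest: borel_measurable_integrable)
    then show ?thesis using False by (simp add: m_def)
  qed (use ub[of t] that in \<open>simp add: m_def\<close>)
  ultimately show ?thesis
    unfolding u_def[symmetric] by (subst measurable_cong) auto
qed

section \<open>Modes of an arbitrary weak solution\<close>

lemma sg_pow_cm: "cm k (if \<sigma> then 1 else 0) = sg \<sigma> ^ k"
  by (simp add: cm_def sg_def)

text \<open>If \<open>h\<close> is not integrable its integral is 0, and the bound holds because
  \<open>w\<close> is nonnegative.\<close>

lemma lint_abs_le_integrable:
  assumes "integrable M w" "\<And>x. x \<in> space M \<Longrightarrow> \<bar>h x\<bar> \<le> w x"
  shows "\<bar>LINT x|M. h x\<bar> \<le> (LINT x|M. (w x :: real))"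
proof (cases "integrable M h")
  case True
  have "\<bar>LINT x|M. h x\<bar> \<le> (LINT x|M. \<bar>h x\<bar>)" by (rule integral_abs_bound)
  also have "\<dots> \<le> (LINT x|M. w x)" using True assms by (intro integral_mono) auto
  finally show ?thesis .
next
  case False
  have "0 \<le> (LINT x|M. w x)" using assms(2) by (intro Bochner_Integration.integral_nonneg) (auto intro: order_trans[OF abs_ge_zero])
  then show ?thesis using False by (simp add: not_integrable_integral_eq)
qed

lemma C12_mode:
  "C12 T (\<lambda>t x. exp (lam k * t) * cm k x) (\<lambda>t x. lam k * (exp (lam k * t) * cm k x)) (\<lambda>t x. - (real k * pi) * (exp (lam k * t) * sm k x))"
  unfolding C12_def
proof (intro exI[of _ "\<lambda>t x. - lam k * (exp (lam k * t) * cm k x)"] conjI ballI)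
  fix t x :: real
  show "((\<lambda>s. exp (lam k * s) * cm k x) has_real_derivative lam k * (exp (lam k * t) * cm k x)) (at t)"
    by (auto intro!: derivative_eq_intros)
  show "((\<lambda>y. exp (lam k * t) * cm k y) has_real_derivative - (real k * pi) * (exp (lam k * t) * sm k x)) (at x)"
    by (auto intro!: derivative_eq_intros)
  have "(sm k has_real_derivative real k * pi * cm k x) (at x)"
    unfolding sm_def[abs_def] cm_def by (auto intro!: derivative_eq_intros)
  from DERIV_cmult[OF DERIV_cmult[OF this, of "exp (lam k * t)"], of "- (real k * pi)"]
  show "((\<lambda>y. - (real k * pi) * (exp (lam k * t) * sm k y)) has_real_derivative - lam k * (exp (lam k * t) * cm k x)) (at x)"
    by (simp add: lam_def power2_eq_square mult_ac)
next
  let ?S = "{0..T} \<times> {0..1::real}"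
  have e: "continuous_on ?S (\<lambda>z. exp (lam k * fst z))"
    by (intro continuous_on_exp continuous_on_mult_left continuous_on_fst continuous_on_id)
  have c: "continuous_on ?S (\<lambda>z. exp (lam k * fst z) * cm k (snd z))"
    by (intro continuous_on_mult[OF e] continuous_cm continuous_on_snd continuous_on_id)
  have s: "continuous_on ?S (\<lambda>z. exp (lam k * fst z) * sm k (snd z))"
    unfolding sm_def by (intro continuous_on_mult[OF e] continuous_on_sin continuous_on_mult_left continuous_on_snd continuous_on_id)
  fix F assume "F \<in> {\<lambda>t x. exp (lam k * t) * cm k x, \<lambda>t x. lam k * (exp (lam k * t) * cm k x),
    \<lambda>t x. - (real k * pi) * (exp (lam k * t) * sm k x), \<lambda>t x. - lam k * (exp (lam k * t) * cm k x)}"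
  then show "continuous_on ?S (\<lambda>(t, x). F t x)"
    using c s by (elim insertE emptyE) (simp_all only: split_def continuous_on_mult_left)
qed

context modes
begin

text \<open>The factor \<open>e\<^sup>(\<^sup>k\<^sup>\<pi>\<^sup>)\<^sup>2\<^sup>t\<close> of the test function makes the time derivative cancel the gradient term. What is left bounds
  the modes before anything is known about the measurability of the traces, which follows from the bound.\<close>

lemma modes_unique:
  assumes ws: "weak_solution T (F False) (F True) \<gamma> \<rho>'" and t: "t \<in> {0..T}"
  shows "AE x in I01. \<rho>' t x = \<rho> t x"
proof -
  obtain g' where L2: "L2_H1_with_gradient T \<rho>' g'"
    and W: "\<And>H Ht Hx t. C12 T H Ht Hx \<Longrightarrow> t \<in> {0..T} \<Longrightarrow>
           (LINT x|I01. \<rho>' t x * H t x) - (LINT x|I01. \<gamma> x * H 0 x)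
           = (LINT s|lebesgue_on {0..t}. LINT x|I01. \<rho>' s x * Ht s x)
             - (LINT s|lebesgue_on {0..t}. LINT x|I01. g' s x * Hx s x)
             + (LINT s|lebesgue_on {0..t}.
                  F True (boundary_value (\<rho>' s) 1) * H s 1 + F False (boundary_value (\<rho>' s) 0) * H s 0)"
    using ws unfolding weak_solution_def by blast
  have int: "integrable I01 (\<rho>' s)" if "s \<in> {0..T}" for s
    using ws that unfolding weak_solution_def by blast
  have H1: "AE s in lebesgue_on {0..T}. H1_with_gradient (\<rho>' s) (g' s)"
    using L2 unfolding L2_H1_with_gradient_def by blast
  define r' where "r' k s = (LINT x|I01. \<rho>' s x * cm k x)" for k s
  define b where "b \<sigma> s = boundary_value (\<rho>' s) (if \<sigma> then 1 else 0)" for \<sigma> s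
  define \<psi> where "\<psi> k s = (\<Sum>\<sigma>\<in>UNIV. sg \<sigma> ^ k * F \<sigma> (b \<sigma> s))" for k s
  have \<psi>b: "\<bar>\<psi> k s\<bar> \<le> 2 * Q" for k s
  proof -
    have "\<bar>\<psi> k s\<bar> \<le> (\<Sum>\<tau>\<in>(UNIV::bool set). Q)"
      unfolding \<psi>_def by (rule order_trans[OF sum_abs sum_mono]) (simp add: abs_mult Q)
    then show ?thesis by (simp add: UNIV_bool)
  qed
  have pull: "(LINT x|I01. u x * (c * v x)) = c * (LINT x|I01. u x * v x)" for u v and c :: real
    by (simp add: mult.left_commute)
  have E: "exp (lam k * t) * r' k t - gam k = (LINT s|lebesgue_on {0..t}. exp (lam k * s) * \<psi> k s)" if t: "t \<in> {0..T}" for k t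
  proof -
    have "AE s in lebesgue. s \<in> {0..T} \<longrightarrow> H1_with_gradient (\<rho>' s) (g' s)"
      using H1 by (simp add: AE_restrict_space_iff)
    then have "AE s in lebesgue_on {0..t}. H1_with_gradient (\<rho>' s) (g' s)"
      unfolding AE_restrict_space_iff[of "{0..t}" lebesgue, simplified] by eventually_elim (use t in auto)
    then have "AE s in lebesgue_on {0..t}. (LINT x|I01. \<rho>' s x * (lam k * (exp (lam k * s) * cm k x)))
       = (LINT x|I01. g' s x * (- (real k * pi) * (exp (lam k * s) * sm k x)))"
    proof eventually_elim
      case (elim s)
      have "lam k * r' k s = real k * pi * (real k * pi * r' k s)" by (simp add: lam_def power2_eq_square)
      also have "real k * pi * r' k s = - (LINT x|I01. g' s x * sm k x)"
        unfolding r'_def by (rule H1_cos_coeff[OF elim])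
      finally have "exp (lam k * s) * (lam k * r' k s) = exp (lam k * s) * (real k * pi * - (LINT x|I01. g' s x * sm k x))"
        by (simp only:)
      then show ?case unfolding pull r'_def by (simp add: mult_ac)
    qed
    then have "(LINT s|lebesgue_on {0..t}. LINT x|I01. \<rho>' s x * (lam k * (exp (lam k * s) * cm k x)))
      = (LINT s|lebesgue_on {0..t}. LINT x|I01. g' s x * (- (real k * pi) * (exp (lam k * s) * sm k x)))"
      by (rule lebesgue_on_integral_AE_eq(2)) simp
    moreover have "F True (boundary_value (\<rho>' s) 1) * (exp (lam k * s) * cm k 1) + F False (boundary_value (\<rho>' s) 0) * (exp (lam k * s) * cm k 0)
      = exp (lam k * s) * \<psi> k s" for s
      using sg_pow_cm[of k True] sg_pow_cm[of k False] by (simp add: \<psi>_def b_def UNIV_bool algebra_simps)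
    ultimately show ?thesis
      using W[OF C12_mode[of T k] t] by (simp add: pull r'_def gam_eq)
  qed
  have r': "r' k t = exp (- lam k * t) * (gam k + (LINT s|lebesgue_on {0..t}. exp (lam k * s) * \<psi> k s))" if t: "t \<in> {0..T}" for k t
  proof -
    have "exp (- lam k * t) * (exp (lam k * t) * r' k t) = r' k t" by (simp add: mult.assoc[symmetric] flip: exp_add)
    moreover have "exp (lam k * t) * r' k t = gam k + (LINT s|lebesgue_on {0..t}. exp (lam k * s) * \<psi> k s)"
      using E[OF t, of k] by simp
    ultimately show ?thesis by simp
  qed
  \<comment> \<open>The integral is compared with that of a continuous majorant, which is a Duhamel
    integral of the constant \<open>2 * Q\<close>; this is insensitive to the measurability of
    \<psi>.\<close>
  have r'b: "\<bar>r' k t\<bar> \<le> C0 * bk k t" if t: "t \<in> {0..T}" for k t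
  proof -
    let ?L = "LINT s|lebesgue_on {0..t}. exp (lam k * s) * \<psi> k s"
    have c: "continuous_on {0..t} (\<lambda>s. exp (lam k * s) * (2 * Q))" by (intro continuous_intros)
    have "\<bar>?L\<bar> \<le> (LINT s|lebesgue_on {0..t}. exp (lam k * s) * (2 * Q))"
      by (rule lint_abs_le_integrable[OF continuous_imp_integrable_real[OF c]]) (simp add: abs_mult \<psi>b)
    then have "exp (- lam k * t) * \<bar>?L\<bar> \<le> exp (- lam k * t) * integral {0..t} (\<lambda>s. exp (lam k * s) * (2 * Q))"
      unfolding lint_continuous_eq[OF c] by (intro mult_left_mono) auto
    also have "\<dots> = duhamel k (\<lambda>_. 2 * Q) t" by (rule duhamel_eq[symmetric])
    also have "\<dots> \<le> 2 * Q * exp T / (1 + lam k)"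
      using Q_nonneg t by (intro order_trans[OF abs_ge_self duhamel_bounded]) auto
    finally have L: "exp (- lam k * t) * \<bar>?L\<bar> \<le> 2 * Q * exp T / (1 + lam k)" .
    have "\<bar>r' k t\<bar> = exp (- lam k * t) * \<bar>gam k + ?L\<bar>" unfolding r'[OF t] abs_mult by simp
    also have "\<dots> \<le> exp (- lam k * t) * (1 + \<bar>?L\<bar>)"
      using gam[of k] by (intro mult_left_mono) auto
    also have "\<dots> \<le> exp (- lam k * t) * 1 + 2 * Q * exp T / (1 + lam k)" using L by (simp add: distrib_left)
    finally show ?thesis by (rule mode_bound)
  qed
  have r's: "summable (\<lambda>k. \<bar>r' k t\<bar>)" if t: "t \<in> {0<..T}" for t
    by (rule mode_summable[OF t r'b]) (use t in auto)
  \<comment> \<open>Summable coefficients give a continuous version of \<open>\<rho>' t\<close>, and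
    the boundary value is by definition the value of that version.\<close>
  have bt: "b \<sigma> t = (\<Sum>k. wt k * (sg \<sigma> ^ k * r' k t))" if t: "t \<in> {0<..T}" for \<sigma> t
  proof -
    let ?v = "\<lambda>x. \<Sum>k. wt k * r' k t * cm k x"
    have vc: "continuous_on {0..1} ?v" by (rule cos_series_continuous[OF r's[OF t]])
    have i: "integrable I01 (\<rho>' t)" "integrable I01 ?v"
      using t int[of t] continuous_imp_integrable_real[OF vc] by auto
    have "AE x in I01. \<rho>' t x - ?v x = 0"
    proof (rule AE_zero_if_cos_coeffs_zero)
      show "(LINT x|I01. (\<rho>' t x - ?v x) * cm k x) = 0" for k
        using cos_series_coeff[OF r's[OF t], of k] cm_bounded_integrable[OF i(1)] cm_bounded_integrable[OF i(2)]
        by (simp add: left_diff_distrib r'_def)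
    qed (use i in auto)
    then have "AE x in I01. \<rho>' t x = ?v x" by eventually_elim simp
    then have "b \<sigma> t = ?v (if \<sigma> then 1 else 0)"
      unfolding b_def by (intro boundary_value_continuous[OF vc]) auto
    then show ?thesis by (simp only: sg_pow_cm mult_ac)
  qed
  \<comment> \<open>Indefinite integrals are measurable in time, hence so are the modes, then the
    traces as their series, and finally the sources.\<close>
  have r'm: "r' k \<in> borel_measurable (lebesgue_on {0..T})" for k
  proof -
    have "(\<lambda>t. LINT s|lebesgue_on {0..t}. exp (lam k * s) * \<psi> k s) \<in> borel_measurable (lebesgue_on {0..T})"
    proof (rule indefinite_lint_measurable[OF T])
      show "\<bar>exp (lam k * s) * \<psi> k s\<bar> \<le> exp (lam k * T) * (2 * Q)" if "s \<in> {0..T}" for s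
        unfolding abs_mult using that by (intro mult_mono) (auto simp: \<psi>b mult_left_mono)
    qed
    moreover have "(\<lambda>t. exp (- lam k * t)) \<in> borel_measurable (lebesgue_on {0..T})"
      by (intro continuous_imp_measurable_on_sets_lebesgue continuous_intros) auto
    ultimately have "(\<lambda>t. exp (- lam k * t) * (gam k + (LINT s|lebesgue_on {0..t}. exp (lam k * s) * \<psi> k s))) \<in> borel_measurable (lebesgue_on {0..T})"
      by (intro borel_measurable_times borel_measurable_add borel_measurable_const)
    then show ?thesis using r' by (subst measurable_cong) auto
  qed
  have bm: "b \<sigma> \<in> borel_measurable (lebesgue_on {0..T})" for \<sigma>
  proof -
    have ae: "AE s in lebesgue_on {0..T}. b \<sigma> s = (\<Sum>k. wt k * (sg \<sigma> ^ k * r' k s))"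
      using AE_lebesgue_on_interior[of T] by eventually_elim (auto intro: bt)
    have "(\<lambda>s. \<Sum>k. wt k * (sg \<sigma> ^ k * r' k s)) \<in> borel_measurable (lebesgue_on {0..T})"
      by (intro borel_measurable_suminf borel_measurable_times borel_measurable_const r'm)
    then show ?thesis using lebesgue_on_measurable_AE_eq[OF ae] by simp
  qed
  have \<psi>m: "\<psi> k \<in> borel_measurable (lebesgue_on {0..T})" for k
    unfolding \<psi>_def[abs_def]
    by (intro borel_measurable_sum borel_measurable_times borel_measurable_const
      measurable_compose[OF bm borel_measurable_continuous_onI[OF F_cont]])
  have \<psi>i: "\<psi> k integrable_on {0..T}" for k
    by (rule measurable_bounded_by_integrable_imp_integrable_real[where g = "\<lambda>_. 2 * Q"])
      (use \<psi>m \<psi>b T in auto)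
  have r'd: "r' k t = exp (- lam k * t) * gam k + duhamel k (\<psi> k) t" if t: "t \<in> {0..T}" for k t
  proof -
    have e: "continuous_on {0..t} (\<lambda>s. exp (lam k * s))" by (intro continuous_intros)
    have m: "(\<lambda>s. exp (lam k * s) * \<psi> k s) \<in> borel_measurable (lebesgue_on {0..t})"
      by (intro borel_measurable_times measurable_restrict_mono[OF \<psi>m] continuous_imp_measurable_on_sets_lebesgue[OF e])
        (use t in auto)
    have "integrable (lebesgue_on {0..t}) (\<lambda>s. exp (lam k * s) * \<psi> k s)"
    proof (rule measurable_bounded_by_integrable_imp_lebesgue_integrable[OF m, of "\<lambda>_. exp (lam k * t) * (2 * Q)"])

      show "norm (exp (lam k * s) * \<psi> k s) \<le> exp (lam k * t) * (2 * Q)" if "s \<in> {0..t}" for s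
        unfolding norm_mult using that \<psi>b by (intro mult_mono) (auto simp: mult_left_mono)
    qed (auto simp: integrable_const_ivl)
    then have "(LINT s|lebesgue_on {0..t}. exp (lam k * s) * \<psi> k s) = integral {0..t} (\<lambda>s. exp (lam k * s) * \<psi> k s)"
      by (rule lebesgue_integral_eq_integral) simp
    then show ?thesis unfolding r'[OF t] duhamel_eq by (simp only: distrib_left)
  qed
  \<comment> \<open>Both solutions give fixed points of the same map \<Phi>, which depends on the
    initial modes and the fluxes alone; so their Duhamel parts coincide.\<close>
  obtain D where D: "good D" "\<And>\<sigma> t. t \<in> {0..T} \<Longrightarrow> D \<sigma> t = \<Phi> D \<sigma> t"
    "\<And>k t. t \<in> {0..T} \<Longrightarrow> duhamel k (\<psi> k) t = duhamel k (src D k) t"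
  proof (rule trace_fixed_point[of \<psi> b])
    show "\<psi> k integrable_on {0..T}" for k by (rule \<psi>i)
    show "\<psi> k s = (\<Sum>\<sigma>\<in>UNIV. sg \<sigma> ^ k * F \<sigma> (b \<sigma> s))" for k s by (rule \<psi>_def)
    show "b \<sigma> t = (\<Sum>k. wt k * (sg \<sigma> ^ k * (exp (- lam k * t) * gam k + duhamel k (\<psi> k) t)))" if "t \<in> {0<..T}" for \<sigma> t
    proof -
      have "t \<in> {0..T}" using that by auto
      then show ?thesis unfolding bt[OF that] by (simp only: r'd)
    qed
  qed (use \<psi>b in blast)+
  obtain D' where D': "good D'" "\<And>\<sigma> t. t \<in> {0..T} \<Longrightarrow> D' \<sigma> t = \<Phi> D' \<sigma> t"
    "\<And>k t. t \<in> {0..T} \<Longrightarrow> duhamel k (\<phi> k) t = duhamel k (src D' k) t"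
  proof (rule trace_fixed_point[of \<phi> a])
    show "\<phi> k integrable_on {0..T}" for k by (rule \<phi>_integrable)
    show "\<phi> k s = (\<Sum>\<sigma>\<in>UNIV. sg \<sigma> ^ k * F \<sigma> (a \<sigma> s))" for k s using ms by (simp add: \<phi>_def mode_solution_def)
    show "a \<sigma> t = (\<Sum>k. wt k * (sg \<sigma> ^ k * (exp (- lam k * t) * gam k + duhamel k (\<phi> k) t)))" if "t \<in> {0<..T}" for \<sigma> t
      unfolding r_eq[symmetric] using ms that unfolding mode_solution_def by blast
  qed (use \<phi>_bound in blast)+
  have DD: "D \<sigma> s = D' \<sigma> s" if "s \<in> {0..T}" for \<sigma> s
    by (rule \<Phi>_fixed_unique[OF D(1) D'(1) D(2) D'(2) that])
  have rr: "r' k t = r k t" for k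
  proof -
    have "duhamel k (src D k) t = duhamel k (src D' k) t"
      unfolding duhamel_def src_def using DD t by (intro integral_cong) auto
    then show ?thesis unfolding r'd[OF t] r_eq D(3)[OF t] D'(3)[OF t] by simp
  qed
  have "AE x in I01. \<rho>' t x - \<rho> t x = 0"
  proof (rule AE_zero_if_cos_coeffs_zero)
    show "(LINT x|I01. (\<rho>' t x - \<rho> t x) * cm k x) = 0" for k
      using \<rho>_coeff[OF t, of k] rr[of k] cm_bounded_integrable[OF int[OF t]] cm_bounded_integrable[OF \<rho>_integrable[OF t]]
      by (simp add: left_diff_distrib r'_def)
  qed (use int[OF t] \<rho>_integrable[OF t] in auto)
  then show ?thesis by eventually_elim simp
qed

end

section \<open>The marginals of the process\<close>

context micro_model
begin

text \<open>Bounds the generator in the supremum norm over all configurations, not only those in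
  \<open>Omega N\<close>, so that its powers can be estimated by plain iteration.\<close>

definition CL :: real where
  "CL = real N ^ 2 * (\<Sum>x\<in>{1..<n}. 2) + real N * (\<Sum>\<sigma>\<in>(UNIV::bool set). \<Sum>\<xi>\<in>configs {1..l}. RB * 2)"

lemma L_bound:
  assumes f: "\<And>\<eta>. \<bar>f \<eta>\<bar> \<le> c"
  shows "\<bar>L f \<eta>\<bar> \<le> CL * c"
proof -
  have d: "\<bar>f \<eta> - f \<zeta>\<bar> \<le> 2 * c" for \<eta> \<zeta> using f[of \<eta>] f[of \<zeta>] by linarith
  have "\<bar>L f \<eta>\<bar> \<le> \<bar>real N ^ 2 * (\<Sum>x\<in>{1..<n}. f (swap x \<eta>) - f \<eta>)\<bar>
     + \<bar>real N * (\<Sum>\<sigma>\<in>UNIV. \<Sum>\<xi>\<in>configs {1..l}. R \<sigma> (window l (base \<sigma>) \<eta>) \<xi> * (f (paste l (base \<sigma>) \<xi> \<eta>) - f \<eta>))\<bar>"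
    unfolding L_eq by (rule abs_triangle_ineq)
  also have "\<bar>real N ^ 2 * (\<Sum>x\<in>{1..<n}. f (swap x \<eta>) - f \<eta>)\<bar> \<le> real N ^ 2 * (\<Sum>x\<in>{1..<n}. 2 * c)"
    unfolding abs_mult by (intro mult_mono order_trans[OF sum_abs] sum_mono d) auto
  also have "\<bar>real N * (\<Sum>\<sigma>\<in>UNIV. \<Sum>\<xi>\<in>configs {1..l}. R \<sigma> (window l (base \<sigma>) \<eta>) \<xi> * (f (paste l (base \<sigma>) \<xi> \<eta>) - f \<eta>))\<bar>
      \<le> real N * (\<Sum>\<sigma>\<in>(UNIV::bool set). \<Sum>\<xi>\<in>configs {1..l}. RB * (2 * c))"
    unfolding abs_mult
  proof (intro mult_mono)
    show "\<bar>\<Sum>\<sigma>\<in>UNIV. \<Sum>\<xi>\<in>configs {1..l}. R \<sigma> (window l (base \<sigma>) \<eta>) \<xi> * (f (paste l (base \<sigma>) \<xi> \<eta>) - f \<eta>)\<bar>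
      \<le> (\<Sum>\<sigma>\<in>(UNIV::bool set). \<Sum>\<xi>\<in>configs {1..l}. RB * (2 * c))"
    proof (rule order_trans[OF sum_abs sum_mono], rule order_trans[OF sum_abs sum_mono])
      fix \<sigma> \<xi> assume "\<xi> \<in> configs {1..l}"
      then show "\<bar>R \<sigma> (window l (base \<sigma>) \<eta>) \<xi> * (f (paste l (base \<sigma>) \<xi> \<eta>) - f \<eta>)\<bar> \<le> RB * (2 * c)"
        unfolding abs_mult using R_nonneg[of "window l (base \<sigma>) \<eta>" \<xi> \<sigma>] R_bound[of "window l (base \<sigma>) \<eta>" \<xi> \<sigma>] RB_nonneg
        by (intro mult_mono d) auto
    qed
  qed auto
  finally show ?thesis by (simp add: CL_def algebra_simps)
qed

lemma L_pow_bound: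
  assumes f: "\<And>\<eta>. \<bar>f \<eta>\<bar> \<le> c"
  shows "\<bar>(L ^^ k) f \<eta>\<bar> \<le> CL ^ k * c"
proof (induction k arbitrary: \<eta>)
  case (Suc k)
  have "\<bar>L ((L ^^ k) f) \<eta>\<bar> \<le> CL * (CL ^ k * c)" by (rule L_bound[OF Suc.IH])
  then show ?case by (simp add: mult.assoc)
qed (simp add: f)

lemma semigroup_summable:
  assumes f: "\<And>\<eta>. \<bar>f \<eta>\<bar> \<le> c"
  shows "summable (\<lambda>k. (L ^^ k) f \<eta> / fact k * t ^ k)"
proof (rule summable_comparison_test)
  have "summable (\<lambda>k. (\<bar>t\<bar> * CL) ^ k /\<^sub>R fact k)" by (rule summable_exp_generic)
  then show "summable (\<lambda>k. c * ((\<bar>t\<bar> * CL) ^ k /\<^sub>R fact k))" by (rule summable_mult)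
  have "norm ((L ^^ k) f \<eta> / fact k * t ^ k) \<le> c * ((\<bar>t\<bar> * CL) ^ k /\<^sub>R fact k)" for k
  proof -
    have "\<bar>(L ^^ k) f \<eta>\<bar> * (\<bar>t\<bar> ^ k / fact k) \<le> CL ^ k * c * (\<bar>t\<bar> ^ k / fact k)"
      by (intro mult_right_mono L_pow_bound f) auto
    then show ?thesis by (simp add: abs_mult power_abs power_mult_distrib divide_inverse mult_ac)
  qed
  then show "\<exists>M. \<forall>k\<ge>M. norm ((L ^^ k) f \<eta> / fact k * t ^ k) \<le> c * ((\<bar>t\<bar> * CL) ^ k /\<^sub>R fact k)" by blast
qed

lemma semigroup_eq: "semigroup L t f \<eta> = (\<Sum>k. (L ^^ k) f \<eta> / fact k * t ^ k)"
  by (simp add: semigroup_def mult.commute)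

text \<open>Termwise differentiation of an everywhere convergent power series, in which shifting the
  coefficients amounts to applying the generator to \<open>f\<close> first.\<close>

lemma semigroup_deriv:
  assumes f: "\<And>\<eta>. \<bar>f \<eta>\<bar> \<le> c"
  shows "((\<lambda>t. semigroup L t f \<eta>) has_real_derivative semigroup L t (L f) \<eta>) (at t)"
proof -
  have "diffs (\<lambda>k. (L ^^ k) f \<eta> / fact k) k = (L ^^ k) (L f) \<eta> / fact k" for k
    by (simp add: diffs_def funpow_swap1)
  then have "diffs (\<lambda>k. (L ^^ k) f \<eta> / fact k) = (\<lambda>k. (L ^^ k) (L f) \<eta> / fact k)" ..
  then show ?thesis
    using termdiffs_strong_converges_everywhere[of "\<lambda>k. (L ^^ k) f \<eta> / fact k", OF semigroup_summable[OF f]]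
    by (simp add: semigroup_eq[abs_def])
qed

text \<open>On \<open>Omega N\<close> the generator is a finite matrix, since it only looks at
  values in \<open>Omega N\<close>; the expansion in indicators passes through all powers and
  through the series.\<close>

lemma semigroup_expand:
  assumes \<zeta>: "\<zeta> \<in> Omega N"
  shows "semigroup L t f \<zeta> = (\<Sum>\<xi>\<in>Omega N. f \<xi> * semigroup L t (\<lambda>\<zeta>. of_bool (\<zeta> = \<xi>)) \<zeta>)"
proof -
  have pow: "(L ^^ k) f \<zeta> = (\<Sum>\<xi>\<in>Omega N. f \<xi> * (L ^^ k) (\<lambda>\<zeta>. of_bool (\<zeta> = \<xi>)) \<zeta>)" if "\<zeta> \<in> Omega N" for k \<zeta>
    using that
  proof (induction k arbitrary: \<zeta>)
    case 0
    have "(\<Sum>\<xi>\<in>Omega N. f \<xi> * of_bool (\<zeta> = \<xi>)) = (\<Sum>\<xi>\<in>Omega N. if \<zeta> = \<xi> then f \<xi> else 0)" by (rule sum.cong) auto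
    then show ?case using 0 by simp
  next
    case (Suc k)
    have "(L ^^ Suc k) f \<zeta> = L (\<lambda>\<zeta>. \<Sum>\<xi>\<in>Omega N. f \<xi> * (L ^^ k) (\<lambda>\<zeta>. of_bool (\<zeta> = \<xi>)) \<zeta>) \<zeta>"
      using L_cong[OF Suc.IH Suc.prems] by simp
    then show ?case by (simp add: L_sum)
  qed
  have s: "summable (\<lambda>k. (L ^^ k) (\<lambda>\<zeta>. of_bool (\<zeta> = \<xi>)) \<zeta> / fact k * t ^ k)" for \<xi>
    by (rule semigroup_summable[of _ 1]) simp
  have "semigroup L t f \<zeta> = (\<Sum>k. \<Sum>\<xi>\<in>Omega N. f \<xi> * ((L ^^ k) (\<lambda>\<zeta>. of_bool (\<zeta> = \<xi>)) \<zeta> / fact k * t ^ k))"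
    unfolding semigroup_eq pow[OF \<zeta>] by (simp add: sum_distrib_right sum_divide_distrib mult.assoc)
  also have "\<dots> = (\<Sum>\<xi>\<in>Omega N. \<Sum>k. f \<xi> * ((L ^^ k) (\<lambda>\<zeta>. of_bool (\<zeta> = \<xi>)) \<zeta> / fact k * t ^ k))"
    by (rule suminf_sum) (intro summable_mult s)
  also have "\<dots> = (\<Sum>\<xi>\<in>Omega N. f \<xi> * semigroup L t (\<lambda>\<zeta>. of_bool (\<zeta> = \<xi>)) \<zeta>)"
    unfolding semigroup_eq by (intro sum.cong refl suminf_mult s)
  finally show ?thesis .
qed

end

section \<open>From the path measure to the forward equation\<close>

locale micro_process = micro_model +
  fixes T :: real and \<nu> :: "config pmf" and P :: "(real \<Rightarrow> config) measure"
  assumes T: "0 < T" and law: "process_law N l (R False) (R True) T \<nu> P"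
begin

sublocale prob_space P using law by (simp add: process_law_def)

lemma sets_P: "sets P = sets (path_space N T)" using law by (simp add: process_law_def)

lemma space_P: "space P = space (path_space N T)" by (rule sets_eq_imp_space_eq[OF sets_P])

lemma path_Omega: "\<omega> \<in> space P \<Longrightarrow> t \<in> {0..T} \<Longrightarrow> \<omega> t \<in> Omega N"
  by (auto simp: space_P path_space_def space_restrict_space space_PiM)

lemma eval_measurable:
  assumes "t \<in> {0..T}"
  shows "(\<lambda>\<omega>. \<omega> t) \<in> measurable P (count_space (Omega N))"
proof -
  have "(\<lambda>\<omega>. \<omega> t) \<in> measurable (path_space N T) (count_space (Omega N))"
    unfolding path_space_def using assms by (intro measurable_restrict_space1 measurable_component_singleton)
  then show ?thesis using measurable_cong_sets[OF sets_P refl] by blast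
qed

lemma eval_sets: "t \<in> {0..T} \<Longrightarrow> {\<omega> \<in> space P. A (\<omega> t)} \<in> sets P"
proof -
  assume t: "t \<in> {0..T}"
  have "(\<lambda>\<omega>. \<omega> t) -` {\<eta> \<in> Omega N. A \<eta>} \<inter> space P \<in> sets P"
    by (rule measurable_sets[OF eval_measurable[OF t]]) auto
  moreover have "(\<lambda>\<omega>. \<omega> t) -` {\<eta> \<in> Omega N. A \<eta>} \<inter> space P = {\<omega> \<in> space P. A (\<omega> t)}"
    using path_Omega t by auto
  ultimately show ?thesis by simp
qed

lemma eval_integral:
  assumes t: "t \<in> {0..T}"
  shows "integrable P (\<lambda>\<omega>. f (\<omega> t) :: real)"
    "(\<integral>\<omega>. f (\<omega> t) \<partial>P) = (\<Sum>\<eta>\<in>Omega N. f \<eta> * prob {\<omega> \<in> space P. \<omega> t = \<eta>})"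
proof -
  have e: "f (\<omega> t) = (\<Sum>\<eta>\<in>Omega N. f \<eta> * indicator {\<omega> \<in> space P. \<omega> t = \<eta>} \<omega>)" if "\<omega> \<in> space P" for \<omega>
  proof -
    have "(\<Sum>\<eta>\<in>Omega N. f \<eta> * indicator {\<omega> \<in> space P. \<omega> t = \<eta>} \<omega>) = (\<Sum>\<eta>\<in>Omega N. if \<omega> t = \<eta> then f \<eta> else 0)"
      using that by (intro sum.cong) (auto simp: indicator_def)
    then show ?thesis using path_Omega[OF that t] by simp
  qed
  have i: "integrable P (\<lambda>\<omega>. f \<eta> * indicator {\<omega> \<in> space P. \<omega> t = \<eta>} \<omega>)" for \<eta>
    using eval_sets[OF t, of "\<lambda>\<zeta>. \<zeta> = \<eta>"] by (intro integrable_mult_right integrable_real_indicator) (auto simp: emeasure_eq_measure)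
  have "integrable P (\<lambda>\<omega>. \<Sum>\<eta>\<in>Omega N. f \<eta> * indicator {\<omega> \<in> space P. \<omega> t = \<eta>} \<omega>)" using i by (rule Bochner_Integration.integrable_sum)
  moreover have "integrable P (\<lambda>\<omega>. f (\<omega> t)) \<longleftrightarrow> integrable P (\<lambda>\<omega>. \<Sum>\<eta>\<in>Omega N. f \<eta> * indicator {\<omega> \<in> space P. \<omega> t = \<eta>} \<omega>)"
    by (rule Bochner_Integration.integrable_cong[OF refl e])
  ultimately show "integrable P (\<lambda>\<omega>. f (\<omega> t))" by blast
  have "(\<integral>\<omega>. f (\<omega> t) \<partial>P) = (\<integral>\<omega>. (\<Sum>\<eta>\<in>Omega N. f \<eta> * indicator {\<omega> \<in> space P. \<omega> t = \<eta>} \<omega>) \<partial>P)"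
    by (rule Bochner_Integration.integral_cong[OF refl e])
  also have "\<dots> = (\<Sum>\<eta>\<in>Omega N. \<integral>\<omega>. f \<eta> * indicator {\<omega> \<in> space P. \<omega> t = \<eta>} \<omega> \<partial>P)"
    by (rule Bochner_Integration.integral_sum[OF i])
  also have "\<dots> = (\<Sum>\<eta>\<in>Omega N. f \<eta> * prob {\<omega> \<in> space P. \<omega> t = \<eta>})"
    using eval_sets[OF t] by (intro sum.cong) (auto intro!: arg_cong[where f = prob])
  finally show "(\<integral>\<omega>. f (\<omega> t) \<partial>P) = (\<Sum>\<eta>\<in>Omega N. f \<eta> * prob {\<omega> \<in> space P. \<omega> t = \<eta>})" .
qed

lemma past_subalgebra: "sigma_finite_subalgebra P (past N T 0)"
proof (rule finite_measure_subalgebra_is_sigma_finite)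
  have "subalgebra P (past N T 0)"
    unfolding subalgebra_def
  proof
    show "space (past N T 0) = space P" by (simp add: past_def space_P)
    have "(\<lambda>\<omega>. restrict \<omega> {0..0}) \<in> measurable (path_space N T) (PiM {0..0} (\<lambda>_. count_space (Omega N)))"
      unfolding path_space_def using T by (intro measurable_restrict_space1 measurable_restrict_subset) auto
    then show "sets (past N T 0) \<subseteq> sets P"
      unfolding past_def sets_P by (intro sets_image_in_sets refl)
  qed
  then show "finite_measure_subalgebra P (past N T 0)"
    by unfold_locales
qed

text \<open>The Markov property is taken from time 0: the expectation of the conditional expectation
  given the past at 0 determines every one-time marginal.\<close>

lemma eval_integral_semigroup:
  assumes t: "t \<in> {0..T}"
  shows "(\<integral>\<omega>. f (\<omega> t) \<partial>P) = (\<Sum>\<zeta>\<in>Omega N. pmf \<nu> \<zeta> * semigroup L t f \<zeta>)"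
proof -
  interpret S: sigma_finite_subalgebra P "past N T 0" by (rule past_subalgebra)
  have T0: "0 \<in> {0..T}" using T by simp
  have "(\<integral>\<omega>. f (\<omega> t) \<partial>P) = (\<integral>\<omega>. real_cond_exp P (past N T 0) (\<lambda>\<omega>. f (\<omega> t)) \<omega> \<partial>P)"
    by (rule S.real_cond_exp_int(2)[symmetric, OF eval_integral(1)[OF t]])
  also have "\<dots> = (\<integral>\<omega>. semigroup L (t - 0) f (\<omega> 0) \<partial>P)"
  proof (rule integral_cong_AE)
    show "AE \<omega> in P. real_cond_exp P (past N T 0) (\<lambda>\<omega>. f (\<omega> t)) \<omega> = semigroup L (t - 0) f (\<omega> 0)"
      using law t unfolding process_law_def atLeastAtMost_iff by blast
    show "real_cond_exp P (past N T 0) (\<lambda>\<omega>. f (\<omega> t)) \<in> borel_measurable P"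
      by (rule borel_measurable_integrable[OF S.real_cond_exp_int(1)[OF eval_integral(1)[OF t]]])
    show "(\<lambda>\<omega>. semigroup L (t - 0) f (\<omega> 0)) \<in> borel_measurable P"
      by (rule borel_measurable_integrable[OF eval_integral(1)[OF T0]])
  qed
  also have "\<dots> = (\<Sum>\<zeta>\<in>Omega N. semigroup L t f \<zeta> * prob {\<omega> \<in> space P. \<omega> 0 = \<zeta>})"
    using eval_integral(2)[OF T0, of "semigroup L t f"] by simp
  also have "\<dots> = (\<Sum>\<zeta>\<in>Omega N. pmf \<nu> \<zeta> * semigroup L t f \<zeta>)"
    using law unfolding process_law_def by (intro sum.cong) auto
  finally show ?thesis .
qed

text \<open>Defined through the semigroup and not as a probability, so that it makes sense and is
  differentiable at every real time; on \<open>{0..T}\<close> the two agree.\<close>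

definition p :: "real \<Rightarrow> config \<Rightarrow> real" where
  "p t \<eta> = (\<Sum>\<zeta>\<in>Omega N. pmf \<nu> \<zeta> * semigroup L t (\<lambda>\<xi>. of_bool (\<xi> = \<eta>)) \<zeta>)"

lemma p_prob: "t \<in> {0..T} \<Longrightarrow> \<eta> \<in> Omega N \<Longrightarrow> p t \<eta> = prob {\<omega> \<in> space P. \<omega> t = \<eta>}"
proof -
  assume t: "t \<in> {0..T}" and \<eta>: "\<eta> \<in> Omega N"
  have "p t \<eta> = (\<integral>\<omega>. of_bool (\<omega> t = \<eta>) \<partial>P)" unfolding p_def by (rule eval_integral_semigroup[OF t, symmetric])
  also have "\<dots> = (\<Sum>\<zeta>\<in>Omega N. of_bool (\<zeta> = \<eta>) * prob {\<omega> \<in> space P. \<omega> t = \<zeta>})" by (rule eval_integral(2)[OF t])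
  also have "\<dots> = (\<Sum>\<zeta>\<in>Omega N. if \<zeta> = \<eta> then prob {\<omega> \<in> space P. \<omega> t = \<zeta>} else 0)" by (rule sum.cong) auto
  finally show ?thesis using \<eta> by simp
qed

lemma p_prob_event:
  assumes t: "t \<in> {0..T}"
  shows "prob {\<omega> \<in> space P. A (\<omega> t)} = (\<Sum>\<eta>\<in>Omega N. p t \<eta> * of_bool (A \<eta>))"
proof -
  have "prob {\<omega> \<in> space P. A (\<omega> t)} = (\<integral>\<omega>. indicator {\<omega> \<in> space P. A (\<omega> t)} \<omega> \<partial>P)"
    using eval_sets[OF t, of A] by simp
  also have "\<dots> = (\<integral>\<omega>. of_bool (A (\<omega> t)) \<partial>P)"
    by (intro Bochner_Integration.integral_cong) (auto simp: indicator_def)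
  also have "\<dots> = (\<Sum>\<eta>\<in>Omega N. of_bool (A \<eta>) * prob {\<omega> \<in> space P. \<omega> t = \<eta>})"
    by (rule eval_integral(2)[OF t])
  finally show ?thesis using p_prob[OF t] by (simp add: mult.commute)
qed

lemma p_initial: "\<eta> \<in> Omega N \<Longrightarrow> p 0 \<eta> = pmf \<nu> \<eta>"
  using p_prob[of 0 \<eta>] T law by (simp add: process_law_def)

lemma flow_p: "flow N l R RB T p"
proof
  show "0 \<le> p s \<eta>" if "s \<in> {0..T}" "\<eta> \<in> Omega N" for s \<eta> using p_prob[OF that] by simp
  show "(\<Sum>\<eta>\<in>Omega N. p s \<eta>) = 1" if "s \<in> {0..T}" for s
    using p_prob_event[OF that, of "\<lambda>_. True"] by (simp add: prob_space)
  show "((\<lambda>s. p s \<eta>) has_real_derivative (\<Sum>\<zeta>\<in>Omega N. p s \<zeta> * L (\<lambda>\<xi>. of_bool (\<xi> = \<eta>)) \<zeta>)) (at s)"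
    if "\<eta> \<in> Omega N" for s \<eta>
  proof -
    have "((\<lambda>s. p s \<eta>) has_real_derivative (\<Sum>\<zeta>\<in>Omega N. pmf \<nu> \<zeta> * semigroup L s (L (\<lambda>\<xi>. of_bool (\<xi> = \<eta>))) \<zeta>)) (at s)"
      unfolding p_def by (intro DERIV_sum DERIV_cmult semigroup_deriv[of _ 1]) simp
    moreover have "(\<Sum>\<zeta>\<in>Omega N. pmf \<nu> \<zeta> * semigroup L s f \<zeta>) = (\<Sum>\<zeta>\<in>Omega N. p s \<zeta> * f \<zeta>)" for f
    proof -
      have "(\<Sum>\<zeta>\<in>Omega N. pmf \<nu> \<zeta> * semigroup L s f \<zeta>)
        = (\<Sum>\<zeta>\<in>Omega N. \<Sum>\<xi>\<in>Omega N. pmf \<nu> \<zeta> * (f \<xi> * semigroup L s (\<lambda>\<zeta>. of_bool (\<zeta> = \<xi>)) \<zeta>))"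
        by (intro sum.cong refl) (simp add: semigroup_expand[of _ s f] sum_distrib_left)
      also have "\<dots> = (\<Sum>\<xi>\<in>Omega N. \<Sum>\<zeta>\<in>Omega N. pmf \<nu> \<zeta> * (f \<xi> * semigroup L s (\<lambda>\<zeta>. of_bool (\<zeta> = \<xi>)) \<zeta>))"
        by (rule sum.swap)
      also have "\<dots> = (\<Sum>\<zeta>\<in>Omega N. p s \<zeta> * f \<zeta>)"
        unfolding p_def sum_distrib_right by (intro sum.cong refl) (simp only: mult_ac)
      finally show ?thesis .
    qed
    ultimately show ?thesis by simp
  qed
qed (use l N T R_nonneg R_bound in auto)

end

section \<open>Convergence\<close>

lemma fc_tendsto: "(\<lambda>K. fc K k) \<longlonglongrightarrow> wt k"
proof -
  have "(\<lambda>K. wt k * (1 - real k / real K)) \<longlonglongrightarrow> wt k * (1 - 0)"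
    by (intro tendsto_intros lim_const_over_n)
  then have "(\<lambda>K. wt k * (1 - real k / real K)) \<longlonglongrightarrow> wt k" by simp
  moreover have "\<forall>\<^sub>F K in sequentially. wt k * (1 - real k / real K) = fc K k"
    using eventually_gt_at_top[of k] by eventually_elim (simp add: fc_def)
  ultimately show ?thesis by (rule Lim_transform_eventually)
qed

text \<open>Tannery's theorem with majorant \<open>2 * \<bar>h k\<bar>\<close>, since the Fejer
  coefficients are bounded by 2 and tend to \<open>wt k\<close>.\<close>

lemma fejer_means_tendsto:
  assumes "summable (\<lambda>k. \<bar>h k\<bar>)"
  shows "(\<lambda>K. \<Sum>k<K. fc K k * h k) \<longlonglongrightarrow> (\<Sum>k. wt k * h k)"
proof -
  have "(\<lambda>K. \<Sum>k. fc K k * h k) \<longlonglongrightarrow> (\<Sum>k. wt k * h k)"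
  proof (rule tannerys_theorem[THEN conjunct2, THEN conjunct2])
    show "(\<lambda>K. fc K k * h k) \<longlonglongrightarrow> wt k * h k" for k by (intro tendsto_intros fc_tendsto)
    have "norm (fc K k * h k) \<le> 2 * \<bar>h k\<bar>" for k K
      using mult_right_mono[OF fc_bounds(3)[of K k], of "\<bar>h k\<bar>"] fc_bounds(1)[of K k] by (simp add: abs_mult)
    then show "\<forall>\<^sub>F (k, K) in at_top \<times>\<^sub>F sequentially. norm (fc K k * h k) \<le> 2 * \<bar>h k\<bar>"
      by (intro always_eventually) auto
  qed (use assms in auto)
  moreover have "(\<Sum>k. fc K k * h k) = (\<Sum>k<K. fc K k * h k)" for K
    by (rule suminf_finite) (auto simp: fc_def)
  ultimately show ?thesis by simp
qed

lemma inverse_sites_tendsto: "(\<lambda>N. 1 / real (N - 1)) \<longlonglongrightarrow> 0" "(\<lambda>N. real N / real (N - 1)) \<longlonglongrightarrow> 1" "(\<lambda>N. real (N - 1) / real N) \<longlonglongrightarrow> 1"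
proof -
  have f: "filterlim (\<lambda>N. N - 1) sequentially sequentially" by (rule filterlim_minus_const_nat_at_top)
  show 1: "(\<lambda>N. 1 / real (N - 1)) \<longlonglongrightarrow> 0"
    by (rule filterlim_compose[OF lim_1_over_n f])
  have "(\<lambda>N. 1 + 1 / real (N - 1)) \<longlonglongrightarrow> 1 + 0" by (intro tendsto_intros 1)
  then have "(\<lambda>N. 1 + 1 / real (N - 1)) \<longlonglongrightarrow> 1" by simp
  moreover have "\<forall>\<^sub>F N in sequentially. 1 + 1 / real (N - 1) = real N / real (N - 1)"
    using eventually_gt_at_top[of 1] by eventually_elim (simp add: of_nat_diff field_simps)
  ultimately show "(\<lambda>N. real N / real (N - 1)) \<longlonglongrightarrow> 1" by (rule Lim_transform_eventually)
  have "(\<lambda>N. 1 - 1 / real N) \<longlonglongrightarrow> 1 - 0" by (intro tendsto_intros lim_1_over_n)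
  then have "(\<lambda>N. 1 - 1 / real N) \<longlonglongrightarrow> 1" by simp
  moreover have "\<forall>\<^sub>F N in sequentially. 1 - 1 / real N = real (N - 1) / real N"
    using eventually_gt_at_top[of 1] by eventually_elim (simp add: of_nat_diff field_simps)
  ultimately show "(\<lambda>N. real (N - 1) / real N) \<longlonglongrightarrow> 1" by (rule Lim_transform_eventually)
qed

definition ev :: "nat \<Rightarrow> nat \<Rightarrow> real" where
  "ev N k = 2 * real N ^ 2 * (1 - cos (real k * pi / real (N - 1)))"

text \<open>Here 1 - cos is twice a squared sine, so the limit is the square of the derivative of a
  sine at 0, up to N / (N - 1).\<close>

lemma ev_tendsto: "(\<lambda>N. ev N k) \<longlonglongrightarrow> lam k"
proof -
  define c where "c = real k * pi / 2"
  have "((\<lambda>x. sin (c * x)) has_real_derivative c) (at 0)" by (auto intro!: derivative_eq_intros)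
  then have d: "((\<lambda>h. sin (c * h) / h) \<longlongrightarrow> c) (at 0)" by (simp add: has_field_derivative_iff)
  have "\<forall>\<^sub>F N in sequentially. 1 / real (N - 1) \<noteq> 0"
    using eventually_gt_at_top[of 1] by eventually_elim auto
  then have "filterlim (\<lambda>N. 1 / real (N - 1)) (at 0) sequentially"
    by (intro filterlim_atI inverse_sites_tendsto)
  from filterlim_compose[OF d this]
  have "(\<lambda>N. (real N / real (N - 1))^2 * (2 * (sin (c * (1 / real (N - 1))) / (1 / real (N - 1))))^2) \<longlonglongrightarrow> 1^2 * (2 * c)^2"
    by (intro tendsto_intros inverse_sites_tendsto)
  moreover have "1^2 * (2 * c)^2 = lam k" by (simp add: c_def lam_def)
  moreover have "\<forall>\<^sub>F N in sequentially. (real N / real (N - 1))^2 * (2 * (sin (c * (1 / real (N - 1))) / (1 / real (N - 1))))^2 = ev N k"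
    using eventually_gt_at_top[of 1]
  proof eventually_elim
    case (elim N)
    have "1 - cos (real k * pi / real (N - 1)) = 2 * (sin (c * (1 / real (N - 1))))^2"
      using cos_double_sin[of "c * (1 / real (N - 1))"] by (simp add: c_def)
    moreover have "(real N / n)^2 * (2 * (s / (1 / n)))^2 = 2 * real N ^ 2 * (2 * s^2)" if "n \<noteq> 0" for n s :: real
      using that by (simp add: power2_eq_square)
    ultimately show ?case using elim by (simp add: ev_def)
  qed
  ultimately show ?thesis using Lim_transform_eventually by fastforce
qed

lemma carre_error_tendsto:
  "(\<lambda>N. real N ^ 2 * real (N - 1) * (A / real (N - 1) ^ 2)^2 + real N * (B * (C / real (N - 1))^2)) \<longlonglongrightarrow> 0"
proof -
  have "(\<lambda>N. (real N / real (N - 1))^2 * A^2 * (1 / real (N - 1)) + (real N / real (N - 1)) * (B * C^2) * (1 / real (N - 1))) \<longlonglongrightarrow> 1^2 * A^2 * 0 + 1 * (B * C^2) * 0"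
    by (intro tendsto_intros inverse_sites_tendsto)
  moreover have "(real N / n)^2 * A^2 * (1 / n) + (real N / n) * (B * C^2) * (1 / n)
    = real N ^ 2 * n * (A / n ^ 2)^2 + real N * (B * (C / n)^2)" for n :: real and N
    by (cases "n = 0") (simp_all add: field_simps power2_eq_square)
  ultimately show ?thesis by simp
qed

text \<open>The microscopic locales fix N. Here they run along a sequence, and what depends on N is
  restated with N as an argument: \<open>pN\<close>, \<open>EN\<close>, \<open>XN\<close>,
  \<open>uN\<close>, \<open>erN\<close> below.\<close>

locale hydro = modes T LF Q F gam \<gamma> r a f for T LF Q F gam \<gamma> r a f +
  fixes l :: nat and R :: "bool \<Rightarrow> rates" and RB :: real and \<nu> :: "nat \<Rightarrow> config pmf"
    and P :: "nat \<Rightarrow> (real \<Rightarrow> config) measure"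
  assumes l: "1 \<le> l" and F_eq: "F = (\<lambda>\<sigma>. boundary_flux l (R \<sigma>))"
    and Q_eq: "Q = 2 ^ l * RB * real l" and LF_eq: "LF = 2 * real l * Q"
    and R_nonneg: "\<And>\<sigma> \<xi> \<xi>'. \<xi> \<in> configs {1..l} \<Longrightarrow> \<xi>' \<in> configs {1..l} \<Longrightarrow> 0 \<le> R \<sigma> \<xi> \<xi>'"
    and R_bound: "\<And>\<sigma> \<xi> \<xi>'. \<xi> \<in> configs {1..l} \<Longrightarrow> \<xi>' \<in> configs {1..l} \<Longrightarrow> R \<sigma> \<xi> \<xi>' \<le> RB"
    and \<nu>_Omega: "\<And>N. 1 \<le> N \<Longrightarrow> set_pmf (\<nu> N) \<subseteq> Omega N"
    and assoc: "associated \<nu> \<gamma>"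
    and law: "\<And>N. l < N \<Longrightarrow> process_law N l (R False) (R True) T (\<nu> N) (P N)"
begin

text \<open>The sum is the integral of \<gamma> against a nonnegative function of total integral
  1.\<close>

lemma heat_fejer_gam:
  assumes "0 \<le> u" "1 \<le> K"
  shows "\<bar>\<Sum>k<K. fc K k * sg \<sigma> ^ k * exp (- lam k * u) * gam k\<bar> \<le> 1"
proof -
  let ?G = "\<lambda>x. \<Sum>k<K. fc K k * sg \<sigma> ^ k * exp (- lam k * u) * cm k x"
  have G0: "0 \<le> ?G x" for x by (rule heat_fejer_refl_nonneg[OF assms(1)])
  have Gc: "continuous_on {0..1} ?G" by (intro continuous_intros)
  have i: "integrable I01 (\<lambda>x. \<gamma> x * ?G x)" by (rule continuous_mult_integrable[OF \<gamma>_integrable Gc])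
  have "(LINT x|I01. \<gamma> x * ?G x) = (LINT x|I01. (\<Sum>k<K. fc K k * sg \<sigma> ^ k * exp (- lam k * u) * (\<gamma> x * cm k x)))"
    by (simp add: sum_distrib_left mult_ac)
  also have "\<dots> = (\<Sum>k<K. fc K k * sg \<sigma> ^ k * exp (- lam k * u) * gam k)"
    using cm_bounded_integrable[OF \<gamma>_integrable] by (simp add: gam_eq)
  finally have e: "(LINT x|I01. \<gamma> x * ?G x) = (\<Sum>k<K. fc K k * sg \<sigma> ^ k * exp (- lam k * u) * gam k)" .
  have ci: "integrable I01 (cm k)" for k by (intro continuous_imp_integrable_real continuous_intros)
  have "(LINT x|I01. ?G x) = (\<Sum>k<K. if k = 0 then fc K 0 else 0)"
    using ci by (simp add: integral_cm if_distrib cong: if_cong)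
  then have G1: "(LINT x|I01. ?G x) = 1" using assms(2) by (simp add: fc_def wt_def)
  have "0 \<le> (LINT x|I01. \<gamma> x * ?G x)"
    using \<gamma>_range G0 by (intro Bochner_Integration.integral_nonneg mult_nonneg_nonneg) (auto simp: image_subset_iff)
  moreover have "(LINT x|I01. \<gamma> x * ?G x) \<le> (LINT x|I01. ?G x)"
  proof (rule integral_mono[OF i continuous_imp_integrable_real[OF Gc]])
    fix x :: real assume "x \<in> space I01"
    then have "\<gamma> x * ?G x \<le> 1 * ?G x" using \<gamma>_range G0 by (intro mult_right_mono) (auto simp: image_subset_iff)
    then show "\<gamma> x * ?G x \<le> ?G x" by simp
  qed
  ultimately show ?thesis using e G1 by simp
qed

text \<open>The bound must not depend on K, which excludes bounding the modes one by one. The part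
  from the initial profile is handled by positivity of the kernel, the Duhamel part by absolute
  summability.\<close>

lemma uniform_bound:
  obtains B where "\<And>K \<sigma> u s. 1 \<le> K \<Longrightarrow> 0 \<le> u \<Longrightarrow> s \<in> {0..T} \<Longrightarrow> \<bar>\<Sum>k<K. fc K k * sg \<sigma> ^ k * exp (- lam k * u) * r k s\<bar> + 1 \<le> B"
    "\<And>k s. s \<in> {0..T} \<Longrightarrow> \<bar>r k s\<bar> + 1 \<le> B"
proof
  define S where "S = 2 * Q * exp T * (\<Sum>k. 2 / (1 + lam k))"
  define B where "B = 2 + S + 2 * C0"
  have S0: "0 \<le> S" using Q_nonneg lam_summable[of 1] unfolding S_def by (intro mult_nonneg_nonneg suminf_nonneg) auto
  show "\<bar>\<Sum>k<K. fc K k * sg \<sigma> ^ k * exp (- lam k * u) * r k s\<bar> + 1 \<le> B" if K: "1 \<le> K" and u: "0 \<le> u" and s: "s \<in> {0..T}" for K \<sigma> u s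
  proof -
    have e: "fc K k * sg \<sigma> ^ k * exp (- lam k * u) * r k s = fc K k * sg \<sigma> ^ k * exp (- lam k * (u + s)) * gam k
       + fc K k * sg \<sigma> ^ k * exp (- lam k * u) * duhamel k (\<phi> k) s" for k
    proof -
      have "exp (- lam k * (u + s)) = exp (- lam k * u) * exp (- lam k * s)"
        by (subst exp_add[symmetric]) (simp add: algebra_simps)
      then show ?thesis unfolding r_eq by (simp only: distrib_left mult.assoc)
    qed
    have "\<bar>\<Sum>k<K. fc K k * sg \<sigma> ^ k * exp (- lam k * u) * duhamel k (\<phi> k) s\<bar> \<le> (\<Sum>k<K. 2 * Q * exp T * (2 / (1 + lam k)))"
    proof (rule order_trans[OF sum_abs sum_mono])
      fix k
      have "\<bar>fc K k * sg \<sigma> ^ k * exp (- lam k * u) * duhamel k (\<phi> k) s\<bar> \<le> 2 * 1 * 1 * (2 * Q * exp T / (1 + lam k))"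
        unfolding abs_mult using fc_bounds[of K k] duhamel_\<phi>_bound[OF s, of k] u by (intro mult_mono) auto
      then show "\<bar>fc K k * sg \<sigma> ^ k * exp (- lam k * u) * duhamel k (\<phi> k) s\<bar> \<le> 2 * Q * exp T * (2 / (1 + lam k))" by simp
    qed
    also have "\<dots> \<le> S"
      unfolding S_def sum_distrib_left[symmetric] using Q_nonneg by (intro mult_left_mono sum_le_suminf lam_summable) auto
    finally show ?thesis
      using heat_fejer_gam[of "u + s" K \<sigma>] u s K C0_pos
        abs_triangle_ineq[of "\<Sum>k<K. fc K k * sg \<sigma> ^ k * exp (- lam k * (u + s)) * gam k" "\<Sum>k<K. fc K k * sg \<sigma> ^ k * exp (- lam k * u) * duhamel k (\<phi> k) s"]
      unfolding e sum.distrib B_def by auto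
  qed
  show "\<bar>r k s\<bar> + 1 \<le> B" if "s \<in> {0..T}" for k s
  proof -
    have "C0 * bk k s \<le> C0 * 2" using C0_pos that by (intro mult_left_mono bk_le_2) auto
    then show ?thesis using r_bound[OF that, of k] S0 unfolding B_def by linarith
  qed
qed

definition DK :: "nat \<Rightarrow> real" where
  "DK K = (\<Sum>\<sigma>\<in>UNIV. integral {0..T} (\<lambda>s. \<bar>F \<sigma> (\<Sum>k<K. fc K k * sg \<sigma> ^ k * r k s) - f \<sigma> s\<bar>))"

text \<open>Fejer means converge to the traces at positive times only. Setting the integrand to 0 at
  time 0 changes no integral and lets dominated convergence run on the closed interval.\<close>

lemma DK_tendsto: "DK \<longlonglongrightarrow> 0"
proof -
  have "(\<lambda>K. integral {0..T} (\<lambda>s. \<bar>F \<sigma> (\<Sum>k<K. fc K k * sg \<sigma> ^ k * r k s) - f \<sigma> s\<bar>)) \<longlonglongrightarrow> 0" for \<sigma>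
  proof -
    define d where "d K s = (if s = 0 then 0 else \<bar>F \<sigma> (\<Sum>k<K. fc K k * sg \<sigma> ^ k * r k s) - f \<sigma> s\<bar>)" for K s
    have b: "\<bar>F \<sigma> (\<Sum>k<K. fc K k * sg \<sigma> ^ k * r k s) - f \<sigma> s\<bar> \<le> 2 * Q" for K s
      using Q[of \<sigma> "\<Sum>k<K. fc K k * sg \<sigma> ^ k * r k s"] f_bound[of \<sigma> s] by linarith
    have sum_cont: "continuous_on {0<..T} (\<lambda>s. \<Sum>k<K. fc K k * sg \<sigma> ^ k * r k s)" for K
      by (intro continuous_intros continuous_on_subset[OF r_cont]) auto
    have c: "continuous_on {0<..T} (\<lambda>s. \<bar>F \<sigma> (\<Sum>k<K. fc K k * sg \<sigma> ^ k * r k s) - f \<sigma> s\<bar>)" for K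
      by (intro continuous_intros f_cont continuous_on_compose2[OF F_cont[of UNIV] sum_cont]) auto
    have eq: "integral {0..T} (\<lambda>s. \<bar>F \<sigma> (\<Sum>k<K. fc K k * sg \<sigma> ^ k * r k s) - f \<sigma> s\<bar>) = integral {0..T} (d K)" for K
      by (rule integral_spike[of "{0}"]) (auto simp: d_def)
    have "(\<lambda>K. integral {0..T} (d K)) \<longlonglongrightarrow> integral {0..T} (\<lambda>_. 0)"
    proof (rule dominated_convergence(2))
      show "d K integrable_on {0..T}" for K
      proof (rule integrable_on_half_open[of _ _ "2 * Q"])
        show "continuous_on {0<..T} (d K)"
          using c[of K] by (rule continuous_on_eq) (auto simp: d_def)
        show "\<bar>d K s\<bar> \<le> 2 * Q" for s using b[of K s] Q_nonneg by (auto simp: d_def)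
      qed
      show "(\<lambda>_. 2 * Q) integrable_on {0..T}" by (rule integrable_const_ivl)
      show "norm (d K s) \<le> 2 * Q" for K s using b[of K s] Q_nonneg by (auto simp: d_def)
      show "(\<lambda>K. d K s) \<longlonglongrightarrow> 0" if s: "s \<in> {0..T}" for s
      proof (cases "s = 0")
        case False
        then have s': "s \<in> {0<..T}" using s by auto
        have "(\<lambda>K. \<Sum>k<K. fc K k * (sg \<sigma> ^ k * r k s)) \<longlonglongrightarrow> (\<Sum>k. wt k * (sg \<sigma> ^ k * r k s))"
          by (rule fejer_means_tendsto) (use r_summable[OF s'] in \<open>simp add: abs_mult\<close>)
        also have "(\<Sum>k. wt k * (sg \<sigma> ^ k * r k s)) = a \<sigma> s" using ms s' by (simp add: mode_solution_def)
        finally have A: "(\<lambda>K. \<Sum>k<K. fc K k * sg \<sigma> ^ k * r k s) \<longlonglongrightarrow> a \<sigma> s" by (simp only: mult.assoc)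
        have "(\<lambda>K. F \<sigma> (\<Sum>k<K. fc K k * sg \<sigma> ^ k * r k s)) \<longlonglongrightarrow> F \<sigma> (a \<sigma> s)"
          by (rule continuous_on_tendsto_compose[OF F_cont[of UNIV] A]) auto
        then have "(\<lambda>K. \<bar>F \<sigma> (\<Sum>k<K. fc K k * sg \<sigma> ^ k * r k s) - f \<sigma> s\<bar>) \<longlonglongrightarrow> \<bar>F \<sigma> (a \<sigma> s) - f \<sigma> s\<bar>"
          by (intro tendsto_intros)
        moreover have "f \<sigma> s = F \<sigma> (a \<sigma> s)" using ms by (simp add: mode_solution_def)
        ultimately show ?thesis using False by (simp add: d_def)
      qed (simp add: d_def)
    qed
    then show ?thesis unfolding eq by simp
  qed
  then have "DK \<longlonglongrightarrow> (\<Sum>\<sigma>\<in>(UNIV::bool set). 0)" unfolding DK_def[abs_def] by (intro tendsto_sum)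
  then show ?thesis by simp
qed

definition pN :: "nat \<Rightarrow> real \<Rightarrow> config \<Rightarrow> real" where
  "pN N t \<eta> = (\<Sum>\<zeta>\<in>Omega N. pmf (\<nu> N) \<zeta> * semigroup (generator N l (R False) (R True)) t (\<lambda>\<xi>. of_bool (\<xi> = \<eta>)) \<zeta>)"

definition EN :: "nat \<Rightarrow> real \<Rightarrow> (config \<Rightarrow> real) \<Rightarrow> real" where
  "EN N t h = (\<Sum>\<eta>\<in>Omega N. pN N t \<eta> * h \<eta>)"

definition XN :: "nat \<Rightarrow> nat \<Rightarrow> config \<Rightarrow> real" where
  "XN N k \<eta> = (\<Sum>i\<in>{1..N - 1}. of_bool (\<eta> i) * cm k (th (N - 1) i)) / real (N - 1)"

definition V :: "nat \<Rightarrow> nat \<Rightarrow> real \<Rightarrow> real" where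
  "V N k t = EN N t (\<lambda>\<eta>. (XN N k \<eta> - r k t)^2)"

definition uN :: "real \<Rightarrow> nat \<Rightarrow> nat \<Rightarrow> real" where
  "uN B N K = 4 * (real l * (4 * B * Q * sqrt ((real (N - 1) / sqrt (real K) + real l + 1) / real N) * (T + 4 + 2 * (4 * RB * 4 ^ l) * T)
     + (Q * (4 * real K / real (N - 1)) + 4 * real l * B * Q * (2 * real K / real (N - 1))) * T)) + 2 * B * DK K"

definition erN :: "real \<Rightarrow> nat \<Rightarrow> nat \<Rightarrow> real" where
  "erN B N K = 2 * B * (\<Sum>k<K. 2 * (\<bar>lam k - ev N k\<bar> + 2 * (Q * ((1 + real k * pi * real l) / real (N - 1)))))
     + (real N ^ 2 * real (N - 1) * (2 * real K ^ 2 * pi / real (N - 1) ^ 2)^2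
       + real N * (2 * (2 ^ l * (RB * (2 * real K * real l / real (N - 1))^2))))"

lemma micro: "2 * l + 2 \<le> N \<Longrightarrow> micro_process N l R RB T (\<nu> N) (P N)"
  by unfold_locales (use l R_nonneg R_bound T law in auto)

lemma flow_pN:
  assumes "2 * l + 2 \<le> N"
  shows "flow N l R RB T (pN N)"
    "\<eta> \<in> Omega N \<Longrightarrow> pN N 0 \<eta> = pmf (\<nu> N) \<eta>"
    "t \<in> {0..T} \<Longrightarrow> measure (P N) {\<omega> \<in> space (P N). A (\<omega> t)} = EN N t (\<lambda>\<eta>. of_bool (A \<eta>))"
proof -
  interpret M: micro_process N l R RB T "\<nu> N" "P N" by (rule micro[OF assms])
  have p: "M.p = pN N" by (intro ext) (simp add: M.p_def pN_def)
  show "flow N l R RB T (pN N)" using M.flow_p unfolding p .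
  show "\<eta> \<in> Omega N \<Longrightarrow> pN N 0 \<eta> = pmf (\<nu> N) \<eta>" using M.p_initial unfolding p .
  show "t \<in> {0..T} \<Longrightarrow> measure (P N) {\<omega> \<in> space (P N). A (\<omega> t)} = EN N t (\<lambda>\<eta>. of_bool (A \<eta>))"
    using M.p_prob_event[of t A] unfolding p EN_def .
qed

lemma EN_props:
  assumes N: "2 * l + 2 \<le> N" and t: "t \<in> {0..T}"
  shows "EN N t (\<lambda>_. c) = c" "(\<And>\<eta>. \<eta> \<in> Omega N \<Longrightarrow> h \<eta> \<le> h' \<eta>) \<Longrightarrow> EN N t h \<le> EN N t h'"
proof -
  interpret W: flow N l R RB T "pN N" by (rule flow_pN[OF N])
  have EN: "EN N t = W.Ex t" by (intro ext) (simp add: EN_def W.Ex_def)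
  show "EN N t (\<lambda>_. c) = c" unfolding EN by (rule W.Ex_const[OF t])
  show "(\<And>\<eta>. \<eta> \<in> Omega N \<Longrightarrow> h \<eta> \<le> h' \<eta>) \<Longrightarrow> EN N t h \<le> EN N t h'" unfolding EN by (rule W.Ex_mono[OF t])
qed

lemma EN_add: "EN N t (\<lambda>\<eta>. h \<eta> + h' \<eta>) = EN N t h + EN N t h'"
  and EN_cmult: "EN N t (\<lambda>\<eta>. c * h \<eta>) = c * EN N t h"
  by (simp_all add: EN_def distrib_left sum.distrib sum_distrib_left mult.left_commute)

lemma micro_estimate:
  assumes N: "2 * l + 2 \<le> N" and K: "1 \<le> K" "K < N - 1" and K1: "1 \<le> K1" and k: "k < K" and t: "t \<in> {0..T}"
    and B: "\<And>K \<sigma> u s. 1 \<le> K \<Longrightarrow> 0 \<le> u \<Longrightarrow> s \<in> {0..T} \<Longrightarrow> \<bar>\<Sum>k<K. fc K k * sg \<sigma> ^ k * exp (- lam k * u) * r k s\<bar> + 1 \<le> B"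
      "\<And>k s. s \<in> {0..T} \<Longrightarrow> \<bar>r k s\<bar> + 1 \<le> B"
    and \<Lambda>: "0 < \<Lambda>" "8 * LF * (\<Sum>k. 2 / (\<Lambda> + lam k)) \<le> 1"
  shows "V N k t \<le> 2 * (4 * real K * (\<Sum>k<K. V N k 0) + 2 * real K1 * uN B N K
     + 16 * B * Q * (\<Sum>k\<in>{K1..<K}. 2 / lam k) + erN B N K * T) * exp (\<Lambda> * T)"
proof -
  interpret W: flow N l R RB T "pN N" by (rule flow_pN[OF N])
  have Q: "W.Q = Q" by (simp add: W.Q_def Q_eq)
  interpret D: flow_pde N l R RB T "pN N" K K1 r f B \<Lambda>
  proof
    show "(r k has_real_derivative - lam k * r k s + (\<Sum>\<sigma>\<in>UNIV. sg \<sigma> ^ k * f \<sigma> s)) (at s)" if "s \<in> {0<..<T}" for k s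
      using r_deriv[OF that, of k] by (simp add: \<phi>_def)
    show "\<bar>f \<sigma> s\<bar> \<le> 2 ^ l * RB * real l" for \<sigma> s using f_bound[of \<sigma> s] by (simp add: Q_eq)
    have "(\<Sum>k<K. 2 / (\<Lambda> + lam k)) \<le> (\<Sum>k. 2 / (\<Lambda> + lam k))"
      using \<Lambda>(1) by (intro sum_le_suminf lam_summable) auto
    then have "8 * LF * (\<Sum>k<K. 2 / (\<Lambda> + lam k)) \<le> 8 * LF * (\<Sum>k. 2 / (\<Lambda> + lam k))"
      using LF(1) by (intro mult_left_mono) auto
    then show "8 * (2 * real l * (2 ^ l * RB * real l)) * (\<Sum>k<K. 2 / (\<Lambda> + lam k)) \<le> 1"
      using \<Lambda>(2) unfolding LF_eq Q_eq by linarith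
  qed (use K K1 r_cont f_cont B \<Lambda> in auto)
  have X: "W.X = XN N" by (intro ext) (simp add: W.X_def XN_def W.n_def)
  have EN: "EN N s = W.Ex s" for s by (intro ext) (simp add: EN_def W.Ex_def)
  have "D.Z (\<lambda>j. of_bool (j = k)) t = V N k t"
    using k by (simp add: D.Z_def W.Yf_def V_def X EN of_bool_def if_distrib[of "\<lambda>x. x * _"] cong: if_cong)
  moreover have "D.Z (\<lambda>j. of_bool (j = k)) t \<le> 2 * D.Atot * exp (\<Lambda> * T)"
    by (rule D.micro_bound[OF D.unit_CC[OF k] t])
  moreover have At: "D.Atot \<le> 4 * real K * (\<Sum>k<K. V N k 0) + 2 * real K1 * uN B N K
     + 16 * B * Q * (\<Sum>k\<in>{K1..<K}. 2 / lam k) + erN B N K * T"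
  proof -
    have "D.Ainit = 4 * real K * (\<Sum>k<K. V N k 0)" by (simp add: D.Ainit_def V_def X EN)
    moreover have "D.\<delta> \<sigma> = (\<lambda>s. \<bar>F \<sigma> (\<Sum>k<K. fc K k * sg \<sigma> ^ k * r k s) - f \<sigma> s\<bar>)" for \<sigma>
      by (intro ext) (simp add: D.\<delta>_def D.AK_def D.fcs_def F_eq)
    then have "integral {0..T} D.EE \<le> uN B N K"
      using D.integral_EE_le by (simp add: uN_def DK_def Q D.\<Delta>K_def D.\<omega>K_def D.wmK_def W.n_def W.CR_def)
    then have "2 * real K1 * integral {0..T} D.EE \<le> 2 * real K1 * uN B N K" by (intro mult_left_mono) auto
    moreover have "W.errN K B = erN B N K"
      by (simp add: W.errN_def erN_def W.lamN_def ev_def W.EB_def W.GB_def W.n_def Q)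
    ultimately show ?thesis unfolding D.Atot_def Q by simp
  qed
  have "2 * D.Atot * exp (\<Lambda> * T) \<le> 2 * (4 * real K * (\<Sum>k<K. V N k 0) + 2 * real K1 * uN B N K
     + 16 * B * Q * (\<Sum>k\<in>{K1..<K}. 2 / lam k) + erN B N K * T) * exp (\<Lambda> * T)"
    by (intro mult_right_mono mult_left_mono At) auto
  ultimately show ?thesis by linarith
qed

text \<open>For fixed K the limit in N is not 0 in general: a term of order K to the power -1/4 from
  the replacement and the Fejer error remain, and both vanish as K grows.\<close>

lemma uN_tendsto: "(\<lambda>N. uN B N K) \<longlonglongrightarrow> 4 * (real l * (4 * B * Q * sqrt (1 / sqrt (real K)) * (T + 4 + 2 * (4 * RB * 4 ^ l) * T))) + 2 * B * DK K"
proof -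
  have "(\<lambda>N. 1 / sqrt (real K) * (real (N - 1) / real N) + (real l + 1) * (1 / real N)) \<longlonglongrightarrow> 1 / sqrt (real K) * 1 + (real l + 1) * 0"
    by (intro tendsto_intros inverse_sites_tendsto lim_1_over_n)
  then have s: "(\<lambda>N. (real (N - 1) / sqrt (real K) + real l + 1) / real N) \<longlonglongrightarrow> 1 / sqrt (real K)"
    by (simp add: add_divide_distrib algebra_simps)
  have "(\<lambda>N. 4 * (real l * (4 * B * Q * sqrt ((real (N - 1) / sqrt (real K) + real l + 1) / real N) * (T + 4 + 2 * (4 * RB * 4 ^ l) * T)
     + (Q * (4 * real K * (1 / real (N - 1))) + 4 * real l * B * Q * (2 * real K * (1 / real (N - 1)))) * T)) + 2 * B * DK K)
     \<longlonglongrightarrow> 4 * (real l * (4 * B * Q * sqrt (1 / sqrt (real K)) * (T + 4 + 2 * (4 * RB * 4 ^ l) * T)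
     + (Q * (4 * real K * 0) + 4 * real l * B * Q * (2 * real K * 0)) * T)) + 2 * B * DK K"
    by (intro tendsto_intros inverse_sites_tendsto s)
  then show ?thesis by (simp add: uN_def)
qed

lemma erN_tendsto: "(\<lambda>N. erN B N K) \<longlonglongrightarrow> 0"
proof -
  have "(\<lambda>N. 2 * B * (\<Sum>k<K. 2 * (\<bar>lam k - ev N k\<bar> + 2 * (Q * ((1 + real k * pi * real l) * (1 / real (N - 1))))))
     + (real N ^ 2 * real (N - 1) * (2 * real K ^ 2 * pi / real (N - 1) ^ 2)^2
       + real N * (2 * 2 ^ l * RB * (2 * real K * real l / real (N - 1))^2)))
     \<longlonglongrightarrow> 2 * B * (\<Sum>k<K. 2 * (\<bar>lam k - lam k\<bar> + 2 * (Q * ((1 + real k * pi * real l) * 0)))) + 0"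
    by (intro tendsto_intros inverse_sites_tendsto ev_tendsto carre_error_tendsto)
  then show ?thesis by (simp add: erN_def mult.assoc)
qed

section \<open>Comparison with the empirical measure and convergence of the modes\<close>

lemma XN_empirical: "2 \<le> N \<Longrightarrow> \<bar>XN N k \<eta> - empirical N \<eta> (cm k)\<bar> \<le> real k * pi * (1 / real (N - 1))"
proof -
  assume N: "2 \<le> N"
  obtain m where m: "N = Suc m" "0 < m" using N by (cases N) auto
  let ?n = "real m"
  have n: "0 < ?n" "N - 1 = m" "real N = ?n + 1" "real N - 1 = ?n" using m by auto
  have d: "\<bar>th m i - real i / real N\<bar> \<le> 1 / ?n" if "i \<in> {1..m}" for i
  proof -
    have i: "1 \<le> real i" "real i \<le> ?n" using that by auto
    have "th m i - real i / real N = (real i / real N - 1 / 2) / ?n"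
      unfolding n(3) using n(1) by (simp add: th_def field_simps)
    moreover have "0 \<le> real i / real N" "real i / real N \<le> 1" unfolding n(3) using i n(1) by (auto simp: field_simps)
    then have "\<bar>real i / real N - 1 / 2\<bar> \<le> 1" by linarith
    then have "\<bar>(real i / real N - 1 / 2) / ?n\<bar> \<le> 1 / ?n" using n(1) by (simp add: abs_divide divide_right_mono)
    ultimately show ?thesis by simp
  qed
  have "\<bar>(\<Sum>i\<in>{1..m}. of_bool (\<eta> i) * cm k (th m i)) - (\<Sum>i\<in>{1..m}. of_bool (\<eta> i) * cm k (real i / real N))\<bar>
    \<le> (\<Sum>i\<in>{1..m}. real k * pi * (1 / ?n))"
    unfolding sum_subtractf[symmetric]
  proof (rule order_trans[OF sum_abs sum_mono])
    fix i assume i: "i \<in> {1..m}"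
    have "\<bar>cm k (th m i) - cm k (real i / real N)\<bar> \<le> real k * pi * \<bar>th m i - real i / real N\<bar>" by (rule cm_lipschitz)
    also have "\<dots> \<le> real k * pi * (1 / ?n)" using d[OF i] by (intro mult_left_mono) auto
    finally show "\<bar>of_bool (\<eta> i) * cm k (th m i) - of_bool (\<eta> i) * cm k (real i / real N)\<bar> \<le> real k * pi * (1 / ?n)"
      by (cases "\<eta> i") simp_all
  qed
  also have "\<dots> = real k * pi" using n(1) by simp
  finally have "\<bar>((\<Sum>i\<in>{1..m}. of_bool (\<eta> i) * cm k (th m i)) - (\<Sum>i\<in>{1..m}. of_bool (\<eta> i) * cm k (real i / real N))) / ?n\<bar> \<le> real k * pi / ?n"
    using n(1) by (simp add: abs_divide divide_right_mono)
  then show ?thesis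
    unfolding XN_def empirical_def n(2,4) by (simp add: diff_divide_distrib)
qed

lemma empirical_bound: "2 \<le> N \<Longrightarrow> (\<And>x. x \<in> {0..1} \<Longrightarrow> \<bar>G x\<bar> \<le> c) \<Longrightarrow> \<bar>empirical N \<eta> G\<bar> \<le> c"
proof -
  assume N: "2 \<le> N" and G: "\<And>x. x \<in> {0..1} \<Longrightarrow> \<bar>G x\<bar> \<le> c"
  obtain m where m: "N = Suc m" "0 < m" using N by (cases N) auto
  have n: "N - 1 = m" "real N - 1 = real m" using m by auto
  have "\<bar>\<Sum>i\<in>{1..m}. of_bool (\<eta> i) * G (real i / real N)\<bar> \<le> (\<Sum>i\<in>{1..m}. c)"
  proof (rule order_trans[OF sum_abs sum_mono])
    fix i assume "i \<in> {1..m}"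
    then have "real i / real N \<in> {0..1}" using m by (auto simp: field_simps)
    from G[OF this] show "\<bar>of_bool (\<eta> i) * G (real i / real N)\<bar> \<le> c" by (auto simp: of_bool_def intro: order_trans[OF abs_ge_zero])
  qed
  also have "\<dots> = real m * c" by simp
  finally have "\<bar>\<Sum>i\<in>{1..m}. of_bool (\<eta> i) * G (real i / real N)\<bar> / real m \<le> c"
    using m by (simp add: divide_le_eq mult.commute)
  then show ?thesis using m unfolding empirical_def n by (simp add: abs_mult)
qed

text \<open>Being associated means convergence in probability. The modes are bounded, so second
  moments converge too: up to the shift of the sites the deviation is at most d outside the bad
  event and at most 2 on it.\<close>

lemma V_initial: "(\<lambda>N. V N k 0) \<longlonglongrightarrow> 0"
proof -
  define pr where "pr d N = measure_pmf.prob (\<nu> N) {\<eta>. \<bar>empirical N \<eta> (cm k) - (LINT x|I01. cm k x * \<gamma> x)\<bar> > d}" for d N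
  have pr: "pr d \<longlonglongrightarrow> 0" if "0 < d" for d
    using assoc that continuous_cm[OF continuous_on_id, of "{0..1}" k] unfolding associated_def pr_def by blast
  have T0: "0 \<in> {0..T}" using T by simp
  have bound: "V N k 0 \<le> 2 * (real k * pi * (1 / real (N - 1)))^2 + (2 * d^2 + 8 * pr d N)" if d: "0 < d" and N: "2 * l + 2 \<le> N" for d N
  proof -
    let ?bad = "\<lambda>\<eta>. \<bar>empirical N \<eta> (cm k) - gam k\<bar> > d"
    have g: "gam k = (LINT x|I01. cm k x * \<gamma> x)" by (simp add: gam_eq mult.commute)
    have "V N k 0 \<le> EN N 0 (\<lambda>\<eta>. 2 * (real k * pi * (1 / real (N - 1)))^2 + (2 * d^2 + 8 * of_bool (?bad \<eta>)))"
      unfolding V_def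
    proof (rule EN_props(2)[OF N T0])
      fix \<eta>
      let ?x = "XN N k \<eta> - empirical N \<eta> (cm k)" and ?e = "empirical N \<eta> (cm k) - gam k"
      have "(XN N k \<eta> - r k 0)^2 \<le> 2 * ?x^2 + 2 * ?e^2"
        using zero_le_power2[of "?x - ?e"] by (simp add: r_0 power2_eq_square algebra_simps)
      moreover have "?x^2 \<le> (real k * pi * (1 / real (N - 1)))^2"
        using N by (intro sq_le_if_abs_le XN_empirical) auto
      moreover have "?e^2 \<le> d^2 + 4 * of_bool (?bad \<eta>)"
      proof (cases "?bad \<eta>")
        case True
        have "\<bar>?e\<bar> \<le> 2" using empirical_bound[of N "cm k" 1 \<eta>] N gam[of k] by simp
        from sq_le_if_abs_le[OF this] have "?e^2 \<le> 4" by simp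
        moreover have "0 \<le> d^2" by simp
        ultimately show ?thesis using True by (simp only: of_bool_eq)
      qed (use sq_le_if_abs_le[of ?e d] in simp)
      ultimately show "(XN N k \<eta> - r k 0)^2 \<le> 2 * (real k * pi * (1 / real (N - 1)))^2 + (2 * d^2 + 8 * of_bool (?bad \<eta>))" by linarith
    qed
    also have "\<dots> = 2 * (real k * pi * (1 / real (N - 1)))^2 + (2 * d^2 + 8 * EN N 0 (\<lambda>\<eta>. of_bool (?bad \<eta>)))"
      by (simp only: EN_add EN_cmult EN_props(1)[OF N T0])
    also have "EN N 0 (\<lambda>\<eta>. of_bool (?bad \<eta>)) \<le> pr d N"
    proof -
      have "EN N 0 (\<lambda>\<eta>. of_bool (?bad \<eta>)) = (\<Sum>\<eta>\<in>Omega N. if ?bad \<eta> then pmf (\<nu> N) \<eta> else 0)"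
        unfolding EN_def by (intro sum.cong refl) (simp add: flow_pN(2)[OF N])
      also have "\<dots> = (\<Sum>\<eta>\<in>{\<eta> \<in> Omega N. ?bad \<eta>}. pmf (\<nu> N) \<eta>)" by (rule sum.inter_filter[symmetric]) simp
      also have "\<dots> = measure_pmf.prob (\<nu> N) {\<eta> \<in> Omega N. ?bad \<eta>}" by (rule measure_measure_pmf_finite[symmetric]) simp
      also have "\<dots> \<le> pr d N" unfolding pr_def g by (intro measure_pmf.finite_measure_mono) auto
      finally show ?thesis .
    qed
    finally show ?thesis by simp
  qed
  show ?thesis
  proof (rule order_tendstoI)
    fix e :: real assume "e < 0"
    have p: "0 \<le> V N k 0" if N: "2 * l + 2 \<le> N" for N
      using EN_props(2)[OF N T0, of "\<lambda>_. 0" "\<lambda>\<eta>. (XN N k \<eta> - r k 0)^2"] EN_props(1)[OF N T0, of 0] by (simp add: V_def)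
    show "\<forall>\<^sub>F N in sequentially. e < V N k 0"
      using eventually_ge_at_top[of "2 * l + 2"] by eventually_elim (rule order.strict_trans2[OF \<open>e < 0\<close> p])
  next
    fix e :: real assume e: "0 < e"
    define d where "d = sqrt (e / 4)"
    have d: "0 < d" "d^2 = e / 4" using e by (auto simp: d_def)
    have "(\<lambda>N. 2 * (real k * pi * (1 / real (N - 1)))^2 + (2 * d^2 + 8 * pr d N)) \<longlonglongrightarrow> 2 * (real k * pi * 0)^2 + (2 * d^2 + 8 * 0)"
      by (intro tendsto_intros inverse_sites_tendsto pr d)
    moreover have "2 * (real k * pi * 0)^2 + (2 * d^2 + 8 * 0) < e" using e d by simp
    ultimately have "\<forall>\<^sub>F N in sequentially. 2 * (real k * pi * (1 / real (N - 1)))^2 + (2 * d^2 + 8 * pr d N) < e"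
      by (rule order_tendstoD(2))
    then show "\<forall>\<^sub>F N in sequentially. V N k 0 < e"
      using eventually_ge_at_top[of "2 * l + 2"] by eventually_elim (rule order.strict_trans1[OF bound[OF d(1)]])
  qed
qed

text \<open>The order of the choices matters: \<Lambda> from the Lipschitz constant,
  \<open>K1\<close> from the tail of the series of \<open>2 / lam k\<close>, then K so large that
  the error multiplied by \<open>K1\<close> is small, and N last, with K fixed, which removes the
  initial and the discretisation errors.\<close>

lemma V_tendsto:
  assumes t: "t \<in> {0..T}"
  shows "(\<lambda>N. V N k t) \<longlonglongrightarrow> 0"
proof (rule order_tendstoI)
  fix e :: real assume "e < 0"
  have p: "0 \<le> V N k t" if N: "2 * l + 2 \<le> N" for N
    using EN_props(2)[OF N t, of "\<lambda>_. 0" "\<lambda>\<eta>. (XN N k \<eta> - r k t)^2"] EN_props(1)[OF N t, of 0] by (simp add: V_def)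
  show "\<forall>\<^sub>F N in sequentially. e < V N k t"
    using eventually_ge_at_top[of "2 * l + 2"] by eventually_elim (rule order.strict_trans2[OF \<open>e < 0\<close> p])
next
  fix e :: real assume e: "0 < e"
  have "\<exists>B. (\<forall>K \<sigma> u s. 1 \<le> K \<longrightarrow> 0 \<le> u \<longrightarrow> s \<in> {0..T} \<longrightarrow> \<bar>\<Sum>k<K. fc K k * sg \<sigma> ^ k * exp (- lam k * u) * r k s\<bar> + 1 \<le> B)
    \<and> (\<forall>k s. s \<in> {0..T} \<longrightarrow> \<bar>r k s\<bar> + 1 \<le> B)"
    by (rule uniform_bound) blast
  then obtain B where B: "\<And>K \<sigma> u s. 1 \<le> K \<Longrightarrow> 0 \<le> u \<Longrightarrow> s \<in> {0..T} \<Longrightarrow> \<bar>\<Sum>k<K. fc K k * sg \<sigma> ^ k * exp (- lam k * u) * r k s\<bar> + 1 \<le> B"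
    "\<And>k s. s \<in> {0..T} \<Longrightarrow> \<bar>r k s\<bar> + 1 \<le> B"
    by blast
  obtain \<Lambda> where \<Lambda>: "1 \<le> \<Lambda>" and \<Lambda>2: "8 * LF * (\<Sum>k. 2 / (\<Lambda> + lam k)) \<le> 1"
    using lam_contraction[of "8 * LF"] LF(1) by auto
  \<comment> \<open>Two error terms below q, doubled and multiplied by
    \<open>exp (\<Lambda> * T)\<close>, add up to less than e / 2.\<close>
  define q where "q = e / (8 * exp (\<Lambda> * T))"
  have q: "0 < q" using e by (simp add: q_def)
  have B1: "1 \<le> B" using B(2)[of 0 0] T abs_ge_zero[of "r 0 0"] by simp
  have BQ: "0 \<le> 16 * B * Q" using B1 Q_nonneg by simp
  obtain K1 where K1: "1 \<le> K1" "\<And>K. 16 * B * Q * (\<Sum>k\<in>{K1..<K}. 2 / lam k) < q"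
  proof -
    have "0 < q / (16 * B * Q + 1)" using q BQ by simp
    then obtain M where M: "\<And>m n. M \<le> m \<Longrightarrow> norm (\<Sum>k\<in>{m..<n}. 2 / lam k) < q / (16 * B * Q + 1)"
      using lam_summable0 unfolding summable_Cauchy by blast
    show ?thesis
    proof
      show "1 \<le> M + 1" by simp
      fix K
      have "(\<Sum>k\<in>{M + 1..<K}. 2 / lam k) < q / (16 * B * Q + 1)" using M[of "M + 1" K] by auto
      then have "(16 * B * Q) * (\<Sum>k\<in>{M + 1..<K}. 2 / lam k) \<le> (16 * B * Q) * (q / (16 * B * Q + 1))"
        using BQ by (intro mult_left_mono) auto
      also have "\<dots> < q" using q BQ by (simp add: field_simps)
      finally show "16 * B * Q * (\<Sum>k\<in>{M + 1..<K}. 2 / lam k) < q" .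
    qed
  qed
  define u where "u K = 2 * real K1 * (4 * (real l * (4 * B * Q * sqrt (1 / sqrt (real K)) * (T + 4 + 2 * (4 * RB * 4 ^ l) * T))) + 2 * B * DK K)" for K
  have "u \<longlonglongrightarrow> 0"
  proof -
    have "(\<lambda>K. 1 / real K) \<longlonglongrightarrow> 0" by (rule lim_1_over_n)
    then have "(\<lambda>K. sqrt (sqrt (1 / real K))) \<longlonglongrightarrow> sqrt (sqrt 0)" by (intro tendsto_intros)
    then have s: "(\<lambda>K. sqrt (1 / sqrt (real K))) \<longlonglongrightarrow> 0" by (simp add: real_sqrt_divide)
    have "u \<longlonglongrightarrow> 2 * real K1 * (4 * (real l * (4 * B * Q * 0 * (T + 4 + 2 * (4 * RB * 4 ^ l) * T))) + 2 * B * 0)"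
      unfolding u_def[abs_def] by (intro tendsto_intros s DK_tendsto)
    then show ?thesis by simp
  qed
  then have "\<forall>\<^sub>F K in sequentially. u K < q" by (rule order_tendstoD(2)) (rule q)
  then have "\<forall>\<^sub>F K in sequentially. u K < q \<and> k < K" using eventually_gt_at_top[of k] by (rule eventually_conj)
  then obtain K where K: "u K < q" "k < K" using eventually_sequentially by auto
  define bnd where "bnd N = 2 * (4 * real K * (\<Sum>k<K. V N k 0) + 2 * real K1 * uN B N K
     + 16 * B * Q * (\<Sum>k\<in>{K1..<K}. 2 / lam k) + erN B N K * T) * exp (\<Lambda> * T)" for N
  have "bnd \<longlonglongrightarrow> 2 * (4 * real K * (\<Sum>k<K. 0) + u K + 16 * B * Q * (\<Sum>k\<in>{K1..<K}. 2 / lam k) + 0 * T) * exp (\<Lambda> * T)"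
    unfolding bnd_def[abs_def] u_def by (intro tendsto_intros V_initial uN_tendsto erN_tendsto)
  moreover have "2 * (4 * real K * (\<Sum>k<K. 0) + u K + 16 * B * Q * (\<Sum>k\<in>{K1..<K}. 2 / lam k) + 0 * T) * exp (\<Lambda> * T) < e"
  proof -
    have "2 * (u K + 16 * B * Q * (\<Sum>k\<in>{K1..<K}. 2 / lam k)) * exp (\<Lambda> * T) < (4 * q) * exp (\<Lambda> * T)"
      using K(1) K1(2)[of K] by (intro mult_strict_right_mono) auto
    also have "\<dots> < e" using e by (simp add: q_def)
    finally show ?thesis by simp
  qed
  ultimately have ev_bnd: "\<forall>\<^sub>F N in sequentially. bnd N < e" by (rule order_tendstoD(2))
  have Vb: "V N k t \<le> bnd N" if N: "2 * l + 2 \<le> N" "K + 2 \<le> N" for N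
    unfolding bnd_def
    by (rule micro_estimate[OF N(1) _ _ K1(1) K(2) t B _ \<Lambda>2]) (use K(2) N \<Lambda> in auto)
  from ev_bnd show "\<forall>\<^sub>F N in sequentially. V N k t < e"
    using eventually_ge_at_top[of "2 * l + 2"] eventually_ge_at_top[of "K + 2"]
  proof eventually_elim
    case (elim N)
    then show ?case using Vb[of N] by linarith
  qed
qed

text \<open>Two majorants are allowed, so that one lemma serves a single mode and the sum of two
  cosine polynomials.\<close>

lemma EN_squeeze:
  assumes t: "t \<in> {0..T}"
    and h: "\<And>N \<eta>. 2 * l + 2 \<le> N \<Longrightarrow> \<eta> \<in> Omega N \<Longrightarrow> 0 \<le> h N \<eta> \<and> h N \<eta> \<le> w N + c * h1 N \<eta> + c * h2 N \<eta>"
    and lim: "w \<longlonglongrightarrow> 0" "(\<lambda>N. EN N t (h1 N)) \<longlonglongrightarrow> 0" "(\<lambda>N. EN N t (h2 N)) \<longlonglongrightarrow> 0"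
  shows "(\<lambda>N. EN N t (h N)) \<longlonglongrightarrow> 0"
proof (rule tendsto_sandwich[of "\<lambda>_. 0" _ _ "\<lambda>N. w N + c * EN N t (h1 N) + c * EN N t (h2 N)"])
  have b: "0 \<le> EN N t (h N) \<and> EN N t (h N) \<le> w N + c * EN N t (h1 N) + c * EN N t (h2 N)" if N: "2 * l + 2 \<le> N" for N
  proof
    have "EN N t (\<lambda>_. 0) \<le> EN N t (h N)" using h[OF N] by (intro EN_props(2)[OF N t]) auto
    then show "0 \<le> EN N t (h N)" by (simp add: EN_props(1)[OF N t])
    have "EN N t (h N) \<le> EN N t (\<lambda>\<eta>. w N + c * h1 N \<eta> + c * h2 N \<eta>)" using h[OF N] by (intro EN_props(2)[OF N t]) auto
    then show "EN N t (h N) \<le> w N + c * EN N t (h1 N) + c * EN N t (h2 N)"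
      by (simp only: EN_add EN_cmult EN_props(1)[OF N t])
  qed
  show "\<forall>\<^sub>F N in sequentially. 0 \<le> EN N t (h N)" "\<forall>\<^sub>F N in sequentially. EN N t (h N) \<le> w N + c * EN N t (h1 N) + c * EN N t (h2 N)"
    using b by (auto intro: eventually_sequentiallyI[of "2 * l + 2"])
  have "(\<lambda>N. w N + c * EN N t (h1 N) + c * EN N t (h2 N)) \<longlonglongrightarrow> 0 + c * 0 + c * 0" by (intro tendsto_intros lim)
  then show "(\<lambda>N. w N + c * EN N t (h1 N) + c * EN N t (h2 N)) \<longlonglongrightarrow> 0" by simp
qed simp

text \<open>Jensen's inequality for the square in the form of a tangent: the parabola (x - r)^2 lies
  above its tangent at the mean.\<close>

lemma EN_XN_tendsto:
  assumes t: "t \<in> {0..T}"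
  shows "(\<lambda>N. EN N t (XN N k)) \<longlonglongrightarrow> r k t"
proof -
  define m where "m N = EN N t (XN N k)" for N
  have "(m N - r k t)^2 \<le> V N k t" if N: "2 * l + 2 \<le> N" for N
  proof -
    have "EN N t (\<lambda>\<eta>. ((m N - r k t)^2 - 2 * (m N - r k t) * m N) + 2 * (m N - r k t) * XN N k \<eta>) \<le> V N k t"
      unfolding V_def
    proof (rule EN_props(2)[OF N t])
      fix \<eta>
      show "((m N - r k t)^2 - 2 * (m N - r k t) * m N) + 2 * (m N - r k t) * XN N k \<eta> \<le> (XN N k \<eta> - r k t)^2"
        using zero_le_power2[of "XN N k \<eta> - m N"] by (simp add: power2_eq_square algebra_simps)
    qed
    then show ?thesis unfolding EN_add EN_cmult EN_props(1)[OF N t] m_def by simp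
  qed
  then have "\<forall>\<^sub>F N in sequentially. (m N - r k t)^2 \<le> V N k t" by (rule eventually_sequentiallyI)
  then have "(\<lambda>N. (m N - r k t)^2) \<longlonglongrightarrow> 0"
    by (intro tendsto_sandwich[OF _ _ tendsto_const V_tendsto[OF t]]) auto
  then have "(\<lambda>N. sqrt ((m N - r k t)^2)) \<longlonglongrightarrow> sqrt 0" by (rule tendsto_real_sqrt)
  then show ?thesis unfolding m_def by (simp add: tendsto_rabs_zero_iff LIM_zero_iff)
qed

text \<open>The bounds come from the particles and not from a maximum principle. A Fejer mean of the
  density at x is the limit of expectations of averages of occupation variables with nonnegative
  weights of total mass 1, and the Fejer means converge to the density.\<close>

lemma \<rho>_range:
  assumes t: "t \<in> {0<..T}" and x: "x \<in> {0..1}"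
  shows "0 \<le> \<rho> t x \<and> \<rho> t x \<le> 1"
proof -
  have tT: "t \<in> {0..T}" using t by auto
  define S where "S K = (\<Sum>k<K. fc K k * (cm k x * r k t))" for K
  have SK: "0 \<le> S K \<and> S K \<le> 1" if K: "1 \<le> K" for K
  proof -
    define G where "G y = (\<Sum>k<K. fc K k * cm k x * cm k y)" for y
    \<comment> \<open>The kernel adapted to the cosine basis is the mean of the Fejer kernel and its
      reflection, hence nonnegative.\<close>
    have Geq: "G y = (fejer K (x + y) + fejer K (x - y)) / 2" for y
    proof -
      have "cm k x * cm k y = (cm k (x + y) + cm k (x - y)) / 2" for k
        by (simp add: cm_def distrib_left right_diff_distrib cos_add cos_diff)
      then show ?thesis
        by (simp add: G_def fejer_def mult.assoc sum_divide_distrib sum.distrib[symmetric] distrib_left add_divide_distrib)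
    qed
    have G0: "0 \<le> G y" for y using fejer_nonneg[of K "x + y"] fejer_nonneg[of K "x - y"] unfolding Geq by simp
    define h where "h N \<eta> = (\<Sum>k<K. fc K k * (cm k x * XN N k \<eta>))" for N \<eta>
    have hG: "h N \<eta> = (\<Sum>i\<in>{1..N - 1}. of_bool (\<eta> i) * G (th (N - 1) i)) / real (N - 1)" for N \<eta>
    proof -
      have "(\<Sum>i\<in>{1..N - 1}. of_bool (\<eta> i) * G (th (N - 1) i)) = (\<Sum>k<K. \<Sum>i\<in>{1..N - 1}. of_bool (\<eta> i) * (fc K k * cm k x * cm k (th (N - 1) i)))"
        unfolding G_def sum_distrib_left by (rule sum.swap)
      also have "\<dots> = (\<Sum>k<K. fc K k * (cm k x * (\<Sum>i\<in>{1..N - 1}. of_bool (\<eta> i) * cm k (th (N - 1) i))))"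
        unfolding sum_distrib_left by (intro sum.cong refl) (simp only: mult_ac)
      finally show ?thesis
        unfolding h_def XN_def by (simp only: sum_divide_distrib[of _ "{..<K}"] times_divide_eq_right)
    qed
    have h01: "0 \<le> h N \<eta> \<and> h N \<eta> \<le> 1" if N: "K + 2 \<le> N" for N \<eta>
    proof -
      have n: "0 < real (N - 1)" "K < 2 * (N - 1)" using N by auto
      have "(\<Sum>i\<in>{1..N - 1}. G (th (N - 1) i)) = (\<Sum>k<K. fc K k * cm k x * (\<Sum>i\<in>{1..N - 1}. cm k (th (N - 1) i)))"
        unfolding G_def sum_distrib_left by (rule sum.swap)
      also have "\<dots> = (\<Sum>k<K. if k = 0 then real (N - 1) else 0)"
      proof (intro sum.cong refl)
        fix k assume k: "k \<in> {..<K}"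
        show "fc K k * cm k x * (\<Sum>i\<in>{1..N - 1}. cm k (th (N - 1) i)) = (if k = 0 then real (N - 1) else 0)"
          using sum_cm_th[of k "N - 1"] k n(2) K by (cases "k = 0") (auto simp: fc_def wt_def)
      qed
      also have "\<dots> = real (N - 1)" using K by simp
      finally have G1: "(\<Sum>i\<in>{1..N - 1}. G (th (N - 1) i)) = real (N - 1)" .
      have "(\<Sum>i\<in>{1..N - 1}. of_bool (\<eta> i) * G (th (N - 1) i)) \<le> real (N - 1)"
        unfolding G1[symmetric] using G0 by (intro sum_mono) (simp add: of_bool_def)
      moreover have "0 \<le> (\<Sum>i\<in>{1..N - 1}. of_bool (\<eta> i) * G (th (N - 1) i))" using G0 by (intro sum_nonneg) simp
      ultimately show ?thesis unfolding hG using n(1) by simp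
    qed
    have "EN N t (h N) = (\<Sum>k<K. fc K k * (cm k x * EN N t (XN N k)))" for N
    proof -
      have "EN N t (h N) = (\<Sum>k<K. \<Sum>\<eta>\<in>Omega N. pN N t \<eta> * (fc K k * (cm k x * XN N k \<eta>)))"
        unfolding EN_def h_def sum_distrib_left by (rule sum.swap)
      then show ?thesis unfolding EN_def sum_distrib_left by (simp only: mult.left_commute)
    qed
    moreover have "(\<lambda>N. \<Sum>k<K. fc K k * (cm k x * EN N t (XN N k))) \<longlonglongrightarrow> S K"
      unfolding S_def by (intro tendsto_intros EN_XN_tendsto tT)
    ultimately have lim: "(\<lambda>N. EN N t (h N)) \<longlonglongrightarrow> S K" by simp
    have b: "0 \<le> EN N t (h N) \<and> EN N t (h N) \<le> 1" if N: "2 * l + 2 + K \<le> N" for N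
    proof -
      have N': "2 * l + 2 \<le> N" "K + 2 \<le> N" using N by auto
      show ?thesis
        using EN_props(2)[OF N'(1) tT, of "\<lambda>_. 0" "h N"] EN_props(2)[OF N'(1) tT, of "h N" "\<lambda>_. 1"] h01[OF N'(2)]
        by (simp add: EN_props(1)[OF N'(1) tT])
    qed
    show ?thesis
      using LIMSEQ_le_const[OF lim, of 0] LIMSEQ_le_const2[OF lim, of 1] b by blast
  qed
  have "summable (\<lambda>k. \<bar>cm k x * r k t\<bar>)"
  proof (rule summable_comparison_test[OF _ r_summable[OF t]])
    show "\<exists>N. \<forall>k\<ge>N. norm \<bar>cm k x * r k t\<bar> \<le> \<bar>r k t\<bar>"
      using mult_right_mono[OF abs_cm_le] by (simp add: abs_mult)
  qed
  then have "S \<longlonglongrightarrow> (\<Sum>k. wt k * (cm k x * r k t))" unfolding S_def by (rule fejer_means_tendsto)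
  also have "(\<Sum>k. wt k * (cm k x * r k t)) = \<rho> t x" using t by (simp add: \<rho>_def mult_ac)
  finally have lim: "S \<longlonglongrightarrow> \<rho> t x" .
  show ?thesis
    using LIMSEQ_le_const[OF lim, of 0] LIMSEQ_le_const2[OF lim, of 1] SK by blast
qed

lemma empirical_cospoly:
  assumes t: "t \<in> {0..T}" and f: "cospoly f'"
  shows "(\<lambda>N. EN N t (\<lambda>\<eta>. (empirical N \<eta> f' - (LINT x|I01. f' x * \<rho> t x))^2)) \<longlonglongrightarrow> 0"
  using f
proof (induction rule: cospoly.induct)
  case (cospoly_cm c k)
  have emp: "empirical N \<eta> (\<lambda>x. c * cm k x) = c * empirical N \<eta> (cm k)" for N \<eta>
    unfolding empirical_def sum_distrib_left by (intro sum.cong refl) (simp only: mult_ac)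
  have lint: "(LINT x|I01. c * cm k x * \<rho> t x) = c * r k t"
    using \<rho>_coeff[OF t, of k] by (simp add: mult.assoc mult.commute[of "cm k _"])
  show ?case
    unfolding emp lint
  proof (rule EN_squeeze[OF t, where w = "\<lambda>N. 2 * c^2 * (real k * pi * (1 / real (N - 1)))^2" and c = "2 * c^2" and ?h2.0 = "\<lambda>N \<eta>. 0"])
    show "(\<lambda>N. EN N t (\<lambda>\<eta>. (XN N k \<eta> - r k t)^2)) \<longlonglongrightarrow> 0" using V_tendsto[OF t, of k] by (simp add: V_def)
    show "(\<lambda>N. EN N t (\<lambda>\<eta>. 0)) \<longlonglongrightarrow> 0" by (simp add: EN_def)
    have "(\<lambda>N. 2 * c^2 * (real k * pi * (1 / real (N - 1)))^2) \<longlonglongrightarrow> 2 * c^2 * (real k * pi * 0)^2"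
      by (intro tendsto_intros inverse_sites_tendsto)
    then show "(\<lambda>N. 2 * c^2 * (real k * pi * (1 / real (N - 1)))^2) \<longlonglongrightarrow> 0" by simp
    fix N \<eta> assume N: "2 * l + 2 \<le> N"
    let ?x = "XN N k \<eta> - empirical N \<eta> (cm k)" and ?y = "XN N k \<eta> - r k t"
    have "(empirical N \<eta> (cm k) - r k t)^2 \<le> 2 * ?x^2 + 2 * ?y^2"
      using zero_le_power2[of "?x + ?y"] by (simp add: power2_eq_square algebra_simps)
    moreover have "?x^2 \<le> (real k * pi * (1 / real (N - 1)))^2"
      using N by (intro sq_le_if_abs_le XN_empirical) auto
    ultimately have "(empirical N \<eta> (cm k) - r k t)^2 \<le> 2 * (real k * pi * (1 / real (N - 1)))^2 + 2 * ?y^2" by linarith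
    then have "c^2 * (empirical N \<eta> (cm k) - r k t)^2 \<le> c^2 * (2 * (real k * pi * (1 / real (N - 1)))^2 + 2 * ?y^2)"
      by (intro mult_left_mono) auto
    then show "0 \<le> (c * empirical N \<eta> (cm k) - c * r k t)^2 \<and> (c * empirical N \<eta> (cm k) - c * r k t)^2
      \<le> 2 * c^2 * (real k * pi * (1 / real (N - 1)))^2 + 2 * c^2 * (XN N k \<eta> - r k t)^2 + 2 * c^2 * 0"
      unfolding right_diff_distrib[symmetric] power_mult_distrib[of c] by (simp add: distrib_left mult.assoc mult.left_commute)
  qed
next
  case (cospoly_add u v)
  have emp: "empirical N \<eta> (\<lambda>x. u x + v x) = empirical N \<eta> u + empirical N \<eta> v" for N \<eta>
    by (simp add: empirical_def distrib_left sum.distrib)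
  have i: "integrable I01 (\<lambda>x. u x * \<rho> t x)" "integrable I01 (\<lambda>x. v x * \<rho> t x)"
    using continuous_mult_integrable[OF \<rho>_integrable[OF t] cospoly_continuous[OF cospoly_add.hyps(1)]]
      continuous_mult_integrable[OF \<rho>_integrable[OF t] cospoly_continuous[OF cospoly_add.hyps(2)]]
    by (simp_all add: mult.commute)
  then have lint: "(LINT x|I01. (u x + v x) * \<rho> t x) = (LINT x|I01. u x * \<rho> t x) + (LINT x|I01. v x * \<rho> t x)"
    by (simp add: distrib_right)
  show ?case
    unfolding emp lint
  proof (rule EN_squeeze[OF t _ tendsto_const cospoly_add.IH, where c = 2])
    have "(y1 + y2 - (z1 + z2))^2 \<le> 0 + 2 * (y1 - z1)^2 + 2 * (y2 - z2)^2" for y1 y2 z1 z2 :: real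
      using zero_le_power2[of "(y1 - z1) - (y2 - z2)"] by (simp add: power2_eq_square algebra_simps)
    then show "0 \<le> (empirical N \<eta> u + empirical N \<eta> v - ((LINT x|I01. u x * \<rho> t x) + (LINT x|I01. v x * \<rho> t x)))^2 \<and>
      (empirical N \<eta> u + empirical N \<eta> v - ((LINT x|I01. u x * \<rho> t x) + (LINT x|I01. v x * \<rho> t x)))^2
      \<le> 0 + 2 * (empirical N \<eta> u - (LINT x|I01. u x * \<rho> t x))^2 + 2 * (empirical N \<eta> v - (LINT x|I01. v x * \<rho> t x))^2" for N \<eta>
      by simp
  qed
qed

text \<open>Chebyshev's inequality for an approximating cosine polynomial u. With c the L1 norm of
  the density, replacing G by u costs at most e in the empirical mean and \<open>e * c\<close> in
  the limit; e is chosen so that the two make up half of \<delta>.\<close>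

lemma empirical_tendsto:
  assumes G: "continuous_on {0..1} G" and t: "t \<in> {0..T}" and \<delta>: "0 < \<delta>"
  shows "(\<lambda>N. measure (P N) {\<omega> \<in> space (P N). \<bar>empirical N (\<omega> t) G - (LINT x|I01. G x * \<rho> t x)\<bar> > \<delta>}) \<longlonglongrightarrow> 0"
proof -
  define c where "c = (LINT x|I01. \<bar>\<rho> t x\<bar>)"
  define e where "e = \<delta> / (2 * (1 + c))"
  have c0: "0 \<le> c" unfolding c_def by (intro Bochner_Integration.integral_nonneg) simp
  have "e * (1 + c) = \<delta> / 2" using c0 by (simp add: e_def add_pos_nonneg field_simps)
  then have e: "0 < e" "e + e * c = \<delta> / 2" using \<delta> c0 by (auto simp: e_def distrib_left)
  have "\<exists>u. cospoly u \<and> (\<forall>x\<in>{0..1}. \<bar>G x - u x\<bar> < e)" by (rule cospoly_dense[OF G e(1)]) blast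
  then obtain u where u: "cospoly u" "\<And>x. x \<in> {0..1} \<Longrightarrow> \<bar>G x - u x\<bar> < e" by blast
  let ?Y = "\<lambda>N \<eta>. empirical N \<eta> u - (LINT x|I01. u x * \<rho> t x)"
  have i: "integrable I01 (\<lambda>x. G x * \<rho> t x)" "integrable I01 (\<lambda>x. u x * \<rho> t x)"
    using continuous_mult_integrable[OF \<rho>_integrable[OF t] G]
      continuous_mult_integrable[OF \<rho>_integrable[OF t] cospoly_continuous[OF u(1)]]
    by (simp_all add: mult.commute)
  have L: "\<bar>(LINT x|I01. G x * \<rho> t x) - (LINT x|I01. u x * \<rho> t x)\<bar> \<le> e * c"
  proof -
    have "(LINT x|I01. G x * \<rho> t x) - (LINT x|I01. u x * \<rho> t x) = (LINT x|I01. (G x - u x) * \<rho> t x)"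
      using i by (simp add: left_diff_distrib)
    also have "\<bar>LINT x|I01. (G x - u x) * \<rho> t x\<bar> \<le> (LINT x|I01. e * \<bar>\<rho> t x\<bar>)"
    proof (rule lint_abs_le_integrable)
      show "integrable I01 (\<lambda>x. e * \<bar>\<rho> t x\<bar>)" using \<rho>_integrable[OF t] by simp
      show "\<bar>(G x - u x) * \<rho> t x\<bar> \<le> e * \<bar>\<rho> t x\<bar>" if "x \<in> space I01" for x
        unfolding abs_mult using u(2)[of x] that by (intro mult_right_mono) (auto intro: less_imp_le)
    qed
    finally show ?thesis by (simp add: c_def)
  qed
  have bad: "of_bool (\<bar>empirical N \<eta> G - (LINT x|I01. G x * \<rho> t x)\<bar> > \<delta>) \<le> 0 + (2 / \<delta>)^2 * (?Y N \<eta>)^2 + (2 / \<delta>)^2 * 0"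
    if N: "2 * l + 2 \<le> N" for N \<eta>
  proof (cases "\<bar>empirical N \<eta> G - (LINT x|I01. G x * \<rho> t x)\<bar> > \<delta>")
    case True
    have "empirical N \<eta> G - empirical N \<eta> u = empirical N \<eta> (\<lambda>x. G x - u x)"
      by (simp add: empirical_def right_diff_distrib sum_subtractf)
    moreover have "\<bar>empirical N \<eta> (\<lambda>x. G x - u x)\<bar> \<le> e"
      using N u(2) by (intro empirical_bound) (auto intro: less_imp_le)
    ultimately have "\<delta> / 2 < \<bar>?Y N \<eta>\<bar>" using True L e(2) by linarith
    then have "1 < (2 / \<delta>) * \<bar>?Y N \<eta>\<bar>" using \<delta> by (simp add: field_simps)
    then have "1 \<le> ((2 / \<delta>) * \<bar>?Y N \<eta>\<bar>)^2" by (intro one_le_power) simp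
    then show ?thesis using True by (simp only: power_mult_distrib power2_abs) simp
  qed simp
  have "(\<lambda>N. EN N t (\<lambda>\<eta>. of_bool (\<bar>empirical N \<eta> G - (LINT x|I01. G x * \<rho> t x)\<bar> > \<delta>))) \<longlonglongrightarrow> 0"
  proof (rule EN_squeeze[OF t _ tendsto_const empirical_cospoly[OF t u(1)], where c = "(2 / \<delta>)^2" and ?h2.0 = "\<lambda>N \<eta>. 0"])
    show "(\<lambda>N. EN N t (\<lambda>\<eta>. 0)) \<longlonglongrightarrow> 0" by (simp add: EN_def)
    show "(0::real) \<le> of_bool (\<bar>empirical N \<eta> G - (LINT x|I01. G x * \<rho> t x)\<bar> > \<delta>) \<and>
      of_bool (\<bar>empirical N \<eta> G - (LINT x|I01. G x * \<rho> t x)\<bar> > \<delta>) \<le> 0 + (2 / \<delta>)^2 * (?Y N \<eta>)^2 + (2 / \<delta>)^2 * (0::real)"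
      if "2 * l + 2 \<le> N" for N \<eta>
      using bad[OF that, of \<eta>] by (intro conjI) simp_all
  qed
  moreover have "\<forall>\<^sub>F N in sequentially. EN N t (\<lambda>\<eta>. of_bool (\<bar>empirical N \<eta> G - (LINT x|I01. G x * \<rho> t x)\<bar> > \<delta>))
    = measure (P N) {\<omega> \<in> space (P N). \<bar>empirical N (\<omega> t) G - (LINT x|I01. G x * \<rho> t x)\<bar> > \<delta>}"
    by (rule eventually_sequentiallyI[of "2 * l + 2"]) (rule flow_pN(3)[OF _ t, symmetric])
  ultimately show ?thesis by (rule Lim_transform_eventually)
qed

end

theorem theorem2p2:
  fixes l :: nat and T :: real and Rm Rp :: rates
    and \<gamma> :: "real \<Rightarrow> real"
    and \<nu> :: "nat \<Rightarrow> config pmf"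
    and P :: "nat \<Rightarrow> (real \<Rightarrow> config) measure"
  assumes "1 \<le> l" and "0 < T"
    and "admissible_rates l Rm" and "admissible_rates l Rp"
    and "\<gamma> \<in> borel_measurable (lebesgue_on {0..1})" and "\<gamma> ` {0..1} \<subseteq> {0..1}"
    and "\<And>N. 1 \<le> N \<Longrightarrow> set_pmf (\<nu> N) \<subseteq> Omega N"
    and "associated \<nu> \<gamma>"
    and "\<And>N. l < N \<Longrightarrow> process_law N l Rm Rp T (\<nu> N) (P N)"
  shows "\<exists>\<rho>. weak_solution T (boundary_flux l Rm) (boundary_flux l Rp) \<gamma> \<rho> \<and>
    (\<forall>\<rho>'. weak_solution T (boundary_flux l Rm) (boundary_flux l Rp) \<gamma> \<rho>' \<longrightarrow>
       (\<forall>t\<in>{0..T}. AE x in lebesgue_on {0..1}. \<rho>' t x = \<rho> t x)) \<and>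
    (\<forall>G t \<delta>. continuous_on {0..1} G \<and> t \<in> {0..T} \<and> \<delta> > 0 \<longrightarrow>
       (\<lambda>N. measure (P N) {\<omega> \<in> space (P N).
          \<bar>empirical N (\<omega> t) G - (LINT x|lebesgue_on {0..1}. G x * \<rho> t x)\<bar> > \<delta>}) \<longlonglongrightarrow> 0)"
proof -
  define R where "R \<sigma> = (if \<sigma> then Rp else Rm)" for \<sigma>
  \<comment> \<open>The rates are finitely many and nonnegative, so their sum bounds each of
    them.\<close>
  define RB where "RB = (\<Sum>\<sigma>\<in>(UNIV::bool set). \<Sum>\<xi>\<in>configs {1..l}. \<Sum>\<xi>'\<in>configs {1..l}. R \<sigma> \<xi> \<xi>')"
  have R0: "0 \<le> R \<sigma> \<xi> \<xi>'" if "\<xi> \<in> configs {1..l}" "\<xi>' \<in> configs {1..l}" for \<sigma> \<xi> \<xi>'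
    using assms(3,4) that by (simp add: R_def admissible_rates_def)
  have RB: "R \<sigma> \<xi> \<xi>' \<le> RB" if \<xi>: "\<xi> \<in> configs {1..l}" "\<xi>' \<in> configs {1..l}" for \<sigma> \<xi> \<xi>'
  proof -
    have "R \<sigma> \<xi> \<xi>' \<le> (\<Sum>\<xi>'\<in>configs {1..l}. R \<sigma> \<xi> \<xi>')"
      using \<xi> R0 by (intro member_le_sum) auto
    also have "\<dots> \<le> (\<Sum>\<xi>\<in>configs {1..l}. \<Sum>\<xi>'\<in>configs {1..l}. R \<sigma> \<xi> \<xi>')"
      by (rule member_le_sum[of \<xi> "configs {1..l}" "\<lambda>\<xi>. \<Sum>\<xi>'\<in>configs {1..l}. R \<sigma> \<xi> \<xi>'"]) (use \<xi> R0 in \<open>auto intro!: sum_nonneg\<close>)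
    also have "\<dots> \<le> RB"
      unfolding RB_def
      by (rule member_le_sum[of \<sigma> UNIV "\<lambda>\<sigma>. \<Sum>\<xi>\<in>configs {1..l}. \<Sum>\<xi>'\<in>configs {1..l}. R \<sigma> \<xi> \<xi>'"]) (use R0 in \<open>auto intro!: sum_nonneg\<close>)
    finally show ?thesis .
  qed
  define F where "F = (\<lambda>\<sigma>. boundary_flux l (R \<sigma>))"
  define Q where "Q = 2 ^ l * RB * real l"
  define LF where "LF = 2 * real l * Q"
  define gam where "gam k = (LINT x|I01. \<gamma> x * cm k x)" for k
  have z: "(\<lambda>_. False) \<in> configs {1..l}" by (auto simp: configs_def)
  have "0 \<le> RB" using R0[OF z z, of False] RB[OF z z, of False] by linarith
  then have Q0: "0 \<le> Q" by (simp add: Q_def)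
  interpret volterra T LF Q F gam
  proof
    show "\<bar>F \<sigma> x - F \<sigma> y\<bar> \<le> LF * \<bar>x - y\<bar>" for \<sigma> x y
      unfolding F_def LF_def Q_def using R0 RB by (intro boundary_flux_lipschitz) auto
    show "\<bar>F \<sigma> x\<bar> \<le> Q" for \<sigma> x
      unfolding F_def Q_def using R0 RB by (intro boundary_flux_bound) auto
    show "\<bar>gam k\<bar> \<le> 1" for k
    proof -
      have "integrable I01 (\<lambda>x. 1 :: real)" by (intro continuous_imp_integrable_real continuous_intros)
      then have "\<bar>gam k\<bar> \<le> (LINT x|I01. 1)"
        unfolding gam_def
      proof (rule lint_abs_le_integrable)
        fix x assume "x \<in> space I01"
        then have "\<bar>\<gamma> x\<bar> * \<bar>cm k x\<bar> \<le> 1 * 1" using assms(6) by (intro mult_mono) (auto simp: image_subset_iff)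
        then show "\<bar>\<gamma> x * cm k x\<bar> \<le> 1" by (simp add: abs_mult)
      qed
      then show ?thesis by (simp add: measure_restrict_space)
    qed
  qed (use assms(2) Q0 in \<open>auto simp: LF_def\<close>)
  obtain r a f where ms: "mode_solution r a f" using mode_solution_exists by blast
  interpret hydro T LF Q F gam \<gamma> r a f l R RB \<nu> P
  proof
    show "process_law N l (R False) (R True) T (\<nu> N) (P N)" if "l < N" for N
      using assms(9)[OF that] by (simp add: R_def)
  qed (use assms ms R0 RB in \<open>auto simp: gam_def F_def Q_def LF_def\<close>)
  have Fb: "boundary_flux l Rm = F False" "boundary_flux l Rp = F True" by (simp_all add: F_def R_def)
  show ?thesis
    unfolding Fb
  proof (intro exI[of _ \<rho>] conjI allI impI ballI)
    show "weak_solution T (F False) (F True) \<gamma> \<rho>" by (rule modes_weak_solution[OF \<rho>_range])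
  qed (use modes_unique empirical_tendsto in blast)+
qed

end
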